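(* Let $0<p_1,p_2,q_1,q_2<\infty$, $p_2<p_1$ and $p_2<\min\{q_1,q_2\}$. Let $v_1,v_2\in\mathcal W(0,\infty)$, $u_1\in{}^{\mathbf c}\Omega_{q_1}$ and $u_2\in\Omega_{q_2}$. Put $v(x)=v_1(x)^{-1}v_2(x)$, $V(x)=\|v\|_{p_1\to p_2,(0,x)}$ and $\mathcal V(t,x)=\frac{V(t)}{V(t)+V(x)}$ for $t,x>0$. Assume that $V$ is admissible and that $$\varphi_2(x):=\bigg(\int_0^\infty[\mathcal V(x,t)V(t)]^{q_1\to p_2}\,d\Big(-\|u_1\|_{q_1,(0,t)}^{-(q_1\to p_2)}\Big)\bigg)^{\frac1{q_1\to p_2}}\in Q_{V^{\frac1{p_1\to p_2}}}.$$ Write $N=\|\mathrm I\|_{\mathrm{Cop}_{p_1,q_1}(u_1,v_1)\to\mathrm{Ces}_{p_2,q_2}(u_2,v_2)}$. (i) If $\max\{p_1,q_1\}\le q_2$, then $$N\approx\sup_{x\in(0,\infty)}\varphi_2(x)\sup_{t\in(0,\infty)}\mathcal V(t,x)\|u_2\|_{q_2,(t,\infty)}+\|u_1\|_{q_1,(0,\infty)}^{-1}\sup_{t\in(0,\infty)}V(t)\|u_2\|_{q_2,(t,\infty)}.$$ (ii) If $p_1\le q_2<q_1$, then $$N\approx\bigg(\int_0^\infty\varphi_2(x)^{\frac{(q_1\to q_2)(q_1\to p_2)}{q_2\to p_2}}V(x)^{q_1\to p_2}\Big(\sup_{t\in(0,\infty)}\mathcal V(t,x)\|u_2\|_{q_2,(t,\infty)}\Big)^{q_1\to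 q_2}d\Big(-\|u_1\|_{q_1,(0,x)}^{-(q_1\to p_2)}\Big)\bigg)^{\frac1{q_1\to q_2}}+\|u_1\|_{q_1,(0,\infty)}^{-1}\sup_{t\in(0,\infty)}V(t)\|u_2\|_{q_2,(t,\infty)}.$$ (iii) If $q_1\le q_2<p_1$, then $$N\approx\sup_{x\in(0,\infty)}\varphi_2(x)\bigg(\int_0^\infty\mathcal V(t,x)^{p_1\to q_2}d\Big(-\|u_2\|_{q_2,(t,\infty)}^{p_1\to q_2}\Big)\bigg)^{\frac1{p_1\to q_2}}+\|u_1\|_{q_1,(0,\infty)}^{-1}\bigg(\int_0^\infty V(t)^{p_1\to q_2}d\Big(-\|u_2\|_{q_2,(t,\infty)}^{p_1\to q_2}\Big)\bigg)^{\frac1{p_1\to q_2}}.$$ (iv) If $q_2<\min\{p_1,q_1\}$, then $$N\approx\bigg(\int_0^\infty\varphi_2(x)^{\frac{(q_1\to q_2)(q_1\to p_2)}{q_2\to p_2}}V(x)^{q_1\to p_2}\bigg(\int_0^\infty\mathcal V(t,x)^{p_1\to q_2}d\Big(-\|u_2\|_{q_2,(t,\infty)}^{p_1\to q_2}\Big)\bigg)^{\frac{q_1\to q_2}{p_1\to q_2}}d\Big(-\|u_1\|_{q_1,(0,x)}^{-(q_1\to p_2)}\Big)\bigg)^{\frac1{q_1\to q_2}}$$ $$\qquad+\|u_1\|_{q_1,(0,\infty)}^{-1}\bigg(\int_0^\infty V(t)^{p_1\to q_2}d\Big(-\|u_2\|_{q_2,(t,\infty)}^{p_1\to q_2}\Big)\bigg)^{\frac1{p_1\to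 q_2}}.$$
   Context: $\mathfrak M^+(0,\infty)$ is the set of non-negative measurable functions on $(0,\infty)$; $\mathcal W(0,\infty)$ is the set of weights (measurable functions, positive and finite a.e. on $(0,\infty)$). For $0<p\le\infty$ and measurable $A\subseteq(0,\infty)$, $\|f\|_{p,A}=(\int_A|f|^p\,dx)^{1/p}$ if $p<\infty$, $\|f\|_{\infty,A}=\operatorname{ess\,sup}_A|f|$, and $\|f\|_{p,w,A}=\|fw\|_{p,A}$. Conventions: $0/0=0$, $0\cdot(\pm\infty)=0$, $1/(\pm\infty)=0$. For $u\in\mathfrak M^+(0,\infty)$, $v\in\mathcal W(0,\infty)$ and $0<p,q\le\infty$, $\mathrm{Ces}_{p,q}(u,v)$ and $\mathrm{Cop}_{p,q}(u,v)$ are the sets of $f\in\mathfrak M^+(0,\infty)$ with finite $\|f\|_{\mathrm{Ces}_{p,q}(u,v)}=\big\|\,\|f\|_{p,v,(0,\cdot)}\big\|_{q,u,(0,\infty)}$, respectively $\|f\|_{\mathrm{Cop}_{p,q}(u,v)}=\big\|\,\|f\|_{p,v,(\cdot,\infty)}\big\|_{q,u,(0,\infty)}$. $\Omega_q$ is the set of $u\in\mathfrak M^+(0,\infty)$ with $0<\|u\|_{q,(t,\infty)}<\infty$ for all $t>0$; ${}^{\mathbf c}\Omega_q$ is the set of $u\in\mathfrak M^+(0,\infty)$ with $0<\|u\|_{q,(0,t)}<\infty$ for all $t>0$. $\|\mathrm I\|_{X\to Y}$ is the best constant of the embedding $X\hookrightarrow Y$: the least $c\in[0,\infty]$ with $\|f\|_Y\le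 c\|f\|_X$ for all $f\in X$. For $0<p,q\le\infty$, $p\to q$ denotes the number given by $\frac1{p\to q}=\frac1q-\frac1p$ if $q<p$, and $p\to q=\infty$ if $q\ge p$. A function $U$ is admissible if it is continuous and strictly increasing on $[0,\infty)$ with $U(0)=0$ and $\lim_{t\to\infty}U(t)=\infty$ (here $V(0)$ means $\lim_{x\to0+}V(x)$). For admissible $U$, a function $\varphi$ is $U$-quasiconcave if $\varphi$ is equivalent (up to multiplicative constants) to an increasing function on $(0,\infty)$ and $\varphi/U$ is equivalent to a decreasing function on $(0,\infty)$; it is non-degenerate if $\lim_{t\to0+}\varphi(t)=\lim_{t\to\infty}\frac1{\varphi(t)}=\lim_{t\to\infty}\frac{\varphi(t)}{U(t)}=\lim_{t\to0+}\frac{U(t)}{\varphi(t)}=0$. $Q_U$ is the family of non-degenerate $U$-quasiconcave functions. For non-decreasing $h$ on $(0,\infty)$, $\int f\,dh$ is the Lebesgue–Stieltjes integral. $A\approx B$ means $c^{-1}B\le A\le cB$ with a constant $c>0$ depending only on $p_1,p_2,q_1,q_2$. *)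

theory Defs
  imports "HOL-Analysis.Analysis"
begin

text \<open>
  All functions on the half-line take values in \<^typ>\<open>ennreal\<close>, whose arithmetic provides the
  conventions \<open>0 * \<infinity> = 0\<close>, \<open>0 / 0 = 0\<close> and \<open>1 / \<infinity> = 0\<close>.  A function on \<open>(0,\<infinity>)\<close> is represented by a
  function on \<^typ>\<open>real\<close> whose values outside \<open>{0<..}\<close> are irrelevant.  Only finite exponents are
  covered by the definitions below.
\<close>

definition epowr :: "ennreal \<Rightarrow> real \<Rightarrow> ennreal"  (infixr "epowr" 80) where
  "x epowr a =
     (if x = 0 then (if a < 0 then \<infinity> else if a = 0 then 1 else 0)
      else if x = \<infinity> then (if a < 0 then 0 else if a = 0 then 1 else \<infinity>)
      else ennreal (enn2real x powr a))"

text \<open>The number \<open>p \<rightarrow> q\<close>; meant for \<open>0 < q < p\<close> only (its value is \<open>\<infinity>\<close> if \<open>q \<ge> p\<close>).\<close>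

definition arrow :: "real \<Rightarrow> real \<Rightarrow> real"  (infix "\<rightarrowtail>" 75) where
  "p \<rightarrowtail> q = 1 / (1 / q - 1 / p)"

definition Mplus :: "(real \<Rightarrow> ennreal) set" where
  "Mplus = borel_measurable (lebesgue_on {0<..})"

definition weights :: "(real \<Rightarrow> ennreal) set" where
  "weights = {w \<in> Mplus. AE x in lebesgue_on {0<..}. 0 < w x \<and> w x < \<infinity>}"

definition Lnorm :: "real \<Rightarrow> real set \<Rightarrow> (real \<Rightarrow> ennreal) \<Rightarrow> ennreal" where
  "Lnorm p A f = (\<integral>\<^sup>+x\<in>A. (f x) epowr p \<partial>lebesgue) epowr (1 / p)"

definition wLnorm :: "real \<Rightarrow> (real \<Rightarrow> ennreal) \<Rightarrow> real set \<Rightarrow> (real \<Rightarrow> ennreal) \<Rightarrow> ennreal" where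
  "wLnorm p w A f = Lnorm p A (\<lambda>x. f x * w x)"

definition Ces_norm ::
  "real \<Rightarrow> real \<Rightarrow> (real \<Rightarrow> ennreal) \<Rightarrow> (real \<Rightarrow> ennreal) \<Rightarrow> (real \<Rightarrow> ennreal) \<Rightarrow> ennreal" where
  "Ces_norm p q u v f = wLnorm q u {0<..} (\<lambda>t. wLnorm p v {0<..<t} f)"

definition Cop_norm ::
  "real \<Rightarrow> real \<Rightarrow> (real \<Rightarrow> ennreal) \<Rightarrow> (real \<Rightarrow> ennreal) \<Rightarrow> (real \<Rightarrow> ennreal) \<Rightarrow> ennreal" where
  "Cop_norm p q u v f = wLnorm q u {0<..} (\<lambda>t. wLnorm p v {t<..} f)"

definition Ces :: "real \<Rightarrow> real \<Rightarrow> (real \<Rightarrow> ennreal) \<Rightarrow> (real \<Rightarrow> ennreal) \<Rightarrow> (real \<Rightarrow> ennreal) set" where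
  "Ces p q u v = {f \<in> Mplus. Ces_norm p q u v f < \<infinity>}"

definition Cop :: "real \<Rightarrow> real \<Rightarrow> (real \<Rightarrow> ennreal) \<Rightarrow> (real \<Rightarrow> ennreal) \<Rightarrow> (real \<Rightarrow> ennreal) set" where
  "Cop p q u v = {f \<in> Mplus. Cop_norm p q u v f < \<infinity>}"

definition Omega :: "real \<Rightarrow> (real \<Rightarrow> ennreal) set" where
  "Omega q = {u \<in> Mplus. \<forall>t>0. 0 < Lnorm q {t<..} u \<and> Lnorm q {t<..} u < \<infinity>}"

definition cOmega :: "real \<Rightarrow> (real \<Rightarrow> ennreal) set" where
  "cOmega q = {u \<in> Mplus. \<forall>t>0. 0 < Lnorm q {0<..<t} u \<and> Lnorm q {0<..<t} u < \<infinity>}"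

text \<open>
  The best constant of the embedding of \<open>(X, nX)\<close> into a space with norm \<open>nY\<close>; it is \<open>\<infinity>\<close> if
  no finite constant works, in particular if \<open>X\<close> is not contained in the target space.
\<close>

definition embedding_norm ::
  "'a set \<Rightarrow> ('a \<Rightarrow> ennreal) \<Rightarrow> ('a \<Rightarrow> ennreal) \<Rightarrow> ennreal" where
  "embedding_norm X nX nY = Inf {c. \<forall>f\<in>X. nY f \<le> c * nX f}"

definition Cop_Ces_norm ::
  "real \<Rightarrow> real \<Rightarrow> (real \<Rightarrow> ennreal) \<Rightarrow> (real \<Rightarrow> ennreal) \<Rightarrow>
   real \<Rightarrow> real \<Rightarrow> (real \<Rightarrow> ennreal) \<Rightarrow> (real \<Rightarrow> ennreal) \<Rightarrow> ennreal" where
  "Cop_Ces_norm p1 q1 u1 v1 p2 q2 u2 v2 =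
     embedding_norm (Cop p1 q1 u1 v1) (Cop_norm p1 q1 u1 v1) (Ces_norm p2 q2 u2 v2)"

definition approx_by :: "real \<Rightarrow> ennreal \<Rightarrow> ennreal \<Rightarrow> bool" where
  "approx_by c A B \<longleftrightarrow> ennreal (1 / c) * B \<le> A \<and> A \<le> ennreal c * B"

text \<open>
  Strict monotonicity on \<open>[0,\<infinity>)\<close> forces an admissible function to be finite.  For
  \<open>V(x) = Lnorm r {0<..<x} v\<close> we have \<open>V 0 = 0\<close> outright, so that continuity at \<open>0\<close>
  is what expresses that the limit of \<open>V\<close> at \<open>0+\<close> is \<open>0\<close>.
\<close>

definition admissible :: "(real \<Rightarrow> ennreal) \<Rightarrow> bool" where
  "admissible U \<longleftrightarrow> continuous_on {0..} U \<and> strict_mono_on {0..} U \<and> U 0 = 0 \<and>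
     (U \<longlongrightarrow> \<infinity>) at_top"

definition equiv_fun :: "(real \<Rightarrow> ennreal) \<Rightarrow> (real \<Rightarrow> ennreal) \<Rightarrow> bool" where
  "equiv_fun f g \<longleftrightarrow> (\<exists>c>0. \<forall>x>0. approx_by c (f x) (g x))"

definition quasiconcave :: "(real \<Rightarrow> ennreal) \<Rightarrow> (real \<Rightarrow> ennreal) \<Rightarrow> bool" where
  "quasiconcave U \<phi> \<longleftrightarrow>
     (\<exists>\<psi>. mono_on {0<..} \<psi> \<and> equiv_fun \<phi> \<psi>) \<and>
     (\<exists>\<psi>. antimono_on {0<..} \<psi> \<and> equiv_fun (\<lambda>x. \<phi> x / U x) \<psi>)"

definition nondegenerate :: "(real \<Rightarrow> ennreal) \<Rightarrow> (real \<Rightarrow> ennreal) \<Rightarrow> bool" where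
  "nondegenerate U \<phi> \<longleftrightarrow>
     (\<phi> \<longlongrightarrow> 0) (at_right 0) \<and>
     ((\<lambda>t. 1 / \<phi> t) \<longlongrightarrow> 0) at_top \<and>
     ((\<lambda>t. \<phi> t / U t) \<longlongrightarrow> 0) at_top \<and>
     ((\<lambda>t. U t / \<phi> t) \<longlongrightarrow> 0) (at_right 0)"

definition QU :: "(real \<Rightarrow> ennreal) \<Rightarrow> (real \<Rightarrow> ennreal) set" where
  "QU U = {\<phi>. quasiconcave U \<phi> \<and> nondegenerate U \<phi>}"

text \<open>
  The Lebesgue--Stieltjes measure on \<open>(0,\<infinity>)\<close> of a non-decreasing \<open>h\<close> on \<open>(0,\<infinity>)\<close>.  As \<open>h\<close> may
  tend to \<open>-\<infinity>\<close> at \<open>0\<close>, it need not extend to a non-decreasing real function on the line, so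
  the measure is obtained from \<^const>\<open>interval_measure\<close> by transport along \<^const>\<open>exp\<close>; the
  lemma below shows that this gives the usual mass \<open>h(b+) - h(a+)\<close> to \<open>(a,b]\<close>.
\<close>

definition right_lim :: "(real \<Rightarrow> real) \<Rightarrow> real \<Rightarrow> real" where
  "right_lim h x = (INF y\<in>{x<..}. h y)"

definition LS_measure :: "(real \<Rightarrow> real) \<Rightarrow> real measure" where
  "LS_measure h = distr (interval_measure (\<lambda>y. right_lim h (exp y))) borel exp"

lemma right_lim_bdd:
  fixes h :: "real \<Rightarrow> real"
  assumes "mono_on {0<..} h" "0 < x"
  shows "bdd_below (h ` {x<..})"
  using assms by (intro bdd_belowI2[of _ "h x"]) (auto intro!: mono_onD[of "{0<..}" h])

lemma right_lim_mono:
  assumes "mono_on {0<..} h" "0 < x" "x \<le> y"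
  shows "right_lim h x \<le> right_lim h y"
  unfolding right_lim_def
  using assms by (intro cINF_superset_mono right_lim_bdd) auto

lemma right_lim_eq:
  assumes "mono_on {0<..} h" "0 < x" "continuous (at_right x) h"
  shows "right_lim h x = h x"
proof (rule antisym)
  show "h x \<le> right_lim h x"
    unfolding right_lim_def using assms by (intro cINF_greatest) (auto intro!: mono_onD[of "{0<..}" h])
  have "\<forall>\<^sub>F y in at_right x. right_lim h x \<le> h y"
    using eventually_at_right_less[of x]
    by eventually_elim (use assms right_lim_bdd in \<open>auto simp: right_lim_def intro!: cINF_lower\<close>)
  moreover have "(h \<longlongrightarrow> h x) (at_right x)"
    using assms(3) by (simp add: continuous_within)
  ultimately show "right_lim h x \<le> h x"
    by (intro tendsto_lowerbound) auto
qed

lemma emeasure_LS_measure_Ioc: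
  assumes h: "mono_on {0<..} h" and "0 < a" "a \<le> b"
  shows "emeasure (LS_measure h) {a<..b} = ennreal (right_lim h b - right_lim h a)"
proof -
  let ?F = "\<lambda>y. right_lim h (exp y)"
  have mono: "?F x \<le> ?F y" if "x \<le> y" for x y
    using that by (intro right_lim_mono[OF h]) auto
  have cont: "continuous (at_right y) ?F" for y
    unfolding continuous_within
  proof (rule order_tendstoI)
    fix l assume l: "l < ?F y"
    show "\<forall>\<^sub>F x in at_right y. l < ?F x"
      using eventually_at_right_less[of y]
      by eventually_elim (use l mono in \<open>force intro: less_le_trans\<close>)
  next
    fix u assume "?F y < u"
    then obtain z where z: "exp y < z" "h z < u"
      unfolding right_lim_def
      by (subst (asm) cINF_less_iff) (auto intro: right_lim_bdd[OF h])
    have "0 < z" using z(1) exp_gt_zero[of y] by linarith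
    then have "y < ln z" using z(1) by (metis exp_less_cancel_iff exp_ln)
    show "\<forall>\<^sub>F x in at_right y. ?F x < u"
      using eventually_at_right_real[OF \<open>y < ln z\<close>]
    proof eventually_elim
      case (elim x)
      then have "exp x < z" using \<open>0 < z\<close> by (metis exp_less_cancel_iff exp_ln greaterThanLessThan_iff)
      then have "?F x \<le> h z"
        unfolding right_lim_def by (intro cINF_lower right_lim_bdd[OF h]) auto
      then show ?case using z(2) by simp
    qed
  qed
  have vim: "exp -` {a<..b} = {ln a<..ln b}"
  proof -
    have "a < exp y \<longleftrightarrow> ln a < y" "exp y \<le> b \<longleftrightarrow> y \<le> ln b" for y
      using assms(2,3) exp_less_cancel_iff[of "ln a" y] exp_le_cancel_iff[of y "ln b"] by auto
    then show ?thesis by auto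
  qed
  have "emeasure (LS_measure h) {a<..b} = emeasure (interval_measure ?F) {ln a<..ln b}"
    unfolding LS_measure_def by (subst emeasure_distr) (auto simp: vim)
  also have "\<dots> = ennreal (?F (ln b) - ?F (ln a))"
    using assms(2,3) by (intro emeasure_interval_measure_Ioc mono cont) auto
  finally show ?thesis using assms(2,3) by simp
qed

definition LS_int :: "(real \<Rightarrow> ennreal) \<Rightarrow> (real \<Rightarrow> real) \<Rightarrow> ennreal" where
  "LS_int f h = (\<integral>\<^sup>+x. f x \<partial>LS_measure h)"

text \<open>
  The integrators are \<open>-\<parallel>u\<parallel>\<^bsub>q,(0,t)\<^esub>\<^bsup>-s\<^esup>\<close> and \<open>-\<parallel>u\<parallel>\<^bsub>q,(t,\<infinity>)\<^esub>\<^bsup>s\<^esup>\<close>, where \<open>s > 0\<close>; they are real-valued for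
  \<open>u\<close> in \<open>cOmega q\<close> and \<open>Omega q\<close>, respectively.
\<close>

definition hleft :: "real \<Rightarrow> (real \<Rightarrow> ennreal) \<Rightarrow> real \<Rightarrow> real \<Rightarrow> real" where
  "hleft q u s t = - enn2real (Lnorm q {0<..<t} u epowr (- s))"

definition hright :: "real \<Rightarrow> (real \<Rightarrow> ennreal) \<Rightarrow> real \<Rightarrow> real \<Rightarrow> real" where
  "hright q u s t = - enn2real (Lnorm q {t<..} u epowr s)"

definition Vfun :: "real \<Rightarrow> real \<Rightarrow> (real \<Rightarrow> ennreal) \<Rightarrow> (real \<Rightarrow> ennreal) \<Rightarrow> real \<Rightarrow> ennreal" where
  "Vfun p1 p2 v1 v2 x = Lnorm (p1 \<rightarrowtail> p2) {0<..<x} (\<lambda>y. inverse (v1 y) * v2 y)"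

definition Vfrac :: "(real \<Rightarrow> ennreal) \<Rightarrow> real \<Rightarrow> real \<Rightarrow> ennreal" where
  "Vfrac V t x = V t / (V t + V x)"

definition phi2 ::
  "real \<Rightarrow> real \<Rightarrow> (real \<Rightarrow> ennreal) \<Rightarrow> (real \<Rightarrow> ennreal) \<Rightarrow> real \<Rightarrow> ennreal" where
  "phi2 p2 q1 u1 V x =
     LS_int (\<lambda>t. (Vfrac V x t * V t) epowr (q1 \<rightarrowtail> p2)) (hleft q1 u1 (q1 \<rightarrowtail> p2))
       epowr (1 / (q1 \<rightarrowtail> p2))"

end

theory Submission
  imports Defs
begin

text \<open>
  Dividing all exponents by \<open>p\<^sub>2\<close> and substituting \<open>h = (f v\<^sub>1)\<^bsup>p\<^sub>2\<^esup> v\<^bsup>p\<^sub>2 - r\<^esup>\<close>, where \<open>r = p\<^sub>1 \<rightarrow> p\<^sub>2\<close> and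
  \<open>d\<mu> = v\<^sup>r dx\<close>, turns the embedding into
  \<open>\<integral> (\<integral>\<^bsub>s<t\<^esub> h d\<mu>)\<^sup>q d\<nu>\<^sub>2 \<le> c\<^sup>q (\<integral> (\<integral>\<^bsub>s>t\<^esub> h\<^sup>p d\<mu>)\<^bsup>\<theta>/p\<^esup> d\<nu>\<^sub>1)\<^bsup>q/\<theta>\<^esup>\<close> with \<open>p, q, \<theta> > 1\<close>.
  Cut the half-line into the blocks \<open>2\<^sup>k < \<nu>\<^sub>1(0,t) \<le> 2\<^bsup>k+1\<^esup>\<close>.  The right-hand side is then comparable
  with \<open>\<Sum> 2\<^sup>k a\<^sub>k\<^bsup>\<theta>\<^esup>\<close>, where \<open>a\<^sub>k\<close> is the \<open>L\<^sup>p(\<mu>)\<close>-norm of \<open>h\<close> on the \<open>k\<close>-th block.  For \<open>t\<close> in a given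
  block, the part of \<open>h\<close> in this block and in the preceding one is controlled by the weighted Hardy
  inequality on an initial interval, with constant \<open>K\<close>; the parts in earlier blocks are estimated by
  Hoelder's inequality and summed by the discrete Hardy inequality with exponents \<open>\<theta>\<close> and \<open>q\<close>.

  Conversely, an almost extremal function of Hardy's inequality on \<open>(0,x)\<close> can be dilated to any
  smaller interval, and superpositions of such functions, weighted by \<open>2\<^bsup>-i/\<theta>\<^esup>\<close> on block \<open>i\<close>, test the
  inequality.  If \<open>\<theta> \<le> q\<close>, one point \<open>x\<close> suffices.  If \<open>q < \<theta>\<close>, sample points, one in each block, are
  grouped by the dyadic size of the discretised \<open>\<phi>\<^sub>2\<close>, and only the first point of each group is used.
\<close>

text \<open>In the estimate of the earlier blocks, block i enters with the weight
  \<open>2 powr (- i / \<theta>) * m powr (1 / p')\<close>. Its power of order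
  \<open>\<theta>'\<close> is \<open>2 powr (i * (1 - \<theta>')) * m powr (\<theta>' / p')\<close>,
  as \<open>\<theta>' / \<theta> = \<theta>' - 1\<close>, and the partial sums of these powers
  discretise the integral of \<open>min (m x) (m t) powr (\<theta>' / p')\<close> against
  d(-U^(1-\<theta>')). This is the origin of the function in the statement, up to a power and an
  equivalent kernel. The second summand is forced by bounded \<open>U\<close>: there is then a last
  block without right end point, on which the Hardy constant of an initial interval must be replaced
  by its supremum over all intervals, while d(-U^(1-\<theta>')) misses the positive limit at
  infinity. The lower bounds combine two facts: as q > 1, the left-hand side is superadditive over
  the pieces of a test function, and the right-hand side is almost additive if the pieces are
  weighted and cut off at levels of \<open>U\<close>. All constants depend on the exponents alone,
  so the final one can be fixed before the weights.\<close>

section \<open>Powers of extended non-negative reals\<close>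

lemma epowr_0 [simp]: "0 < a \<Longrightarrow> 0 epowr a = 0"
  by (simp add: epowr_def)

lemma epowr_top [simp]: "0 < a \<Longrightarrow> \<infinity> epowr a = \<infinity>" "0 < a \<Longrightarrow> top epowr a = top"
  by (simp_all add: epowr_def)

lemma epowr_1 [simp]: "x epowr 1 = x"
proof (cases x)
  case (real r)
  then show ?thesis by (cases "r = 0") (auto simp: epowr_def)
qed (simp add: epowr_def)

lemma one_epowr [simp]: "1 epowr a = 1"
  by (simp add: epowr_def)

lemma epowr_zero_exp [simp]: "x epowr 0 = 1"
  by (cases x) (auto simp: epowr_def)

lemma epowr_ennreal: "0 < x \<Longrightarrow> ennreal x epowr a = ennreal (x powr a)"
  by (simp add: epowr_def)

lemma epowr_ennreal_pos: "0 \<le> x \<Longrightarrow> 0 < a \<Longrightarrow> ennreal x epowr a = ennreal (x powr a)"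
  by (cases "x = 0") (auto simp: epowr_ennreal)

text \<open>The values at \<open>0\<close> and at infinity trade places when the exponent changes
  sign, so iterated powers agree there as well. In particular \<open>epowr (1 / a)\<close> inverts
  \<open>epowr a\<close> for nonzero \<open>a\<close>.\<close>

lemma epowr_epowr [simp]: "(x epowr a) epowr b = x epowr (a * b)"
proof -
  have *: "ennreal y \<noteq> \<infinity>" for y by simp
  show ?thesis
    by (cases x) (auto simp: epowr_def powr_powr mult_pos_pos mult_neg_neg mult_pos_neg mult_neg_pos
      mult_less_0_iff zero_less_mult_iff)
qed

text \<open>Negative exponents are excluded by \<open>0 * \<infinity> = 0\<close>: for the factors 0
  and infinity and the exponent -1 the left-hand side would be infinite and the right-hand side
  0.\<close>

lemma epowr_mult: "0 < a \<Longrightarrow> (x * y) epowr a = x epowr a * y epowr a"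
  by (cases x; cases y)
    (auto simp: epowr_def ennreal_mult_top ennreal_top_mult powr_mult enn2real_mult ennreal_mult[symmetric]
      simp del: ennreal_mult)

lemma epowr_add: "0 < a \<Longrightarrow> 0 < b \<Longrightarrow> x epowr (a + b) = x epowr a * x epowr b"
  by (cases x) (auto simp: epowr_def powr_add ennreal_mult'' ennreal_top_mult)

lemma epowr_mono: "0 \<le> a \<Longrightarrow> x \<le> y \<Longrightarrow> x epowr a \<le> y epowr a"
proof (cases "a = 0")
  assume a: "0 \<le> a" "x \<le> y" "a \<noteq> 0"
  show ?thesis
    using a by (cases x; cases y) (auto simp: epowr_def top_unique intro!: ennreal_leI powr_mono2)
qed simp

lemma epowr_le_iff: "0 < a \<Longrightarrow> x epowr a \<le> y \<longleftrightarrow> x \<le> y epowr (1 / a)"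
  using epowr_mono[of a x "y epowr (1/a)"] epowr_mono[of "1/a" "x epowr a" y] by auto

lemma epowr_le_cancel: "0 < a \<Longrightarrow> x epowr a \<le> y epowr a \<longleftrightarrow> x \<le> y"
  by (simp add: epowr_le_iff)

lemma epowr_eq_0_iff: "0 < a \<Longrightarrow> x epowr a = 0 \<longleftrightarrow> x = 0"
  by (cases x) (auto simp: epowr_def)

lemma epowr_eq_top_iff: "0 < a \<Longrightarrow> x epowr a = top \<longleftrightarrow> x = top"
  by (cases x) (auto simp: epowr_def)

lemma epowr_less_top: "0 < a \<Longrightarrow> x < top \<Longrightarrow> x epowr a < top"
  by (simp add: epowr_eq_top_iff less_top[symmetric] flip: less_top)

lemma epowr_SUP:
  assumes "0 < a" shows "(SUP i\<in>I. f i) epowr a = (SUP i\<in>I. f i epowr a)"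
proof (rule antisym)
  show "(SUP i\<in>I. f i) epowr a \<le> (SUP i\<in>I. f i epowr a)"
    unfolding epowr_le_iff[OF assms]
  proof (rule SUP_least)
    fix i assume "i \<in> I"
    then show "f i \<le> (SUP i\<in>I. f i epowr a) epowr (1 / a)"
      unfolding epowr_le_iff[OF assms, symmetric] by (rule SUP_upper)
  qed
  show "(SUP i\<in>I. f i epowr a) \<le> (SUP i\<in>I. f i) epowr a"
    using assms by (intro SUP_least epowr_mono SUP_upper) auto
qed

lemma measurable_epowr [measurable]:
  assumes [measurable]: "f \<in> borel_measurable M"
  shows "(\<lambda>x. f x epowr a) \<in> borel_measurable M"
  unfolding epowr_def by measurable

lemma epowr_add_le:
  assumes "0 < a" shows "(x + y) epowr a \<le> ennreal (2 powr a) * (x epowr a + y epowr a)"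
proof -
  have "x + y \<le> 2 * max x y"
    by (metis add_mono max.cobounded1 max.cobounded2 mult_2)
  then have "(x + y) epowr a \<le> (2 * max x y) epowr a"
    using assms by (intro epowr_mono) auto
  also have "\<dots> = ennreal (2 powr a) * max x y epowr a"
    using assms epowr_ennreal[of 2 a] by (simp add: epowr_mult)
  also have "max x y epowr a \<le> x epowr a + y epowr a"
    by (cases "x \<le> y") (auto simp: max_def)
  finally show ?thesis by (simp add: mult_left_mono)
qed

lemma add_epowr_le:
  assumes "0 < a" shows "x epowr a + y epowr a \<le> 2 * (x + y) epowr a"
proof -
  have "x epowr a + y epowr a \<le> (x + y) epowr a + (x + y) epowr a"
    using assms by (intro add_mono epowr_mono) auto
  then show ?thesis by (simp add: mult_2)
qed

text \<open>Of the product \<open>x i * x i epowr (a - 1)\<close> only the second factor is enlarged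
  to the whole sum.\<close>

lemma sum_epowr_le:
  assumes "1 \<le> a" "finite I"
  shows "(\<Sum>i\<in>I. x i epowr a) \<le> (\<Sum>i\<in>I. x i) epowr a"
proof (cases "a = 1")
  case False
  then have a: "0 < a - 1" using assms by simp
  have "(\<Sum>i\<in>I. x i epowr a) = (\<Sum>i\<in>I. x i * x i epowr (a - 1))"
    using epowr_add[OF zero_less_one a] by simp
  also have "\<dots> \<le> (\<Sum>i\<in>I. x i * (\<Sum>i\<in>I. x i) epowr (a - 1))"
    using a assms by (intro sum_mono mult_left_mono epowr_mono sum_nonneg member_le_sum) auto
  also have "\<dots> = (\<Sum>i\<in>I. x i) * (\<Sum>i\<in>I. x i) epowr (a - 1)"
    by (simp add: sum_distrib_right)
  also have "\<dots> = (\<Sum>i\<in>I. x i) epowr a"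
    using epowr_add[OF zero_less_one a] by simp
  finally show ?thesis .
qed simp

section \<open>Geometric sums over sets of integers\<close>

lemma sum_geometric_above:
  fixes k :: int
  assumes "finite I" "I \<subseteq> {k..}" "0 < d"
  shows "(\<Sum>i\<in>I. 2 powr (- d * real_of_int (i - k))) \<le> 1 / (1 - 2 powr (- d))"
proof -
  let ?x = "2 powr (- d) :: real"
  have x: "0 < ?x" "?x < 1" using assms(3) by (auto simp: powr_less_one)
  have inj: "inj_on (\<lambda>i. nat (i - k)) I" 

  proof (rule inj_onI)
    fix x y assume "x \<in> I" "y \<in> I" "nat (x - k) = nat (y - k)"
    then show "x = y" using assms(2) by (auto simp: eq_nat_nat_iff subset_iff)
  qed
  have "(\<Sum>i\<in>I. 2 powr (- d * real_of_int (i - k))) = (\<Sum>i\<in>I. ?x ^ nat (i - k))"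
  proof (rule sum.cong[OF refl])
    fix i assume "i \<in> I"
    then have "k \<le> i" using assms(2) by auto
    then show "2 powr (- d * real_of_int (i - k)) = ?x ^ nat (i - k)"
      by (simp add: powr_powr flip: powr_realpow)
  qed
  also have "\<dots> = (\<Sum>n\<in>(\<lambda>i. nat (i - k)) ` I. ?x ^ n)"
    by (subst sum.reindex[OF inj]) simp
  also have "\<dots> \<le> (\<Sum>n. ?x ^ n)"
    using x assms(1) by (intro sum_le_suminf summable_geometric) auto
  also have "\<dots> = 1 / (1 - ?x)" using x by (intro suminf_geometric) auto
  finally show ?thesis .
qed

lemma sum_geometric_below:
  fixes k :: int
  assumes "finite I" "I \<subseteq> {..k}" "0 < d"
  shows "(\<Sum>i\<in>I. 2 powr (d * real_of_int i)) \<le> 2 powr (d * real_of_int k) / (1 - 2 powr (- d))"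
proof -
  have "(\<Sum>i\<in>I. 2 powr (d * real_of_int i))
      = 2 powr (d * real_of_int k) * (\<Sum>i\<in>I. 2 powr (- d * real_of_int (- i - (- k))))"
    by (simp add: sum_distrib_left algebra_simps flip: powr_add)
  also have "(\<Sum>i\<in>I. 2 powr (- d * real_of_int (- i - (- k))))
      = (\<Sum>i\<in>uminus ` I. 2 powr (- d * real_of_int (i - (- k))))"
    by (subst sum.reindex) (auto simp: inj_on_def)
  also have "\<dots> \<le> 1 / (1 - 2 powr (- d))"
    using assms by (intro sum_geometric_above) auto
  finally show ?thesis by (simp add: mult_left_mono)
qed

text \<open>Passing to the largest term \<open>2\<^sup>\<epsilon>\<^sup>i x\<^sub>i\<^sup>a\<close> replaces Minkowski's and Jensen's
  inequalities at the price of the weight \<open>2\<^sup>\<epsilon>\<^sup>i\<close>.\<close>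

definition geoC :: "real \<Rightarrow> real \<Rightarrow> real" where
  "geoC a \<epsilon> = (1 / (1 - 2 powr (- (\<epsilon> / a)))) powr a"

lemma epowr_sum_geometric:
  fixes k :: int
  assumes I: "finite I" "I \<subseteq> {k..}" and a: "0 < a" "0 < \<epsilon>"
  shows "(\<Sum>i\<in>I. x i) epowr a \<le> ennreal (geoC a \<epsilon>) * (\<Sum>i\<in>I. ennreal (2 powr (\<epsilon> * real_of_int (i - k))) * x i epowr a)"
    (is "_ \<le> _ * ?M")
proof -
  let ?d = "\<epsilon> / a"
  have d: "0 < ?d" using a by simp
  \<comment> \<open>Each \<open>x i\<close> is bounded through its own term of \<open>?M\<close>.
    The rate is \<epsilon>/a because the a-th power is taken only after the geometric series has
    been summed.\<close>
  have le: "x i \<le> ennreal (2 powr (- ?d * real_of_int (i - k))) * ?M epowr (1 / a)" if "i \<in> I" for i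
  proof -
    have "ennreal (2 powr (\<epsilon> * real_of_int (i - k))) * x i epowr a \<le> ?M"
      using I(1) that by (intro member_le_sum) auto
    then have "(ennreal (2 powr (\<epsilon> * real_of_int (i - k))) * x i epowr a) epowr (1 / a) \<le> ?M epowr (1 / a)"
      using a by (intro epowr_mono) auto
    then have "ennreal (2 powr (?d * real_of_int (i - k))) * x i \<le> ?M epowr (1 / a)"
      using a by (simp add: epowr_mult epowr_ennreal powr_powr)
    then have "ennreal (2 powr (- ?d * real_of_int (i - k))) * (ennreal (2 powr (?d * real_of_int (i - k))) * x i)
      \<le> ennreal (2 powr (- ?d * real_of_int (i - k))) * ?M epowr (1 / a)"
      by (intro mult_left_mono) auto
    moreover have "ennreal (2 powr (- ?d * real_of_int (i - k))) * ennreal (2 powr (?d * real_of_int (i - k))) = 1"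
      by (subst ennreal_mult'[symmetric]) (auto simp flip: powr_add)
    ultimately show ?thesis by (simp add: mult.assoc[symmetric])
  qed
  have "(\<Sum>i\<in>I. x i) \<le> (\<Sum>i\<in>I. ennreal (2 powr (- ?d * real_of_int (i - k))) * ?M epowr (1 / a))"
    by (intro sum_mono le)
  also have "\<dots> = ennreal (\<Sum>i\<in>I. 2 powr (- ?d * real_of_int (i - k))) * ?M epowr (1 / a)"
    by (simp add: sum_distrib_right sum_ennreal[symmetric] del: sum_ennreal)
  also have "\<dots> \<le> ennreal (1 / (1 - 2 powr (- ?d))) * ?M epowr (1 / a)"
    using sum_geometric_above[OF I d] by (intro mult_right_mono ennreal_leI) auto
  finally have "(\<Sum>i\<in>I. x i) epowr a \<le> (ennreal (1 / (1 - 2 powr (- ?d))) * ?M epowr (1 / a)) epowr a"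
    using a by (intro epowr_mono) auto
  also have "\<dots> = ennreal (geoC a \<epsilon>) * ?M"
    using a d by (simp add: epowr_mult epowr_ennreal geoC_def powr_less_one)
  finally show ?thesis .
qed

text \<open>Young's inequality for the functions divided by their norms. Vanishing and infinite
  norms come first, since this normalisation is impossible there.\<close>

lemma nn_integral_Hoelder:
  assumes [measurable]: "f \<in> borel_measurable M" "g \<in> borel_measurable M"
    and p: "1 < p" "1 / p + 1 / p' = 1"
  shows "(\<integral>\<^sup>+x. f x * g x \<partial>M)
    \<le> (\<integral>\<^sup>+x. f x epowr p \<partial>M) epowr (1 / p) * (\<integral>\<^sup>+x. g x epowr p' \<partial>M) epowr (1 / p')"
    (is "?L \<le> ?A epowr _ * ?B epowr _")
proof -
  have p': "1 < p'"
  proof -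
    have "1 / p < 1" "0 < 1 / p" using p(1) by auto
    then have "0 < 1 / p'" "1 / p' < 1" using p(2) by linarith+
    then show ?thesis by (simp add: divide_less_eq split: if_splits)
  qed
  consider "?A = 0" | "?B = 0" | "?A \<noteq> 0" "?B \<noteq> 0" "?A = top \<or> ?B = top"
    | "?A \<noteq> 0" "?B \<noteq> 0" "?A \<noteq> top" "?B \<noteq> top" by auto
  then show ?thesis
  proof cases
    case 1
    then have "AE x in M. f x epowr p = 0" by (subst (asm) nn_integral_0_iff_AE) auto
    then have "AE x in M. f x * g x = 0" using p by (auto simp: epowr_eq_0_iff elim!: eventually_mono)
    then have "?L = 0" by (subst nn_integral_0_iff_AE) auto
    then show ?thesis by simp
  next
    case 2
    then have "AE x in M. g x epowr p' = 0" by (subst (asm) nn_integral_0_iff_AE) auto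
    then have "AE x in M. f x * g x = 0" using p' by (auto simp: epowr_eq_0_iff elim!: eventually_mono)
    then have "?L = 0" by (subst nn_integral_0_iff_AE) auto
    then show ?thesis by simp
  next
    case 3
    then have "?A epowr (1 / p) * ?B epowr (1 / p') = top"
      using p p' by (auto simp: ennreal_mult_eq_top_iff epowr_eq_top_iff epowr_eq_0_iff)
    then show ?thesis by simp
  next
    case 4
    define A where "A = enn2real ?A"
    define B where "B = enn2real ?B"
    have A: "?A = ennreal A" "0 < A" using 4 by (auto simp: A_def enn2real_positive_iff less_top zero_less_iff_neq_zero)
    have B: "?B = ennreal B" "0 < B" using 4 by (auto simp: B_def enn2real_positive_iff less_top zero_less_iff_neq_zero)
    let ?c = "A powr (1/p) * B powr (1/p')"
    have pt: "f x * g x \<le> ennreal ?c * (ennreal (1 / (p * A)) * f x epowr p + ennreal (1 / (p' * B)) * g x epowr p')" for x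
    proof -
      consider "f x = 0 \<or> g x = 0" | "f x = top \<or> g x = top" "f x \<noteq> 0" "g x \<noteq> 0" | a b where "f x = ennreal a" "g x = ennreal b" "0 < a" "0 < b"
        by (cases "f x"; cases "g x") (auto simp: less_le)
      then show ?thesis
      proof cases
        case 1 then show ?thesis by auto
      next
        case 2
        then have "ennreal (1 / (p * A)) * f x epowr p + ennreal (1 / (p' * B)) * g x epowr p' = top"
          using p p' A B by (auto simp: ennreal_mult_eq_top_iff epowr_eq_top_iff)
        then show ?thesis using A B by (simp only:) (simp add: ennreal_mult_top)
      next
        case (3 a b)
        have "(a / A powr (1/p)) * (b / B powr (1/p')) \<le> (a / A powr (1/p)) powr p / p + (b / B powr (1/p')) powr p' / p'"
          using 3 A B p p' by (intro Youngs_inequality) auto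
        also have "\<dots> = a powr p / (p * A) + b powr p' / (p' * B)"
          using 3 A B p p' by (simp add: powr_divide powr_powr mult.commute)
        finally have "a * b \<le> ?c * (a powr p / (p * A) + b powr p' / (p' * B))"
          using A B by (simp add: field_simps)
        then have "ennreal (a * b) \<le> ennreal (?c * (a powr p / (p * A) + b powr p' / (p' * B)))"
          by (rule ennreal_leI)
        also have "\<dots> = ennreal ?c * (ennreal (1 / (p * A)) * ennreal (a powr p) + ennreal (1 / (p' * B)) * ennreal (b powr p'))"
          using 3 A B p p' by (simp add: ennreal_mult'[symmetric] ennreal_plus[symmetric] del: ennreal_plus)
        finally show ?thesis using 3 by (simp add: epowr_ennreal ennreal_mult')
      qed
    qed
    have "?L \<le> (\<integral>\<^sup>+x. ennreal ?c * (ennreal (1 / (p * A)) * f x epowr p + ennreal (1 / (p' * B)) * g x epowr p') \<partial>M)"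
      by (intro nn_integral_mono pt)
    also have "\<dots> = ennreal ?c * (ennreal (1 / (p * A)) * ennreal A + ennreal (1 / (p' * B)) * ennreal B)"
      using A B by (simp add: nn_integral_cmult nn_integral_add)
    also have "\<dots> = ennreal ?c * ennreal (1 / p + 1 / p')"
      using A B p p' by (simp add: ennreal_mult'[symmetric] ennreal_plus[symmetric] del: ennreal_plus)
    also have "\<dots> = ennreal ?c" using p by simp
    also have "\<dots> = ?A epowr (1/p) * ?B epowr (1/p')"
      using A B by (simp add: epowr_ennreal ennreal_mult')
    finally show ?thesis .
  qed
qed

lemma sum_Hoelder:
  fixes f g :: "'i \<Rightarrow> real"
  assumes fin: "finite I" and nn: "\<And>i. i \<in> I \<Longrightarrow> 0 \<le> f i" "\<And>i. i \<in> I \<Longrightarrow> 0 \<le> g i"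
    and p: "1 < p" "1 / p + 1 / p' = 1"
  shows "(\<Sum>i\<in>I. f i * g i) \<le> (\<Sum>i\<in>I. f i powr p) powr (1 / p) * (\<Sum>i\<in>I. g i powr p') powr (1 / p')"
proof -
  have p': "0 < p'"
  proof -
    have "1 / p < 1" "0 < 1 / p" using p(1) by auto
    then have "0 < 1 / p'" using p(2) by linarith
    then show ?thesis by simp
  qed
  have "ennreal (\<Sum>i\<in>I. f i * g i) = (\<integral>\<^sup>+i. ennreal (f i) * ennreal (g i) \<partial>count_space I)"
    using fin nn by (simp add: nn_integral_count_space_finite sum_ennreal[symmetric] ennreal_mult del: sum_ennreal)
  also have "\<dots> \<le> (\<integral>\<^sup>+i. ennreal (f i) epowr p \<partial>count_space I) epowr (1 / p)
     * (\<integral>\<^sup>+i. ennreal (g i) epowr p' \<partial>count_space I) epowr (1 / p')"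
    using p by (intro nn_integral_Hoelder) auto
  also have "\<dots> = ennreal (\<Sum>i\<in>I. f i powr p) epowr (1 / p) * ennreal (\<Sum>i\<in>I. g i powr p') epowr (1 / p')"
    using fin nn p p' by (simp add: nn_integral_count_space_finite epowr_ennreal_pos)
  also have "\<dots> = ennreal ((\<Sum>i\<in>I. f i powr p) powr (1 / p) * (\<Sum>i\<in>I. g i powr p') powr (1 / p'))"
    using p p' by (simp add: epowr_ennreal_pos sum_nonneg ennreal_mult)
  finally show ?thesis by (subst (asm) ennreal_le_iff) auto
qed

section \<open>The discrete Hardy inequality\<close>

lemma powr_diff_le:
  fixes x y s :: real
  assumes "0 \<le> y" "y \<le> x" "1 \<le> s"
  shows "x powr s - y powr s \<le> s * (x - y) * x powr (s - 1)"
proof (cases "y = 0 \<or> y = x")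
  case True
  show ?thesis
  proof (cases "x = 0")
    case False
    then have "x powr s = x * x powr (s - 1)"
      using assms by (simp add: powr_diff)
    moreover have "x * x powr (s - 1) \<le> s * (x * x powr (s - 1))"
      using assms mult_right_mono[of 1 s "x * x powr (s - 1)"] by simp
    ultimately show ?thesis using True assms by (auto simp: mult.assoc)
  qed (use assms True in auto)
next
  case False
  then have y: "0 < y" "y < x" using assms by auto
  have "\<exists>z>y. z < x \<and> x powr s - y powr s = (x - y) * (s * z powr (s - 1))"
    using y by (intro MVT2) (auto intro!: derivative_eq_intros)
  then obtain z where z: "y < z" "z < x" "x powr s - y powr s = (x - y) * (s * z powr (s - 1))" by auto
  have "(x - y) * (s * z powr (s - 1)) \<le> (x - y) * (s * x powr (s - 1))"
    using y z assms by (intro mult_left_mono powr_mono2) auto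
  then show ?thesis using z(3) by (simp add: mult_ac)
qed

lemma powr_neg_diff_ge:
  fixes x y s :: real
  assumes "0 < y" "y \<le> x" "1 < s"
  shows "(s - 1) * (x - y) * x powr (- s) \<le> y powr (1 - s) - x powr (1 - s)"
proof (cases "y = x")
  case False
  then have y: "y < x" using assms by auto
  have "\<exists>z>y. z < x \<and> x powr (1 - s) - y powr (1 - s) = (x - y) * ((1 - s) * z powr (1 - s - 1))"
    using y assms by (intro MVT2) (auto intro!: derivative_eq_intros)
  then obtain z where z: "y < z" "z < x" "x powr (1 - s) - y powr (1 - s) = (x - y) * ((1 - s) * z powr (- s))" by auto
  have "(x - y) * ((s - 1) * x powr (- s)) \<le> (x - y) * ((s - 1) * z powr (- s))"
    using y z assms by (intro mult_left_mono powr_mono2') auto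
  then show ?thesis using z(3) by (simp add: algebra_simps)
qed simp

lemma sum_atLeastAtMost_Suc_int:
  fixes a b :: int shows "a \<le> b + 1 \<Longrightarrow> sum f {a..b + 1} = sum f {a..b} + f (b + 1)"
  by (subgoal_tac "{a..b + 1} = insert (b + 1) {a..b}") (auto simp: add.commute)

text \<open>A discrete form of (f^s)' = s f' f^(s-1): each increment of the power is estimated at
  its upper end by \<open>powr_diff_le\<close>.\<close>

lemma sum_powr_le_telescope:
  fixes d :: "int \<Rightarrow> real"
  assumes d: "\<And>i. 0 \<le> d i" and s: "1 \<le> s" and "a - 1 \<le> b"
  shows "(\<Sum>i=a..b. d i) powr s \<le> s * (\<Sum>i=a..b. d i * (\<Sum>j=a..i. d j) powr (s - 1))"
  using \<open>a - 1 \<le> b\<close>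
proof (induction b rule: int_ge_induct)
  case (step b)
  have "(\<Sum>i=a..b + 1. d i) powr s - (\<Sum>i=a..b. d i) powr s
    \<le> s * ((\<Sum>i=a..b + 1. d i) - (\<Sum>i=a..b. d i)) * (\<Sum>i=a..b + 1. d i) powr (s - 1)"
    using d s step by (intro powr_diff_le sum_nonneg) (auto simp: sum_atLeastAtMost_Suc_int)
  also have "(\<Sum>i=a..b + 1. d i) - (\<Sum>i=a..b. d i) = d (b + 1)"
    using step by (simp add: sum_atLeastAtMost_Suc_int)
  finally have "(\<Sum>i=a..b + 1. d i) powr s
      \<le> (\<Sum>i=a..b. d i) powr s + s * (d (b + 1) * (\<Sum>i=a..b + 1. d i) powr (s - 1))" by simp
  also have "\<dots> \<le> s * (\<Sum>i=a..b. d i * (\<Sum>j=a..i. d j) powr (s - 1)) + s * (d (b + 1) * (\<Sum>i=a..b + 1. d i) powr (s - 1))"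
    using step by simp
  also have "\<dots> = s * (\<Sum>i=a..b + 1. d i * (\<Sum>j=a..i. d j) powr (s - 1))"
    using step sum_atLeastAtMost_Suc_int[of a b "\<lambda>i. d i * (\<Sum>j=a..i. d j) powr (s - 1)"]
    by (simp add: distrib_left)
  finally show ?case .
qed simp

text \<open>The integral of W^(-s) dW beyond W_i is W_i^(1-s) / (s-1). The term k = i sits at the
  left end of this range and adds one more W_i^(1-s), hence the constant 1 + 1/(s-1).\<close>

lemma sum_tail_powr_le:
  fixes l :: "int \<Rightarrow> real"
  assumes l: "\<And>i. 0 < l i" and s: "1 < s" and that: "a \<le> i" "i \<le> b"
  shows "(\<Sum>k=i..b. l k * (\<Sum>j=a..k. l j) powr (- s)) \<le> s / (s - 1) * (\<Sum>j=a..i. l j) powr (1 - s)"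
proof -
  let ?W = "\<lambda>k. \<Sum>j=a..k. l j"
  have W0: "0 < ?W k" if "a \<le> k" for k using l that by (intro sum_pos) auto
  \<comment> \<open>The extra summand bounds whatever would follow beyond b; with it the induction
    closes.\<close>
  have "(\<Sum>k=i..b. l k * ?W k powr (- s)) + ?W b powr (1 - s) / (s - 1) \<le> s / (s - 1) * ?W i powr (1 - s)"
    using \<open>i \<le> b\<close>
  proof (induction b rule: int_ge_induct)
    case base
    have "l i * ?W i powr (- s) \<le> ?W i * ?W i powr (- s)"
      using that l by (intro mult_right_mono member_le_sum) (auto intro: less_imp_le)
    also have "\<dots> = ?W i powr (1 - s)" using W0[of i] that by (simp add: powr_diff powr_minus divide_simps)
    finally have "l i * ?W i powr (- s) + ?W i powr (1 - s) / (s - 1) \<le> ?W i powr (1 - s) + ?W i powr (1 - s) / (s - 1)" by simp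
    also have "\<dots> = s / (s - 1) * ?W i powr (1 - s)" using s by (simp add: field_simps)
    finally show ?case by simp
  next
    case (step b)
    have b: "a \<le> b" using step that by simp
    have "(s - 1) * (?W (b + 1) - ?W b) * ?W (b + 1) powr (- s) \<le> ?W b powr (1 - s) - ?W (b + 1) powr (1 - s)"
      using W0[OF b] s b l[of "b+1"] by (intro powr_neg_diff_ge) (auto simp: sum_atLeastAtMost_Suc_int)
    moreover have "?W (b + 1) - ?W b = l (b + 1)" using b by (simp add: sum_atLeastAtMost_Suc_int)
    ultimately have "(s - 1) * (l (b + 1) * ?W (b + 1) powr (- s)) \<le> ?W b powr (1 - s) - ?W (b + 1) powr (1 - s)"
      by (simp add: mult_ac)
    then have *: "l (b + 1) * ?W (b + 1) powr (- s) + ?W (b + 1) powr (1 - s) / (s - 1) \<le> ?W b powr (1 - s) / (s - 1)"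
    proof -
      let ?c = "l (b + 1) * ?W (b + 1) powr (- s)"
      have "(s - 1) * ?c / (s - 1) \<le> (?W b powr (1 - s) - ?W (b + 1) powr (1 - s)) / (s - 1)"
        using s \<open>(s - 1) * ?c \<le> _\<close> by (intro divide_right_mono) auto
      then show ?thesis using s by (simp add: diff_divide_distrib)
    qed
    have "(\<Sum>k=i..b + 1. l k * ?W k powr (- s)) = (\<Sum>k=i..b. l k * ?W k powr (- s)) + l (b + 1) * ?W (b + 1) powr (- s)"
      using step by (intro sum_atLeastAtMost_Suc_int) auto
    then show ?case using * step.IH by linarith
  qed
  moreover have "0 \<le> ?W b powr (1 - s) / (s - 1)" using s by simp
  ultimately show ?thesis by linarith
qed

lemma sum_triangle_swap:
  fixes a b :: int and f :: "int \<Rightarrow> int \<Rightarrow> 'a::comm_monoid_add"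
  shows "(\<Sum>k=a..b. \<Sum>i=a..k. f k i) = (\<Sum>i=a..b. \<Sum>k=i..b. f k i)"
proof -
  have "(\<Sum>k=a..b. \<Sum>i=a..k. f k i) = (\<Sum>k\<in>{a..b}. \<Sum>i | i \<in> {a..b} \<and> i \<le> k. f k i)"
    by (intro sum.cong refl) auto
  also have "\<dots> = (\<Sum>i\<in>{a..b}. \<Sum>k | k \<in> {a..b} \<and> i \<le> k. f k i)"
    by (rule sum.swap_restrict) auto
  also have "\<dots> = (\<Sum>i=a..b. \<Sum>k=i..b. f k i)"
    by (intro sum.cong refl) auto
  finally show ?thesis .
qed

lemma sum_power_Fubini_le:
  fixes d n :: "int \<Rightarrow> real"
  assumes "\<And>i. 0 \<le> d i" "\<And>i. 0 \<le> n i" "1 \<le> s"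
  shows "(\<Sum>k=a..b. n k * (\<Sum>i=a..k. d i) powr s)
    \<le> s * (\<Sum>i=a..b. d i * (\<Sum>j=a..i. d j) powr (s - 1) * (\<Sum>k=i..b. n k))"
proof -
  have "(\<Sum>k=a..b. n k * (\<Sum>i=a..k. d i) powr s)
     \<le> (\<Sum>k=a..b. n k * (s * (\<Sum>i=a..k. d i * (\<Sum>j=a..i. d j) powr (s - 1))))"
    using assms by (intro sum_mono mult_left_mono sum_powr_le_telescope) auto
  also have "\<dots> = s * (\<Sum>k=a..b. \<Sum>i=a..k. n k * (d i * (\<Sum>j=a..i. d j) powr (s - 1)))"
    by (simp add: sum_distrib_left mult_ac)
  also have "\<dots> = s * (\<Sum>i=a..b. d i * (\<Sum>j=a..i. d j) powr (s - 1) * (\<Sum>k=i..b. n k))"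
    by (subst sum_triangle_swap) (simp add: sum_distrib_left sum_distrib_right mult_ac)
  finally show ?thesis .
qed

locale discrete_hardy =
  fixes s q s' q' :: real and a b :: int and n w \<alpha> :: "int \<Rightarrow> real"
  assumes s: "1 < s" "1 / s + 1 / s' = 1" and q: "1 < q" "1 / q + 1 / q' = 1"
    and n: "\<And>k. 0 \<le> n k" and w: "\<And>k. 0 < w k" and \<alpha>: "\<And>k. 0 \<le> \<alpha> k"
begin

definition "F k = (\<Sum>i=a..k. w i * \<alpha> i)"
definition "W k = (\<Sum>i=a..k. w i powr s')"
definition "Nt k = (\<Sum>i=k..b. n i)"
definition "A = (\<Sum>i=a..b. \<alpha> i powr s)"

lemma s': "s' = s / (s - 1)" "1 < s'" "s = (s - 1) * s'"
proof -
  have "1 / s' = 1 - 1 / s" using s by linarith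
  also have "\<dots> = (s - 1) / s" using s by (simp add: diff_divide_distrib)
  finally have "inverse (1 / s') = inverse ((s - 1) / s)" by (rule arg_cong)
  then show *: "s' = s / (s - 1)" by simp
  show "1 < s'" "s = (s - 1) * s'" using s(1) unfolding * by simp_all
qed

lemma q': "q' = q / (q - 1)" "1 < q'" "q = (q - 1) * q'"
proof -
  have "1 / q' = 1 - 1 / q" using q by linarith
  also have "\<dots> = (q - 1) / q" using q by (simp add: diff_divide_distrib)
  finally have "inverse (1 / q') = inverse ((q - 1) / q)" by (rule arg_cong)
  then show *: "q' = q / (q - 1)" by simp
  show "1 < q'" "q = (q - 1) * q'" using q(1) unfolding * by simp_all
qed

lemma ss': "s / s' = s - 1"
proof -
  have "s / s' = s * (1 / s')" by simp
  also have "1 / s' = 1 - 1 / s" using s(2) by linarith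
  finally show ?thesis using s(1) by (simp add: right_diff_distrib)
qed

lemma qq': "q / q' = q - 1"
proof -
  have "q / q' = q * (1 / q')" by simp
  also have "1 / q' = 1 - 1 / q" using q(2) by linarith
  finally show ?thesis using q(1) by (simp add: right_diff_distrib)
qed

lemma w_ne: "w k \<noteq> 0" using w[of k] by simp
lemma F0: "0 \<le> F k" unfolding F_def using w \<alpha> by (intro sum_nonneg) (auto simp: less_imp_le)
lemma W0: "a \<le> k \<Longrightarrow> 0 < W k" unfolding W_def using w by (intro sum_pos) (auto simp: less_imp_le w_ne)
lemma N0: "0 \<le> Nt k" unfolding Nt_def using n by (intro sum_nonneg) auto
lemma A0: "0 \<le> A" unfolding A_def by (intro sum_nonneg) auto

lemma F_le: "k \<le> b \<Longrightarrow> F k \<le> W k powr (1 / s') * A powr (1 / s)"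
proof -
  assume k: "k \<le> b"
  have "F k = (\<Sum>i=a..k. \<alpha> i * w i)" by (simp add: F_def mult.commute)
  also have "\<dots> \<le> (\<Sum>i=a..k. \<alpha> i powr s) powr (1 / s) * W k powr (1 / s')"
    unfolding W_def using s \<alpha> w by (intro sum_Hoelder) (auto simp: less_imp_le)
  also have "(\<Sum>i=a..k. \<alpha> i powr s) powr (1 / s) \<le> A powr (1 / s)"
    unfolding A_def using k s by (intro powr_mono2 sum_mono2 sum_nonneg) auto
  finally show ?thesis by (simp add: mult_ac mult_left_mono mult_right_mono)
qed

text \<open>The left-hand side of Hardy's inequality for the averages \<open>F / W\<close>. Being a
  finite real number, it can be cancelled in \<open>X_le\<close>.\<close>

definition "X = (\<Sum>i=a..b. w i powr s' * (F i / W i) powr s)"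

lemma X0: "0 \<le> X" unfolding X_def by (intro sum_nonneg) auto

lemma avg_sum_le:
  assumes "a \<le> b"
  shows "(\<Sum>i=a..b. w i * \<alpha> i * (F i / W i) powr (s - 1)) \<le> A powr (1 / s) * X powr (1 / s')"
proof -
  have "(\<Sum>i=a..b. w i * \<alpha> i * (F i / W i) powr (s - 1)) = (\<Sum>i=a..b. \<alpha> i * (w i * (F i / W i) powr (s - 1)))"
    by (simp add: mult_ac)
  also have "\<dots> \<le> (\<Sum>i=a..b. \<alpha> i powr s) powr (1 / s) * (\<Sum>i=a..b. (w i * (F i / W i) powr (s - 1)) powr s') powr (1 / s')"
    using s \<alpha> w by (intro sum_Hoelder) (auto simp: less_imp_le)
  also have "(\<Sum>i=a..b. (w i * (F i / W i) powr (s - 1)) powr s') = X"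
    unfolding X_def using w s'(3) by (intro sum.cong) (auto simp: powr_mult powr_powr less_imp_le)
  finally show ?thesis by (simp add: A_def)
qed

text \<open>Expanding \<open>F powr s\<close> and summing the tails of \<open>W powr (- s)\<close>
  leads back to averages of order s - 1, and Hoelder's inequality then bounds \<open>X\<close> by a
  multiple of \<open>X powr (1 / s')\<close>; this power is divided out.\<close>

lemma X_le: "X \<le> (s * s') powr s * A"
proof (cases "a \<le> b")
  case True
  have "X = (\<Sum>k=a..b. (w k powr s' * W k powr (- s)) * F k powr s)"
    unfolding X_def using F0 W0 by (intro sum.cong) (auto simp: powr_divide powr_minus less_imp_le field_simps)
  also have "\<dots> \<le> s * (\<Sum>i=a..b. w i * \<alpha> i * F i powr (s - 1) * (\<Sum>k=i..b. w k powr s' * W k powr (- s)))"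
    unfolding F_def using s w \<alpha> by (intro sum_power_Fubini_le) (auto simp: less_imp_le)
  also have "\<dots> \<le> s * (\<Sum>i=a..b. w i * \<alpha> i * F i powr (s - 1) * (s / (s - 1) * W i powr (1 - s)))"
    unfolding W_def using s w \<alpha> True
    by (intro mult_left_mono sum_mono sum_tail_powr_le) (auto simp: less_imp_le w_ne)
  also have "\<dots> = s * s' * (\<Sum>i=a..b. w i * \<alpha> i * (F i / W i) powr (s - 1))"
  proof -
    have "w i * \<alpha> i * F i powr (s - 1) * (s / (s - 1) * W i powr (1 - s)) = s' * (w i * \<alpha> i * (F i / W i) powr (s - 1))"
      if "i \<in> {a..b}" for i
      using F0[of i] W0[of i] that by (auto simp: powr_divide s'(1) powr_diff less_imp_le field_simps)
    then have "(\<Sum>i=a..b. w i * \<alpha> i * F i powr (s - 1) * (s / (s - 1) * W i powr (1 - s)))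
       = (\<Sum>i=a..b. s' * (w i * \<alpha> i * (F i / W i) powr (s - 1)))" by (rule sum.cong[OF refl])
    then show ?thesis by (simp only: sum_distrib_left[symmetric] mult.assoc)
  qed
  also have "\<dots> \<le> s * s' * (A powr (1 / s) * X powr (1 / s'))"
    using avg_sum_le[OF True] s s' by (intro mult_left_mono) auto
  finally have *: "X \<le> s * s' * A powr (1 / s) * X powr (1 / s')" by (simp add: mult_ac)
  show ?thesis
  proof (cases "X = 0")
    case False
    then have X: "0 < X" using X0 by simp
    have "X powr (1 / s) * X powr (1 / s') = X" using X s by (simp flip: powr_add)
    then have "X powr (1 / s) \<le> s * s' * A powr (1 / s)"
      using * X by (metis mult_le_cancel_right powr_gt_zero not_less less_irrefl)
    then have "(X powr (1 / s)) powr s \<le> (s * s' * A powr (1 / s)) powr s"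
      using s by (intro powr_mono2) auto
    then show ?thesis using X A0 s(1) s'(2) by (simp add: powr_powr powr_mult)
  qed (use A0 in simp)
qed (simp add: X_def A_def)

lemma avg_sum_le': "(\<Sum>i=a..b. w i * \<alpha> i * (F i / W i) powr (s - 1)) \<le> (s * s') powr (s - 1) * A"
proof (cases "a \<le> b")
  case True
  have "(\<Sum>i=a..b. w i * \<alpha> i * (F i / W i) powr (s - 1)) \<le> A powr (1 / s) * X powr (1 / s')"
    by (rule avg_sum_le[OF True])
  also have "\<dots> \<le> A powr (1 / s) * ((s * s') powr s * A) powr (1 / s')"
    using X_le X0 s'(2) by (intro mult_left_mono powr_mono2) auto
  also have "\<dots> = (s * s') powr (s - 1) * (A powr (1 / s) * A powr (1 / s'))"
    using ss' A0 s' s by (simp add: powr_mult powr_powr)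
  also have "A powr (1 / s) * A powr (1 / s') = A"
    using s A0 by (simp flip: powr_add)
  finally show ?thesis .
qed (simp add: A_def)

lemma power_step: "(\<Sum>k=a..b. n k * F k powr q) \<le> q * (\<Sum>i=a..b. w i * \<alpha> i * F i powr (q - 1) * Nt i)"
  unfolding F_def Nt_def using q n w \<alpha> by (intro sum_power_Fubini_le) (auto simp: less_imp_le)

text \<open>Of \<open>F powr (q - 1)\<close> the part \<open>F powr (s - 1)\<close> goes into the
  averages, and the rest \<open>F powr (q - s)\<close>, of non-negative exponent, into Hoelder's
  bound \<open>F_le\<close>. The powers of \<open>W\<close> then add up to q/s', which is what
  \<open>B\<close> controls.\<close>

lemma upper_le:
  assumes sq: "s \<le> q" and B: "\<And>k. a \<le> k \<Longrightarrow> k \<le> b \<Longrightarrow> W k powr (1 / s') * Nt k powr (1 / q) \<le> B"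
  shows "(\<Sum>k=a..b. n k * F k powr q) \<le> q * (s * s') powr (s - 1) * B powr q * A powr (q / s)"
proof -
  have trm: "w i * \<alpha> i * F i powr (q - 1) * Nt i
      \<le> B powr q * A powr ((q - s) / s) * (w i * \<alpha> i * (F i / W i) powr (s - 1))" if i: "i \<in> {a..b}" for i
  proof (cases "F i = 0")
    case False
    then have Fi: "0 < F i" using F0[of i] by simp
    have Wi: "0 < W i" using W0 i by simp
    have "(W i powr (1 / s') * Nt i powr (1 / q)) powr q \<le> B powr q"
      using B i q by (intro powr_mono2) auto
    then have 1: "W i powr (q / s') * Nt i \<le> B powr q"
      using q N0[of i] by (simp add: powr_mult powr_powr)
    have "F i powr (q - s) \<le> (W i powr (1 / s') * A powr (1 / s)) powr (q - s)"
      using i F_le[of i] F0 sq by (intro powr_mono2) auto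
    then have 2: "F i powr (q - s) \<le> W i powr ((q - s) / s') * A powr ((q - s) / s)"
      by (simp add: powr_mult powr_powr)
    have e: "(q - s) / s' + (s - 1) = q / s'"
      by (simp add: diff_divide_distrib ss')
    have "F i powr (q - 1) * Nt i = F i powr (s - 1) * (F i powr (q - s) * Nt i)"
      using Fi by (simp add: mult.assoc[symmetric] flip: powr_add)
    also have "\<dots> \<le> F i powr (s - 1) * (W i powr ((q - s) / s') * A powr ((q - s) / s) * Nt i)"
      using 2 N0 by (intro mult_left_mono mult_right_mono) auto
    also have "\<dots> = (F i / W i) powr (s - 1) * A powr ((q - s) / s) * (W i powr (q / s') * Nt i)"
      using Wi Fi unfolding e[symmetric] by (simp add: powr_add powr_divide)
    also have "\<dots> \<le> (F i / W i) powr (s - 1) * A powr ((q - s) / s) * B powr q"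
      using 1 by (intro mult_left_mono) auto
    finally have "w i * \<alpha> i * (F i powr (q - 1) * Nt i) \<le> w i * \<alpha> i * ((F i / W i) powr (s - 1) * A powr ((q - s) / s) * B powr q)"
      using w \<alpha> by (intro mult_left_mono) (auto simp: less_imp_le)
    then show ?thesis by (simp add: mult_ac)
  qed (use w[of i] in simp)
  have "(\<Sum>k=a..b. n k * F k powr q) \<le> q * (\<Sum>i=a..b. B powr q * A powr ((q - s) / s) * (w i * \<alpha> i * (F i / W i) powr (s - 1)))"
    using q(1) by (intro order.trans[OF power_step] mult_left_mono sum_mono trm) auto
  also have "\<dots> = q * (B powr q * A powr ((q - s) / s)) * (\<Sum>i=a..b. w i * \<alpha> i * (F i / W i) powr (s - 1))"
    by (simp add: sum_distrib_left mult_ac)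
  also have "\<dots> \<le> q * (B powr q * A powr ((q - s) / s)) * ((s * s') powr (s - 1) * A)"
    using avg_sum_le' q by (intro mult_left_mono) auto
  also have "\<dots> = q * (s * s') powr (s - 1) * B powr q * (A powr ((q - s) / s) * A)" by (simp add: mult_ac)
  also have "A powr ((q - s) / s) * A = A powr (q / s)"
  proof (cases "A = 0")
    case False
    have "A powr ((q - s) / s) * A powr 1 = A powr ((q - s) / s + 1)" by (simp only: powr_add)
    then show ?thesis using s False A0 by (simp add: diff_divide_distrib)
  qed simp
  finally show ?thesis .
qed

text \<open>The exponent q - s is now negative. So the weights are separated by Hoelder's inequality
  with exponents s/q and r/q, and \<alpha> is separated from the averages by a second one with q and
  q'.\<close>

lemma upper_gt:
  assumes qs: "q < s" "1 / r = 1 / q - 1 / s"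
  shows "(\<Sum>k=a..b. n k * F k powr q)
    \<le> q * (s * s') powr (q - 1) * A powr (q / s) * (\<Sum>k=a..b. W k powr (r / q') * w k powr s' * Nt k powr (r / q)) powr (q / r)"
proof -
  have r: "0 < r" "q / s + q / r = 1"
  proof -
    have "0 < 1 / r" using qs q by (simp add: frac_less2)
    then show "0 < r" by simp
    have "q * (1 / s + 1 / r) = 1" using qs q by simp
    then show "q / s + q / r = 1" by (simp add: distrib_left)
  qed
  \<comment> \<open>The powers of \<open>w\<close> in \<open>Z\<close> and in
    \<open>G powr (q - 1)\<close> cancel. They are such that the s-th powers of \<open>G\<close> sum
    to \<open>X\<close> and the (r/q)-th powers of \<open>Z\<close> are the summands of the
    criterion.\<close>
  define Z where "Z i = w i * w i powr (- s' * (q - 1) / s) * W i powr (q - 1) * Nt i" for i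
  define G where "G i = w i powr (s' / s) * (F i / W i)" for i
  have G0: "0 \<le> G i" if "i \<in> {a..b}" for i using that F0 W0[of i] by (auto simp: G_def intro!: mult_nonneg_nonneg divide_nonneg_pos)
  have Z0: "0 \<le> Z i" for i using w N0 by (auto simp: Z_def less_imp_le intro!: mult_nonneg_nonneg)
  have trm: "w i * \<alpha> i * F i powr (q - 1) * Nt i = (\<alpha> i * G i powr (q - 1)) * Z i" if i: "i \<in> {a..b}" for i
  proof -
    have "G i powr (q - 1) = w i powr (s' * (q - 1) / s) * (F i powr (q - 1) / W i powr (q - 1))"
      using w[of i] F0[of i] W0[of i] i by (simp add: G_def powr_mult powr_powr powr_divide less_imp_le)
    then have "(\<alpha> i * G i powr (q - 1)) * Z i = w i * \<alpha> i * F i powr (q - 1) * Nt i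
        * (w i powr (s' * (q - 1) / s) * w i powr (- s' * (q - 1) / s)) * (W i powr (q - 1) / W i powr (q - 1))"
      by (simp add: Z_def)
    moreover have "w i powr (s' * (q - 1) / s) * w i powr (- s' * (q - 1) / s) = 1"
      using w[of i] by (simp flip: powr_add)
    moreover have "W i powr (q - 1) / W i powr (q - 1) = 1" using W0[of i] i by simp
    ultimately show ?thesis by (simp only: mult_1_right)
  qed
  have Zr: "Z i powr (r / q) = W i powr (r / q') * w i powr s' * Nt i powr (r / q)" if i: "i \<in> {a..b}" for i
  proof -
    have e1: "(q - 1) * (r / q) = r / q'"
      using q q'(2) by (subst qq'[symmetric]) simp
    have "q / r = (s - q) / s"
    proof -
      have "q / r = q * (1 / r)" by simp
      also have "\<dots> = 1 - q / s" unfolding qs(2) using q(1) by (simp add: right_diff_distrib)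
      finally show ?thesis using s(1) by (simp add: diff_divide_distrib)
    qed
    then have "inverse (q / r) = inverse ((s - q) / s)" by (rule arg_cong)
    then have "r / q = s / (s - q)" by simp
    then have "(1 + - s' * (q - 1) / s) * (r / q) = (1 - (q - 1) / (s - 1)) * (s / (s - q))"
      using s(1) by (simp add: s'(1))
    also have "1 - (q - 1) / (s - 1) = (s - q) / (s - 1)"
      using s(1) divide_self[of "s - 1"] by (simp add: diff_divide_distrib[symmetric] diff_divide_eq_iff)
    finally have e2: "(1 + - s' * (q - 1) / s) * (r / q) = s'" using s(1) qs by (simp add: s'(1))
    have "Z i = w i powr (1 + - s' * (q - 1) / s) * W i powr (q - 1) * Nt i"
      using w[of i] by (simp only: Z_def powr_add) simp
    then have "Z i powr (r / q) = w i powr ((1 + - s' * (q - 1) / s) * (r / q)) * W i powr ((q - 1) * (r / q)) * Nt i powr (r / q)"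
      by (simp only: powr_mult powr_powr)
    then show ?thesis unfolding e1 e2 by (simp add: mult_ac)
  qed
  have GX: "(\<Sum>i=a..b. G i powr s) = X"
  proof -
    have "G i powr s = w i powr s' * (F i / W i) powr s" for i
      using s(1) by (simp only: G_def powr_mult powr_powr) simp
    then show ?thesis by (simp add: X_def)
  qed
  let ?Y = "\<Sum>k=a..b. W k powr (r / q') * w k powr s' * Nt k powr (r / q)"
  let ?S = "\<Sum>i=a..b. (\<alpha> i * G i powr (q - 1)) powr (s / q)"
  have 1: "(\<Sum>k=a..b. n k * F k powr q) \<le> q * (\<Sum>i=a..b. (\<alpha> i * G i powr (q - 1)) * Z i)"
    using power_step by (subst sum.cong[OF refl trm, symmetric])
  have Y: "(\<Sum>i=a..b. Z i powr (r / q)) = ?Y"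
    by (intro sum.cong) (auto simp: Zr)
  have "1 < s / q" using qs q by simp
  moreover have "1 / (s / q) + 1 / (r / q) = 1" using r(2) by simp
  ultimately have 2: "(\<Sum>i=a..b. (\<alpha> i * G i powr (q - 1)) * Z i) \<le> ?S powr (1 / (s / q)) * ?Y powr (1 / (r / q))"
    unfolding Y[symmetric] using \<alpha> Z0 by (intro sum_Hoelder) auto
  have e3: "(q - 1) * (s / q) * q' = s" using q q'(2) by (subst qq'[symmetric]) simp
  have "?S = (\<Sum>i=a..b. \<alpha> i powr (s / q) * G i powr ((q - 1) * (s / q)))"
    by (simp add: powr_mult powr_powr)
  also have "\<dots> \<le> (\<Sum>i=a..b. (\<alpha> i powr (s / q)) powr q) powr (1 / q) * (\<Sum>i=a..b. (G i powr ((q - 1) * (s / q))) powr q') powr (1 / q')"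
    using q by (intro sum_Hoelder) auto
  also have "\<dots> = A powr (1 / q) * X powr (1 / q')"
  proof -
    have "(G i powr ((q - 1) * (s / q))) powr q' = G i powr s" for i
      by (simp only: powr_powr e3)
    moreover have "(\<alpha> i powr (s / q)) powr q = \<alpha> i powr s" for i
      using q(1) by (simp add: powr_powr)
    ultimately show ?thesis by (simp only: A_def GX)
  qed
  finally have "?S powr (1 / (s / q)) \<le> (A powr (1 / q) * X powr (1 / q')) powr (1 / (s / q))"
    using q s by (intro powr_mono2 sum_nonneg) auto
  then have 3: "?S powr (1 / (s / q)) * ?Y powr (1 / (r / q)) \<le> (A powr (1 / q) * X powr (1 / q')) powr (1 / (s / q)) * ?Y powr (1 / (r / q))"
    by (intro mult_right_mono) auto
  have *: "(\<Sum>k=a..b. n k * F k powr q) \<le> q * ((A powr (1 / q) * X powr (1 / q')) powr (1 / (s / q)) * ?Y powr (1 / (r / q)))"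
    using q by (intro order.trans[OF 1] mult_left_mono order.trans[OF 2 3]) auto
  have "A powr (1 / q) * X powr (1 / q') \<le> A powr (1 / q) * ((s * s') powr s * A) powr (1 / q')"
    using X_le X0 q'(2) by (intro mult_left_mono powr_mono2) auto
  also have "\<dots> = (s * s') powr (s / q') * (A powr (1 / q) * A powr (1 / q'))"
    using A0 s(1) s'(2) by (simp add: powr_mult powr_powr)
  also have "A powr (1 / q) * A powr (1 / q') = A"
    using q A0 by (simp flip: powr_add)
  finally have "(A powr (1 / q) * X powr (1 / q')) powr (q / s) \<le> ((s * s') powr (s / q') * A) powr (q / s)"
    using q s by (intro powr_mono2) auto
  also have "\<dots> = (s * s') powr (q / q') * A powr (q / s)"
    using A0 s(1) s'(2) by (simp add: powr_mult powr_powr)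
  finally have "(A powr (1 / q) * X powr (1 / q')) powr (1 / (s / q)) \<le> (s * s') powr (q - 1) * A powr (q / s)"
    by (simp add: qq')
  then have "q * ((A powr (1 / q) * X powr (1 / q')) powr (1 / (s / q)) * ?Y powr (1 / (r / q)))
    \<le> q * (((s * s') powr (q - 1) * A powr (q / s)) * ?Y powr (1 / (r / q)))"
    using q(1) by (intro mult_left_mono mult_right_mono) auto
  with * show ?thesis by (simp only: mult.assoc divide_divide_eq_right mult_1) 
qed

end

section \<open>Dyadic blocks of a continuous distribution function\<close>

text \<open>One constant for both inequalities: \<open>s / (s - 1)\<close> is s', and
  \<open>min s q - 1\<close> is the exponent s - 1 of \<open>upper_le\<close> or q - 1 of
  \<open>upper_gt\<close>.\<close>

definition hardyC :: "real \<Rightarrow> real \<Rightarrow> real" where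
  "hardyC s q = q * (s * (s / (s - 1))) powr (min s q - 1)"

lemma conj_exp:
  fixes s s' :: real
  assumes "1 < s" "1 / s + 1 / s' = 1"
  shows "s' = s / (s - 1)" "1 < s'" "s / s' = s - 1" "s' / s = s' - 1"
proof -
  have "1 / s' = 1 - 1 / s" using assms by linarith
  also have "\<dots> = (s - 1) / s" using assms by (simp add: diff_divide_distrib)
  finally have "inverse (1 / s') = inverse ((s - 1) / s)" by (rule arg_cong)
  then show *: "s' = s / (s - 1)" by simp
  show s': "1 < s'" using assms(1) unfolding * by simp
  have "s / s' = s * (1 / s')" by simp
  also have "1 / s' = 1 - 1 / s" using assms by linarith
  finally show "s / s' = s - 1" using assms(1) by (simp add: right_diff_distrib)
  have "s' / s = s' * (1 / s)" by simp
  also have "1 / s = 1 - 1 / s'" using assms by linarith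
  finally show "s' / s = s' - 1" using s' by (simp add: right_diff_distrib)
qed

text \<open>\<open>discrete_hardy.upper_le\<close> with values in [0,\<infinity>]: if
  \<open>B\<close> or some \<open>A i\<close> is infinite, then so is the right-hand side, unless
  the other factor vanishes, and in that case the left-hand side vanishes too.\<close>

lemma hardy_upper_le:
  fixes n A :: "int \<Rightarrow> ennreal" and w :: "int \<Rightarrow> real"
  assumes s: "1 < s" "1 / s + 1 / s' = 1" and q: "1 < q" and sq: "s \<le> q"
    and n: "\<And>k. n k < top" and w: "\<And>k. 0 < w k"
    and B: "\<And>k. a \<le> k \<Longrightarrow> k \<le> b \<Longrightarrow> ennreal ((\<Sum>i=a..k. w i powr s') powr (1 / s')) * (\<Sum>i=k..b. n i) epowr (1 / q) \<le> B"
  shows "(\<Sum>k=a..b. n k * (\<Sum>i=a..k. ennreal (w i) * A i) epowr q)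
    \<le> ennreal (hardyC s q) * B epowr q * (\<Sum>i=a..b. A i epowr s) epowr (q / s)" (is "?L \<le> ?R")
proof -
  define n' where "n' k = enn2real (n k)" for k
  have n': "n k = ennreal (n' k)" "0 \<le> n' k" for k using n[of k] by (auto simp: n'_def)
  have s'0: "1 < s'" using conj_exp[OF s] by simp
  have C0: "0 < hardyC s q" using s q by (auto simp: hardyC_def)
  have Wpos: "0 < (\<Sum>i=a..k. w i powr s')" if "a \<le> k" for k
    using that w by (intro sum_pos) (auto simp: less_imp_neq[THEN not_sym])
  have L0: "?L = 0" if "\<And>k. a \<le> k \<Longrightarrow> k \<le> b \<Longrightarrow> n k * (\<Sum>i=a..k. ennreal (w i) * A i) epowr q = 0"
    using that by (intro sum.neutral) auto
  consider "B = 0" | "\<forall>i\<in>{a..b}. A i = 0"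
    | "B = top \<or> (\<exists>i\<in>{a..b}. A i = top)" "B \<noteq> 0" "\<not> (\<forall>i\<in>{a..b}. A i = 0)"
    | "B \<noteq> 0" "\<not> (B = top \<or> (\<exists>i\<in>{a..b}. A i = top))" by blast
  then show ?thesis
  proof cases
    case 1
    have "n k = 0" if k: "a \<le> k" "k \<le> b" for k
    proof -
      have "(\<Sum>i=k..b. n i) = 0"
        using B[OF k] Wpos[OF k(1)] s'0 q 1 by (auto simp: epowr_eq_0_iff simp del: sum_eq_0_iff)
      then show ?thesis using k by auto
    qed
    then have "?L = 0" by (intro L0) auto
    then show ?thesis by (rule order.trans[OF eq_refl]) simp
  next
    case 2
    then have "?L = 0" using q by (intro L0) auto
    then show ?thesis by (rule order.trans[OF eq_refl]) simp
  next
    case 3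
    have "(\<Sum>i=a..b. A i epowr s) \<noteq> 0" "(\<exists>i\<in>{a..b}. A i = top) \<longrightarrow> (\<Sum>i=a..b. A i epowr s) = top"
      using s 3(3) by (auto simp: epowr_eq_0_iff epowr_eq_top_iff)
    then have "?R = top" using C0 3 s q by (auto simp: ennreal_mult_eq_top_iff epowr_eq_top_iff epowr_eq_0_iff)
    then show ?thesis by simp
  next
    case 4
    have A: "A i < top" if "a \<le> i" "i \<le> b" for i using 4 that by (auto simp: less_top)
    define B' where "B' = enn2real B"
    have B': "B = ennreal B'" "0 < B'"
      using 4 by (auto simp: B'_def enn2real_positive_iff less_top zero_less_iff_neq_zero)
    define \<alpha> where "\<alpha> i = enn2real (if i \<in> {a..b} then A i else 0)" for i
    have \<alpha>: "0 \<le> \<alpha> i" "a \<le> i \<Longrightarrow> i \<le> b \<Longrightarrow> A i = ennreal (\<alpha> i)" for i using A by (auto simp: \<alpha>_def)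
    interpret H: discrete_hardy s q s' "q / (q - 1)" a b n' w \<alpha>
      by unfold_locales (use s q n' w \<alpha> in \<open>auto simp: diff_divide_distrib\<close>)
    have F: "(\<Sum>i=a..k. ennreal (w i) * A i) = ennreal (H.F k)" if "k \<le> b" for k
    proof -
      have "(\<Sum>i=a..k. ennreal (w i) * A i) = (\<Sum>i=a..k. ennreal (w i * \<alpha> i))"
        using that \<alpha> w by (intro sum.cong) (auto simp: ennreal_mult less_imp_le)
      then show ?thesis using \<alpha> w unfolding H.F_def by (simp add: less_imp_le)
    qed
    have "H.W k powr (1 / s') * H.Nt k powr (1 / q) \<le> B'" if k: "a \<le> k" "k \<le> b" for k
    proof -
      have "(\<Sum>i=k..b. n i) = ennreal (H.Nt k)"
        unfolding H.Nt_def using n' by simp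
      then have "ennreal (H.W k powr (1 / s') * H.Nt k powr (1 / q)) \<le> ennreal B'"
        using B[OF k] q B' H.N0 by (simp add: H.W_def[symmetric] epowr_ennreal_pos ennreal_mult)
      then show ?thesis using B' by simp
    qed
    then have "(\<Sum>k=a..b. n' k * H.F k powr q) \<le> q * (s * s') powr (s - 1) * B' powr q * H.A powr (q / s)"
      using sq by (intro H.upper_le) auto
    then have "ennreal (\<Sum>k=a..b. n' k * H.F k powr q) \<le> ennreal (hardyC s q * B' powr q * H.A powr (q / s))"
      using conj_exp(1)[OF s] sq by (intro ennreal_leI) (simp add: hardyC_def)
    also have "\<dots> = ennreal (hardyC s q) * B epowr q * (ennreal H.A) epowr (q / s)"
      using C0 B' q s H.A0 by (simp add: ennreal_mult epowr_ennreal_pos less_imp_le)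
    also have "ennreal H.A = (\<Sum>i=a..b. A i epowr s)"
    proof -
      have "(\<Sum>i=a..b. A i epowr s) = (\<Sum>i=a..b. ennreal (\<alpha> i powr s))"
        using \<alpha> s(1) by (intro sum.cong) (auto simp: epowr_ennreal_pos)
      then show ?thesis by (simp add: H.A_def)
    qed
    also have "ennreal (\<Sum>k=a..b. n' k * H.F k powr q) = ?L"
    proof -
      have "?L = (\<Sum>k=a..b. ennreal (n' k * H.F k powr q))"
        using n' F H.F0 q(1) by (intro sum.cong) (auto simp: epowr_ennreal_pos ennreal_mult)
      then show ?thesis using n' by simp
    qed
    finally show ?thesis .
  qed
qed

lemma hardy_upper_gt:
  fixes n A :: "int \<Rightarrow> ennreal" and w :: "int \<Rightarrow> real"
  assumes s: "1 < s" "1 / s + 1 / s' = 1" and q: "1 < q" "1 / q + 1 / q' = 1" and sq: "q < s" "1 / r = 1 / q - 1 / s"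
    and n: "\<And>k. n k < top" and w: "\<And>k. 0 < w k"
    and B: "(\<Sum>k=a..b. ennreal ((\<Sum>i=a..k. w i powr s') powr (r / q') * w k powr s') * (\<Sum>i=k..b. n i) epowr (r / q)) \<le> B"
  shows "(\<Sum>k=a..b. n k * (\<Sum>i=a..k. ennreal (w i) * A i) epowr q)
    \<le> ennreal (hardyC s q) * B epowr (q / r) * (\<Sum>i=a..b. A i epowr s) epowr (q / s)" (is "?L \<le> ?R")
proof -
  define n' where "n' k = enn2real (n k)" for k
  have n': "n k = ennreal (n' k)" "0 \<le> n' k" for k using n[of k] by (auto simp: n'_def)
  have "0 < 1 / r" using sq q by (simp add: frac_less2)
  then have r: "0 < r" by simp
  have s'0: "1 < s'" using conj_exp[OF s] by simp
  have C0: "0 < hardyC s q" using s q by (auto simp: hardyC_def)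
  have Wpos: "0 < (\<Sum>i=a..k. w i powr s')" if "a \<le> k" for k
    using that w by (intro sum_pos) (auto simp: less_imp_neq[THEN not_sym])
  have L0: "?L = 0" if "\<And>k. a \<le> k \<Longrightarrow> k \<le> b \<Longrightarrow> n k * (\<Sum>i=a..k. ennreal (w i) * A i) epowr q = 0"
    using that by (intro sum.neutral) auto
  consider "B = 0" | "\<forall>i\<in>{a..b}. A i = 0"
    | "B \<noteq> 0" "\<exists>i\<in>{a..b}. A i = top"
    | "B \<noteq> 0" "\<not> (\<exists>i\<in>{a..b}. A i = top)" by blast
  then show ?thesis
  proof cases
    case 1
    have "n k = 0" if k: "a \<le> k" "k \<le> b" for k
    proof -
      have "ennreal ((\<Sum>i=a..k. w i powr s') powr (r / q') * w k powr s') * (\<Sum>i=k..b. n i) epowr (r / q) = 0"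
        using B k 1 by (auto simp: sum_eq_0_iff)
      then have "(\<Sum>i=k..b. n i) = 0"
        using Wpos[OF k(1)] w[of k] r q by (auto simp: epowr_eq_0_iff simp del: sum_eq_0_iff)
      then show ?thesis using k by auto
    qed
    then have "?L = 0" by (intro L0) auto
    then show ?thesis by (rule order.trans[OF eq_refl]) simp
  next
    case 2
    then have "?L = 0" using q by (intro L0) auto
    then show ?thesis by (rule order.trans[OF eq_refl]) simp
  next
    case 3
    then have "(\<Sum>i=a..b. A i epowr s) = top"
      using s by (auto simp: epowr_eq_top_iff)
    then have "?R = top" using C0 3 s q r by (auto simp: ennreal_mult_eq_top_iff epowr_eq_top_iff epowr_eq_0_iff)
    then show ?thesis by simp
  next
    case 4
    have A: "A i < top" if "a \<le> i" "i \<le> b" for i using 4 that by (auto simp: less_top)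
    define \<alpha> where "\<alpha> i = enn2real (if i \<in> {a..b} then A i else 0)" for i
    have \<alpha>: "0 \<le> \<alpha> i" "a \<le> i \<Longrightarrow> i \<le> b \<Longrightarrow> A i = ennreal (\<alpha> i)" for i using A by (auto simp: \<alpha>_def)
    interpret H: discrete_hardy s q s' q' a b n' w \<alpha>
      by unfold_locales (use s q n' w \<alpha> in auto)
    have F: "(\<Sum>i=a..k. ennreal (w i) * A i) = ennreal (H.F k)" if "k \<le> b" for k
    proof -
      have "(\<Sum>i=a..k. ennreal (w i) * A i) = (\<Sum>i=a..k. ennreal (w i * \<alpha> i))"
        using that \<alpha> w by (intro sum.cong) (auto simp: ennreal_mult less_imp_le)
      then show ?thesis using \<alpha> w unfolding H.F_def by (simp add: less_imp_le)
    qed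
    let ?Y = "\<Sum>k=a..b. H.W k powr (r / q') * w k powr s' * H.Nt k powr (r / q)"
    have Y0: "0 \<le> ?Y" by (intro sum_nonneg) auto
    have Y: "ennreal ?Y \<le> B"
    proof -
      have "(\<Sum>i=k..b. n i) = ennreal (H.Nt k)" for k
        unfolding H.Nt_def using n' by simp
      then have "ennreal ?Y = (\<Sum>k=a..b. ennreal ((\<Sum>i=a..k. w i powr s') powr (r / q') * w k powr s') * (\<Sum>i=k..b. n i) epowr (r / q))"
        using r q H.N0 by (simp add: H.W_def[symmetric] epowr_ennreal_pos ennreal_mult flip: sum_ennreal)
      then show ?thesis using B by simp
    qed
    have "(\<Sum>k=a..b. n' k * H.F k powr q) \<le> q * (s * s') powr (q - 1) * H.A powr (q / s) * ?Y powr (q / r)"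
      using sq by (intro H.upper_gt) auto
    then have "ennreal (\<Sum>k=a..b. n' k * H.F k powr q) \<le> ennreal (hardyC s q * H.A powr (q / s) * ?Y powr (q / r))"
      using conj_exp(1)[OF s] sq by (intro ennreal_leI) (simp add: hardyC_def)
    also have "\<dots> = ennreal (hardyC s q) * (ennreal H.A) epowr (q / s) * (ennreal ?Y) epowr (q / r)"
      using C0 q s r H.A0 Y0 by (simp add: ennreal_mult epowr_ennreal_pos less_imp_le)
    also have "\<dots> \<le> ennreal (hardyC s q) * (ennreal H.A) epowr (q / s) * B epowr (q / r)"
      using Y q r by (intro mult_left_mono epowr_mono) auto
    also have "ennreal H.A = (\<Sum>i=a..b. A i epowr s)"
    proof -
      have "(\<Sum>i=a..b. A i epowr s) = (\<Sum>i=a..b. ennreal (\<alpha> i powr s))"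
        using \<alpha> s(1) by (intro sum.cong) (auto simp: epowr_ennreal_pos)
      then show ?thesis by (simp add: H.A_def)
    qed
    also have "ennreal (\<Sum>k=a..b. n' k * H.F k powr q) = ?L"
    proof -
      have "?L = (\<Sum>k=a..b. ennreal (n' k * H.F k powr q))"
        using n' F H.F0 q(1) by (intro sum.cong) (auto simp: epowr_ennreal_pos ennreal_mult)
      then show ?thesis using n' by simp
    qed
    finally show ?thesis by (simp add: mult_ac)
  qed
qed

section \<open>Monotone functions and their dyadic level sets\<close>

lemma is_interval_sets_borel:
  fixes S :: "real set"
  assumes "is_interval S" shows "S \<in> sets borel"
  using is_real_interval[OF assms] by (elim exE disjE) simp_all

lemma borel_measurable_mono_ennreal:
  fixes f :: "real \<Rightarrow> ennreal"
  assumes "mono f" shows "f \<in> borel_measurable borel"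
proof (rule borel_measurableI_greater)
  fix y
  have "is_interval ({x \<in> space borel. y < f x})"
    unfolding is_interval_1
  proof (intro ballI allI impI)
    fix a b x assume "a \<in> {x \<in> space borel. y < f x}" "b \<in> {x \<in> space borel. y < f x}" "a \<le> x \<and> x \<le> b"
    then have "y < f a" "f a \<le> f x" using monoD[OF assms, of a x] by simp_all
    then have "y < f x" by (rule less_le_trans)
    then show "x \<in> {x \<in> space borel. y < f x}" by simp
  qed
  then show "{x \<in> space borel. y < f x} \<in> sets borel" by (rule is_interval_sets_borel)
qed

lemma borel_measurable_antimono_ennreal:
  fixes f :: "real \<Rightarrow> ennreal"
  assumes "antimono f" shows "f \<in> borel_measurable borel"
proof -
  have [measurable]: "(\<lambda>x. f (- x)) \<in> borel_measurable borel"
    using assms by (intro borel_measurable_mono_ennreal) (simp add: mono_def antimono_def)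
  have "(\<lambda>x. f (- (- x))) \<in> borel_measurable borel"
    by (rule measurable_compose[of uminus borel borel "\<lambda>x. f (- x)"]) measurable
  then show ?thesis by simp
qed

locale level_fun =
  fixes G :: "real \<Rightarrow> real"
  assumes mono: "mono G" and cont: "continuous_on UNIV G" and zero: "G 0 = 0" and pos: "0 < x \<Longrightarrow> 0 < G x"
begin

lemma pos_iff: "0 < G x \<longleftrightarrow> 0 < x"
  using monoD[OF mono, of x 0] pos[of x] zero by (cases "0 < x") auto

text \<open>As \<open>G\<close> may be constant on intervals, it is the last point of level
  \<open>c\<close> that gives the equivalence with \<open>t < s\<close>.\<close>

lemma level:
  assumes "0 < c" "c < G x"
  obtains t where "0 < t" "G t = c" "\<And>s. c < G s \<longleftrightarrow> t < s"
proof -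
  have x: "0 < x" using assms pos_iff[of x] by linarith
  let ?S = "{s \<in> {0..x}. G s \<le> c}"
  have "closed ?S"
    using cont by (auto intro!: closed_Collect_conj closed_Collect_le continuous_intros)
  moreover have "bounded ?S"
    by (rule bounded_subset[of "{0..x}"]) auto
  ultimately have "compact ?S" by (simp add: compact_eq_bounded_closed)
  moreover have "0 \<in> ?S" using assms x zero by auto
  ultimately obtain t where t: "t \<in> ?S" "\<And>s. s \<in> ?S \<Longrightarrow> s \<le> t"
    using compact_attains_sup[of ?S] by auto
  obtain y where y: "0 \<le> y" "y \<le> x" "G y = c"
    using IVT'[of G 0 c x] assms x zero cont by (auto intro: continuous_on_subset)
  have "c = G t" using t y monoD[OF mono, of y t] by force
  moreover have "0 < t" using \<open>c = G t\<close> assms pos_iff[of t] by simp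
  moreover have "c < G s \<longleftrightarrow> t < s" for s
  proof
    show "t < s" if "c < G s"
      using that \<open>c = G t\<close> monoD[OF mono, of s t] by linarith
    show "c < G s" if "t < s"
    proof (rule ccontr)
      assume "\<not> c < G s"
      then have "G s \<le> c" by simp
      moreover have "s \<le> x" using \<open>G s \<le> c\<close> assms(2) monoD[OF mono, of x s] by linarith
      ultimately have "s \<in> ?S" using \<open>0 < t\<close> that by auto
      with t(2) that show False by force
    qed
  qed
  ultimately show ?thesis using that by blast
qed

definition blk :: "int \<Rightarrow> real set" where
  "blk k = {s. 2 powr real_of_int k < G s \<and> G s \<le> 2 powr real_of_int (k + 1)}"

lemma borel_G [measurable]: "G \<in> borel_measurable borel"
  using cont by (rule borel_measurable_continuous_onI)

lemma blk_sets [measurable]: "blk k \<in> sets borel"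
  unfolding blk_def by measurable

lemma blk_ex: assumes "0 < s" obtains k where "s \<in> blk k"
proof -
  let ?k = "\<lceil>log 2 (G s)\<rceil> - 1"
  have "log 2 (G s) \<le> real_of_int (?k + 1)" "real_of_int ?k < log 2 (G s)" by linarith+
  then have "s \<in> blk ?k"
    unfolding blk_def using pos[OF assms] less_log_iff[of 2 "G s" "real_of_int ?k"] log_le_iff[of 2 "G s" "real_of_int (?k + 1)"]
    by simp
  then show ?thesis by (rule that)
qed

lemma blk_le: "s \<in> blk i \<Longrightarrow> t \<in> blk k \<Longrightarrow> s \<le> t \<Longrightarrow> i \<le> k"
proof (rule ccontr)
  assume *: "s \<in> blk i" "t \<in> blk k" "s \<le> t" "\<not> i \<le> k"
  have "G t \<le> 2 powr real_of_int (k + 1)" using * by (simp add: blk_def)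
  also have "\<dots> \<le> 2 powr real_of_int i" using * by (intro powr_mono) auto
  also have "\<dots> < G s" using * by (simp add: blk_def)
  also have "\<dots> \<le> G t" using * mono by (auto dest: monoD)
  finally show False by simp
qed

lemma blk_unique: "s \<in> blk i \<Longrightarrow> s \<in> blk k \<Longrightarrow> i = k"
  using blk_le by (metis antisym order.refl)

lemma blk_pos: "s \<in> blk k \<Longrightarrow> 0 < s"
proof -
  assume "s \<in> blk k"
  then have "2 powr real_of_int k < G s" by (simp add: blk_def)
  then have "0 < G s" using powr_gt_zero[of 2 "real_of_int k"] by linarith
  then show ?thesis by (simp add: pos_iff)
qed

lemma blk_window:
  assumes "2 powr real_of_int a < G s" "G s \<le> 2 powr real_of_int (b + 1)"
  obtains k where "a \<le> k" "k \<le> b" "s \<in> blk k"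
proof -
  have "0 < G s" using assms(1) powr_gt_zero[of 2 "real_of_int a"] by linarith
  then have "0 < s" by (simp add: pos_iff)
  then obtain k where k: "s \<in> blk k" by (rule blk_ex)
  then have "2 powr real_of_int k < G s" "G s \<le> 2 powr real_of_int (k + 1)" by (auto simp: blk_def)
  then have "2 powr real_of_int a < 2 powr real_of_int (k + 1)" "2 powr real_of_int k < 2 powr real_of_int (b + 1)"
    using assms by linarith+
  then have "real_of_int a < real_of_int (k + 1)" "real_of_int k < real_of_int (b + 1)"
    by (simp_all only: powr_less_cancel_iff one_less_numeral_iff semiring_norm)
  then have "a \<le> k" "k \<le> b" by linarith+
  with k that show ?thesis by blast
qed

end

section \<open>The normalised inequality\<close>

context level_fun begin

lemma sum_blk:
  fixes c :: "int \<Rightarrow> ennreal"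
  assumes "finite I" "s \<in> blk k"
  shows "(\<Sum>i\<in>I. c i * indicator (blk i) s) = (if k \<in> I then c k else 0)"
proof -
  have "c i * indicator (blk i) s = (if k = i then c i else 0)" for i
    using assms(2) blk_unique[of s k i] by (auto split: split_indicator)
  then have "(\<Sum>i\<in>I. c i * indicator (blk i) s) = (\<Sum>i\<in>I. if k = i then c i else 0)"
    by simp
  then show ?thesis using assms(1) by simp
qed

lemma sum_blk_nonpos:
  fixes c :: "int \<Rightarrow> ennreal"
  assumes "s \<le> 0"
  shows "(\<Sum>i\<in>I. c i * indicator (blk i) s) = 0"
  using assms blk_pos[of s] by (intro sum.neutral) (auto split: split_indicator)

end

text \<open>Here \<open>p = p\<^sub>1/p\<^sub>2\<close>, \<open>q = q\<^sub>2/p\<^sub>2\<close> and \<open>\<theta> = q\<^sub>1/p\<^sub>2\<close>; primes denote conjugate exponents.\<close>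

locale cope =
  m: level_fun m + U: level_fun U
  for m U :: "real \<Rightarrow> real" +
  fixes N :: "real \<Rightarrow> real" and \<mu> \<nu>1 \<nu>2 :: "real measure" and p q \<theta> p' q' \<theta>' :: real
  assumes p: "1 < p" "1 / p + 1 / p' = 1" and q: "1 < q" "1 / q + 1 / q' = 1"
    and \<theta>: "1 < \<theta>" "1 / \<theta> + 1 / \<theta>' = 1"
    and sets_\<mu> [measurable_cong]: "sets \<mu> = sets lebesgue"
    and sets_\<nu>1 [measurable_cong]: "sets \<nu>1 = sets lebesgue"
    and sets_\<nu>2 [measurable_cong]: "sets \<nu>2 = sets lebesgue"
    and m_lt: "\<And>t. emeasure \<mu> {..<t} = ennreal (m t)"
    and m_le: "\<And>t. emeasure \<mu> {..t} = ennreal (m t)"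
    and m_unb: "\<And>c. \<exists>x. c < m x"
    and U_le: "\<And>t. emeasure \<nu>1 {..t} = ennreal (U t)"
    and N_gt: "\<And>t. 0 < t \<Longrightarrow> emeasure \<nu>2 {t<..} = ennreal (N t)"
    and N_nonneg: "\<And>t. 0 < t \<Longrightarrow> 0 \<le> N t"
    and \<nu>2_neg: "emeasure \<nu>2 {..0} = 0"
begin

lemma p'1: "1 < p'" and q'1: "1 < q'" and \<theta>'1: "1 < \<theta>'"
  using conj_exp(2)[OF p] conj_exp(2)[OF q] conj_exp(2)[OF \<theta>] by auto

lemma borel_imp_measurable [measurable (raw)]:
  assumes "f \<in> borel_measurable borel"
  shows "f \<in> borel_measurable \<mu>" "f \<in> borel_measurable \<nu>1" "f \<in> borel_measurable \<nu>2"
proof -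
  have "f \<in> borel_measurable lebesgue" using assms by (intro measurable_completion) simp
  then show "f \<in> borel_measurable \<mu>" "f \<in> borel_measurable \<nu>1" "f \<in> borel_measurable \<nu>2"
    by (simp_all add: measurable_cong_sets[OF sets_\<mu> refl] measurable_cong_sets[OF sets_\<nu>1 refl] measurable_cong_sets[OF sets_\<nu>2 refl])
qed

lemma borel_sets [simp, measurable]:
  assumes "A \<in> sets borel" shows "A \<in> sets \<mu>" "A \<in> sets \<nu>1" "A \<in> sets \<nu>2"
  using assms by (auto simp: sets_\<mu> sets_\<nu>1 sets_\<nu>2)

definition F :: "(real \<Rightarrow> ennreal) \<Rightarrow> real \<Rightarrow> ennreal" where
  "F h t = (\<integral>\<^sup>+s\<in>{..<t}. h s \<partial>\<mu>)"

definition \<Phi> :: "(real \<Rightarrow> ennreal) \<Rightarrow> real \<Rightarrow> ennreal" where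
  "\<Phi> h t = (\<integral>\<^sup>+s\<in>{t<..}. h s epowr p \<partial>\<mu>)"

definition L :: "(real \<Rightarrow> ennreal) \<Rightarrow> ennreal" where
  "L h = (\<integral>\<^sup>+t. F h t epowr q \<partial>\<nu>2)"

definition D :: "(real \<Rightarrow> ennreal) \<Rightarrow> ennreal" where
  "D h = (\<integral>\<^sup>+t. \<Phi> h t epowr (\<theta> / p) \<partial>\<nu>1)"

definition Lp :: "real set \<Rightarrow> (real \<Rightarrow> ennreal) \<Rightarrow> ennreal" where
  "Lp A h = (\<integral>\<^sup>+s\<in>A. h s epowr p \<partial>\<mu>)"

lemma F_borel [measurable]: "F h \<in> borel_measurable borel"
  unfolding F_def by (intro borel_measurable_mono_ennreal monoI nn_integral_mono mult_left_mono) (auto split: split_indicator)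

lemma \<Phi>_borel [measurable]: "\<Phi> h \<in> borel_measurable borel"
  unfolding \<Phi>_def by (intro borel_measurable_antimono_ennreal antimonoI nn_integral_mono mult_left_mono) (auto split: split_indicator)

lemma F_mono: "(\<And>s. h s \<le> g s) \<Longrightarrow> F h t \<le> F g t"
  unfolding F_def by (intro nn_integral_mono mult_right_mono) auto

lemma AE_\<mu>: "AE s in \<mu>. 0 < s"
  using m_le[of 0] m.zero by (intro AE_I[of _ _ "{..0}"]) auto

lemma F_cong: "h \<in> borel_measurable \<mu> \<Longrightarrow> (\<And>s. 0 < s \<Longrightarrow> h s = g s) \<Longrightarrow> F h t = F g t"
  unfolding F_def using AE_\<mu> by (intro nn_integral_cong_AE) (auto elim!: eventually_mono)

lemma F_SUP:
  assumes [measurable]: "\<And>n::nat. h n \<in> borel_measurable \<mu>" and inc: "incseq h"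
  shows "F (\<lambda>s. SUP n. h n s) t = (SUP n. F (h n) t)"
proof -
  have "F (\<lambda>s. SUP n. h n s) t = (\<integral>\<^sup>+s. (SUP n. h n s * indicator {..<t} s) \<partial>\<mu>)"
    unfolding F_def by (simp add: SUP_mult_right_ennreal)
  also have "\<dots> = (SUP n. F (h n) t)"
    unfolding F_def
    by (intro nn_integral_monotone_convergence_SUP)
      (use inc in \<open>auto simp: incseq_def le_fun_def intro!: mult_right_mono\<close>)
  finally show ?thesis .
qed

lemma L_SUP:
  assumes [measurable]: "\<And>n::nat. h n \<in> borel_measurable \<mu>" and inc: "incseq h"
  shows "L (\<lambda>s. SUP n. h n s) = (SUP n. L (h n))"
proof -
  have "L (\<lambda>s. SUP n. h n s) = (\<integral>\<^sup>+t. (SUP n. F (h n) t epowr q) \<partial>\<nu>2)"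
    unfolding L_def using q by (simp add: F_SUP[OF assms] epowr_SUP)
  also have "\<dots> = (SUP n. L (h n))"
    unfolding L_def
    by (intro nn_integral_monotone_convergence_SUP)
      (use inc q in \<open>auto simp: incseq_def le_fun_def intro!: epowr_mono F_mono\<close>)
  finally show ?thesis .
qed

text \<open>Bounds for \<open>L\<close> are proved for truncations to finitely many blocks and
  carried over by monotone convergence. Domination is asked on the positive half-line only, which
  carries all of \<mu>.\<close>

lemma L_le_SUP:
  assumes h: "\<And>n::nat. h n \<in> borel_measurable \<mu>" "incseq h" and [measurable]: "g \<in> borel_measurable \<mu>"
    and g: "\<And>s. 0 < s \<Longrightarrow> g s \<le> (SUP n. h n s)" and le: "\<And>n. L (h n) \<le> Z"
  shows "L g \<le> Z"
proof -
  have "L g \<le> L (\<lambda>s. SUP n. h n s)"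
    unfolding L_def
  proof (intro nn_integral_mono epowr_mono)
    fix t
    have "F g t = F (\<lambda>s. g s * indicator {0<..} s) t"
      by (rule F_cong) auto
    also have "\<dots> \<le> F (\<lambda>s. SUP n. h n s) t"
      using g by (intro F_mono) (auto split: split_indicator)
    finally show "F g t \<le> F (\<lambda>s. SUP n. h n s) t" .
  qed (use q in auto)
  also have "\<dots> \<le> Z" unfolding L_SUP[OF h] by (intro SUP_least le)
  finally show ?thesis .
qed

text \<open>Since \<open>m\<close> is unbounded, both levels that bound a block are attained, and no
  block is cut short. The blocks of \<open>U\<close> may lack this property.\<close>

lemma emeasure_\<mu>_blk: "emeasure \<mu> (m.blk k) = ennreal (2 powr real_of_int k)"
proof -
  obtain x y where x: "2 powr real_of_int k < m x" and y: "2 powr real_of_int (k + 1) < m y"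
    using m_unb by metis
  obtain s where s: "m s = 2 powr real_of_int k" "\<And>t. 2 powr real_of_int k < m t \<longleftrightarrow> s < t"
    using m.level[OF _ x] by auto
  obtain u where u: "m u = 2 powr real_of_int (k + 1)" "\<And>t. 2 powr real_of_int (k + 1) < m t \<longleftrightarrow> u < t"
    using m.level[OF _ y] by auto
  have su: "s \<le> u" using s(1) u(1) u(2)[of s] by (metis linorder_not_less less_imp_le powr_mono add_increasing2 order.asym zero_le_one of_int_le_iff numeral_le_iff one_le_numeral le_add_same_cancel1 not_le)
  have "m.blk k = {..u} - {..s}"
    unfolding m.blk_def using s(2) u(2) by (auto simp: not_less[symmetric])
  also have "emeasure \<mu> \<dots> = emeasure \<mu> {..u} - emeasure \<mu> {..s}"
    using su m_le[of s] by (intro emeasure_Diff) auto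
  also have "\<dots> = ennreal (2 powr real_of_int (k + 1) - 2 powr real_of_int k)"
    by (simp add: m_le s u ennreal_minus)
  finally show ?thesis by (simp add: powr_add)
qed

lemma m_level_pt:
  obtains t where "0 < t" "m t = 2 powr real_of_int k" "{s. 2 powr real_of_int k < m s} = {t<..}"
proof -
  obtain x where x: "2 powr real_of_int k < m x" using m_unb by metis
  show ?thesis using m.level[OF _ x] that by (metis (mono_tags, lifting) Collect_cong greaterThan_def powr_gt_zero zero_neq_numeral)
qed

lemma int_blk_le:
  assumes [measurable]: "h \<in> borel_measurable \<mu>"
  shows "(\<integral>\<^sup>+s\<in>m.blk k. h s \<partial>\<mu>) \<le> ennreal (2 powr (real_of_int k / p')) * Lp (m.blk k) h epowr (1 / p)"
proof -
  have "(\<integral>\<^sup>+s\<in>m.blk k. h s \<partial>\<mu>) = (\<integral>\<^sup>+s. (h s * indicator (m.blk k) s) * indicator (m.blk k) s \<partial>\<mu>)"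
    by (intro nn_integral_cong) (auto split: split_indicator)
  also have "\<dots> \<le> (\<integral>\<^sup>+s. (h s * indicator (m.blk k) s) epowr p \<partial>\<mu>) epowr (1 / p) * (\<integral>\<^sup>+s. indicator (m.blk k) s epowr p' \<partial>\<mu>) epowr (1 / p')"
    using p by (intro nn_integral_Hoelder) auto
  also have "(\<integral>\<^sup>+s. (h s * indicator (m.blk k) s) epowr p \<partial>\<mu>) = Lp (m.blk k) h"
    unfolding Lp_def using p by (intro nn_integral_cong) (auto split: split_indicator)
  also have "(\<integral>\<^sup>+s. indicator (m.blk k) s epowr p' \<partial>\<mu>) = (\<integral>\<^sup>+s. indicator (m.blk k) s \<partial>\<mu>)"
    using p'1 by (intro nn_integral_cong) (auto split: split_indicator)
  also have "\<dots> = ennreal (2 powr real_of_int k)" by (simp add: emeasure_\<mu>_blk)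
  finally show ?thesis by (simp add: epowr_ennreal powr_powr mult.commute)
qed

text \<open>If \<open>h\<close> vanishes beyond a point of block j, then \<open>F h\<close> is
  constant from there on, so block j can take over the \<nu>2-mass of everything beyond it.\<close>

definition nblk :: "int \<Rightarrow> int \<Rightarrow> ennreal" where
  "nblk j k = emeasure \<nu>2 (if k = j then {s. 2 powr real_of_int k < m s} else m.blk k)"

lemma nblk_tail:
  assumes "k \<le> j"
  shows "(\<Sum>i=k..j. nblk j i) = emeasure \<nu>2 {s. 2 powr real_of_int k < m s}"
proof -
  let ?B = "\<lambda>i. if i = j then {s. 2 powr real_of_int i < m s} else m.blk i"
  have "(\<Sum>i=k..j. nblk j i) = emeasure \<nu>2 (\<Union>i\<in>{k..j}. ?B i)"
    unfolding nblk_def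
  proof (rule sum_emeasure)
    have "?B i \<inter> ?B l = {}" if "i < l" "l \<le> j" for i l
    proof -
      have le: "2 powr real_of_int (i + 1) \<le> 2 powr real_of_int l" using that by (intro powr_mono) auto
      have "False" if "t \<in> ?B i" "t \<in> ?B l" for t
      proof -
        have "m t \<le> 2 powr real_of_int (i + 1)" "2 powr real_of_int l < m t"
          using that \<open>i < l\<close> \<open>l \<le> j\<close> by (auto simp: m.blk_def split: if_splits)
        then show False using le by linarith
      qed
      then show ?thesis by blast
    qed
    then show "disjoint_family_on ?B {k..j}"
      unfolding disjoint_family_on_def by (metis Int_commute atLeastAtMost_iff linorder_neqE)
  qed auto
  also have "(\<Union>i\<in>{k..j}. ?B i) = {s. 2 powr real_of_int k < m s}"
  proof (intro equalityI subsetI)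
    fix s assume "s \<in> (\<Union>i\<in>{k..j}. ?B i)"
    then obtain i where "k \<le> i" "2 powr real_of_int i < m s" by (auto simp: m.blk_def split: if_splits)
    moreover have "2 powr real_of_int k \<le> 2 powr real_of_int i" using \<open>k \<le> i\<close> by simp
    ultimately have "2 powr real_of_int k < m s" by linarith
    then show "s \<in> {s. 2 powr real_of_int k < m s}" by simp
  next
    fix s assume s: "s \<in> {s. 2 powr real_of_int k < m s}"
    show "s \<in> (\<Union>i\<in>{k..j}. ?B i)"
    proof (cases "2 powr real_of_int j < m s")
      case True then show ?thesis using assms by auto
    next
      case False
      then have "m s \<le> 2 powr real_of_int ((j - 1) + 1)" by simp
      then obtain i where "k \<le> i" "i \<le> j - 1" "s \<in> m.blk i" using m.blk_window s by blast
      then show ?thesis by (intro UN_I[of i]) auto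
    qed
  qed
  finally show ?thesis .
qed

lemma nblk_finite: "nblk j k < top"
proof -
  obtain t where t: "0 < t" "{s. 2 powr real_of_int k < m s} = {t<..}" by (rule m_level_pt)
  have "nblk j k \<le> emeasure \<nu>2 {s. 2 powr real_of_int k < m s}"
    unfolding nblk_def by (intro emeasure_mono) (auto simp: m.blk_def)
  also have "\<dots> < top" using t N_gt by simp
  finally show ?thesis .
qed

lemma Lp_blk_sum:
  assumes [measurable]: "h \<in> borel_measurable \<mu>"
  shows "(\<Sum>i=a..b. Lp (m.blk i) h) \<le> Lp UNIV h"
proof -
  have "(\<Sum>i=a..b. Lp (m.blk i) h) = (\<integral>\<^sup>+s. (\<Sum>i=a..b. h s epowr p * indicator (m.blk i) s) \<partial>\<mu>)"
    unfolding Lp_def by (intro nn_integral_sum[symmetric]) auto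
  also have "\<dots> \<le> Lp UNIV h"
    unfolding Lp_def
  proof (intro nn_integral_mono)
    fix s
    show "(\<Sum>i=a..b. h s epowr p * indicator (m.blk i) s) \<le> h s epowr p * indicator UNIV s"
    proof (cases "0 < s")
      case True
      then obtain k where "s \<in> m.blk k" by (rule m.blk_ex)
      then show ?thesis by (subst m.sum_blk) auto
    qed (subst m.sum_blk_nonpos, auto)
  qed
  finally show ?thesis .
qed

text \<open>On block k, \<open>F h\<close> is at most the sum of the integrals of \<open>h\<close>
  over the blocks up to k, and by Hoelder's inequality the i-th of them is at most
  \<open>2 powr (i / p')\<close> times the norm of \<open>h\<close> on block i. \<open>H\<close> is
  the discrete inequality that remains, with a constant uniform in the lower end
  \<open>a\<close>.\<close>

lemma block_upper:
  assumes [measurable]: "h \<in> borel_measurable \<mu>"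
    and j: "x \<in> m.blk j" and supp: "\<And>s. x < s \<Longrightarrow> h s = 0"
    and H: "\<And>a A. a \<le> j \<Longrightarrow> (\<Sum>k=a..j. nblk j k * (\<Sum>i=a..k. ennreal (2 powr (real_of_int i / p')) * A i) epowr q)
        \<le> Z * (\<Sum>i=a..j. A i epowr p) epowr (q / p)"
  shows "L h \<le> Z * Lp UNIV h epowr (q / p)"
proof -
  define g where "g n s = h s * indicator {s. 2 powr real_of_int (j - int n) < m s} s" for n s
  have [measurable]: "g n \<in> borel_measurable \<mu>" for n unfolding g_def by measurable
  have gn: "L (g n) \<le> Z * Lp UNIV h epowr (q / p)" for n
  proof -
    define a where "a = j - int n"
    have aj: "a \<le> j" by (simp add: a_def)
    let ?B = "\<lambda>i. if i = j then {s. 2 powr real_of_int i < m s} else m.blk i"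
    define X where "X i = (\<integral>\<^sup>+s\<in>m.blk i. h s \<partial>\<mu>)" for i
    define A where "A i = Lp (m.blk i) h epowr (1 / p)" for i
    have Fle: "F (g n) t epowr q \<le> (\<Sum>k=a..j. (\<Sum>i=a..k. X i) epowr q * indicator (?B k) t)" for t
    proof (cases "2 powr real_of_int a < m t")
      case False
      have "F (g n) t = (\<integral>\<^sup>+s. 0 \<partial>\<mu>)"
        unfolding F_def
      proof (rule nn_integral_cong)
        fix s
        show "g n s * indicator {..<t} s = 0"
          using False monoD[OF m.mono, of s t] by (auto simp: g_def a_def split: split_indicator)
      qed
      then show ?thesis using q by simp
    next
      case True
      obtain k where k: "a \<le> k" "k \<le> j" "t \<in> ?B k"
      proof (cases "2 powr real_of_int j < m t")
        case True then show ?thesis using that[of j] aj by auto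
      next
        case False
        then have "m t \<le> 2 powr real_of_int ((j - 1) + 1)" by simp
        then obtain i where "a \<le> i" "i \<le> j - 1" "t \<in> m.blk i" using m.blk_window True by blast
        then show ?thesis using that[of i] by auto
      qed
      have "F (g n) t \<le> (\<integral>\<^sup>+s. (\<Sum>i=a..k. h s * indicator (m.blk i) s) \<partial>\<mu>)"
        unfolding F_def
      proof (rule nn_integral_mono)
        fix s
        show "g n s * indicator {..<t} s \<le> (\<Sum>i=a..k. h s * indicator (m.blk i) s)"
        proof (cases "2 powr real_of_int a < m s \<and> s < t \<and> s \<le> x")
          case True
          have "m s \<le> 2 powr real_of_int (k + 1)"
          proof (cases "k = j")
            case True
            then show ?thesis using j monoD[OF m.mono, of s x] \<open>_ \<and> _ \<and> _\<close> by (auto simp: m.blk_def)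
          next
            case False
            then show ?thesis using k monoD[OF m.mono, of s t] True by (auto simp: m.blk_def)
          qed
          then obtain i where i: "a \<le> i" "i \<le> k" "s \<in> m.blk i" using m.blk_window True by blast
          have "g n s * indicator {..<t} s \<le> h s * indicator (m.blk i) s"
            using i by (auto simp: g_def split: split_indicator)
          also have "\<dots> \<le> (\<Sum>i=a..k. h s * indicator (m.blk i) s)"
            using i by (intro member_le_sum) auto
          finally show ?thesis .
        next
          case False
          then show ?thesis using supp[of s] by (auto simp: g_def a_def split: split_indicator)
        qed
      qed
      also have "\<dots> = (\<Sum>i=a..k. X i)"
        unfolding X_def by (intro nn_integral_sum) auto
      finally have "F (g n) t epowr q \<le> (\<Sum>i=a..k. X i) epowr q * indicator (?B k) t"
        using k q by (auto intro: epowr_mono)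
      also have "\<dots> \<le> (\<Sum>k=a..j. (\<Sum>i=a..k. X i) epowr q * indicator (?B k) t)"
        using k by (intro member_le_sum[of k "{a..j}" "\<lambda>k. (\<Sum>i=a..k. X i) epowr q * indicator (?B k) t"]) auto
      finally show ?thesis .
    qed
    have "L (g n) \<le> (\<integral>\<^sup>+t. (\<Sum>k=a..j. (\<Sum>i=a..k. X i) epowr q * indicator (?B k) t) \<partial>\<nu>2)"
      unfolding L_def by (intro nn_integral_mono Fle)
    also have "\<dots> = (\<Sum>k=a..j. (\<Sum>i=a..k. X i) epowr q * nblk j k)"
      unfolding nblk_def by (subst nn_integral_sum) (auto simp: nn_integral_cmult)
    also have "\<dots> \<le> (\<Sum>k=a..j. nblk j k * (\<Sum>i=a..k. ennreal (2 powr (real_of_int i / p')) * A i) epowr q)"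
      unfolding X_def A_def using q
      by (subst mult.commute) (intro sum_mono mult_left_mono epowr_mono int_blk_le, auto)
    also have "\<dots> \<le> Z * (\<Sum>i=a..j. A i epowr p) epowr (q / p)"
      using aj by (rule H)
    also have "(\<Sum>i=a..j. A i epowr p) = (\<Sum>i=a..j. Lp (m.blk i) h)"
      using p by (simp add: A_def)
    also have "Z * \<dots> epowr (q / p) \<le> Z * Lp UNIV h epowr (q / p)"
      using p q by (intro mult_left_mono epowr_mono Lp_blk_sum) auto
    finally show ?thesis .
  qed
  show ?thesis
  proof (rule L_le_SUP[of g, OF _ _ _ _ gn])
    show "incseq g"
    proof (intro incseq_SucI le_funI)
      fix n s
      have "2 powr real_of_int (j - int (Suc n)) \<le> 2 powr real_of_int (j - int n)" by (intro powr_mono) auto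
      then have "{s. 2 powr real_of_int (j - int n) < m s} \<subseteq> {s. 2 powr real_of_int (j - int (Suc n)) < m s}"
        by (auto simp only: mem_Collect_eq)
      then show "g n s \<le> g (Suc n) s" unfolding g_def by (intro mult_left_mono) (auto split: split_indicator)
    qed
    fix s :: real assume "0 < s"
    then obtain k where k: "s \<in> m.blk k" by (rule m.blk_ex)
    have "2 powr real_of_int (j - int (nat (j - k))) \<le> 2 powr real_of_int k" by (intro powr_mono) auto
    then have "2 powr real_of_int (j - int (nat (j - k))) < m s" using k unfolding m.blk_def mem_Collect_eq by linarith
    then have "h s = g (nat (j - k)) s" by (simp only: g_def indicator_simps mem_Collect_eq mult_1_right)
    then show "h s \<le> (SUP n. g n s)" by (metis SUP_upper UNIV_I)
  qed auto
qed

end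

section \<open>Hardy's inequality on initial intervals\<close>

text \<open>
  \<open>T\<close> abstracts the inner supremum (if \<open>p \<le> q\<close>) or integral (if \<open>q < p\<close>) of the statement, so that
  \<open>m\<^bsup>1/p'\<^esup> T\<close> is comparable with the best constant of Hardy's inequality on \<open>(0,x)\<close>.  In the lower
  bound the same \<open>G\<close> serves every \<open>y \<le> x\<close>: this is the dilation of an almost extremal function.
\<close>

locale cope_T = cope m U N \<mu> \<nu>1 \<nu>2 p q \<theta> p' q' \<theta>'
  for m U N \<mu> \<nu>1 \<nu>2 p q \<theta> p' q' \<theta>' +
  fixes T :: "real \<Rightarrow> ennreal" and Cu Cl :: real
  assumes T_anti: "\<And>x y. 0 < x \<Longrightarrow> x \<le> y \<Longrightarrow> T y \<le> T x"
    and K_mono': "\<And>x y. 0 < x \<Longrightarrow> x \<le> y \<Longrightarrow> ennreal (m x powr (1 / p')) * T x \<le> ennreal (m y powr (1 / p')) * T y"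
    and N_T: "\<And>x. 0 < x \<Longrightarrow> ennreal (N x powr (1 / q)) \<le> T x"
    and C_pos: "0 < Cu" "0 < Cl"
    and upper: "\<And>h x. h \<in> borel_measurable \<mu> \<Longrightarrow> 0 < x \<Longrightarrow> (\<And>s. x < s \<Longrightarrow> h s = 0) \<Longrightarrow>
       L h \<le> ennreal Cu * (ennreal (m x powr (1 / p')) * T x) epowr q * Lp UNIV h epowr (q / p)"
    and lower: "\<And>x \<kappa>. 0 < x \<Longrightarrow> \<kappa> < ennreal (m x powr (1 / p')) * T x \<Longrightarrow>
       \<exists>G\<in>borel_measurable borel. \<kappa> epowr q \<le> ennreal Cl * (\<integral>\<^sup>+t. G t epowr q \<partial>\<nu>2) \<and>
         (\<forall>y. 0 < y \<longrightarrow> y \<le> x \<longrightarrow> (\<exists>h\<in>borel_measurable borel. (\<forall>s\<ge>y. h s = 0) \<and> Lp UNIV h \<le> 1 \<and>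
            (\<forall>t. ennreal ((m y / m x) powr (1 / p')) * G t \<le> F h t)))"

context cope
begin

text \<open>If the half-line below t meets block i, then it contains every earlier block entirely,
  and moving down by l blocks divides the mass of a full block by 2^l.\<close>

lemma emeasure_blk_shift:
  assumes "0 \<le> l"
  shows "ennreal (2 powr (- real_of_int l)) * emeasure \<mu> (m.blk i \<inter> {..<t}) \<le> emeasure \<mu> (m.blk (i - l) \<inter> {..<t})"
proof (cases "l = 0")
  case False
  then have l: "1 \<le> l" using assms by simp
  show ?thesis
  proof (cases "2 powr real_of_int i < m t")
    case False
    have "m.blk i \<inter> {..<t} = {}"
    proof -
      have False if "s \<in> m.blk i" "s < t" for s
        using that False monoD[OF m.mono, of s t] by (auto simp: m.blk_def)
      then show ?thesis by blast
    qed
    then show ?thesis by simp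
  next
    case True
    have "m.blk (i - l) \<subseteq> {..<t}"
    proof
      fix s assume s: "s \<in> m.blk (i - l)"
      have "2 powr real_of_int (i - l + 1) \<le> 2 powr real_of_int i" using l by (intro powr_mono) auto
      then have "m s < m t" using s True unfolding m.blk_def mem_Collect_eq by linarith
      then show "s \<in> {..<t}" using monoD[OF m.mono, of t s] by (cases "s < t") auto
    qed
    then have "emeasure \<mu> (m.blk (i - l) \<inter> {..<t}) = ennreal (2 powr real_of_int (i - l))"
      by (simp add: Int_absorb2 emeasure_\<mu>_blk)
    also have "\<dots> = ennreal (2 powr (- real_of_int l)) * emeasure \<mu> (m.blk i)"
      by (simp add: emeasure_\<mu>_blk ennreal_mult'[symmetric] flip: powr_add)
    finally show ?thesis by (simp add: mult_left_mono emeasure_mono)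
  qed
qed simp

text \<open>Dilation becomes a shift of the block index. A step function with values
  \<open>\<alpha> i * 2 powr (- i / p)\<close> keeps its norm when it is moved down by l blocks,
  because block i has mass \<open>2 powr i\<close>, while its integral shrinks by the factor
  \<open>2 powr (- l / p')\<close> only.\<close>

lemma step_lower:
  assumes x: "x \<in> m.blk j" and \<alpha>: "\<And>i. 0 \<le> \<alpha> i" and sum1: "(\<Sum>i=a..j - 1. \<alpha> i powr p) \<le> 1"
  obtains G where "G \<in> borel_measurable borel"
    "\<And>y. 0 < y \<Longrightarrow> y \<le> x \<Longrightarrow> \<exists>h\<in>borel_measurable borel. (\<forall>s\<ge>y. h s = 0) \<and> Lp UNIV h \<le> 1 \<and>
            (\<forall>t. ennreal ((m y / m x) powr (1 / p')) * G t \<le> F h t)"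
    "\<And>i t. a \<le> i \<Longrightarrow> i < j \<Longrightarrow> 2 powr real_of_int (i + 1) < m t \<Longrightarrow> ennreal (2 powr (real_of_int (i - 1) / p') * \<alpha> i) \<le> G t"
proof -
  define h where "h l s = (\<Sum>i=a..j - 1. ennreal (\<alpha> i * 2 powr (- real_of_int (i - l) / p)) * indicator (m.blk (i - l)) s)" for l s
  have hm [measurable]: "h l \<in> borel_measurable borel" for l unfolding h_def by measurable
  have hre: "h l s = (\<Sum>i=a - l..j - 1 - l. ennreal (\<alpha> (i + l) * 2 powr (- real_of_int i / p)) * indicator (m.blk i) s)" for l s
    unfolding h_def by (rule sum.reindex_bij_witness[of _ "\<lambda>i. i + l" "\<lambda>i. i - l"]) auto
  have Lph: "Lp UNIV (h l) \<le> 1" for l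
  proof -
    have pt: "h l s epowr p \<le> (\<Sum>i=a - l..j - 1 - l. ennreal (\<alpha> (i + l) powr p * 2 powr (- real_of_int i)) * indicator (m.blk i) s)" for s
    proof (cases "0 < s")
      case True
      then obtain k where k: "s \<in> m.blk k" by (rule m.blk_ex)
      show ?thesis unfolding hre
        by (subst (1 2) m.sum_blk[OF _ k]) (use \<alpha> p in \<open>auto simp: epowr_ennreal_pos powr_mult powr_powr\<close>)
    next
      case False
      then show ?thesis unfolding hre using p by (subst (1 2) m.sum_blk_nonpos) auto
    qed
    have "Lp UNIV (h l) \<le> (\<integral>\<^sup>+s. (\<Sum>i=a - l..j - 1 - l. ennreal (\<alpha> (i + l) powr p * 2 powr (- real_of_int i)) * indicator (m.blk i) s) \<partial>\<mu>)"
      unfolding Lp_def using pt by (intro nn_integral_mono) auto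
    also have "\<dots> = (\<Sum>i=a - l..j - 1 - l. ennreal (\<alpha> (i + l) powr p * 2 powr (- real_of_int i)) * ennreal (2 powr real_of_int i))"
      by (subst nn_integral_sum) (auto simp: nn_integral_cmult emeasure_\<mu>_blk)
    also have "\<dots> = (\<Sum>i=a - l..j - 1 - l. ennreal (\<alpha> (i + l) powr p))"
      by (intro sum.cong refl) (simp add: ennreal_mult'[symmetric] mult.assoc flip: powr_add)
    also have "\<dots> = (\<Sum>i=a..j - 1. ennreal (\<alpha> i powr p))"
      by (rule sum.reindex_bij_witness[of _ "\<lambda>i. i - l" "\<lambda>i. i + l"]) auto
    also have "\<dots> \<le> 1" using sum1 by (simp add: ennreal_le_1)
    finally show ?thesis .
  qed
  have Fh: "F (h l) t = (\<Sum>i=a..j - 1. ennreal (\<alpha> i * 2 powr (- real_of_int (i - l) / p)) * emeasure \<mu> (m.blk (i - l) \<inter> {..<t}))" for l t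
  proof -
    have "F (h l) t = (\<integral>\<^sup>+s. (\<Sum>i=a..j - 1. ennreal (\<alpha> i * 2 powr (- real_of_int (i - l) / p)) * indicator (m.blk (i - l) \<inter> {..<t}) s) \<partial>\<mu>)"
      unfolding F_def h_def by (intro nn_integral_cong) (simp only: sum_distrib_right indicator_inter_arith mult.assoc)
    also have "\<dots> = (\<Sum>i=a..j - 1. ennreal (\<alpha> i * 2 powr (- real_of_int (i - l) / p)) * emeasure \<mu> (m.blk (i - l) \<inter> {..<t}))"
      by (subst nn_integral_sum) (auto simp: nn_integral_cmult)
    finally show ?thesis .
  qed
  have shift: "ennreal (2 powr (- real_of_int l / p')) * F (h 0) t \<le> F (h l) t" if l: "0 \<le> l" for l t
  proof -
    have "ennreal (2 powr (- real_of_int l / p')) * (ennreal (\<alpha> i * 2 powr (- real_of_int (i - 0) / p)) * emeasure \<mu> (m.blk (i - 0) \<inter> {..<t}))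
      \<le> ennreal (\<alpha> i * 2 powr (- real_of_int (i - l) / p)) * emeasure \<mu> (m.blk (i - l) \<inter> {..<t})" for i
    proof -
      have e: "- real_of_int l / p' = real_of_int l / p - real_of_int l"
      proof -
        have "1 / p' = 1 - 1 / p" using p by linarith
        then have "- real_of_int l * (1 / p') = - real_of_int l * (1 - 1 / p)" by simp
        then show ?thesis by (simp add: algebra_simps)
      qed
      have "ennreal (2 powr (- real_of_int l / p')) * (ennreal (\<alpha> i * 2 powr (- real_of_int (i - 0) / p)) * emeasure \<mu> (m.blk (i - 0) \<inter> {..<t}))
         = ennreal (2 powr (- real_of_int l / p') * (\<alpha> i * 2 powr (- real_of_int i / p))) * emeasure \<mu> (m.blk i \<inter> {..<t})"
        using \<alpha>[of i] by (simp add: ennreal_mult' mult.assoc)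
      also have "2 powr (- real_of_int l / p') * (\<alpha> i * 2 powr (- real_of_int i / p)) = \<alpha> i * 2 powr (- real_of_int (i - l) / p) * 2 powr (- real_of_int l)"
        unfolding e by (simp add: mult_ac powr_add[symmetric] diff_divide_distrib) (simp add: algebra_simps)
      also have "ennreal (\<alpha> i * 2 powr (- real_of_int (i - l) / p) * 2 powr (- real_of_int l)) * emeasure \<mu> (m.blk i \<inter> {..<t})
        = ennreal (\<alpha> i * 2 powr (- real_of_int (i - l) / p)) * (ennreal (2 powr (- real_of_int l)) * emeasure \<mu> (m.blk i \<inter> {..<t}))"
        using \<alpha>[of i] by (simp add: ennreal_mult' ennreal_mult'' mult.assoc)
      finally show ?thesis using emeasure_blk_shift[OF l, of i t] by (simp add: mult_left_mono)
    qed
    then show ?thesis unfolding Fh sum_distrib_left by (rule sum_mono)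
  qed
  \<comment> \<open>The factor pays for rounding: if y and x lie l blocks apart, then
    \<open>m y / m x\<close> may exceed \<open>2 powr (- l)\<close> by a factor of up to 2.\<close>
  define G where "G t = ennreal (2 powr (- (1 / p'))) * F (h 0) t" for t
  show ?thesis
  proof (rule that[of G])
    show "G \<in> borel_measurable borel" unfolding G_def by measurable
  next
    fix y assume y: "0 < y" "y \<le> x"
    then obtain jy where jy: "y \<in> m.blk jy" using m.blk_ex by metis
    then have jj: "jy \<le> j" using m.blk_le y x by blast
    show "\<exists>h\<in>borel_measurable borel. (\<forall>s\<ge>y. h s = 0) \<and> Lp UNIV h \<le> 1 \<and> (\<forall>t. ennreal ((m y / m x) powr (1 / p')) * G t \<le> F h t)"
    \<comment> \<open>At x only blocks up to j - 1 are used, so the shifted function lives on blocks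
      up to jy - 1, all to the left of y.\<close>
    proof (intro bexI[of _ "h (j - jy)"] conjI allI impI)
      fix s assume s: "y \<le> s"
      show "h (j - jy) s = 0" unfolding h_def
      proof (intro sum.neutral ballI)
        fix i assume i: "i \<in> {a..j - 1}"
        have "2 powr real_of_int (i - (j - jy) + 1) \<le> 2 powr real_of_int jy" using i by (intro powr_mono) auto
        also have "\<dots> < m y" using jy by (simp add: m.blk_def)
        also have "\<dots> \<le> m s" using s m.mono by (auto dest: monoD)
        finally have "s \<notin> m.blk (i - (j - jy))" unfolding m.blk_def by auto
        then show "ennreal (\<alpha> i * 2 powr (- real_of_int (i - (j - jy)) / p)) * indicator (m.blk (i - (j - jy))) s = 0" by simp
      qed
    next
      fix t
      have mx: "0 < m x" "0 < m y" using m.pos y by auto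
      have "m y / m x \<le> 2 powr real_of_int (jy + 1) / 2 powr real_of_int j"
        using jy x y mx by (intro frac_le) (auto simp: m.blk_def less_imp_le)
      also have "\<dots> = 2 powr (1 - real_of_int (j - jy))" by (simp add: powr_diff[symmetric] algebra_simps)
      finally have "(m y / m x) powr (1 / p') \<le> (2 powr (1 - real_of_int (j - jy))) powr (1 / p')"
        using mx p'1 by (intro powr_mono2) auto
      then have "(m y / m x) powr (1 / p') * 2 powr (- (1 / p')) \<le> 2 powr ((1 - real_of_int (j - jy)) * (1 / p')) * 2 powr (- (1 / p'))"
        by (intro mult_right_mono) (auto simp: powr_powr)
      also have "\<dots> = 2 powr (- real_of_int (j - jy) / p')"
        by (simp add: powr_add[symmetric] algebra_simps diff_divide_distrib)
      finally have "ennreal ((m y / m x) powr (1 / p')) * G t \<le> ennreal (2 powr (- real_of_int (j - jy) / p')) * F (h 0) t"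
        unfolding G_def mult.assoc[symmetric] by (intro mult_right_mono) (auto simp: ennreal_mult'[symmetric] intro!: ennreal_leI)
      also have "\<dots> \<le> F (h (j - jy)) t" using jj by (intro shift) auto
      finally show "ennreal ((m y / m x) powr (1 / p')) * G t \<le> F (h (j - jy)) t" .
    qed (use Lph hm in auto)
  next
    fix i t assume i: "a \<le> i" "i < j" and t: "2 powr real_of_int (i + 1) < m t"
    have sub: "m.blk i \<subseteq> {..<t}"
    proof
      fix s assume "s \<in> m.blk i"
      then have "m s < m t" using t unfolding m.blk_def mem_Collect_eq by linarith
      then show "s \<in> {..<t}" using monoD[OF m.mono, of t s] by (cases "s < t") auto
    qed
    have e: "real_of_int (i - 1) / p' = - (1 / p') + (- real_of_int i / p + real_of_int i)"
    proof -
      have "1 / p' = 1 - 1 / p" using p by linarith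
      then have "real_of_int i * (1 / p') = real_of_int i * (1 - 1 / p)" by simp
      then show ?thesis by (simp add: algebra_simps diff_divide_distrib)
    qed
    have "ennreal (2 powr (real_of_int (i - 1) / p') * \<alpha> i)
      = ennreal (2 powr (- (1 / p'))) * (ennreal (\<alpha> i * 2 powr (- real_of_int (i - 0) / p)) * emeasure \<mu> (m.blk (i - 0) \<inter> {..<t}))"
      using sub \<alpha>[of i] unfolding e powr_add by (simp add: Int_absorb2 emeasure_\<mu>_blk ennreal_mult'[symmetric] ennreal_mult''[symmetric] mult_ac)
    also have "\<dots> \<le> G t"
      unfolding G_def Fh
      by (intro mult_left_mono member_le_sum[of i "{a..j - 1}" "\<lambda>i. ennreal (\<alpha> i * 2 powr (- real_of_int (i - 0) / p)) * emeasure \<mu> (m.blk (i - 0) \<inter> {..<t})"]) (use i in auto)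
    finally show "ennreal (2 powr (real_of_int (i - 1) / p') * \<alpha> i) \<le> G t" .
  qed
qed

section \<open>The case p \<le> q: a supremum\<close>

definition Tsup :: "real \<Rightarrow> ennreal" where
  "Tsup x = (SUP t\<in>{0<..}. ennreal (min 1 (m t / m x) powr (1 / p')) * ennreal (N t powr (1 / q)))"

text \<open>As \<open>N\<close> decreases, the points t \<ge> x add nothing to the term t = x. What
  remains is Muckenhoupt's condition for Hardy's inequality on (0,x).\<close>

lemma Ksup:
  assumes "0 < x"
  shows "ennreal (m x powr (1 / p')) * Tsup x = (SUP t\<in>{0<..}. ennreal (min (m x) (m t) powr (1 / p') * N t powr (1 / q)))"
proof -
  have mx: "0 < m x" using m.pos assms by simp
  have "ennreal (m x powr (1 / p')) * Tsup x = (SUP t\<in>{0<..}. ennreal (m x powr (1 / p')) * (ennreal (min 1 (m t / m x) powr (1 / p')) * ennreal (N t powr (1 / q))))"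
    unfolding Tsup_def by (rule SUP_mult_left_ennreal)
  also have "\<dots> = (SUP t\<in>{0<..}. ennreal (min (m x) (m t) powr (1 / p') * N t powr (1 / q)))"
  proof (intro SUP_cong refl)
    fix t :: real assume "t \<in> {0<..}"
    then have mt: "0 < m t" using m.pos by simp
    have "m x powr (1 / p') * min 1 (m t / m x) powr (1 / p') = (m x * min 1 (m t / m x)) powr (1 / p')"
      by (simp add: powr_mult)
    also have "m x * min 1 (m t / m x) = min (m x) (m t)" using mx by (simp add: min_def field_simps)
    finally have e: "m x powr (1 / p') * min 1 (m t / m x) powr (1 / p') = min (m x) (m t) powr (1 / p')" .
    show "ennreal (m x powr (1 / p')) * (ennreal (min 1 (m t / m x) powr (1 / p')) * ennreal (N t powr (1 / q)))
      = ennreal (min (m x) (m t) powr (1 / p') * N t powr (1 / q))"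
      unfolding e[symmetric] by (simp add: ennreal_mult mult.assoc)
  qed
  finally show ?thesis .
qed

text \<open>The upper bound is the discrete Hardy inequality on the blocks of \<open>m\<close>. For
  the lower bound a function living on a single block suffices.\<close>

lemma cope_T_sup:
  assumes pq: "p \<le> q"
  shows "cope_T m U N \<mu> \<nu>1 \<nu>2 p q \<theta> p' q' \<theta>' Tsup (hardyC p q * 4 powr q) (2 powr (3 * q / p'))"
proof (unfold_locales, goal_cases)
  case (1 x y)
  have m0: "0 < m x" "m x \<le> m y" using 1 m.pos monoD[OF m.mono] by auto
  show ?case unfolding Tsup_def
  proof (intro SUP_mono)
    fix t :: real assume t: "t \<in> {0<..}"
    have "0 < m t" using m.pos t by simp
    then have "m t / m y \<le> m t / m x" "0 \<le> m t / m y"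
      using m0 by (auto intro!: divide_left_mono mult_pos_pos)
    then have "min 1 (m t / m y) \<le> min 1 (m t / m x)" "0 \<le> min 1 (m t / m y)"
      by (simp_all add: min_le_iff_disj)
    then show "\<exists>s\<in>{0<..}. ennreal (min 1 (m t / m y) powr (1 / p')) * ennreal (N t powr (1 / q))
       \<le> ennreal (min 1 (m s / m x) powr (1 / p')) * ennreal (N s powr (1 / q))"
      using t p'1 by (intro bexI[of _ t] mult_right_mono ennreal_leI powr_mono2) auto
  qed
next
  case (2 x y)
  have m0: "0 < m x" "m x \<le> m y" using 2 m.pos monoD[OF m.mono] by auto
  have "(SUP t\<in>{0<..}. ennreal (min (m x) (m t) powr (1 / p') * N t powr (1 / q)))
      \<le> (SUP t\<in>{0<..}. ennreal (min (m y) (m t) powr (1 / p') * N t powr (1 / q)))"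
  proof (intro SUP_mono)
    fix t :: real assume t: "t \<in> {0<..}"
    have "0 < m t" using m.pos t by simp
    then show "\<exists>s\<in>{0<..}. ennreal (min (m x) (m t) powr (1 / p') * N t powr (1 / q))
       \<le> ennreal (min (m y) (m s) powr (1 / p') * N s powr (1 / q))"
      using t p'1 m0 by (intro bexI[of _ t] ennreal_leI mult_right_mono powr_mono2) auto
  qed
  then show ?case using 2 by (simp add: Ksup)
next
  case (3 x)
  have "ennreal (N x powr (1 / q)) = ennreal (min 1 (m x / m x) powr (1 / p')) * ennreal (N x powr (1 / q))"
    using m.pos[OF 3] by simp
  also have "\<dots> \<le> Tsup x" unfolding Tsup_def using 3 by (intro SUP_upper) auto
  finally show ?case .
next
  case 4
  show ?case using p q p'1 by (simp add: hardyC_def)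
next
  case 5
  show ?case by simp
next
  case (6 h x)
  obtain j where j: "x \<in> m.blk j" using m.blk_ex 6(2) by metis
  let ?K = "ennreal (m x powr (1 / p')) * Tsup x"
  have "L h \<le> (ennreal (hardyC p q) * (4 * ?K) epowr q) * Lp UNIV h epowr (q / p)"
  proof (rule block_upper[OF 6(1) j 6(3)])
    fix a A assume a: "a \<le> j"
    show "(\<Sum>k=a..j. nblk j k * (\<Sum>i=a..k. ennreal (2 powr (real_of_int i / p')) * A i) epowr q)
        \<le> ennreal (hardyC p q) * (4 * ?K) epowr q * (\<Sum>i=a..j. A i epowr p) epowr (q / p)"
    proof (rule hardy_upper_le[where s' = p'])
      fix k assume k: "a \<le> k" "k \<le> j"
      obtain t where t: "0 < t" "m t = 2 powr real_of_int k" "{s. 2 powr real_of_int k < m s} = {t<..}" by (rule m_level_pt)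
      have "(\<Sum>i=a..k. (2 powr (real_of_int i / p')) powr p') = (\<Sum>i=a..k. 2 powr (1 * real_of_int i))"
        using p'1 by (simp add: powr_powr)
      also have "\<dots> \<le> 2 powr (1 * real_of_int k) / (1 - 2 powr (- 1))" by (intro sum_geometric_below) auto
      also have "\<dots> = 2 * 2 powr real_of_int k" by (simp add: powr_minus)
      finally have "(\<Sum>i=a..k. (2 powr (real_of_int i / p')) powr p') powr (1 / p') \<le> (2 * 2 powr real_of_int k) powr (1 / p')"
        using p'1 by (intro powr_mono2 sum_nonneg) auto
      also have "\<dots> \<le> 2 powr 1 * (2 powr real_of_int k) powr (1 / p')"
        unfolding powr_mult using p'1 by (intro mult_right_mono powr_mono) auto
      \<comment> \<open>At the level point t with k \<le> j the minimum is exactly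
        \<open>2 powr k\<close>, because x lies beyond that level.\<close>
      also have "\<dots> \<le> 4 * min (m x) (m t) powr (1 / p')"
      proof -
        have "2 powr real_of_int k \<le> 2 powr real_of_int j" using k by simp
        then have "min (m x) (m t) = 2 powr real_of_int k"
          using t(2) j unfolding m.blk_def mem_Collect_eq by linarith
        then show ?thesis by simp
      qed
      finally have *: "(\<Sum>i=a..k. (2 powr (real_of_int i / p')) powr p') powr (1 / p') \<le> 4 * min (m x) (m t) powr (1 / p')" .
      have "(\<Sum>i=k..j. nblk j i) epowr (1 / q) = ennreal (N t powr (1 / q))"
        using t q k N_nonneg[OF t(1)] by (simp add: nblk_tail N_gt epowr_ennreal_pos)
      then have "ennreal ((\<Sum>i=a..k. (2 powr (real_of_int i / p')) powr p') powr (1 / p')) * (\<Sum>i=k..j. nblk j i) epowr (1 / q)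
        \<le> ennreal (4 * min (m x) (m t) powr (1 / p')) * ennreal (N t powr (1 / q))"
        using * by (auto intro!: mult_right_mono ennreal_leI)
      also have "\<dots> = 4 * ennreal (min (m x) (m t) powr (1 / p') * N t powr (1 / q))"
        by (simp add: ennreal_mult' mult.assoc)
      also have "\<dots> \<le> 4 * ?K"
        unfolding Ksup[OF 6(2)] using t by (intro mult_left_mono SUP_upper) auto
      finally show "ennreal ((\<Sum>i=a..k. (2 powr (real_of_int i / p')) powr p') powr (1 / p')) * (\<Sum>i=k..j. nblk j i) epowr (1 / q) \<le> 4 * ?K" .
    qed (use p q pq nblk_finite in auto)
  qed auto
  also have "(4 * ?K) epowr q = ennreal (4 powr q) * ?K epowr q"
  proof -
    have "(4::ennreal) epowr q = ennreal (4 powr q)" using epowr_ennreal[of 4 q] by simp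
    then show ?thesis using q by (subst epowr_mult) auto
  qed
  also have "ennreal (hardyC p q) * (ennreal (4 powr q) * ?K epowr q) = ennreal (hardyC p q * 4 powr q) * ?K epowr q"
    by (simp add: ennreal_mult'' mult.assoc)
  finally show ?case .
next
  case (7 x \<kappa>)
  obtain j where j: "x \<in> m.blk j" using m.blk_ex 7(1) by metis
  obtain t where t: "0 < t" "\<kappa> < ennreal (min (m x) (m t) powr (1 / p') * N t powr (1 / q))"
    using 7 by (auto simp: Ksup less_SUP_iff)
  obtain k where k: "t \<in> m.blk k" using m.blk_ex t(1) by metis
  \<comment> \<open>Block i has to lie before the block of x, for \<open>step_lower\<close>, and
    before that of t, so that \<open>G\<close> has collected its full integral there. The loss is
    three levels, from \<open>min k j + 1\<close> down to i - 1, hence the factor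
    \<open>2 powr (3 * q / p')\<close>.\<close>
  define i where "i = min k j - 1"
  define \<alpha> where "\<alpha> l = (if l = i then 1 else 0 :: real)" for l
  have a1: "(\<Sum>l=i..j - 1. \<alpha> l powr p) \<le> 1"
    by (auto simp: \<alpha>_def i_def if_distrib[of "\<lambda>x. x powr p"] cong: if_cong)
  have a0: "0 \<le> \<alpha> l" for l by (simp add: \<alpha>_def)
  obtain G where G: "G \<in> borel_measurable borel"
    "\<And>y. 0 < y \<Longrightarrow> y \<le> x \<Longrightarrow> \<exists>h\<in>borel_measurable borel. (\<forall>s\<ge>y. h s = 0) \<and> Lp UNIV h \<le> 1 \<and>
            (\<forall>t. ennreal ((m y / m x) powr (1 / p')) * G t \<le> F h t)"
    "\<And>l t. i \<le> l \<Longrightarrow> l < j \<Longrightarrow> 2 powr real_of_int (l + 1) < m t \<Longrightarrow> ennreal (2 powr (real_of_int (l - 1) / p') * \<alpha> l) \<le> G t"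
    using step_lower[OF j a0 a1] by metis
  note [measurable] = G(1)
  have "min (m x) (m t) \<le> 2 powr real_of_int (min k j + 1)"
    using j k unfolding m.blk_def by (auto simp: min_def)
  then have mm: "min (m x) (m t) powr (q / p') \<le> (2 powr real_of_int (min k j + 1)) powr (q / p')"
    using p'1 q m.pos[OF t(1)] m.pos[OF 7(1)] by (intro powr_mono2) auto
  have "\<kappa> epowr q \<le> ennreal (min (m x) (m t) powr (1 / p') * N t powr (1 / q)) epowr q"
    using q t by (intro epowr_mono) auto
  also have "\<dots> = ennreal (min (m x) (m t) powr (q / p') * N t)"
    using q N_nonneg[OF t(1)] by (simp add: epowr_ennreal_pos powr_mult powr_powr)
  also have "\<dots> \<le> ennreal ((2 powr real_of_int (min k j + 1)) powr (q / p') * N t)"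
    using mm N_nonneg[OF t(1)] by (intro ennreal_leI mult_right_mono) auto
  also have "\<dots> = ennreal (2 powr (3 * q / p')) * (ennreal (2 powr (real_of_int (i - 1) / p')) epowr q * emeasure \<nu>2 {t<..})"
  proof -
    have "((2::real) powr real_of_int (min k j + 1)) powr (q / p') = 2 powr (3 * q / p') * (2 powr (real_of_int (i - 1) / p')) powr q"
    proof -
      have e: "real_of_int (min k j + 1) * (q / p') = 3 * q / p' + real_of_int (i - 1) / p' * q"
        using p'1 by (simp add: i_def field_simps)
      show ?thesis by (simp only: powr_powr e powr_add)
    qed
    then show ?thesis using N_nonneg[OF t(1)] t(1) q
      by (simp add: N_gt epowr_ennreal ennreal_mult' ennreal_mult'' mult.assoc)
  qed
  also have "ennreal (2 powr (real_of_int (i - 1) / p')) epowr q * emeasure \<nu>2 {t<..} = (\<integral>\<^sup>+s. ennreal (2 powr (real_of_int (i - 1) / p')) epowr q * indicator {t<..} s \<partial>\<nu>2)"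
    by (simp add: nn_integral_cmult)
  also have "\<dots> \<le> (\<integral>\<^sup>+s. G s epowr q \<partial>\<nu>2)"
  proof (intro nn_integral_mono)
    fix s
    have "ennreal (2 powr (real_of_int (i - 1) / p')) \<le> G s" if "t < s"
    proof -
      have "2 powr real_of_int (i + 1) \<le> 2 powr real_of_int k" by (simp add: i_def)
      then have "2 powr real_of_int (i + 1) < m s"
        using k monoD[OF m.mono, of t s] that unfolding m.blk_def mem_Collect_eq by linarith
      then show ?thesis using G(3)[of i s] by (simp add: i_def \<alpha>_def)
    qed
    then show "ennreal (2 powr (real_of_int (i - 1) / p')) epowr q * indicator {t<..} s \<le> G s epowr q"
      using q by (auto split: split_indicator intro: epowr_mono)
  qed
  finally have "\<kappa> epowr q \<le> ennreal (2 powr (3 * q / p')) * (\<integral>\<^sup>+s. G s epowr q \<partial>\<nu>2)"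
    by (simp add: mult_left_mono)
  then show ?case using G(1,2) by (intro bexI[of _ G]) auto
qed

end

section \<open>The case q < p: an integral with respect to d(-N^(\<rho>/q))\<close>

locale cope_sigma = cope m U N \<mu> \<nu>1 \<nu>2 p q \<theta> p' q' \<theta>'
  for m U N \<mu> \<nu>1 \<nu>2 p q \<theta> p' q' \<theta>' +
  fixes \<sigma> :: "real measure" and \<rho> :: real
  assumes qp: "q < p" and \<rho>: "1 / \<rho> = 1 / q - 1 / p"
    and sets_\<sigma> [measurable_cong, simp]: "sets \<sigma> = sets borel"
    and \<sigma>_gt: "\<And>t. 0 < t \<Longrightarrow> emeasure \<sigma> {t<..} = ennreal (N t powr (\<rho> / q))"
    and \<sigma>_neg: "emeasure \<sigma> {..0} = 0"
begin

lemma \<rho>_pos: "0 < \<rho>" and \<rho>_q': "\<rho> / q' + 1 = \<rho> / p'" and \<rho>_p: "\<rho> / p = \<rho> / q - 1" and \<rho>_q: "1 < \<rho> / q"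
  and q\<rho>: "q / \<rho> = 1 - q / p" and \<rho>qp: "\<rho> * q / p = \<rho> - q"
proof -
  have "0 < 1 / \<rho>" unfolding \<rho> using qp q by (simp add: frac_less2)
  then show r: "0 < \<rho>" by simp
  have 1: "\<rho> * (1 / \<rho>) = \<rho> * (1 / q) - \<rho> * (1 / p)" unfolding \<rho> by (simp add: right_diff_distrib)
  then show rp: "\<rho> / p = \<rho> / q - 1" using r by simp
  have "1 / q' = 1 - 1 / q" "1 / p' = 1 - 1 / p" using p q by linarith+
  then have "\<rho> * (1 / q') = \<rho> - \<rho> * (1 / q)" "\<rho> * (1 / p') = \<rho> - \<rho> * (1 / p)" by (simp_all add: right_diff_distrib)
  then show "\<rho> / q' + 1 = \<rho> / p'" using 1 r by simp
  have "0 < \<rho> / p" using r p by simp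
  then show "1 < \<rho> / q" using rp by linarith
  have "q * (1 / \<rho>) = 1 - q * (1 / p)" unfolding \<rho> using q by (simp add: right_diff_distrib)
  then show "q / \<rho> = 1 - q / p" by simp
  have "\<rho> * q / p = q * (\<rho> / p)" by simp
  also have "\<dots> = \<rho> - q" unfolding rp using q by (simp add: right_diff_distrib)
  finally show "\<rho> * q / p = \<rho> - q" .
qed

lemma AE_\<sigma>: "AE t in \<sigma>. 0 < t"
  using \<sigma>_neg by (intro AE_I[of _ _ "{..0}"]) auto

definition Tint :: "real \<Rightarrow> ennreal" where
  "Tint x = (\<integral>\<^sup>+t. ennreal (min 1 (m t / m x) powr (\<rho> / p')) \<partial>\<sigma>) epowr (1 / \<rho>)"

text \<open>By \<open>Kint\<close>, the root of order \<rho> of \<open>I x\<close> is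
  \<open>m x powr (1 / p') * Tint x\<close>. It is the integral condition for Hardy's inequality on
  (0,x) when q < p.\<close>

definition I :: "real \<Rightarrow> ennreal" where
  "I x = (\<integral>\<^sup>+t. ennreal (min (m x) (m t) powr (\<rho> / p')) \<partial>\<sigma>)"

lemma Kint:
  assumes "0 < x"
  shows "ennreal (m x powr (1 / p')) * Tint x = I x epowr (1 / \<rho>)"
proof -
  have mx: "0 < m x" using m.pos assms by simp
  have "ennreal (m x powr (\<rho> / p')) * (\<integral>\<^sup>+t. ennreal (min 1 (m t / m x) powr (\<rho> / p')) \<partial>\<sigma>)
     = (\<integral>\<^sup>+t. ennreal (m x powr (\<rho> / p')) * ennreal (min 1 (m t / m x) powr (\<rho> / p')) \<partial>\<sigma>)"
    by (intro nn_integral_cmult[symmetric]) measurable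
  also have "\<dots> = I x"
    unfolding I_def
  proof (intro nn_integral_cong_AE, use AE_\<sigma> in eventually_elim)
    fix t :: real assume "0 < t"
    have "m x powr (\<rho> / p') * min 1 (m t / m x) powr (\<rho> / p') = (m x * min 1 (m t / m x)) powr (\<rho> / p')"
      by (simp add: powr_mult)
    also have "m x * min 1 (m t / m x) = min (m x) (m t)" using mx by (simp add: min_def field_simps)
    finally show "ennreal (m x powr (\<rho> / p')) * ennreal (min 1 (m t / m x) powr (\<rho> / p')) = ennreal (min (m x) (m t) powr (\<rho> / p'))"
      by (simp add: ennreal_mult'[symmetric])
  qed
  finally have "I x epowr (1 / \<rho>) = (ennreal (m x powr (\<rho> / p')) * (\<integral>\<^sup>+t. ennreal (min 1 (m t / m x) powr (\<rho> / p')) \<partial>\<sigma>)) epowr (1 / \<rho>)"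
    by simp
  also have "\<dots> = ennreal (m x powr (1 / p')) * Tint x"
    using \<rho>_pos mx by (subst epowr_mult) (auto simp: Tint_def epowr_ennreal powr_powr)
  finally show ?thesis by simp
qed

abbreviation "B j k \<equiv> (if k = j then {s. 2 powr real_of_int k < m s} else m.blk k)"

lemma B_cover:
  assumes "2 powr real_of_int a < m t" "a \<le> j"
  obtains k where "a \<le> k" "k \<le> j" "t \<in> B j k"
proof (cases "2 powr real_of_int j < m t")
  case True then show ?thesis using that[of j] assms by auto
next
  case False
  then have "m t \<le> 2 powr real_of_int ((j - 1) + 1)" by simp
  then obtain i where "a \<le> i" "i \<le> j - 1" "t \<in> m.blk i" using m.blk_window assms(1) by blast
  then show ?thesis using that[of i] by auto
qed

lemma B_unique:
  assumes "t \<in> B j i" "t \<in> B j k" "i \<le> j" "k \<le> j" shows "i = k"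
proof -
  have *: False if "t \<in> B j i" "t \<in> B j k" "i < k" "k \<le> j" for i k
  proof -
    have le: "2 powr real_of_int (i + 1) \<le> 2 powr real_of_int k" using that by (intro powr_mono) auto
    have "m t \<le> 2 powr real_of_int (i + 1)" "2 powr real_of_int k < m t"
      using that by (auto simp: m.blk_def split: if_splits)
    then show False using le by linarith
  qed
  show ?thesis using *[of i k] *[of k i] assms by (cases i k rule: linorder_cases) auto
qed

lemma sum_B_le:
  fixes c :: "int \<Rightarrow> ennreal"
  assumes "\<And>k. a \<le> k \<Longrightarrow> k \<le> j \<Longrightarrow> t \<in> B j k \<Longrightarrow> c k \<le> y"
  shows "(\<Sum>k=a..j. c k * indicator (B j k) t) \<le> y"
proof (cases "\<exists>k\<in>{a..j}. t \<in> B j k")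
  case True
  then obtain k where k: "k \<in> {a..j}" "t \<in> B j k" by blast
  have "c i * indicator (B j i) t = (if k = i then c i else 0)" if "i \<in> {a..j}" for i
  proof (cases "k = i")
    case True
    then show ?thesis using k(2) by (simp only: indicator_simps mult_1_right if_True refl)
  next
    case False
    then have "t \<notin> B j i" using k B_unique[of t k j i] that by (meson atLeastAtMost_iff)
    then show ?thesis using False by (simp only: indicator_simps mult_zero_right if_False not_False_eq_True)
  qed
  then have "(\<Sum>k=a..j. c k * indicator (B j k) t) = (\<Sum>i=a..j. if k = i then c i else 0)"
    by (intro sum.cong) auto
  also have "\<dots> = c k" using k by simp
  finally show ?thesis using assms k by simp
next
  case False
  have "(\<Sum>k=a..j. c k * indicator (B j k) t) = 0"
  proof (rule sum.neutral, rule ballI)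
    fix k assume "k \<in> {a..j}"
    then have "t \<notin> B j k" using False by blast
    then show "c k * indicator (B j k) t = 0" by (simp only: indicator_simps mult_zero_right if_False not_False_eq_True)
  qed
  then show ?thesis by simp
qed

text \<open>The tail sums of \<open>nblk\<close>, raised to \<rho>/q, are \<sigma>-masses of level
  sets of \<open>m\<close>. After exchanging sum and integral only the levels below both
  \<open>m x\<close> and \<open>m t\<close> remain, and their geometric sum is comparable with its
  last term.\<close>

lemma Tint_upper_block:
  assumes x: "x \<in> m.blk j"
  shows "(\<Sum>k=a..j. ennreal ((\<Sum>i=a..k. (2 powr (real_of_int i / p')) powr p') powr (\<rho> / q') * (2 powr (real_of_int k / p')) powr p')
            * (\<Sum>i=k..j. nblk j i) epowr (\<rho> / q))
      \<le> ennreal (2 powr (\<rho> / q') / (1 - 2 powr (- (\<rho> / p')))) * I x" (is "?S \<le> ennreal ?C * _")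
proof -
  let ?c = "2 powr (\<rho> / q')"
  have "?S \<le> (\<Sum>k=a..j. ennreal (?c * 2 powr (\<rho> / p' * real_of_int k)) * emeasure \<sigma> {s. 2 powr real_of_int k < m s})"
  proof (intro sum_mono mult_mono)
    fix k assume k: "k \<in> {a..j}"
    have "(\<Sum>i=a..k. (2 powr (real_of_int i / p')) powr p') = (\<Sum>i=a..k. 2 powr (1 * real_of_int i))"
      using p'1 by (simp add: powr_powr)
    also have "\<dots> \<le> 2 powr (1 * real_of_int k) / (1 - 2 powr (- 1))" by (intro sum_geometric_below) auto
    also have "\<dots> = 2 * 2 powr real_of_int k" by (simp add: powr_minus)
    finally have "(\<Sum>i=a..k. (2 powr (real_of_int i / p')) powr p') powr (\<rho> / q') \<le> (2 * 2 powr real_of_int k) powr (\<rho> / q')"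
      using q'1 \<rho>_pos by (intro powr_mono2 sum_nonneg) auto
    then have "(\<Sum>i=a..k. (2 powr (real_of_int i / p')) powr p') powr (\<rho> / q') * (2 powr (real_of_int k / p')) powr p'
      \<le> (2 * 2 powr real_of_int k) powr (\<rho> / q') * (2 powr (real_of_int k / p')) powr p'"
      by (intro mult_right_mono) auto
    also have "\<dots> = ?c * 2 powr (\<rho> / p' * real_of_int k)"
      using p'1 unfolding \<rho>_q'[symmetric] by (simp add: powr_mult powr_powr powr_add[symmetric] algebra_simps)
    finally show "ennreal ((\<Sum>i=a..k. (2 powr (real_of_int i / p')) powr p') powr (\<rho> / q') * (2 powr (real_of_int k / p')) powr p')
      \<le> ennreal (?c * 2 powr (\<rho> / p' * real_of_int k))" by (rule ennreal_leI)
    obtain t where t: "0 < t" "{s. 2 powr real_of_int k < m s} = {t<..}" by (rule m_level_pt)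
    show "(\<Sum>i=k..j. nblk j i) epowr (\<rho> / q) \<le> emeasure \<sigma> {s. 2 powr real_of_int k < m s}"
      using k t \<rho>_q N_nonneg[OF t(1)] by (simp add: nblk_tail N_gt \<sigma>_gt epowr_ennreal_pos)
  qed auto
  also have "\<dots> = (\<integral>\<^sup>+t. (\<Sum>k=a..j. ennreal (?c * 2 powr (\<rho> / p' * real_of_int k)) * indicator {s. 2 powr real_of_int k < m s} t) \<partial>\<sigma>)"
    by (subst nn_integral_sum) (auto simp: nn_integral_cmult)
  also have "\<dots> \<le> (\<integral>\<^sup>+t. ennreal ?C * ennreal (min (m x) (m t) powr (\<rho> / p')) \<partial>\<sigma>)"
  proof (intro nn_integral_mono_AE, use AE_\<sigma> in eventually_elim)
    fix t :: real assume t: "0 < t"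
    then obtain k0 where k0: "t \<in> m.blk k0" by (rule m.blk_ex)
    let ?J = "{k \<in> {a..j}. 2 powr real_of_int k < m t}"
    have sub: "?J \<subseteq> {..min k0 j}"
    proof
      fix k assume k: "k \<in> ?J"
      then have "2 powr real_of_int k < 2 powr real_of_int (k0 + 1)"
        using k0 unfolding m.blk_def mem_Collect_eq by linarith
      then have "real_of_int k < real_of_int (k0 + 1)" by (simp only: powr_less_cancel_iff one_less_numeral_iff semiring_norm)
      then show "k \<in> {..min k0 j}" using k by auto
    qed
    have d: "0 < \<rho> / p'" using \<rho>_pos p'1 by simp
    have "(\<Sum>k=a..j. ennreal (?c * 2 powr (\<rho> / p' * real_of_int k)) * indicator {s. 2 powr real_of_int k < m s} t)
      = (\<Sum>k\<in>?J. ennreal (?c * 2 powr (\<rho> / p' * real_of_int k)))"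
      by (intro sum.mono_neutral_cong_right) (auto split: split_indicator)
    also have "\<dots> = ennreal (?c * (\<Sum>k\<in>?J. 2 powr (\<rho> / p' * real_of_int k)))"
      by (simp add: sum_distrib_left)
    also have "\<dots> \<le> ennreal (?c * (2 powr (\<rho> / p' * real_of_int (min k0 j)) / (1 - 2 powr (- (\<rho> / p')))))"
      using sub d by (intro ennreal_leI mult_left_mono sum_geometric_below) (auto intro: finite_subset[of _ "{a..j}"])
    also have "\<dots> \<le> ennreal (?C * min (m x) (m t) powr (\<rho> / p'))"
    proof (intro ennreal_leI)
      have "2 powr real_of_int (min k0 j) \<le> min (m x) (m t)"
      proof (rule min.boundedI)
        have "2 powr real_of_int (min k0 j) \<le> 2 powr real_of_int j" "2 powr real_of_int (min k0 j) \<le> 2 powr real_of_int k0"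
          by simp_all
        then show "2 powr real_of_int (min k0 j) \<le> m x" "2 powr real_of_int (min k0 j) \<le> m t"
          using x k0 unfolding m.blk_def mem_Collect_eq by linarith+
      qed
      then have "(2 powr real_of_int (min k0 j)) powr (\<rho> / p') \<le> min (m x) (m t) powr (\<rho> / p')"
        using d by (intro powr_mono2) auto
      then have "2 powr (\<rho> / p' * real_of_int (min k0 j)) \<le> min (m x) (m t) powr (\<rho> / p')"
        by (simp add: powr_powr mult.commute)
      then have "?C * 2 powr (\<rho> / p' * real_of_int (min k0 j)) \<le> ?C * min (m x) (m t) powr (\<rho> / p')"
        using d by (intro mult_left_mono) (auto simp: powr_less_one less_imp_le)
      then show "?c * (2 powr (\<rho> / p' * real_of_int (min k0 j)) / (1 - 2 powr (- (\<rho> / p')))) \<le> ?C * min (m x) (m t) powr (\<rho> / p')"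
        by simp
    qed
    also have "\<dots> = ennreal ?C * ennreal (min (m x) (m t) powr (\<rho> / p'))"
      by (rule ennreal_mult'') simp
    finally show "(\<Sum>k=a..j. ennreal (?c * 2 powr (\<rho> / p' * real_of_int k)) * indicator {s. 2 powr real_of_int k < m s} t)
       \<le> ennreal ?C * ennreal (min (m x) (m t) powr (\<rho> / p'))" .
  qed
  also have "\<dots> = ennreal ?C * I x"
    unfolding I_def by (intro nn_integral_cmult) measurable
  finally show ?thesis .
qed

text \<open>Summation by parts: the increments of the weights are the weights themselves, up to the
  factor 1 - 1/e.\<close>

lemma Abel_geometric:
  fixes M :: "int \<Rightarrow> real" and e :: real
  assumes "1 < e" "a - 1 \<le> j"
  shows "(1 - 1 / e) * (\<Sum>k=a..j. e powr real_of_int k * M k)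
    = (\<Sum>k=a..j. e powr real_of_int k * (M k - M (k + 1))) + e powr real_of_int j * M (j + 1) - e powr real_of_int (a - 1) * M a"
  using assms(2)
proof (induction j rule: int_ge_induct)
  case (step j)
  have s1: "sum f {a..j + 1} = sum f {a..j} + f (j + 1)" for f :: "int \<Rightarrow> real"
    using step(1) by (intro sum_atLeastAtMost_Suc_int) simp
  have d1: "e powr real_of_int (j + 1) = e * e powr real_of_int j" using assms(1) by (simp add: powr_add)
  have d2: "(1 - 1 / e) * (e * e powr real_of_int j * M (j + 1)) = e * e powr real_of_int j * M (j + 1) - e powr real_of_int j * M (j + 1)"
    using assms(1) by (simp add: left_diff_distrib)
  show ?case unfolding s1 distrib_left step.IH d1 d2 by (simp add: algebra_simps)
qed simp

lemma I_SUP: "I x = (SUP n. \<integral>\<^sup>+t. ennreal (min (m x) (m t) powr (\<rho> / p')) * indicator {s. 2 powr real_of_int (j - int n) < m s} t \<partial>\<sigma>)"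
proof -
  have "I x = (\<integral>\<^sup>+t. (SUP n. ennreal (min (m x) (m t) powr (\<rho> / p')) * indicator {s. 2 powr real_of_int (j - int n) < m s} t) \<partial>\<sigma>)"
    unfolding I_def
  proof (intro nn_integral_cong_AE, use AE_\<sigma> in eventually_elim)
    fix t :: real assume "0 < t"
    then obtain k where k: "t \<in> m.blk k" by (rule m.blk_ex)
    have "2 powr real_of_int (j - int (nat (j - k))) \<le> 2 powr real_of_int k" by (intro powr_mono) auto
    then have "2 powr real_of_int (j - int (nat (j - k))) < m t" using k unfolding m.blk_def mem_Collect_eq by linarith
    then have "ennreal (min (m x) (m t) powr (\<rho> / p')) = ennreal (min (m x) (m t) powr (\<rho> / p')) * indicator {s. 2 powr real_of_int (j - int (nat (j - k))) < m s} t"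
      by (simp only: indicator_simps mem_Collect_eq mult_1_right)
    also have "\<dots> \<le> (SUP n. ennreal (min (m x) (m t) powr (\<rho> / p')) * indicator {s. 2 powr real_of_int (j - int n) < m s} t)"
      by (intro SUP_upper) auto
    finally show "ennreal (min (m x) (m t) powr (\<rho> / p')) = (SUP n. ennreal (min (m x) (m t) powr (\<rho> / p')) * indicator {s. 2 powr real_of_int (j - int n) < m s} t)"
      by (intro antisym SUP_least) (auto split: split_indicator)
  qed
  also have "\<dots> = (SUP n. \<integral>\<^sup>+t. ennreal (min (m x) (m t) powr (\<rho> / p')) * indicator {s. 2 powr real_of_int (j - int n) < m s} t \<partial>\<sigma>)"
  proof (intro nn_integral_monotone_convergence_SUP incseq_SucI le_funI mult_left_mono)
    fix n s
    have "2 powr real_of_int (j - int (Suc n)) \<le> 2 powr real_of_int (j - int n)" by (intro powr_mono) auto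
    then have "{s. 2 powr real_of_int (j - int n) < m s} \<subseteq> {s. 2 powr real_of_int (j - int (Suc n)) < m s}"
      by (auto simp only: mem_Collect_eq)
    then show "indicator {s. 2 powr real_of_int (j - int n) < m s} s \<le> (indicator {s. 2 powr real_of_int (j - int (Suc n)) < m s} s :: ennreal)"
      by (auto split: split_indicator)
  qed auto
  finally show ?thesis .
qed

text \<open>Restriction to finitely many blocks makes the integral finite. The coefficients are
  modelled on the equality case of Hoelder's inequality, so that testing returns a multiple of the
  truncated integral.\<close>

lemma Tint_lower:
  assumes x0: "0 < x" and \<kappa>: "\<kappa> < ennreal (m x powr (1 / p')) * Tint x"
  shows "\<exists>G\<in>borel_measurable borel. \<kappa> epowr q \<le> ennreal (2 powr (3 * q / p') * (\<rho> / q) * (1 / (1 - 2 powr (- (\<rho> / p')))) powr (q / p)) * (\<integral>\<^sup>+t. G t epowr q \<partial>\<nu>2) \<and>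
         (\<forall>y. 0 < y \<longrightarrow> y \<le> x \<longrightarrow> (\<exists>h\<in>borel_measurable borel. (\<forall>s\<ge>y. h s = 0) \<and> Lp UNIV h \<le> 1 \<and>
            (\<forall>t. ennreal ((m y / m x) powr (1 / p')) * G t \<le> F h t)))"
proof -
  define C1 where "C1 = 1 / (1 - 2 powr (- (\<rho> / p')))"
  define b where "b = \<rho> / q"
  define e where "e = 2 powr (\<rho> / p')"
  have d: "0 < \<rho> / p'" using \<rho>_pos p'1 by simp
  have C1: "0 < C1" using d by (simp add: C1_def powr_less_one)
  have e1: "1 < e" unfolding e_def using d by (simp add: gr_one_powr)
  have C1e: "C1 * (1 - 1 / e) = 1" using d \<rho>_pos p'1 unfolding C1_def e_def by (simp add: powr_minus_divide powr_less_one)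
  have ek: "e powr real_of_int k = 2 powr (\<rho> / p' * real_of_int k)" for k by (simp add: e_def powr_powr)
  obtain j where j: "x \<in> m.blk j" using x0 by (rule m.blk_ex)
  have "\<kappa> epowr \<rho> < I x"
  proof (rule ccontr)
    assume "\<not> \<kappa> epowr \<rho> < I x"
    then have "I x epowr (1 / \<rho>) \<le> \<kappa>" using epowr_mono[of "1/\<rho>" "I x" "\<kappa> epowr \<rho>"] \<rho>_pos by simp
    then show False using \<kappa> Kint[OF x0] by simp
  qed
  then obtain n where n: "\<kappa> epowr \<rho> < (\<integral>\<^sup>+t. ennreal (min (m x) (m t) powr (\<rho> / p')) * indicator {s. 2 powr real_of_int (j - int n) < m s} t \<partial>\<sigma>)"
    unfolding I_SUP[of x j] less_SUP_iff by auto
  define a where "a = j - int n"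
  have aj: "a \<le> j" by (simp add: a_def)
  define nn where "nn k = enn2real (nblk j k)" for k
  have nn: "nblk j k = ennreal (nn k)" "0 \<le> nn k" for k using nblk_finite[of j k] by (auto simp: nn_def)
  define Nk where "Nk k = (\<Sum>l=k..j. nn l)" for k
  have Nk0: "0 \<le> Nk k" for k unfolding Nk_def by (intro sum_nonneg nn)
  have NkS: "Nk k = nn k + Nk (k + 1)" if "k \<le> j" for k
  proof -
    have "{k..j} = insert k {k + 1..j}" using that by auto
    then show ?thesis by (simp add: Nk_def)
  qed
  have \<sigma>k: "emeasure \<sigma> {s. 2 powr real_of_int k < m s} = ennreal (Nk k powr b)" if k: "k \<le> j" for k
  proof -
    obtain t where t: "0 < t" "{s. 2 powr real_of_int k < m s} = {t<..}" by (rule m_level_pt)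
    have "ennreal (N t) = (\<Sum>i=k..j. nblk j i)" using k t by (simp add: nblk_tail N_gt)
    also have "\<dots> = ennreal (Nk k)" using nn by (simp add: Nk_def)
    finally have "N t = Nk k" using N_nonneg[OF t(1)] Nk0 by simp
    then show ?thesis using t by (simp add: \<sigma>_gt b_def)
  qed
  define s where "s k = Nk k powr b - Nk (k + 1) powr b" for k
  have s0: "0 \<le> s k" if "k \<le> j" for k
    unfolding s_def using NkS[OF that] nn(2)[of k] Nk0[of "k+1"] \<rho>_q by (simp add: b_def powr_mono2)
  have \<sigma>B: "emeasure \<sigma> (B j k) = ennreal (s k)" if k: "k \<le> j" for k
  proof (cases "k = j")
    case True
    then show ?thesis using \<sigma>k[of j] by (simp add: s_def Nk_def)
  next
    case False
    have "m.blk k = {s. 2 powr real_of_int k < m s} - {s. 2 powr real_of_int (k + 1) < m s}"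
      unfolding m.blk_def by auto
    also have "emeasure \<sigma> \<dots> = emeasure \<sigma> {s. 2 powr real_of_int k < m s} - emeasure \<sigma> {s. 2 powr real_of_int (k + 1) < m s}"
    proof (rule emeasure_Diff)
      have "2 powr real_of_int k \<le> 2 powr real_of_int (k + 1)" by simp
      then show "{s. 2 powr real_of_int (k + 1) < m s} \<subseteq> {s. 2 powr real_of_int k < m s}"
        by (intro Collect_mono) linarith
    qed (use \<sigma>k[of "k+1"] False k in auto)
    also have "\<dots> = ennreal (s k)" using \<sigma>k[of k] \<sigma>k[of "k + 1"] k False by (simp add: s_def ennreal_minus)
    finally show ?thesis using False by simp
  qed
  \<comment> \<open>With \<open>min (m x) (m t)\<close> replaced by its value at the left end of the
    block, \<open>S\<close> is the truncated integral up to the factor \<open>e\<close>.\<close>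
  define S where "S = (\<Sum>k=a..j. e powr real_of_int k * s k)"
  have "(\<integral>\<^sup>+t. ennreal (min (m x) (m t) powr (\<rho> / p')) * indicator {s. 2 powr real_of_int (j - int n) < m s} t \<partial>\<sigma>)
     \<le> (\<integral>\<^sup>+t. (\<Sum>k=a..j. ennreal (e * e powr real_of_int k) * indicator (B j k) t) \<partial>\<sigma>)"
  proof (intro nn_integral_mono)
    fix t
    show "ennreal (min (m x) (m t) powr (\<rho> / p')) * indicator {s. 2 powr real_of_int (j - int n) < m s} t \<le> (\<Sum>k=a..j. ennreal (e * e powr real_of_int k) * indicator (B j k) t)"
    proof (cases "2 powr real_of_int a < m t")
      case True
      then obtain k where k: "a \<le> k" "k \<le> j" "t \<in> B j k" using aj by (rule B_cover)
      have "min (m x) (m t) \<le> 2 powr real_of_int (k + 1)"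
        using j k by (auto simp: m.blk_def min_def split: if_splits)
      moreover have "0 < m t" using True powr_gt_zero[of 2 "real_of_int a"] by linarith
      ultimately have "min (m x) (m t) powr (\<rho> / p') \<le> (2 powr real_of_int (k + 1)) powr (\<rho> / p')"
        using d m.pos[OF x0] by (intro powr_mono2) auto
      also have "\<dots> = e * e powr real_of_int k"
        unfolding ek by (simp add: e_def powr_powr powr_add[symmetric] algebra_simps)
      finally have "ennreal (min (m x) (m t) powr (\<rho> / p')) * indicator {s. 2 powr real_of_int (j - int n) < m s} t \<le> ennreal (e * e powr real_of_int k) * indicator (B j k) t"
        using True k(3) by (simp add: a_def ennreal_leI del: if_split_mem2)
      also have "\<dots> \<le> (\<Sum>k=a..j. ennreal (e * e powr real_of_int k) * indicator (B j k) t)"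
        using k by (intro member_le_sum[of k "{a..j}" "\<lambda>k. ennreal (e * e powr real_of_int k) * indicator (B j k) t"]) auto
      finally show ?thesis .
    next
      case False
      then show ?thesis by (simp add: a_def)
    qed
  qed
  also have "\<dots> = (\<Sum>k=a..j. ennreal (e * e powr real_of_int k) * emeasure \<sigma> (B j k))"
    by (subst nn_integral_sum) (auto simp: nn_integral_cmult)
  also have "\<dots> = (\<Sum>k=a..j. ennreal (e * (e powr real_of_int k * s k)))"
    using e1 s0 by (intro sum.cong) (auto simp: \<sigma>B ennreal_mult' mult.assoc[symmetric] simp del: if_split_mem2)
  also have "\<dots> = ennreal (e * S)"
    using e1 s0 by (subst sum_ennreal) (auto simp: S_def sum_distrib_left)
  finally have \<kappa>S: "\<kappa> epowr \<rho> < ennreal (e * S)" using n by (rule less_le_trans[rotated])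
  then have "0 < e * S" by (metis ennreal_neg not_le not_less_zero)
  then have S0: "0 < S" using e1 by (simp add: zero_less_mult_iff)
  \<comment> \<open>The index moves by one because block i is completely integrated only from block
    i + 1 on. Division by \<open>C1 * S\<close> makes the sum of the p-th powers at most 1, by Abel
    summation.\<close>
  define \<alpha> where "\<alpha> i = (e powr real_of_int (i + 1) * Nk (i + 1) powr b / (C1 * S)) powr (1 / p)" for i
  have \<alpha>0: "0 \<le> \<alpha> i" for i by (simp add: \<alpha>_def)
  have X: "(\<Sum>k=a..j. e powr real_of_int k * Nk k powr b) \<le> C1 * S"
  proof -
    have "Nk (j + 1) powr b = 0" by (simp add: Nk_def)
    then have "(1 - 1 / e) * (\<Sum>k=a..j. e powr real_of_int k * Nk k powr b) \<le> S"
      using Abel_geometric[OF e1, of a j "\<lambda>k. Nk k powr b"] aj by (simp add: S_def s_def)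
    then have "C1 * ((1 - 1 / e) * (\<Sum>k=a..j. e powr real_of_int k * Nk k powr b)) \<le> C1 * S"
      using C1 by (intro mult_left_mono) auto
    then show ?thesis by (simp add: mult.assoc[symmetric] C1e)
  qed
  have sum1: "(\<Sum>i=a - 1..j - 1. \<alpha> i powr p) \<le> 1"
  proof -
    have "(\<Sum>i=a - 1..j - 1. \<alpha> i powr p) = (\<Sum>i=a - 1..j - 1. e powr real_of_int (i + 1) * Nk (i + 1) powr b / (C1 * S))"
      using p C1 S0 e1 by (intro sum.cong) (auto simp: \<alpha>_def powr_powr)
    also have "\<dots> = (\<Sum>k=a..j. e powr real_of_int k * Nk k powr b / (C1 * S))"
      by (rule sum.reindex_bij_witness[of _ "\<lambda>i. i - 1" "\<lambda>i. i + 1"]) auto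
    also have "\<dots> = (\<Sum>k=a..j. e powr real_of_int k * Nk k powr b) / (C1 * S)"
      by (rule sum_divide_distrib[symmetric])
    also have "\<dots> \<le> 1" using X C1 S0 by simp
    finally show ?thesis .
  qed
  obtain G where G: "G \<in> borel_measurable borel"
    "\<And>y. 0 < y \<Longrightarrow> y \<le> x \<Longrightarrow> \<exists>h\<in>borel_measurable borel. (\<forall>s\<ge>y. h s = 0) \<and> Lp UNIV h \<le> 1 \<and>
            (\<forall>t. ennreal ((m y / m x) powr (1 / p')) * G t \<le> F h t)"
    "\<And>l t. a - 1 \<le> l \<Longrightarrow> l < j \<Longrightarrow> 2 powr real_of_int (l + 1) < m t \<Longrightarrow> ennreal (2 powr (real_of_int (l - 1) / p') * \<alpha> l) \<le> G t"
    using step_lower[OF j \<alpha>0 sum1] by metis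
  note [measurable] = G(1)
  define g where "g k = (2 powr (real_of_int (k - 2) / p') * \<alpha> (k - 1)) powr q" for k
  define c where "c = 2 powr (- (2 * q / p')) * (C1 * S) powr (- (q / p))"
  have c0: "0 < c" using C1 S0 by (simp add: c_def)
  have gk: "g k = c * (e powr real_of_int k * Nk k powr (b - 1))" for k
  proof -
    have "g k = 2 powr (real_of_int (k - 2) / p' * q) * (e powr real_of_int k * Nk k powr b / (C1 * S)) powr (q / p)"
      using C1 S0 e1 by (simp add: g_def \<alpha>_def powr_mult powr_powr)
    also have "(e powr real_of_int k * Nk k powr b / (C1 * S)) powr (q / p)
       = e powr (real_of_int k * (q / p)) * Nk k powr (b * (q / p)) * (C1 * S) powr (- (q / p))"
      using C1 S0 e1 by (simp add: powr_divide powr_mult powr_powr powr_minus_divide)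
    also have "b * (q / p) = b - 1" using \<rho>_p q by (simp add: b_def)
    also have "2 powr (real_of_int (k - 2) / p' * q) * (e powr (real_of_int k * (q / p)) * Nk k powr (b - 1) * (C1 * S) powr (- (q / p)))
       = (2 powr (real_of_int (k - 2) / p' * q) * e powr (real_of_int k * (q / p))) * (Nk k powr (b - 1) * (C1 * S) powr (- (q / p)))" by simp
    also have "2 powr (real_of_int (k - 2) / p' * q) * e powr (real_of_int k * (q / p)) = 2 powr (- (2 * q / p')) * e powr real_of_int k"
    proof -
      have "real_of_int (k - 2) / p' * q + \<rho> / p' * (real_of_int k * (q / p)) = (real_of_int (k - 2) * q + real_of_int k * (\<rho> * q / p)) / p'"
        by (simp add: add_divide_distrib mult_ac)
      also have "\<dots> = - (2 * q / p') + \<rho> / p' * real_of_int k"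
        unfolding \<rho>qp by (simp add: add_divide_distrib[symmetric] diff_divide_distrib[symmetric] algebra_simps)
      finally show ?thesis by (simp add: ek e_def powr_powr powr_add[symmetric])
    qed
    finally show ?thesis by (simp add: c_def mult_ac)
  qed
  have "ennreal (c * (S / b)) \<le> ennreal (\<Sum>k=a..j. g k * nn k)"
  proof (intro ennreal_leI)
    \<comment> \<open>The mean value estimate d(N^b) \<le> b N^(b-1) dN turns \<sigma>-masses into
      \<nu>2-masses.\<close>
    have "s k \<le> b * (nn k * Nk k powr (b - 1))" if "k \<in> {a..j}" for k
      unfolding s_def using powr_diff_le[of "Nk (k + 1)" "Nk k" b] Nk0[of "k+1"] NkS[of k] nn(2)[of k] \<rho>_q that by (simp add: b_def mult.assoc)
    then have "S \<le> (\<Sum>k=a..j. e powr real_of_int k * (b * (nn k * Nk k powr (b - 1))))"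
      unfolding S_def by (intro sum_mono mult_left_mono) auto
    also have "\<dots> = b * (\<Sum>k=a..j. e powr real_of_int k * Nk k powr (b - 1) * nn k)"
      by (simp add: sum_distrib_left mult_ac)
    finally have "S \<le> b * (\<Sum>k=a..j. e powr real_of_int k * Nk k powr (b - 1) * nn k)" .
    then have "S / b \<le> (\<Sum>k=a..j. e powr real_of_int k * Nk k powr (b - 1) * nn k)"
    proof -
      have "0 < b" using \<rho>_pos q(1) by (simp add: b_def)
      then show ?thesis using \<open>S \<le> b * _\<close> by (simp only: pos_divide_le_eq mult.commute)
    qed
    then have "c * (S / b) \<le> c * (\<Sum>k=a..j. e powr real_of_int k * Nk k powr (b - 1) * nn k)"
      using c0 by (intro mult_left_mono) auto
    also have "\<dots> = (\<Sum>k=a..j. g k * nn k)" unfolding gk by (simp add: sum_distrib_left mult_ac)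
    finally show "c * (S / b) \<le> (\<Sum>k=a..j. g k * nn k)" .
  qed
  also have "\<dots> = (\<Sum>k=a..j. ennreal (g k) * nblk j k)"
    using nn by (simp add: g_def ennreal_mult flip: sum_ennreal)
  also have "\<dots> = (\<integral>\<^sup>+t. (\<Sum>k=a..j. ennreal (g k) * indicator (B j k) t) \<partial>\<nu>2)"
    unfolding nblk_def by (subst nn_integral_sum) (auto simp: nn_integral_cmult)
  also have "\<dots> \<le> (\<integral>\<^sup>+t. G t epowr q \<partial>\<nu>2)"
  proof (intro nn_integral_mono sum_B_le)
    fix t k assume k: "a \<le> k" "k \<le> j" "t \<in> B j k"
    then have "2 powr real_of_int (k - 1 + 1) < m t" by (auto simp: m.blk_def split: if_splits)
    then have "ennreal (2 powr (real_of_int (k - 1 - 1) / p') * \<alpha> (k - 1)) \<le> G t" using k by (intro G(3)) auto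
    then have "ennreal (2 powr (real_of_int (k - 1 - 1) / p') * \<alpha> (k - 1)) epowr q \<le> G t epowr q"
      using q by (intro epowr_mono) auto
    then show "ennreal (g k) \<le> G t epowr q" using q \<alpha>0 by (simp add: g_def epowr_ennreal_pos)
  qed
  finally have IG: "ennreal (c * (S / b)) \<le> (\<integral>\<^sup>+t. G t epowr q \<partial>\<nu>2)" .
  have "\<kappa> epowr q = (\<kappa> epowr \<rho>) epowr (q / \<rho>)" using \<rho>_pos by simp
  also have "\<dots> \<le> ennreal (e * S) epowr (q / \<rho>)"
    using \<kappa>S q \<rho>_pos by (intro epowr_mono) auto
  also have "\<dots> = ennreal (2 powr (q / p') * S powr (1 - q / p))"
    using S0 e1 \<rho>_pos by (simp add: epowr_ennreal powr_mult q\<rho>[symmetric]) (simp add: e_def powr_powr)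
  also have "2 powr (q / p') * S powr (1 - q / p) = (2 powr (3 * q / p') * b * C1 powr (q / p)) * (c * (S / b))"
  proof -
    have 1: "2 powr (3 * q / p') * 2 powr (- (2 * q / p')) = 2 powr (q / p')"
      by (simp add: powr_add[symmetric] add_divide_distrib[symmetric] diff_divide_distrib[symmetric])
    have 2: "S powr (1 - q / p) = S * S powr (- (q / p))"
      using S0 by (simp add: powr_diff powr_minus divide_inverse)
    have 3: "C1 powr (q / p) * (C1 * S) powr (- (q / p)) = S powr (- (q / p))"
      using C1 S0 by (simp add: powr_mult powr_minus)
    have 4: "b / b = 1" using \<rho>_pos q(1) by (simp add: b_def)
    have "(2 powr (3 * q / p') * b * C1 powr (q / p)) * (c * (S / b)) = (2 powr (3 * q / p') * 2 powr (- (2 * q / p'))) * (b / b) * S * (C1 powr (q / p) * (C1 * S) powr (- (q / p)))"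
      by (simp add: c_def)
    then show ?thesis unfolding 1 2 3 4 by (simp only: mult_1_right mult.assoc)
  qed
  also have "ennreal \<dots> = ennreal (2 powr (3 * q / p') * b * C1 powr (q / p)) * ennreal (c * (S / b))"
    using c0 S0 \<rho>_pos q(1) by (intro ennreal_mult) (auto simp: b_def)
  also have "\<dots> \<le> ennreal (2 powr (3 * q / p') * b * C1 powr (q / p)) * (\<integral>\<^sup>+t. G t epowr q \<partial>\<nu>2)"
    using IG by (rule mult_left_mono) simp
  finally show ?thesis using G(1,2) by (intro bexI[of _ G]) (auto simp: b_def C1_def)
qed

lemma cope_T_int:
  "cope_T m U N \<mu> \<nu>1 \<nu>2 p q \<theta> p' q' \<theta>' Tint
     (hardyC p q * (2 powr (\<rho> / q') / (1 - 2 powr (- (\<rho> / p')))) powr (q / \<rho>))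
     (2 powr (3 * q / p') * (\<rho> / q) * (1 / (1 - 2 powr (- (\<rho> / p')))) powr (q / p))"
proof (unfold_locales, goal_cases)
  case (1 x y)
  have m0: "0 < m x" "m x \<le> m y" using 1 m.pos monoD[OF m.mono] by auto
  have "(\<integral>\<^sup>+t. ennreal (min 1 (m t / m y) powr (\<rho> / p')) \<partial>\<sigma>) \<le> (\<integral>\<^sup>+t. ennreal (min 1 (m t / m x) powr (\<rho> / p')) \<partial>\<sigma>)"
  proof (intro nn_integral_mono_AE, use AE_\<sigma> in eventually_elim)
    fix t :: real assume "0 < t"
    then have "0 < m t" using m.pos by simp
    then have "m t / m y \<le> m t / m x" "0 \<le> m t / m y"
      using m0 by (auto intro!: divide_left_mono mult_pos_pos)
    then have "min 1 (m t / m y) \<le> min 1 (m t / m x)" "0 \<le> min 1 (m t / m y)"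
      by (simp_all add: min_le_iff_disj)
    then show "ennreal (min 1 (m t / m y) powr (\<rho> / p')) \<le> ennreal (min 1 (m t / m x) powr (\<rho> / p'))"
      using p'1 \<rho>_pos by (intro ennreal_leI powr_mono2) auto
  qed
  then show ?case unfolding Tint_def using \<rho>_pos by (intro epowr_mono) auto
next
  case (2 x y)
  have m0: "0 < m x" "m x \<le> m y" using 2 m.pos monoD[OF m.mono] by auto
  have "I x \<le> I y" unfolding I_def
  proof (intro nn_integral_mono_AE, use AE_\<sigma> in eventually_elim)
    fix t :: real assume "0 < t"
    then have "0 < m t" using m.pos by simp
    then show "ennreal (min (m x) (m t) powr (\<rho> / p')) \<le> ennreal (min (m y) (m t) powr (\<rho> / p'))"
      using p'1 \<rho>_pos m0 by (intro ennreal_leI powr_mono2) auto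
  qed
  then show ?case using 2 \<rho>_pos by (simp add: Kint epowr_mono)
next
  case (3 x)
  have mx: "0 < m x" using m.pos 3 by simp
  have "ennreal (N x powr (1 / q)) = (ennreal (N x powr (\<rho> / q))) epowr (1 / \<rho>)"
    using \<rho>_pos by (simp add: epowr_ennreal_pos powr_powr)
  also have "\<dots> = (\<integral>\<^sup>+t. indicator {x<..} t \<partial>\<sigma>) epowr (1 / \<rho>)" using 3 by (simp add: \<sigma>_gt)
  also have "\<dots> \<le> Tint x" unfolding Tint_def
  proof (intro epowr_mono nn_integral_mono)
    fix t
    have "min 1 (m t / m x) = 1" if "x < t" using that mx monoD[OF m.mono, of x t] by simp
    then show "indicator {x<..} t \<le> ennreal (min 1 (m t / m x) powr (\<rho> / p'))" by (auto split: split_indicator)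
  qed (use \<rho>_pos in auto)
  finally show ?case .
next
  case 4
  have "2 powr (- (\<rho> / p')) < 1" using \<rho>_pos p'1 by (simp add: powr_less_one)
  then show ?case unfolding hardyC_def using p(1) q(1) by (intro mult_pos_pos) auto
next
  case 5
  have "2 powr (- (\<rho> / p')) < 1" using \<rho>_pos p'1 by (simp add: powr_less_one)
  then show ?case using \<rho>_pos q(1) by (intro mult_pos_pos) auto
next
  case (6 h x)
  let ?C = "2 powr (\<rho> / q') / (1 - 2 powr (- (\<rho> / p')))"
  have C: "0 < ?C" using \<rho>_pos p'1 by (simp add: powr_less_one)
  obtain j where j: "x \<in> m.blk j" using m.blk_ex 6(2) by metis
  have "L h \<le> (ennreal (hardyC p q) * (ennreal ?C * I x) epowr (q / \<rho>)) * Lp UNIV h epowr (q / p)"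
  proof (rule block_upper[OF 6(1) j 6(3)])
    fix a A
    show "(\<Sum>k=a..j. nblk j k * (\<Sum>i=a..k. ennreal (2 powr (real_of_int i / p')) * A i) epowr q)
        \<le> ennreal (hardyC p q) * (ennreal ?C * I x) epowr (q / \<rho>) * (\<Sum>i=a..j. A i epowr p) epowr (q / p)"
      using Tint_upper_block[OF j] p q qp \<rho> nblk_finite by (intro hardy_upper_gt[where s' = p' and q' = q']) auto
  qed auto
  also have "(ennreal ?C * I x) epowr (q / \<rho>) = ennreal (?C powr (q / \<rho>)) * (I x epowr (1 / \<rho>)) epowr q"
    using q \<rho>_pos C by (subst epowr_mult) (auto simp: epowr_ennreal)
  also have "I x epowr (1 / \<rho>) = ennreal (m x powr (1 / p')) * Tint x" using Kint[OF 6(2)] by simp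
  also have "ennreal (hardyC p q) * (ennreal (?C powr (q / \<rho>)) * (ennreal (m x powr (1 / p')) * Tint x) epowr q)
    = ennreal (hardyC p q * ?C powr (q / \<rho>)) * (ennreal (m x powr (1 / p')) * Tint x) epowr q"
    by (simp add: ennreal_mult'' mult.assoc)
  finally show ?case .
next
  case (7 x \<kappa>)
  then show ?case by (rule Tint_lower)
qed

end

section \<open>Upper bounds\<close>

text \<open>
  \<open>\<beta>\<close> is the measure \<open>d(-U\<^bsup>1-\<theta>'\<^esup>)\<close> and \<open>e\<close> the limit of \<open>U\<^bsup>1-\<theta>'\<^esup>\<close> at \<open>\<infinity>\<close>, which vanishes iff \<open>U\<close> is unbounded.
\<close>

locale cope_beta = cope_T m U N \<mu> \<nu>1 \<nu>2 p q \<theta> p' q' \<theta>' T Cu Cl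
  for m U N \<mu> \<nu>1 \<nu>2 p q \<theta> p' q' \<theta>' T Cu Cl +
  fixes \<beta> :: "real measure" and e :: real
  assumes sets_\<beta> [measurable_cong, simp]: "sets \<beta> = sets borel"
    and \<beta>_neg: "emeasure \<beta> {..0} = 0"
    and \<beta>_gt: "\<And>x. 0 < x \<Longrightarrow> emeasure \<beta> {x<..} = ennreal (U x powr (1 - \<theta>') - e)"
    and e_nonneg: "0 \<le> e" and e_le: "\<And>x. 0 < x \<Longrightarrow> e \<le> U x powr (1 - \<theta>')"
    and e_top: "\<And>c. 0 < c \<Longrightarrow> (\<And>x. U x \<le> c) \<Longrightarrow> c powr (1 - \<theta>') \<le> e"
begin

definition K :: "real \<Rightarrow> ennreal" where "K x = ennreal (m x powr (1 / p')) * T x"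
definition \<Psi> :: "real \<Rightarrow> ennreal" where "\<Psi> x = (\<integral>\<^sup>+t. ennreal (min (m x) (m t) powr (\<theta>' / p')) \<partial>\<beta>)"
definition \<phi> :: "real \<Rightarrow> ennreal" where "\<phi> x = \<Psi> x epowr (1 / \<theta>')"
definition Kinf :: ennreal where "Kinf = (SUP x\<in>{0<..}. K x)"
definition B2 :: ennreal where "B2 = ennreal (e powr (1 / \<theta>')) * Kinf"

lemma K_mono: "0 < x \<Longrightarrow> x \<le> y \<Longrightarrow> K x \<le> K y"
  unfolding K_def by (rule K_mono')

lemma K_le_Kinf: "0 < x \<Longrightarrow> K x \<le> Kinf"
  unfolding Kinf_def by (intro SUP_upper) auto

lemma \<theta>_exps: "(1 - \<theta>') * (1 / \<theta>') = - (1 / \<theta>)" "\<theta>' / \<theta> = \<theta>' - 1" "0 < \<theta>'" "0 < \<theta>' / p'"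
proof -
  have "1 / \<theta> = 1 - 1 / \<theta>'" using \<theta> by linarith
  then show "(1 - \<theta>') * (1 / \<theta>') = - (1 / \<theta>)" using \<theta>'1 by (simp add: diff_divide_distrib)
  show "\<theta>' / \<theta> = \<theta>' - 1" by (rule conj_exp(4)[OF \<theta>])
  show "0 < \<theta>'" "0 < \<theta>' / p'" using \<theta>'1 p'1 by auto
qed

lemma AE_\<beta>: "AE t in \<beta>. 0 < t"
  using \<beta>_neg by (intro AE_I[of _ _ "{..0}"]) auto

text \<open>If \<open>U\<close> is bounded, its blocks are empty from some index on.
  \<open>live k\<close> means that block k is not empty; \<open>live (k + 1)\<close> guarantees that
  block k ends at the level point \<open>\<tau> (k + 1)\<close> and has its full
  \<nu>1-mass.\<close>

definition live :: "int \<Rightarrow> bool" where "live k \<longleftrightarrow> (\<exists>x. 2 powr real_of_int k < U x)"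

definition \<tau> :: "int \<Rightarrow> real" where
  "\<tau> k = (SOME t. 0 < t \<and> U t = 2 powr real_of_int k \<and> (\<forall>s. 2 powr real_of_int k < U s \<longleftrightarrow> t < s))"

lemma \<tau>: assumes "live k"
  shows "0 < \<tau> k" "U (\<tau> k) = 2 powr real_of_int k" "2 powr real_of_int k < U s \<longleftrightarrow> \<tau> k < s"
proof -
  obtain x where x: "2 powr real_of_int k < U x" using assms by (auto simp: live_def)
  have "\<exists>t. 0 < t \<and> U t = 2 powr real_of_int k \<and> (\<forall>s. 2 powr real_of_int k < U s \<longleftrightarrow> t < s)"
    by (rule U.level[OF _ x]) auto
  from someI_ex[OF this] show "0 < \<tau> k" "U (\<tau> k) = 2 powr real_of_int k" "2 powr real_of_int k < U s \<longleftrightarrow> \<tau> k < s"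
    unfolding \<tau>_def by blast+
qed

lemma live_mono: "live k \<Longrightarrow> i \<le> k \<Longrightarrow> live i"
proof -
  assume "live k" "i \<le> k"
  then obtain x where "2 powr real_of_int k < U x" by (auto simp: live_def)
  moreover have "2 powr real_of_int i \<le> 2 powr real_of_int k" using \<open>i \<le> k\<close> by simp
  ultimately have "2 powr real_of_int i < U x" by linarith
  then show "live i" by (auto simp: live_def)
qed

lemma dead_blk: "\<not> live k \<Longrightarrow> U.blk k = {}"
  by (auto simp: live_def U.blk_def)

lemma dead_B: "\<not> live k \<Longrightarrow> {s. 2 powr real_of_int k < U s} = {}"
  by (auto simp: live_def)

lemma live_B: "live k \<Longrightarrow> {s. 2 powr real_of_int k < U s} = {\<tau> k<..}"
  using \<tau>(3) by auto

lemma \<tau>_mono: "live k \<Longrightarrow> i \<le> k \<Longrightarrow> \<tau> i \<le> \<tau> k"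
proof -
  assume k: "live k" "i \<le> k"
  have "2 powr real_of_int i \<le> 2 powr real_of_int k" using k by simp
  then have "\<not> 2 powr real_of_int k < U (\<tau> i)" using \<tau>(2)[OF live_mono[OF k]] by linarith
  then show ?thesis using \<tau>(3)[OF k(1), of "\<tau> i"] by simp
qed

lemma blk_live: assumes "live (k + 1)" shows "U.blk k = {\<tau> k<..} - {\<tau> (k + 1)<..}"
proof (rule set_eqI)
  fix x
  have k: "live k" using live_mono[OF assms] by simp
  show "x \<in> U.blk k \<longleftrightarrow> x \<in> {\<tau> k<..} - {\<tau> (k + 1)<..}"
    unfolding U.blk_def mem_Collect_eq Diff_iff greaterThan_iff \<tau>(3)[OF k, symmetric] \<tau>(3)[OF assms, symmetric] by linarith
qed

lemma blk_bounds: "live (k + 1) \<Longrightarrow> t \<in> U.blk k \<Longrightarrow> \<tau> k < t \<and> t \<le> \<tau> (k + 1)"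
  using blk_live[of k] by auto

lemma \<nu>1_blk: assumes "live (k + 1)" shows "emeasure \<nu>1 (U.blk k) = ennreal (2 powr real_of_int k)"
proof -
  have k: "live k" using live_mono[OF assms] by simp
  have "U.blk k = {..\<tau> (k + 1)} - {..\<tau> k}" unfolding blk_live[OF assms] by auto
  also have "emeasure \<nu>1 \<dots> = emeasure \<nu>1 {..\<tau> (k + 1)} - emeasure \<nu>1 {..\<tau> k}"
    using \<tau>_mono[OF assms, of k] by (intro emeasure_Diff) (auto simp: U_le)
  also have "\<dots> = ennreal (2 powr real_of_int (k + 1) - 2 powr real_of_int k)"
    using \<tau>(2)[OF assms] \<tau>(2)[OF k] by (simp add: U_le ennreal_minus)
  finally show ?thesis by (simp add: powr_add)
qed

text \<open>The relative drop of \<open>U powr (1 - \<theta>')\<close> when \<open>U\<close>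
  doubles.\<close>

definition c0 :: real where "c0 = 1 - 2 powr (1 - \<theta>')"

lemma c0_pos: "0 < c0" unfolding c0_def using \<theta>'1 by (simp add: powr_less_one)

lemma \<beta>_blk: assumes "live (k + 1)"
  shows "emeasure \<beta> (U.blk k) = ennreal (c0 * 2 powr (real_of_int k * (1 - \<theta>')))"
proof -
  have k: "live k" using live_mono[OF assms] by simp
  have "emeasure \<beta> (U.blk k) = emeasure \<beta> {\<tau> k<..} - emeasure \<beta> {\<tau> (k + 1)<..}"
    unfolding blk_live[OF assms] using \<tau>_mono[OF assms, of k] \<tau>(1)[OF assms] by (intro emeasure_Diff) (auto simp: \<beta>_gt)
  also have "\<dots> = ennreal ((U (\<tau> k) powr (1 - \<theta>') - e) - (U (\<tau> (k + 1)) powr (1 - \<theta>') - e))"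
    using \<tau>(1)[OF assms] \<tau>(1)[OF k] e_le[of "\<tau> (k + 1)"] by (simp add: \<beta>_gt ennreal_minus)
  also have "(U (\<tau> k) powr (1 - \<theta>') - e) - (U (\<tau> (k + 1)) powr (1 - \<theta>') - e) = c0 * 2 powr (real_of_int k * (1 - \<theta>'))"
  proof -
    have e: "real_of_int (k + 1) * (1 - \<theta>') = (1 - \<theta>') + real_of_int k * (1 - \<theta>')" by (simp add: algebra_simps)
    show ?thesis unfolding \<tau>(2)[OF assms] \<tau>(2)[OF k] powr_powr e powr_add c0_def by (simp only: left_diff_distrib mult_1)
  qed
  finally show ?thesis .
qed

text \<open>For t in block k - 1 the tail integral \<open>\<Phi> h t\<close> contains all of block
  k, and if block k is not empty, then block k - 1 has \<nu>1-mass \<open>2 powr (k - 1)\<close>.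
  This halving is the factor 2.\<close>

lemma sum_D_le:
  assumes [measurable]: "h \<in> borel_measurable \<mu>"
  shows "(\<Sum>k=a..b. ennreal (2 powr real_of_int k) * Lp (U.blk k) h epowr (\<theta> / p)) \<le> 2 * D h"
proof -
  define c where "c k = Lp (U.blk (k + 1)) h epowr (\<theta> / p)" for k
  have pt: "(\<Sum>k=a - 1..b - 1. c k * indicator (U.blk k) t) \<le> \<Phi> h t epowr (\<theta> / p)" for t
  proof (cases "0 < t")
    case True
    then obtain k where k: "t \<in> U.blk k" by (rule U.blk_ex)
    have "Lp (U.blk (k + 1)) h \<le> \<Phi> h t"
      unfolding Lp_def \<Phi>_def
    proof (intro nn_integral_mono mult_left_mono)
      fix s
      have "t < s" if "s \<in> U.blk (k + 1)"
        using that k U.blk_le[of s "k + 1" t k] by (cases "t < s") auto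
      then show "indicator (U.blk (k + 1)) s \<le> (indicator {t<..} s :: ennreal)" by (auto split: split_indicator)
    qed auto
    then have "c k \<le> \<Phi> h t epowr (\<theta> / p)" unfolding c_def using \<theta> p by (intro epowr_mono) auto
    then show ?thesis by (subst U.sum_blk[OF _ k]) auto
  next
    case False
    then show ?thesis by (subst U.sum_blk_nonpos) auto
  qed
  have "(\<Sum>k=a..b. ennreal (2 powr real_of_int k) * Lp (U.blk k) h epowr (\<theta> / p))
    \<le> (\<Sum>k=a..b. 2 * (c (k - 1) * emeasure \<nu>1 (U.blk (k - 1))))"
  proof (intro sum_mono)
    fix k
    show "ennreal (2 powr real_of_int k) * Lp (U.blk k) h epowr (\<theta> / p) \<le> 2 * (c (k - 1) * emeasure \<nu>1 (U.blk (k - 1)))"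
    proof (cases "live k")
      case True
      have "ennreal (2 powr real_of_int k) = 2 * ennreal (2 powr real_of_int (k - 1))"
        by (simp add: powr_diff ennreal_mult''[symmetric] flip: ennreal_numeral)
      then show ?thesis using True \<nu>1_blk[of "k - 1"] by (simp add: c_def mult_ac)
    next
      case False
      then show ?thesis using \<theta> p by (simp add: dead_blk Lp_def)
    qed
  qed
  also have "\<dots> = 2 * (\<Sum>k=a - 1..b - 1. c k * emeasure \<nu>1 (U.blk k))"
    unfolding sum_distrib_left[symmetric]
    by (intro arg_cong[of _ _ "\<lambda>x. 2 * x"] sum.reindex_bij_witness[of _ "\<lambda>i. i + 1" "\<lambda>i. i - 1"]) auto
  also have "(\<Sum>k=a - 1..b - 1. c k * emeasure \<nu>1 (U.blk k)) = (\<integral>\<^sup>+t. (\<Sum>k=a - 1..b - 1. c k * indicator (U.blk k) t) \<partial>\<nu>1)"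
    by (subst nn_integral_sum) (auto simp: nn_integral_cmult)
  also have "\<dots> \<le> D h"
    unfolding D_def by (intro nn_integral_mono pt)
  finally show ?thesis by (simp add: mult_left_mono)
qed

lemma Lp_indicator: "Lp UNIV (\<lambda>s. h s * indicator A s) = Lp A h"
  unfolding Lp_def using p by (intro nn_integral_cong) (auto split: split_indicator)

text \<open>Serves the last block of a bounded \<open>U\<close>, where the support of
  \<open>h\<close> may be unbounded; it is exhausted by initial intervals.\<close>

lemma upper_Kinf:
  assumes [measurable]: "h \<in> borel_measurable \<mu>"
  shows "L h \<le> ennreal Cu * Kinf epowr q * Lp UNIV h epowr (q / p)"
proof (rule L_le_SUP[of "\<lambda>n s. h s * indicator {..real n + 1} s"])
  show "incseq (\<lambda>n s. h s * indicator {..real n + 1} s)"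
    by (intro incseq_SucI le_funI mult_left_mono) (auto split: split_indicator)
  fix n
  have "L (\<lambda>s. h s * indicator {..real n + 1} s) \<le> ennreal Cu * K (real n + 1) epowr q * Lp UNIV (\<lambda>s. h s * indicator {..real n + 1} s) epowr (q / p)"
    unfolding K_def by (intro upper) auto
  also have "\<dots> \<le> ennreal Cu * Kinf epowr q * Lp UNIV h epowr (q / p)"
    using p q by (intro mult_mono epowr_mono K_le_Kinf) (auto simp: Lp_def split: split_indicator intro!: nn_integral_mono epowr_mono)
  finally show "L (\<lambda>s. h s * indicator {..real n + 1} s) \<le> ennreal Cu * Kinf epowr q * Lp UNIV h epowr (q / p)" .
next
  fix s :: real assume "0 < s"
  have "h s = h s * indicator {..real (nat \<lceil>s\<rceil>) + 1} s"
    using real_nat_ceiling_ge[of s] by (simp add: add_increasing2)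
  also have "\<dots> \<le> (SUP n. h s * indicator {..real n + 1} s)" by (rule SUP_upper) simp
  finally show "h s \<le> (SUP n. h s * indicator {..real n + 1} s)" .
qed auto

text \<open>The Hardy constant of the initial interval that ends with block k. A last block has no
  right end point, so the supremum takes its place.\<close>

definition \<kappa> :: "int \<Rightarrow> ennreal" where
  "\<kappa> k = (if live (k + 1) then K (\<tau> (k + 1)) else Kinf)"

lemma \<kappa>_le_Kinf: "\<kappa> k \<le> Kinf"
  unfolding \<kappa>_def using K_le_Kinf \<tau>(1) by auto

lemma upper_block:
  assumes [measurable]: "h \<in> borel_measurable \<mu>"
  shows "L (\<lambda>s. h s * indicator (U.blk (k - 1) \<union> U.blk k) s)
    \<le> ennreal Cu * \<kappa> k epowr q * (Lp (U.blk (k - 1)) h + Lp (U.blk k) h) epowr (q / p)"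
proof -
  have "Lp (U.blk (k - 1) \<union> U.blk k) h = (\<integral>\<^sup>+s. h s epowr p * indicator (U.blk (k - 1)) s + h s epowr p * indicator (U.blk k) s \<partial>\<mu>)"
    unfolding Lp_def
  proof (intro nn_integral_cong)
    fix s
    have "\<not> (s \<in> U.blk (k - 1) \<and> s \<in> U.blk k)" using U.blk_unique[of s "k - 1" k] by auto
    then show "h s epowr p * indicator (U.blk (k - 1) \<union> U.blk k) s = h s epowr p * indicator (U.blk (k - 1)) s + h s epowr p * indicator (U.blk k) s"
      by (auto split: split_indicator)
  qed
  also have "\<dots> = Lp (U.blk (k - 1)) h + Lp (U.blk k) h"
    unfolding Lp_def by (intro nn_integral_add) auto
  finally have Lp: "Lp UNIV (\<lambda>s. h s * indicator (U.blk (k - 1) \<union> U.blk k) s) = Lp (U.blk (k - 1)) h + Lp (U.blk k) h"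
    by (simp add: Lp_indicator)
  show ?thesis
  proof (cases "live (k + 1)")
    case True
    have "L (\<lambda>s. h s * indicator (U.blk (k - 1) \<union> U.blk k) s)
      \<le> ennreal Cu * K (\<tau> (k + 1)) epowr q * Lp UNIV (\<lambda>s. h s * indicator (U.blk (k - 1) \<union> U.blk k) s) epowr (q / p)"
      unfolding K_def
    proof (intro upper)
      fix s assume s: "\<tau> (k + 1) < s"
      have "2 powr real_of_int (k - 1 + 1) \<le> 2 powr real_of_int (k + 1)" by simp
      moreover have "2 powr real_of_int (k + 1) < U s" using s \<tau>(3)[OF True, of s] by blast
      ultimately have "s \<notin> U.blk k" "s \<notin> U.blk (k - 1)"
        unfolding U.blk_def mem_Collect_eq by linarith+
      then show "h s * indicator (U.blk (k - 1) \<union> U.blk k) s = 0" by simp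
    qed (use \<tau>(1)[OF True] in auto)
    then show ?thesis using True by (simp add: Lp \<kappa>_def)
  next
    case False
    have "L (\<lambda>s. h s * indicator (U.blk (k - 1) \<union> U.blk k) s)
      \<le> ennreal Cu * Kinf epowr q * Lp UNIV (\<lambda>s. h s * indicator (U.blk (k - 1) \<union> U.blk k) s) epowr (q / p)"
      by (rule upper_Kinf) measurable
    then show ?thesis using False by (simp add: Lp \<kappa>_def)
  qed
qed

text \<open>\<open>m powr (1 / p')\<close> is Hoelder's factor for block i, and
  \<open>2 powr (- i / \<theta>)\<close> undoes the normalisation of \<open>d\<close> in
  \<open>upper_core\<close>. The value 1 where the end point is missing keeps the weights positive,
  as the discrete inequality demands.\<close>

definition wgt :: "int \<Rightarrow> real" where
  "wgt i = 2 powr (- (real_of_int i / \<theta>)) * (if live (i + 1) then m (\<tau> (i + 1)) powr (1 / p') else 1)"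

lemma wgt_pos: "0 < wgt i"
  using m.pos[OF \<tau>(1), of "i + 1"] by (auto simp: wgt_def)

lemma int_Ublk_le:
  assumes [measurable]: "h \<in> borel_measurable \<mu>" and live: "live (i + 1)"
  shows "(\<integral>\<^sup>+s\<in>U.blk i. h s \<partial>\<mu>) \<le> ennreal (wgt i) * (ennreal (2 powr (real_of_int i / \<theta>)) * Lp (U.blk i) h epowr (1 / p))"
proof -
  have "(\<integral>\<^sup>+s\<in>U.blk i. h s \<partial>\<mu>) = (\<integral>\<^sup>+s. (h s * indicator (U.blk i) s) * indicator (U.blk i) s \<partial>\<mu>)"
    by (intro nn_integral_cong) (auto split: split_indicator)
  also have "\<dots> \<le> (\<integral>\<^sup>+s. (h s * indicator (U.blk i) s) epowr p \<partial>\<mu>) epowr (1 / p) * (\<integral>\<^sup>+s. indicator (U.blk i) s epowr p' \<partial>\<mu>) epowr (1 / p')"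
    using p by (intro nn_integral_Hoelder) auto
  also have "(\<integral>\<^sup>+s. (h s * indicator (U.blk i) s) epowr p \<partial>\<mu>) = Lp (U.blk i) h"
    using Lp_indicator[of h] by (simp add: Lp_def)
  finally have 1: "(\<integral>\<^sup>+s\<in>U.blk i. h s \<partial>\<mu>) \<le> Lp (U.blk i) h epowr (1 / p) * (\<integral>\<^sup>+s. indicator (U.blk i) s epowr p' \<partial>\<mu>) epowr (1 / p')" .
  have "(\<integral>\<^sup>+s. indicator (U.blk i) s epowr p' \<partial>\<mu>) = (\<integral>\<^sup>+s. indicator (U.blk i) s \<partial>\<mu>)"
    using p'1 by (intro nn_integral_cong) (auto split: split_indicator)
  also have "\<dots> = emeasure \<mu> (U.blk i)" by simp
  also have "\<dots> \<le> emeasure \<mu> {..\<tau> (i + 1)}"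
  proof (rule emeasure_mono)
    show "U.blk i \<subseteq> {..\<tau> (i + 1)}" unfolding blk_live[OF live] by (simp add: subset_iff)
  qed simp
  also have "\<dots> = ennreal (m (\<tau> (i + 1)))" by (simp add: m_le)
  finally have 2: "(\<integral>\<^sup>+s. indicator (U.blk i) s epowr p' \<partial>\<mu>) \<le> ennreal (m (\<tau> (i + 1)))" .
  have "(\<integral>\<^sup>+s\<in>U.blk i. h s \<partial>\<mu>) \<le> Lp (U.blk i) h epowr (1 / p) * ennreal (m (\<tau> (i + 1))) epowr (1 / p')"
    using p'1 by (intro order.trans[OF 1] mult_left_mono epowr_mono 2) auto
  also have "\<dots> = ennreal (wgt i) * (ennreal (2 powr (real_of_int i / \<theta>)) * Lp (U.blk i) h epowr (1 / p))"
  proof -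
    have "wgt i * 2 powr (real_of_int i / \<theta>) = m (\<tau> (i + 1)) powr (1 / p')"
      using live by (simp add: wgt_def powr_minus)
    then have "ennreal (wgt i) * ennreal (2 powr (real_of_int i / \<theta>)) = ennreal (m (\<tau> (i + 1)) powr (1 / p'))"
      by (simp add: ennreal_mult''[symmetric])
    then show ?thesis using p'1 m.pos[OF \<tau>(1)[OF live]] by (simp add: epowr_ennreal mult.assoc[symmetric] mult.commute)
  qed
  finally show ?thesis .
qed

abbreviation "BU b k \<equiv> (if k = b then {s. 2 powr real_of_int k < U s} else U.blk k)"

text \<open>The shift by two: for t in block k + 2, the blocks i \<le> k are those before the two
  local ones. The index b takes the whole tail, since the truncated function vanishes beyond block
  b.\<close>

definition nU :: "int \<Rightarrow> int \<Rightarrow> ennreal" where "nU b k = emeasure \<nu>2 (BU b (k + 2))"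

lemma nU_tail:
  assumes "k \<le> b - 2"
  shows "(\<Sum>i=k..b - 2. nU b i) = emeasure \<nu>2 {s. 2 powr real_of_int (k + 2) < U s}"
proof -
  have "(\<Sum>i=k..b - 2. nU b i) = emeasure \<nu>2 (\<Union>i\<in>{k..b - 2}. BU b (i + 2))"
    unfolding nU_def
  proof (rule sum_emeasure)
    have "BU b (i + 2) \<inter> BU b (l + 2) = {}" if "i < l" "l \<le> b - 2" for i l
    proof -
      have le: "2 powr real_of_int (i + 2 + 1) \<le> 2 powr real_of_int (l + 2)" using that by (intro powr_mono) auto
      have False if "t \<in> BU b (i + 2)" "t \<in> BU b (l + 2)" for t
      proof -
        have "U t \<le> 2 powr real_of_int (i + 2 + 1)" "2 powr real_of_int (l + 2) < U t"
          using that \<open>i < l\<close> \<open>l \<le> b - 2\<close> by (auto simp: U.blk_def split: if_splits)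
        then show False using le by linarith
      qed
      then show ?thesis by blast
    qed
    then show "disjoint_family_on (\<lambda>i. BU b (i + 2)) {k..b - 2}"
      unfolding disjoint_family_on_def by (metis Int_commute atLeastAtMost_iff linorder_neqE)
  qed auto
  also have "(\<Union>i\<in>{k..b - 2}. BU b (i + 2)) = {s. 2 powr real_of_int (k + 2) < U s}"
  proof (intro equalityI subsetI)
    fix s assume "s \<in> (\<Union>i\<in>{k..b - 2}. BU b (i + 2))"
    then obtain i where i: "k \<le> i" "2 powr real_of_int (i + 2) < U s" by (auto simp: U.blk_def split: if_splits)
    have "2 powr real_of_int (k + 2) \<le> 2 powr real_of_int (i + 2)" using i by (intro powr_mono) auto
    then show "s \<in> {s. 2 powr real_of_int (k + 2) < U s}" using i unfolding mem_Collect_eq by linarith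
  next
    fix s assume s: "s \<in> {s. 2 powr real_of_int (k + 2) < U s}"
    show "s \<in> (\<Union>i\<in>{k..b - 2}. BU b (i + 2))"
    proof (cases "2 powr real_of_int b < U s")
      case True then show ?thesis using assms by (intro UN_I[of "b - 2"]) auto
    next
      case False
      then have "U s \<le> 2 powr real_of_int ((b - 1) + 1)" by simp
      then obtain i where "k + 2 \<le> i" "i \<le> b - 1" "s \<in> U.blk i" using U.blk_window s by blast
      then show ?thesis by (intro UN_I[of "i - 2"]) auto
    qed
  qed
  finally show ?thesis .
qed

lemma nU_finite: "nU b k < top"
proof -
  have "nU b k \<le> emeasure \<nu>2 {s. 2 powr real_of_int (k + 2) < U s}"
    unfolding nU_def by (intro emeasure_mono) (auto simp: U.blk_def)
  also have "\<dots> < top"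
  proof (cases "live (k + 2)")
    case True
    show ?thesis unfolding live_B[OF True] N_gt[OF \<tau>(1)[OF True]] by simp
  next
    case False
    show ?thesis unfolding dead_B[OF False] by simp
  qed
  finally show ?thesis .
qed

text \<open>On block k, \<open>F h\<close> is split into the contribution of the blocks k - 1 and k,
  bounded by \<open>upper_block\<close>, and that of the earlier blocks. \<open>Hin\<close> and
  \<open>Hcr\<close> are the two discrete inequalities left over, to be supplied separately for
  \<theta> \<le> q and q < \<theta>.\<close>

lemma upper_core:
  assumes [measurable]: "h \<in> borel_measurable \<mu>"
    and Hin: "\<And>a b d. (\<Sum>k\<in>{k\<in>{a..b}. live k}. (\<kappa> k * ennreal (2 powr (- (real_of_int k / \<theta>)))) epowr q * d k epowr q)
        \<le> Z1 * (\<Sum>k=a..b. d k epowr \<theta>) epowr (q / \<theta>)"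
    and Hcr: "\<And>a b d. (\<Sum>k=a..b - 2. nU b k * (\<Sum>i=a..k. ennreal (wgt i) * d i) epowr q)
        \<le> Z2 * (\<Sum>k=a..b - 2. d k epowr \<theta>) epowr (q / \<theta>)"
  shows "L h \<le> ennreal (2 powr q) * (ennreal (Cu * 2 powr (q / p) * (1 + 2 powr (q / \<theta>))) * Z1 + Z2) * (2 * D h) epowr (q / \<theta>)"
proof -
  define A where "A k = Lp (U.blk k) h epowr (1 / p)" for k
  define d where "d k = ennreal (2 powr (real_of_int k / \<theta>)) * A k" for k
  define X where "X i = (\<integral>\<^sup>+s\<in>U.blk i. h s \<partial>\<mu>)" for i
  have d\<theta>: "d k epowr \<theta> = ennreal (2 powr real_of_int k) * Lp (U.blk k) h epowr (\<theta> / p)" for k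
    using \<theta> by (simp add: d_def A_def epowr_mult epowr_ennreal powr_powr)
  have dD: "(\<Sum>k=a..b. d k epowr \<theta>) epowr (q / \<theta>) \<le> (2 * D h) epowr (q / \<theta>)" for a b
    unfolding d\<theta> using q \<theta> by (intro epowr_mono sum_D_le) auto
  define g where "g n s = h s * indicator {s. 2 powr real_of_int (- int n) < U s \<and> U s \<le> 2 powr real_of_int (int n + 1)} s" for n s
  have [measurable]: "g n \<in> borel_measurable \<mu>" for n unfolding g_def by measurable
  let ?R = "ennreal (2 powr q) * (ennreal (Cu * 2 powr (q / p) * (1 + 2 powr (q / \<theta>))) * Z1 + Z2) * (2 * D h) epowr (q / \<theta>)"
  have gn: "L (g n) \<le> ?R" for n
  proof -
    define a where "a = - int n"
    define b where "b = int n"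
    have ab: "a \<le> b" by (simp add: a_def b_def)
    let ?I = "{k\<in>{a..b}. live k}"
    let ?H = "\<lambda>k s. h s * indicator (U.blk (k - 1) \<union> U.blk k) s"
    let ?G = "\<lambda>k t. ennreal (2 powr q) * (F (?H k) t epowr q + (\<Sum>i=a..k - 2. X i) epowr q * indicator (BU b k) t)"
    have Fle: "F (g n) t epowr q \<le> (\<Sum>k\<in>?I. ?G k t)" for t
    proof (cases "2 powr real_of_int a < U t")
      case False
      have "F (g n) t = (\<integral>\<^sup>+s. 0 \<partial>\<mu>)"
        unfolding F_def
      proof (rule nn_integral_cong)
        fix s
        show "g n s * indicator {..<t} s = 0"
          using False monoD[OF U.mono, of s t] by (auto simp: g_def a_def split: split_indicator)
      qed
      then show ?thesis using q by simp
    next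
      case True
      obtain k where k: "a \<le> k" "k \<le> b" "t \<in> BU b k"
      proof (cases "2 powr real_of_int b < U t")
        case True then show ?thesis using that[of b] ab by auto
      next
        case False
        then have "U t \<le> 2 powr real_of_int ((b - 1) + 1)" by simp
        then obtain i where "a \<le> i" "i \<le> b - 1" "t \<in> U.blk i" using U.blk_window True by blast
        then show ?thesis using that[of i] by auto
      qed
      have "2 powr real_of_int k < U t" using k(3) by (auto simp: U.blk_def split: if_splits)
      then have "live k" by (auto simp: live_def)
      then have kI: "k \<in> ?I" using k by simp
      have "F (g n) t \<le> (\<integral>\<^sup>+s. ?H k s * indicator {..<t} s + (\<Sum>i=a..k - 2. h s * indicator (U.blk i) s) \<partial>\<mu>)"
        unfolding F_def
      proof (rule nn_integral_mono)
        fix s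
        show "g n s * indicator {..<t} s \<le> ?H k s * indicator {..<t} s + (\<Sum>i=a..k - 2. h s * indicator (U.blk i) s)"
        proof (cases "2 powr real_of_int a < U s \<and> s < t \<and> U s \<le> 2 powr real_of_int (b + 1)")
          case True
          have "U s \<le> 2 powr real_of_int (k + 1)"
          proof (cases "k = b")
            case True
            then show ?thesis using \<open>_ \<and> _ \<and> _\<close> by simp
          next
            case False
            then show ?thesis using k monoD[OF U.mono, of s t] True by (auto simp: U.blk_def)
          qed
          then obtain i where i: "a \<le> i" "i \<le> k" "s \<in> U.blk i" using U.blk_window True by blast
          have gh: "g n s * indicator {..<t} s \<le> h s" by (auto simp: g_def split: split_indicator)
          consider "i = k \<or> i = k - 1" | "i \<le> k - 2" using i by linarith
          then show ?thesis
          proof cases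
            case 1
            then have "h s = ?H k s * indicator {..<t} s" using i(3) True by (auto split: split_indicator)
            note gh
            also note \<open>h s = _\<close>
            also have "?H k s * indicator {..<t} s \<le> ?H k s * indicator {..<t} s + (\<Sum>i=a..k - 2. h s * indicator (U.blk i) s)"
              by (rule add_increasing2) auto
            finally show ?thesis .
          next
            case 2
            note gh
            also have "h s = h s * indicator (U.blk i) s" using i by simp
            also have "\<dots> \<le> (\<Sum>i=a..k - 2. h s * indicator (U.blk i) s)"
              using i 2 by (intro member_le_sum) auto
            also have "\<dots> \<le> ?H k s * indicator {..<t} s + (\<Sum>i=a..k - 2. h s * indicator (U.blk i) s)"
              by (rule add_increasing) auto
            finally show ?thesis .
          qed
        next
          case False
          then have "g n s * indicator {..<t} s = 0" by (auto simp: g_def a_def b_def split: split_indicator)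
          then show ?thesis by (simp only: zero_le)
        qed
      qed
      also have "\<dots> = F (?H k) t + (\<Sum>i=a..k - 2. X i)"
      proof -
        have "(\<integral>\<^sup>+s. (\<Sum>i=a..k - 2. h s * indicator (U.blk i) s) \<partial>\<mu>) = (\<Sum>i=a..k - 2. X i)"
          unfolding X_def by (rule nn_integral_sum) measurable
        moreover have "(\<integral>\<^sup>+s. ?H k s * indicator {..<t} s + (\<Sum>i=a..k - 2. h s * indicator (U.blk i) s) \<partial>\<mu>)
          = (\<integral>\<^sup>+s. ?H k s * indicator {..<t} s \<partial>\<mu>) + (\<integral>\<^sup>+s. (\<Sum>i=a..k - 2. h s * indicator (U.blk i) s) \<partial>\<mu>)"
          by (rule nn_integral_add) measurable
        ultimately show ?thesis unfolding F_def by (simp only:)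
      qed
      finally have "F (g n) t epowr q \<le> (F (?H k) t + (\<Sum>i=a..k - 2. X i)) epowr q"
        using q by (intro epowr_mono) auto
      also have "\<dots> \<le> ennreal (2 powr q) * (F (?H k) t epowr q + (\<Sum>i=a..k - 2. X i) epowr q)"
        using q by (intro epowr_add_le) auto
      also have "\<dots> = ?G k t" using k(3) by (simp only: indicator_simps mult_1_right)
      also have "\<dots> \<le> (\<Sum>k\<in>?I. ?G k t)"
        using kI by (intro member_le_sum[of k ?I "\<lambda>k. ?G k t"]) (auto intro: finite_subset[of _ "{a..b}"])
      finally show ?thesis .
    qed
    have "L (g n) \<le> (\<integral>\<^sup>+t. (\<Sum>k\<in>?I. ?G k t) \<partial>\<nu>2)"
      unfolding L_def by (intro nn_integral_mono Fle)
    also have "\<dots> = ennreal (2 powr q) * ((\<Sum>k\<in>?I. L (?H k)) + (\<Sum>k\<in>?I. (\<Sum>i=a..k - 2. X i) epowr q * emeasure \<nu>2 (BU b k)))"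
    proof -
      have "(\<integral>\<^sup>+t. (\<Sum>k\<in>?I. ?G k t) \<partial>\<nu>2) = (\<Sum>k\<in>?I. \<integral>\<^sup>+t. ?G k t \<partial>\<nu>2)"
        by (rule nn_integral_sum) measurable
      also have "\<dots> = (\<Sum>k\<in>?I. ennreal (2 powr q) * (L (?H k) + (\<Sum>i=a..k - 2. X i) epowr q * emeasure \<nu>2 (BU b k)))"
        unfolding L_def by (intro sum.cong refl) (auto simp: nn_integral_cmult nn_integral_add)
      finally show ?thesis by (simp add: sum_distrib_left[symmetric] sum.distrib)
    qed
    also have "\<dots> \<le> ennreal (2 powr q) * (ennreal (Cu * 2 powr (q / p) * (1 + 2 powr (q / \<theta>))) * Z1 * (2 * D h) epowr (q / \<theta>) + Z2 * (2 * D h) epowr (q / \<theta>))"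
    proof (intro mult_left_mono add_mono)
      let ?c = "\<lambda>k. (\<kappa> k * ennreal (2 powr (- (real_of_int k / \<theta>)))) epowr q"
      have blk: "L (?H k) \<le> ennreal (Cu * 2 powr (q / p)) * (ennreal (2 powr (q / \<theta>)) * (?c k * d (k - 1) epowr q) + ?c k * d k epowr q)" for k
      proof -
        have "(Lp (U.blk (k - 1)) h + Lp (U.blk k) h) epowr (q / p) \<le> ennreal (2 powr (q / p)) * (A (k - 1) epowr q + A k epowr q)"
          using epowr_add_le[of "q / p" "Lp (U.blk (k - 1)) h" "Lp (U.blk k) h"] p q by (simp add: A_def)
        then have "L (?H k) \<le> ennreal Cu * \<kappa> k epowr q * (ennreal (2 powr (q / p)) * (A (k - 1) epowr q + A k epowr q))"
          by (intro order.trans[OF upper_block] mult_left_mono) auto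
        also have "\<dots> = ennreal (Cu * 2 powr (q / p)) * (\<kappa> k epowr q * A (k - 1) epowr q + \<kappa> k epowr q * A k epowr q)"
          by (simp add: ennreal_mult'' distrib_left mult_ac)
        also have "\<kappa> k epowr q * A k epowr q = ?c k * d k epowr q"
        proof -
          have "ennreal (2 powr (- (real_of_int k / \<theta>))) epowr q * ennreal (2 powr (real_of_int k / \<theta>)) epowr q = 1"
            using q by (simp add: epowr_ennreal powr_powr ennreal_mult''[symmetric] powr_add[symmetric])
          then have "?c k * d k epowr q = \<kappa> k epowr q * A k epowr q * (ennreal (2 powr (- (real_of_int k / \<theta>))) epowr q * ennreal (2 powr (real_of_int k / \<theta>)) epowr q)"
            using q by (simp add: d_def epowr_mult mult_ac)
          then show ?thesis using \<open>_ = 1\<close> by simp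
        qed
        \<comment> \<open>\<open>d (k - 1)\<close> carries the power of 2 of its own block, which is
          one factor \<open>2 powr (1 / \<theta>)\<close> short.\<close>
        also have "\<kappa> k epowr q * A (k - 1) epowr q = ennreal (2 powr (q / \<theta>)) * (?c k * d (k - 1) epowr q)"
        proof -
          have "ennreal (2 powr (q / \<theta>)) * (ennreal (2 powr (- (real_of_int k / \<theta>))) epowr q * ennreal (2 powr (real_of_int (k - 1) / \<theta>)) epowr q) = 1"
            using q by (simp add: epowr_ennreal powr_powr ennreal_mult''[symmetric] powr_add[symmetric] algebra_simps diff_divide_distrib)
          moreover have "ennreal (2 powr (q / \<theta>)) * (?c k * d (k - 1) epowr q) = \<kappa> k epowr q * A (k - 1) epowr q * (ennreal (2 powr (q / \<theta>)) * (ennreal (2 powr (- (real_of_int k / \<theta>))) epowr q * ennreal (2 powr (real_of_int (k - 1) / \<theta>)) epowr q))"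
            using q by (simp add: d_def epowr_mult mult_ac)
          ultimately show ?thesis by simp
        qed
        finally show ?thesis .
      qed
      have "(\<Sum>k\<in>?I. ?c k * d k epowr q) \<le> Z1 * (2 * D h) epowr (q / \<theta>)"
        by (intro order.trans[OF Hin] mult_left_mono dD) auto
      moreover have "(\<Sum>k\<in>?I. ?c k * d (k - 1) epowr q) \<le> Z1 * (2 * D h) epowr (q / \<theta>)"
      proof -
        have "(\<Sum>k=a..b. d (k - 1) epowr \<theta>) = (\<Sum>k=a - 1..b - 1. d k epowr \<theta>)"
          by (rule sum.reindex_bij_witness[of _ "\<lambda>i. i + 1" "\<lambda>i. i - 1"]) auto
        then show ?thesis
          using order.trans[OF Hin[where a = a and b = b and d = "\<lambda>k. d (k - 1)"], of "Z1 * (2 * D h) epowr (q / \<theta>)"]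
            mult_left_mono[OF dD[of "a - 1" "b - 1"], of Z1] by simp
      qed
      ultimately have "ennreal (2 powr (q / \<theta>)) * (\<Sum>k\<in>?I. ?c k * d (k - 1) epowr q) + (\<Sum>k\<in>?I. ?c k * d k epowr q)
        \<le> ennreal (2 powr (q / \<theta>)) * (Z1 * (2 * D h) epowr (q / \<theta>)) + Z1 * (2 * D h) epowr (q / \<theta>)"
        by (intro add_mono mult_left_mono) auto
      also have "\<dots> = ennreal (1 + 2 powr (q / \<theta>)) * (Z1 * (2 * D h) epowr (q / \<theta>))"
        by (simp add: distrib_right)
      finally have "ennreal (Cu * 2 powr (q / p)) * (ennreal (2 powr (q / \<theta>)) * (\<Sum>k\<in>?I. ?c k * d (k - 1) epowr q) + (\<Sum>k\<in>?I. ?c k * d k epowr q))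
         \<le> ennreal (Cu * 2 powr (q / p)) * (ennreal (1 + 2 powr (q / \<theta>)) * (Z1 * (2 * D h) epowr (q / \<theta>)))"
        by (intro mult_left_mono) auto
      moreover have "(\<Sum>k\<in>?I. L (?H k)) \<le> (\<Sum>k\<in>?I. ennreal (Cu * 2 powr (q / p)) * (ennreal (2 powr (q / \<theta>)) * (?c k * d (k - 1) epowr q) + ?c k * d k epowr q))"
        by (intro sum_mono blk)
      moreover have "\<dots> = ennreal (Cu * 2 powr (q / p)) * (ennreal (2 powr (q / \<theta>)) * (\<Sum>k\<in>?I. ?c k * d (k - 1) epowr q) + (\<Sum>k\<in>?I. ?c k * d k epowr q))"
        by (simp only: sum_distrib_left[symmetric] sum.distrib)
      moreover have "ennreal (Cu * 2 powr (q / p)) * (ennreal (1 + 2 powr (q / \<theta>)) * (Z1 * (2 * D h) epowr (q / \<theta>)))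
        = ennreal (Cu * 2 powr (q / p) * (1 + 2 powr (q / \<theta>))) * Z1 * (2 * D h) epowr (q / \<theta>)"
        using C_pos by (subst ennreal_mult) (auto simp: mult_ac)
      ultimately show "(\<Sum>k\<in>?I. L (?H k)) \<le> ennreal (Cu * 2 powr (q / p) * (1 + 2 powr (q / \<theta>))) * Z1 * (2 * D h) epowr (q / \<theta>)"
        by simp
    next
      have "(\<Sum>k\<in>?I. (\<Sum>i=a..k - 2. X i) epowr q * emeasure \<nu>2 (BU b k)) \<le> (\<Sum>k=a..b - 2. nU b k * (\<Sum>i=a..k. ennreal (wgt i) * d i) epowr q)"
      proof -
        have "(\<Sum>k\<in>?I. (\<Sum>i=a..k - 2. X i) epowr q * emeasure \<nu>2 (BU b k)) \<le> (\<Sum>k\<in>{a + 2..b}. nU b (k - 2) * (\<Sum>i=a..k - 2. ennreal (wgt i) * d i) epowr q)"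
        proof -
          \<comment> \<open>For the two lowest indices of the window the sum over earlier blocks is
            empty.\<close>
          have "(\<Sum>k\<in>?I. (\<Sum>i=a..k - 2. X i) epowr q * emeasure \<nu>2 (BU b k)) = (\<Sum>k\<in>{k\<in>{a + 2..b}. live k}. (\<Sum>i=a..k - 2. X i) epowr q * emeasure \<nu>2 (BU b k))"
          proof (rule sum.mono_neutral_right)
            show "\<forall>k\<in>?I - {k\<in>{a + 2..b}. live k}. (\<Sum>i=a..k - 2. X i) epowr q * emeasure \<nu>2 (BU b k) = 0"
            proof
              fix k assume "k \<in> ?I - {k\<in>{a + 2..b}. live k}"
              then have "{a..k - 2} = {}" by auto
              then show "(\<Sum>i=a..k - 2. X i) epowr q * emeasure \<nu>2 (BU b k) = 0" using q by simp
            qed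
          qed (auto intro: finite_subset[of _ "{a..b}"])
          also have "\<dots> \<le> (\<Sum>k\<in>{k\<in>{a + 2..b}. live k}. nU b (k - 2) * (\<Sum>i=a..k - 2. ennreal (wgt i) * d i) epowr q)"
          proof (intro sum_mono)
            fix k assume k: "k \<in> {k\<in>{a + 2..b}. live k}"
            have "(\<Sum>i=a..k - 2. X i) \<le> (\<Sum>i=a..k - 2. ennreal (wgt i) * d i)"
              unfolding X_def d_def A_def using k by (intro sum_mono int_Ublk_le) (auto intro: live_mono)
            then have "(\<Sum>i=a..k - 2. X i) epowr q \<le> (\<Sum>i=a..k - 2. ennreal (wgt i) * d i) epowr q"
              using q by (intro epowr_mono) auto
            moreover have "nU b (k - 2) = emeasure \<nu>2 (BU b k)" unfolding nU_def by simp
            ultimately show "(\<Sum>i=a..k - 2. X i) epowr q * emeasure \<nu>2 (BU b k) \<le> nU b (k - 2) * (\<Sum>i=a..k - 2. ennreal (wgt i) * d i) epowr q"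
              by (subst mult.commute) (simp only: mult_left_mono zero_le)
          qed
          also have "\<dots> \<le> (\<Sum>k\<in>{a + 2..b}. nU b (k - 2) * (\<Sum>i=a..k - 2. ennreal (wgt i) * d i) epowr q)"
            by (intro sum_mono2) auto
          finally show ?thesis .
        qed
        also have "\<dots> = (\<Sum>k=a..b - 2. nU b k * (\<Sum>i=a..k. ennreal (wgt i) * d i) epowr q)"
          by (rule sum.reindex_bij_witness[of _ "\<lambda>i. i + 2" "\<lambda>i. i - 2"]) auto
        finally show ?thesis .
      qed
      also have "\<dots> \<le> Z2 * (2 * D h) epowr (q / \<theta>)"
        by (intro order.trans[OF Hcr] mult_left_mono dD) auto
      finally show "(\<Sum>k\<in>?I. (\<Sum>i=a..k - 2. X i) epowr q * emeasure \<nu>2 (BU b k)) \<le> Z2 * (2 * D h) epowr (q / \<theta>)" .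
    qed auto
    also have "\<dots> = ?R" by (simp add: distrib_right mult.assoc)
    finally show ?thesis .
  qed
  show ?thesis
  proof (rule L_le_SUP[of g, OF _ _ _ _ gn])
    show "incseq g"
    proof (intro incseq_SucI le_funI)
      fix n s
      have "2 powr real_of_int (- int (Suc n)) \<le> 2 powr real_of_int (- int n)" by (intro powr_mono) auto
      moreover have "2 powr real_of_int (int n + 1) \<le> 2 powr real_of_int (int (Suc n) + 1)" by (intro powr_mono) auto
      ultimately have "{s. 2 powr real_of_int (- int n) < U s \<and> U s \<le> 2 powr real_of_int (int n + 1)}
        \<subseteq> {s. 2 powr real_of_int (- int (Suc n)) < U s \<and> U s \<le> 2 powr real_of_int (int (Suc n) + 1)}"
        by (intro Collect_mono) linarith
      then show "g n s \<le> g (Suc n) s" unfolding g_def by (intro mult_left_mono) (auto split: split_indicator)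
    qed
    fix s :: real assume "0 < s"
    then obtain k where k: "s \<in> U.blk k" by (rule U.blk_ex)
    let ?n = "nat \<bar>k\<bar>"
    have "2 powr real_of_int (- int ?n) \<le> 2 powr real_of_int k" "2 powr real_of_int (k + 1) \<le> 2 powr real_of_int (int ?n + 1)"
      by (intro powr_mono; simp)+
    then have "2 powr real_of_int (- int ?n) < U s \<and> U s \<le> 2 powr real_of_int (int ?n + 1)" using k unfolding U.blk_def mem_Collect_eq by linarith
    then have "h s = g ?n s" by (simp only: g_def indicator_simps mem_Collect_eq mult_1_right)
    then show "h s \<le> (SUP n. g n s)" by (metis SUP_upper UNIV_I)
  qed auto
qed

end

section \<open>Upper bounds for the two orders of q and \<theta>\<close>

lemma epowr_superadd: "1 \<le> a \<Longrightarrow> x epowr a + y epowr a \<le> (x + y) epowr a"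
  using sum_epowr_le[of a "{..<2::nat}" "\<lambda>i. if i = 0 then x else y"] by (simp add: numeral_2_eq_2)

lemma sum_Hoelder_ennreal:
  fixes x y :: "'i \<Rightarrow> ennreal"
  assumes "finite I" "1 < P" "1 / P + 1 / P' = 1"
  shows "(\<Sum>i\<in>I. x i * y i) \<le> (\<Sum>i\<in>I. x i epowr P) epowr (1 / P) * (\<Sum>i\<in>I. y i epowr P') epowr (1 / P')"
  using nn_integral_Hoelder[of x "count_space I" y P P'] assms by (simp add: nn_integral_count_space_finite)

lemma hardyC_nonneg: "1 < s \<Longrightarrow> 1 < t \<Longrightarrow> 0 \<le> hardyC s t"
  by (simp add: hardyC_def)

context cope_beta
begin

text \<open>The constant \<open>c0\<close> for block k + 1 when the power of 2 is still indexed by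
  k.\<close>

definition c1 :: real where "c1 = c0 * 2 powr (1 - \<theta>')"

lemma c1_pos: "0 < c1" using c0_pos by (simp add: c1_def)

lemma \<Psi>_ge:
  assumes "0 < x" shows "ennreal (m x powr (\<theta>' / p')) * emeasure \<beta> {x<..} \<le> \<Psi> x"
proof -
  have "ennreal (m x powr (\<theta>' / p')) * emeasure \<beta> {x<..} = (\<integral>\<^sup>+t. ennreal (m x powr (\<theta>' / p')) * indicator {x<..} t \<partial>\<beta>)"
    by (simp add: nn_integral_cmult)
  also have "\<dots> \<le> \<Psi> x"
    unfolding \<Psi>_def
  proof (intro nn_integral_mono)
    fix t
    have "min (m x) (m t) = m x" if "x < t" using that monoD[OF m.mono, of x t] by simp
    then show "ennreal (m x powr (\<theta>' / p')) * indicator {x<..} t \<le> ennreal (min (m x) (m t) powr (\<theta>' / p'))"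
      by (auto split: split_indicator)
  qed
  finally show ?thesis .
qed

lemma \<phi>_\<theta>': "\<phi> x epowr \<theta>' = \<Psi> x"
  unfolding \<phi>_def using \<theta>_exps by simp

lemma K_epowr: "0 < a \<Longrightarrow> 0 < x \<Longrightarrow> K x epowr a = ennreal (m x powr (a / p')) * T x epowr a"
  unfolding K_def using m.pos[of x] by (simp add: epowr_mult epowr_ennreal powr_powr)

text \<open>Raised to \<theta>', the power of \<open>U\<close> becomes
  \<open>U powr (1 - \<theta>')\<close>, which is the \<beta>-mass beyond x plus the limit
  \<open>e\<close>. The mass times \<open>m powr (\<theta>' / p')\<close> is below
  \<open>\<Psi>\<close>, and the limit leads to \<open>B2\<close>: this is how the two summands of
  the criterion arise.\<close>

lemma K_U:
  assumes x: "0 < x"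
  shows "K x * ennreal (U x powr (- (1 / \<theta>))) \<le> \<phi> x * T x + ennreal (e powr (1 / \<theta>')) * K x"
proof -
  have "(K x * ennreal (U x powr (- (1 / \<theta>)))) epowr \<theta>' = K x epowr \<theta>' * ennreal (U x powr (1 - \<theta>'))"
  proof -
    have "- (1 / \<theta>) * \<theta>' = 1 - \<theta>'" using \<theta>_exps(2) by simp
    then have "(U x powr (- (1 / \<theta>))) powr \<theta>' = U x powr (1 - \<theta>')" by (simp only: powr_powr)
    then show ?thesis using \<theta>_exps(3) U.pos[OF x] by (simp add: epowr_mult epowr_ennreal)
  qed
  also have "\<dots> = K x epowr \<theta>' * emeasure \<beta> {x<..} + K x epowr \<theta>' * ennreal e"
    unfolding \<beta>_gt[OF x] distrib_left[symmetric] using e_nonneg e_le[OF x] by (simp flip: ennreal_plus)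
  also have "\<dots> \<le> (\<phi> x * T x) epowr \<theta>' + (ennreal (e powr (1 / \<theta>')) * K x) epowr \<theta>'"
  proof (intro add_mono)
    have "K x epowr \<theta>' * emeasure \<beta> {x<..} = (ennreal (m x powr (\<theta>' / p')) * emeasure \<beta> {x<..}) * T x epowr \<theta>'"
      using \<theta>_exps(3) x by (simp add: K_epowr mult_ac)
    also have "\<dots> \<le> \<Psi> x * T x epowr \<theta>'" by (intro mult_right_mono \<Psi>_ge x) simp
    also have "\<dots> = (\<phi> x * T x) epowr \<theta>'" using \<theta>_exps(3) by (simp add: epowr_mult \<phi>_\<theta>')
    finally show "K x epowr \<theta>' * emeasure \<beta> {x<..} \<le> (\<phi> x * T x) epowr \<theta>'" .
    show "K x epowr \<theta>' * ennreal e \<le> (ennreal (e powr (1 / \<theta>')) * K x) epowr \<theta>'"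
      using \<theta>_exps(3) e_nonneg by (simp add: epowr_mult epowr_ennreal_pos powr_powr mult.commute)
  qed
  also have "\<dots> \<le> (\<phi> x * T x + ennreal (e powr (1 / \<theta>')) * K x) epowr \<theta>'"
    using \<theta>'1 by (intro epowr_superadd) auto
  finally show ?thesis using \<theta>_exps(3) by (simp add: epowr_le_cancel)
qed

text \<open>A bound for \<open>U\<close> from above bounds the limit of its negative power from
  below; thus a last block can be charged to \<open>B2\<close>.\<close>

lemma dead_e:
  assumes "\<not> live k" shows "2 powr (- (real_of_int k / \<theta>)) \<le> e powr (1 / \<theta>')"
proof -
  have "(2 powr real_of_int k) powr (1 - \<theta>') \<le> e"
    using assms by (intro e_top) (auto simp: live_def not_less)
  then have "((2 powr real_of_int k) powr (1 - \<theta>')) powr (1 / \<theta>') \<le> e powr (1 / \<theta>')"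
    using \<theta>_exps(3) by (intro powr_mono2) auto
  moreover have "real_of_int k * (1 - \<theta>') * (1 / \<theta>') = - (real_of_int k / \<theta>)"
    using \<theta>_exps(1) by (simp only: mult.assoc) simp
  ultimately show ?thesis by (simp only: powr_powr)
qed

lemma \<kappa>_bound:
  assumes B1: "\<And>x. 0 < x \<Longrightarrow> \<phi> x * T x \<le> B1"
  shows "\<kappa> k * ennreal (2 powr (- (real_of_int k / \<theta>))) \<le> ennreal (2 powr (1 / \<theta>)) * (B1 + B2)"
proof -
  have e: "ennreal (2 powr (- (real_of_int k / \<theta>))) = ennreal (2 powr (1 / \<theta>)) * ennreal (2 powr (- (real_of_int (k + 1) / \<theta>)))"
    by (simp add: ennreal_mult''[symmetric] powr_add[symmetric] add_divide_distrib)
  have "\<kappa> k * ennreal (2 powr (- (real_of_int (k + 1) / \<theta>))) \<le> B1 + B2"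
  proof (cases "live (k + 1)")
    case True
    note t = \<tau>(1,2)[OF True]
    have "\<kappa> k * ennreal (2 powr (- (real_of_int (k + 1) / \<theta>))) = K (\<tau> (k + 1)) * ennreal (U (\<tau> (k + 1)) powr (- (1 / \<theta>)))"
      using True unfolding t(2) by (simp add: \<kappa>_def powr_powr)
    also have "\<dots> \<le> \<phi> (\<tau> (k + 1)) * T (\<tau> (k + 1)) + ennreal (e powr (1 / \<theta>')) * K (\<tau> (k + 1))"
      by (rule K_U[OF t(1)])
    also have "\<dots> \<le> B1 + B2"
      unfolding B2_def by (intro add_mono B1 mult_left_mono K_le_Kinf t(1)) auto
    finally show ?thesis .
  next
    case False
    have "\<kappa> k * ennreal (2 powr (- (real_of_int (k + 1) / \<theta>))) \<le> Kinf * ennreal (e powr (1 / \<theta>'))"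
      by (intro mult_mono \<kappa>_le_Kinf ennreal_leI dead_e False) auto
    also have "\<dots> \<le> B1 + B2" unfolding B2_def by (simp add: mult.commute add_increasing)
    finally show ?thesis .
  qed
  then have "ennreal (2 powr (1 / \<theta>)) * (\<kappa> k * ennreal (2 powr (- (real_of_int (k + 1) / \<theta>)))) \<le> ennreal (2 powr (1 / \<theta>)) * (B1 + B2)"
    by (intro mult_left_mono) auto
  then show ?thesis unfolding e by (simp only: mult_ac)
qed

lemma wgt_\<theta>': "live (i + 1) \<Longrightarrow> wgt i powr \<theta>' = 2 powr (real_of_int i * (1 - \<theta>')) * m (\<tau> (i + 1)) powr (\<theta>' / p')"
proof -
  assume l: "live (i + 1)"
  have "- (real_of_int i / \<theta>) * \<theta>' = real_of_int i * (- (\<theta>' / \<theta>))" by simp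
  also have "- (\<theta>' / \<theta>) = 1 - \<theta>'" using \<theta>_exps(2) by simp
  finally have e: "- (real_of_int i / \<theta>) * \<theta>' = real_of_int i * (1 - \<theta>')" .
  show ?thesis using l by (simp only: wgt_def powr_mult powr_powr e if_True) simp
qed

lemma \<beta>_blk': "live (k + 2) \<Longrightarrow> emeasure \<beta> (U.blk (k + 1)) = ennreal (c1 * 2 powr (real_of_int k * (1 - \<theta>')))"
proof -
  assume l: "live (k + 2)"
  then have "live (k + 1 + 1)" by (simp only: add.assoc one_add_one)
  from \<beta>_blk[OF this] have "emeasure \<beta> (U.blk (k + 1)) = ennreal (c0 * 2 powr (real_of_int (k + 1) * (1 - \<theta>')))" .
  moreover have "real_of_int (k + 1) * (1 - \<theta>') = (1 - \<theta>') + real_of_int k * (1 - \<theta>')" by (simp add: algebra_simps)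
  ultimately show ?thesis by (simp only: c1_def powr_add mult.assoc)
qed

text \<open>\<open>wgt i powr \<theta>'\<close> is, up to \<open>c1\<close>, the \<beta>-mass of
  block i + 1 times the value of \<open>m powr (\<theta>' / p')\<close> at
  \<open>\<tau> (i + 1)\<close>. This is the left end of that block, so \<open>m\<close> is at least
  as large on all of it.\<close>

lemma \<Psi>_lower:
  assumes l: "live (k + 2)" and x: "\<tau> (k + 1) \<le> x"
  shows "ennreal (c1 * (\<Sum>i=a..k. wgt i powr \<theta>')) \<le> \<Psi> x"
proof -
  have lv: "live (i + 2)" "live (i + 1)" if "i \<in> {a..k}" for i using live_mono[OF l] that by auto
  let ?c = "\<lambda>i. ennreal (m (\<tau> i) powr (\<theta>' / p'))"
  have "ennreal (c1 * (\<Sum>i=a..k. wgt i powr \<theta>')) = (\<Sum>i=a..k. ennreal (c1 * wgt i powr \<theta>'))"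
    using c1_pos by (simp add: sum_distrib_left)
  also have "\<dots> = (\<Sum>i=a..k. ?c (i + 1) * emeasure \<beta> (U.blk (i + 1)))"
  proof (intro sum.cong refl)
    fix i assume i: "i \<in> {a..k}"
    show "ennreal (c1 * wgt i powr \<theta>') = ?c (i + 1) * emeasure \<beta> (U.blk (i + 1))"
      using c1_pos by (simp add: \<beta>_blk'[OF lv(1)[OF i]] wgt_\<theta>'[OF lv(2)[OF i]] ennreal_mult''[symmetric] mult_ac)
  qed
  also have "\<dots> = (\<Sum>i=a + 1..k + 1. ?c i * emeasure \<beta> (U.blk i))"
    by (rule sum.reindex_bij_witness[of _ "\<lambda>i. i - 1" "\<lambda>i. i + 1"]) auto
  also have "\<dots> = (\<integral>\<^sup>+t. (\<Sum>i=a + 1..k + 1. ?c i * indicator (U.blk i) t) \<partial>\<beta>)"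
    by (subst nn_integral_sum) (auto simp: nn_integral_cmult)
  also have "\<dots> \<le> \<Psi> x"
    unfolding \<Psi>_def
  proof (intro nn_integral_mono_AE, use AE_\<beta> in eventually_elim)
    fix t :: real assume "0 < t"
    then obtain i where i: "t \<in> U.blk i" by (rule U.blk_ex)
    have "?c i \<le> ennreal (min (m x) (m t) powr (\<theta>' / p'))" if "i \<in> {a + 1..k + 1}"
    proof -
      have li: "live (i + 1)" "live i" using live_mono[OF l] that by auto
      have "\<tau> i \<le> \<tau> (k + 1)" using that live_mono[OF l, of "k + 1"] by (intro \<tau>_mono) auto
      then have "m (\<tau> i) \<le> m x" using x monoD[OF m.mono, of "\<tau> i" x] by linarith
      moreover have "m (\<tau> i) \<le> m t" using blk_bounds[OF li(1) i] monoD[OF m.mono, of "\<tau> i" t] by linarith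
      ultimately show ?thesis
        using \<theta>_exps(4) m.pos[OF \<tau>(1)[OF li(2)]] by (intro ennreal_leI powr_mono2) auto
    qed
    then show "(\<Sum>i=a + 1..k + 1. ?c i * indicator (U.blk i) t) \<le> ennreal (min (m x) (m t) powr (\<theta>' / p'))"
      by (subst U.sum_blk[OF _ i]) auto
  qed
  finally show ?thesis .
qed

lemma nU_live: assumes "k \<le> b - 2" "live (k + 2)"
  shows "(\<Sum>i=k..b - 2. nU b i) = ennreal (N (\<tau> (k + 2)))"
  unfolding nU_tail[OF assms(1)] live_B[OF assms(2)] by (rule N_gt[OF \<tau>(1)[OF assms(2)]])

lemma nU_dead: assumes "k \<le> b - 2" "\<not> live (k + 2)"
  shows "(\<Sum>i=k..b - 2. nU b i) = 0"
  unfolding nU_tail[OF assms(1)] dead_B[OF assms(2)] by simp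

definition Csmall :: real where
  "Csmall = 2 powr q * (Cu * 2 powr (q / p) * (1 + 2 powr (q / \<theta>)) * 2 powr (q / \<theta>) + hardyC \<theta> q * c1 powr (- (q / \<theta>'))) * 2 powr (q / \<theta>)"

text \<open>Local part: the block constants are bounded uniformly by \<open>\<kappa>_bound\<close>,
  and for \<theta> \<le> q a sum of q-th powers is controlled by that of \<theta>-th powers. Remote
  part: at \<open>\<tau> (k + 2)\<close> the partial sums of the weights are controlled by
  \<open>\<phi>\<close> and the tail masses by \<open>T\<close>.\<close>

theorem upper_small:
  assumes \<theta>q: "\<theta> \<le> q" and [measurable]: "h \<in> borel_measurable \<mu>"
  shows "L h \<le> ennreal Csmall * ((SUP x\<in>{0<..}. \<phi> x * T x) + B2) epowr q * D h epowr (q / \<theta>)"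
proof -
  define B1 where "B1 = (SUP x\<in>{0<..}. \<phi> x * T x)"
  have B1: "\<phi> x * T x \<le> B1" if "0 < x" for x unfolding B1_def using that by (intro SUP_upper) auto
  let ?B = "(B1 + B2) epowr q"
  have "L h \<le> ennreal (2 powr q) * (ennreal (Cu * 2 powr (q / p) * (1 + 2 powr (q / \<theta>))) * (ennreal (2 powr (q / \<theta>)) * ?B)
      + ennreal (hardyC \<theta> q * c1 powr (- (q / \<theta>'))) * ?B) * (2 * D h) epowr (q / \<theta>)"
  proof (rule upper_core)
    fix a b :: int and d :: "int \<Rightarrow> ennreal"
    let ?I = "{k\<in>{a..b}. live k}"
    have "(\<Sum>k\<in>?I. (\<kappa> k * ennreal (2 powr (- (real_of_int k / \<theta>)))) epowr q * d k epowr q)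
      \<le> (\<Sum>k\<in>?I. (ennreal (2 powr (1 / \<theta>)) * (B1 + B2)) epowr q * d k epowr q)"
      using q by (intro sum_mono mult_right_mono epowr_mono \<kappa>_bound B1) auto
    also have "\<dots> = (ennreal (2 powr (1 / \<theta>)) * (B1 + B2)) epowr q * (\<Sum>k\<in>?I. d k epowr q)"
      by (simp only: sum_distrib_left)
    also have "\<dots> \<le> (ennreal (2 powr (1 / \<theta>)) * (B1 + B2)) epowr q * (\<Sum>k=a..b. d k epowr \<theta>) epowr (q / \<theta>)"
    proof (intro mult_left_mono)
      have "(\<Sum>k\<in>?I. d k epowr q) \<le> (\<Sum>k=a..b. (d k epowr \<theta>) epowr (q / \<theta>))"
        using \<theta> by (auto intro!: sum_mono2)
      also have "\<dots> \<le> (\<Sum>k=a..b. d k epowr \<theta>) epowr (q / \<theta>)"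
        using \<theta> \<theta>q by (intro sum_epowr_le) auto
      finally show "(\<Sum>k\<in>?I. d k epowr q) \<le> (\<Sum>k=a..b. d k epowr \<theta>) epowr (q / \<theta>)" .
    qed simp
    also have "(ennreal (2 powr (1 / \<theta>)) * (B1 + B2)) epowr q = ennreal (2 powr (q / \<theta>)) * ?B"
      using q by (simp add: epowr_mult epowr_ennreal powr_powr)
    finally show "(\<Sum>k\<in>?I. (\<kappa> k * ennreal (2 powr (- (real_of_int k / \<theta>)))) epowr q * d k epowr q)
      \<le> ennreal (2 powr (q / \<theta>)) * ?B * (\<Sum>k=a..b. d k epowr \<theta>) epowr (q / \<theta>)" .
  next
    fix a b :: int and d :: "int \<Rightarrow> ennreal"
    have "(\<Sum>k=a..b - 2. nU b k * (\<Sum>i=a..k. ennreal (wgt i) * d i) epowr q)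
       \<le> ennreal (hardyC \<theta> q) * (ennreal (c1 powr (- (1 / \<theta>'))) * (B1 + B2)) epowr q * (\<Sum>k=a..b - 2. d k epowr \<theta>) epowr (q / \<theta>)"
    proof (rule hardy_upper_le[where s' = \<theta>'])
      fix k assume k: "a \<le> k" "k \<le> b - 2"
      let ?W = "\<Sum>i=a..k. wgt i powr \<theta>'"
      show "ennreal (?W powr (1 / \<theta>')) * (\<Sum>i=k..b - 2. nU b i) epowr (1 / q) \<le> ennreal (c1 powr (- (1 / \<theta>'))) * (B1 + B2)"
      proof (cases "live (k + 2)")
        case True
        let ?x = "\<tau> (k + 2)"
        have W0: "0 \<le> ?W" by (intro sum_nonneg) auto
        have "ennreal (c1 * ?W) epowr (1 / \<theta>') \<le> \<Psi> ?x epowr (1 / \<theta>')"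
          using \<theta>_exps(3) by (intro epowr_mono \<Psi>_lower True \<tau>_mono) auto
        then have "ennreal (c1 powr (1 / \<theta>')) * ennreal (?W powr (1 / \<theta>')) \<le> \<phi> ?x"
          using c1_pos W0 \<theta>_exps(3) by (simp add: \<phi>_def epowr_mult epowr_ennreal_pos ennreal_mult'')
        then have "ennreal (c1 powr (- (1 / \<theta>'))) * (ennreal (c1 powr (1 / \<theta>')) * ennreal (?W powr (1 / \<theta>'))) \<le> ennreal (c1 powr (- (1 / \<theta>'))) * \<phi> ?x"
          by (intro mult_left_mono) auto
        moreover have "ennreal (c1 powr (- (1 / \<theta>'))) * (ennreal (c1 powr (1 / \<theta>')) * ennreal (?W powr (1 / \<theta>'))) = ennreal (?W powr (1 / \<theta>'))"
          using c1_pos by (simp add: mult.assoc[symmetric] ennreal_mult''[symmetric] powr_add[symmetric])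
        ultimately have 1: "ennreal (?W powr (1 / \<theta>')) \<le> ennreal (c1 powr (- (1 / \<theta>'))) * \<phi> ?x" by simp
        have 2: "(\<Sum>i=k..b - 2. nU b i) epowr (1 / q) \<le> T ?x"
          unfolding nU_live[OF k(2) True] using N_T[OF \<tau>(1)[OF True]] N_nonneg[OF \<tau>(1)[OF True]] q by (simp add: epowr_ennreal_pos)
        have "ennreal (?W powr (1 / \<theta>')) * (\<Sum>i=k..b - 2. nU b i) epowr (1 / q) \<le> ennreal (c1 powr (- (1 / \<theta>'))) * \<phi> ?x * T ?x"
          by (intro mult_mono 1 2) auto
        also have "\<dots> \<le> ennreal (c1 powr (- (1 / \<theta>'))) * (B1 + B2)"
          unfolding mult.assoc using B1[OF \<tau>(1)[OF True]] by (intro mult_left_mono) (auto intro: add_increasing2)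
        finally show ?thesis .
      next
        case False
        show ?thesis unfolding nU_dead[OF k(2) False] using q by simp
      qed
    qed (use \<theta> q \<theta>q nU_finite wgt_pos in auto)
    also have "(ennreal (c1 powr (- (1 / \<theta>'))) * (B1 + B2)) epowr q = ennreal (c1 powr (- (q / \<theta>'))) * ?B"
      using q c1_pos by (simp add: epowr_mult epowr_ennreal powr_powr)
    also have "ennreal (hardyC \<theta> q) * (ennreal (c1 powr (- (q / \<theta>'))) * ?B) = ennreal (hardyC \<theta> q * c1 powr (- (q / \<theta>'))) * ?B"
      by (simp add: ennreal_mult'' mult.assoc)
    finally show "(\<Sum>k=a..b - 2. nU b k * (\<Sum>i=a..k. ennreal (wgt i) * d i) epowr q)
        \<le> ennreal (hardyC \<theta> q * c1 powr (- (q / \<theta>'))) * ?B * (\<Sum>k=a..b - 2. d k epowr \<theta>) epowr (q / \<theta>)" .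
  qed auto
  also have "(2 * D h) epowr (q / \<theta>) = ennreal (2 powr (q / \<theta>)) * D h epowr (q / \<theta>)"
    using q \<theta> epowr_ennreal[of 2 "q / \<theta>"] by (simp add: epowr_mult)
  also have "ennreal (2 powr q) * (ennreal (Cu * 2 powr (q / p) * (1 + 2 powr (q / \<theta>))) * (ennreal (2 powr (q / \<theta>)) * ?B)
      + ennreal (hardyC \<theta> q * c1 powr (- (q / \<theta>'))) * ?B) * (ennreal (2 powr (q / \<theta>)) * D h epowr (q / \<theta>))
    = ennreal Csmall * ?B * D h epowr (q / \<theta>)"
  proof -
    have "ennreal (Cu * 2 powr (q / p) * (1 + 2 powr (q / \<theta>))) * (ennreal (2 powr (q / \<theta>)) * ?B) + ennreal (hardyC \<theta> q * c1 powr (- (q / \<theta>'))) * ?B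
      = ennreal (Cu * 2 powr (q / p) * (1 + 2 powr (q / \<theta>)) * 2 powr (q / \<theta>) + hardyC \<theta> q * c1 powr (- (q / \<theta>'))) * ?B"
      using C_pos \<theta> q by (subst ennreal_plus) (auto simp: distrib_right ennreal_mult'' mult.assoc intro!: mult_nonneg_nonneg hardyC_nonneg)
    then show ?thesis using C_pos \<theta> q hardyC_nonneg[of \<theta> q]
      by (simp add: Csmall_def ennreal_mult mult_ac)
  qed
  finally show ?thesis unfolding B1_def .
qed

text \<open>\<open>r * \<theta>' / q'\<close> is the exponent of the statement divided by p2. In
  terms of \<open>\<Psi>\<close> it becomes r/q', the exponent in the discrete Hardy inequality for
  q < \<theta>.\<close>

definition J :: "real \<Rightarrow> ennreal" where
  "J r = (\<integral>\<^sup>+x. \<phi> x epowr (r * \<theta>' / q') * ennreal (m x powr (\<theta>' / p')) * T x epowr r \<partial>\<beta>)"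

lemma r_exps:
  assumes "q < \<theta>" "1 / r = 1 / q - 1 / \<theta>"
  shows "0 < r" "r / q' + 1 = r / \<theta>'" "q / r + q / \<theta> = 1" "1 < r / q" "\<theta>' * (r / q' + 1) = r" "\<theta>' \<le> r"
proof -
  have "0 < 1 / r" unfolding assms using assms q by (simp add: frac_less2)
  then show r: "0 < r" by simp
  have "1 / q' = 1 - 1 / q" "1 / \<theta>' = 1 - 1 / \<theta>" using q \<theta> by linarith+
  then have "1 / r = 1 / \<theta>' - 1 / q'" using assms by simp
  then have "r * (1 / r) = r * (1 / \<theta>') - r * (1 / q')" by (simp add: right_diff_distrib)
  then show 1: "r / q' + 1 = r / \<theta>'" using r by simp
  have "q * (1 / r) = 1 - q * (1 / \<theta>)" unfolding assms using q by (simp add: right_diff_distrib)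
  then show "q / r + q / \<theta> = 1" by simp
  moreover have "0 < q / \<theta>" using q \<theta> by simp
  ultimately have "q / r < 1" by linarith
  then show "1 < r / q" using r q by simp
  show 2: "\<theta>' * (r / q' + 1) = r" unfolding 1 using \<theta>_exps(3) by simp
  have "0 \<le> r / q'" using r q'1 by simp
  then have "\<theta>' * 1 \<le> \<theta>' * (r / q' + 1)" using \<theta>_exps(3) by (intro mult_left_mono) auto
  then show "\<theta>' \<le> r" unfolding 2 by simp
qed

lemma J_integrand: "\<phi> x epowr (r * \<theta>' / q') = \<Psi> x epowr (r / q')"
  unfolding \<phi>_def using \<theta>_exps(3) by simp

text \<open>A lower sum for \<open>J\<close>. It is taken over the blocks k + 1 so that quantities
  attached to the ends of such a block can be compared with those at its points by
  monotonicity.\<close>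

lemma J_ge:
  assumes "finite I" and c: "\<And>k x. k \<in> I \<Longrightarrow> x \<in> U.blk (k + 1) \<Longrightarrow>
     c k \<le> \<Psi> x epowr (r / q') * ennreal (m x powr (\<theta>' / p')) * T x epowr r"
  shows "(\<Sum>k\<in>I. c k * emeasure \<beta> (U.blk (k + 1))) \<le> J r"
proof -
  let ?I = "(\<lambda>k. k + 1) ` I"
  have "(\<Sum>k\<in>I. c k * emeasure \<beta> (U.blk (k + 1))) = (\<Sum>k\<in>?I. c (k - 1) * emeasure \<beta> (U.blk k))"
    by (subst sum.reindex) (auto simp: inj_on_def)
  also have "\<dots> = (\<integral>\<^sup>+x. (\<Sum>k\<in>?I. c (k - 1) * indicator (U.blk k) x) \<partial>\<beta>)"
    by (subst nn_integral_sum) (auto simp: nn_integral_cmult)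
  also have "\<dots> \<le> J r"
    unfolding J_def
  proof (intro nn_integral_mono_AE, use AE_\<beta> in eventually_elim)
    fix x :: real assume "0 < x"
    then obtain i where i: "x \<in> U.blk i" by (rule U.blk_ex)
    show "(\<Sum>k\<in>?I. c (k - 1) * indicator (U.blk k) x) \<le> \<phi> x epowr (r * \<theta>' / q') * ennreal (m x powr (\<theta>' / p')) * T x epowr r"
      unfolding J_integrand
      using i assms(1) c[of "i - 1" x] by (subst U.sum_blk[OF _ i]) auto
  qed
  finally show ?thesis .
qed

text \<open>Collects the powers coming from the \<beta>-mass of block k + 2, raised to r/q', and of
  block k + 1, to the first power.\<close>

definition cin :: "real \<Rightarrow> real" where
  "cin r = c0 powr (r / q' + 1) * 2 powr ((1 - \<theta>') * (2 * r / q' + 1))"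

text \<open>\<open>live (k + 3)\<close> leaves two complete blocks after block k: x runs through
  block k + 1, and block k + 2, which lies beyond x, bounds \<open>\<Psi> x\<close> from below. The
  at most three remaining indices form a geometric sum starting at \<open>k0\<close>, which
  \<open>B2\<close> pays for.\<close>

lemma inblock_sum:
  assumes r: "q < \<theta>" "1 / r = 1 / q - 1 / \<theta>"
  shows "(\<Sum>k\<in>{k\<in>{a..b}. live k}. (\<kappa> k * ennreal (2 powr (- (real_of_int k / \<theta>)))) epowr r)
    \<le> ennreal (1 / cin r) * J r + ennreal (2 powr (3 * r / \<theta>) / (1 - 2 powr (- (r / \<theta>)))) * B2 epowr r"
proof -
  note rr = r_exps[OF r]
  have cin: "0 < cin r" using c0_pos by (simp add: cin_def)
  let ?f = "\<lambda>k. (\<kappa> k * ennreal (2 powr (- (real_of_int k / \<theta>)))) epowr r"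
  define I1 where "I1 = {k\<in>{a..b}. live (k + 3)}"
  define I2 where "I2 = {k\<in>{a..b}. live k \<and> \<not> live (k + 3)}"
  have fin: "finite I1" "finite I2" by (auto simp: I1_def I2_def intro: finite_subset[of _ "{a..b}"])
  have "{k\<in>{a..b}. live k} = I1 \<union> I2" "I1 \<inter> I2 = {}"
    by (auto simp: I1_def I2_def intro: live_mono)
  then have split: "(\<Sum>k\<in>{k\<in>{a..b}. live k}. ?f k) = (\<Sum>k\<in>I1. ?f k) + (\<Sum>k\<in>I2. ?f k)"
    using fin by (simp add: sum.union_disjoint)
  have e\<theta>: "(1 - \<theta>') * (r / \<theta>') = - (r / \<theta>)"
  proof -
    have "(1 - \<theta>') * (r / \<theta>') = r * ((1 - \<theta>') * (1 / \<theta>'))" by simp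
    then show ?thesis unfolding \<theta>_exps(1) by simp
  qed
  have fr: "?f k = ennreal (2 powr (- (r / \<theta>) * real_of_int k)) * \<kappa> k epowr r" for k
    using rr(1) by (simp add: epowr_mult epowr_ennreal powr_powr mult_ac)
  have 1: "(\<Sum>k\<in>I1. ?f k) \<le> ennreal (1 / cin r) * J r"
  proof -
    define c where "c k = ennreal ((c0 * 2 powr (real_of_int (k + 2) * (1 - \<theta>'))) powr (r / q')) * K (\<tau> (k + 1)) epowr r" for k
    have "?f k = ennreal (1 / cin r) * (c k * emeasure \<beta> (U.blk (k + 1)))" if k: "k \<in> I1" for k
    proof -
      have l: "live (k + 3)" using k by (simp add: I1_def)
      have l2: "live (k + 2)" "live (k + 1)" using live_mono[OF l] by auto
      have "(c0 * 2 powr (real_of_int (k + 2) * (1 - \<theta>'))) powr (r / q') * (c1 * 2 powr (real_of_int k * (1 - \<theta>')))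
        = cin r * 2 powr (- (r / \<theta>) * real_of_int k)"
      proof -
        have "real_of_int (k + 2) * (1 - \<theta>') * (r / q') + ((1 - \<theta>') + real_of_int k * (1 - \<theta>'))
          = (1 - \<theta>') * (2 * r / q' + 1) + real_of_int k * ((1 - \<theta>') * (r / q' + 1))"
          by (simp add: algebra_simps add_divide_distrib diff_divide_distrib)
        also have "\<dots> = (1 - \<theta>') * (2 * r / q' + 1) + (- (r / \<theta>) * real_of_int k)"
          unfolding rr(2) e\<theta> by simp
        finally have ee: "real_of_int (k + 2) * (1 - \<theta>') * (r / q') + ((1 - \<theta>') + real_of_int k * (1 - \<theta>'))
          = (1 - \<theta>') * (2 * r / q' + 1) + (- (r / \<theta>) * real_of_int k)" .
        have "(c0 * 2 powr (real_of_int (k + 2) * (1 - \<theta>'))) powr (r / q') * (c1 * 2 powr (real_of_int k * (1 - \<theta>')))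
          = (c0 powr (r / q') * c0 powr 1) * (2 powr (real_of_int (k + 2) * (1 - \<theta>') * (r / q')) * (2 powr (1 - \<theta>') * 2 powr (real_of_int k * (1 - \<theta>'))))"
          using c0_pos by (simp only: c1_def powr_mult powr_powr powr_one less_imp_le mult_ac)
        also have "\<dots> = cin r * 2 powr (- (r / \<theta>) * real_of_int k)"
          unfolding cin_def powr_add[symmetric] ee by (simp only: powr_add mult.assoc)
        finally show ?thesis .
      qed
      then have "ennreal ((c0 * 2 powr (real_of_int (k + 2) * (1 - \<theta>'))) powr (r / q')) * ennreal (c1 * 2 powr (real_of_int k * (1 - \<theta>')))
         = ennreal (cin r) * ennreal (2 powr (- (r / \<theta>) * real_of_int k))"
        using c1_pos cin by (simp add: ennreal_mult'[symmetric] ennreal_mult''[symmetric])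
      then have "c k * emeasure \<beta> (U.blk (k + 1)) = ennreal (cin r) * ?f k"
        unfolding fr c_def \<beta>_blk'[OF l2(1)] using l2 by (simp add: \<kappa>_def mult_ac)
      then show ?thesis using cin by (simp add: mult.assoc[symmetric] ennreal_mult'[symmetric])
    qed
    then have "(\<Sum>k\<in>I1. ?f k) = ennreal (1 / cin r) * (\<Sum>k\<in>I1. c k * emeasure \<beta> (U.blk (k + 1)))"
      by (simp add: sum_distrib_left)
    also have "\<dots> \<le> ennreal (1 / cin r) * J r"
    proof (intro mult_left_mono J_ge fin)
      fix k x assume k: "k \<in> I1" and x: "x \<in> U.blk (k + 1)"
      have l: "live (k + 3)" using k by (simp add: I1_def)
      have l2: "live (k + 2)" "live (k + 1)" "live (k + 2 + 1)" "live (k + 1 + 1)"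
        using live_mono[OF l] by auto
      have x2: "\<tau> (k + 1) < x" "x \<le> \<tau> (k + 2)" using blk_bounds[OF l2(4) x] by (simp_all add: add.assoc)
      have x0: "0 < x" using x by (rule U.blk_pos)
      have mx: "0 < m x" by (rule m.pos[OF x0])
      have "ennreal (m x powr (\<theta>' / p')) * ennreal (c0 * 2 powr (real_of_int (k + 2) * (1 - \<theta>'))) \<le> ennreal (m x powr (\<theta>' / p')) * emeasure \<beta> {x<..}"
        unfolding \<beta>_blk[OF l2(3), symmetric]
      proof (intro mult_left_mono emeasure_mono)
        show "U.blk (k + 2) \<subseteq> {x<..}"
        proof
          fix s assume "s \<in> U.blk (k + 2)"
          then have "\<tau> (k + 2) < s" using blk_bounds[OF l2(3)] by blast
          then show "s \<in> {x<..}" using x2(2) by simp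
        qed
      qed auto
      also have "\<dots> \<le> \<Psi> x" by (rule \<Psi>_ge[OF x0])
      finally have "(ennreal (m x powr (\<theta>' / p')) * ennreal (c0 * 2 powr (real_of_int (k + 2) * (1 - \<theta>')))) epowr (r / q') \<le> \<Psi> x epowr (r / q')"
        using rr(1) q'1 by (intro epowr_mono) auto
      then have P: "ennreal (m x powr (\<theta>' / p' * (r / q'))) * ennreal ((c0 * 2 powr (real_of_int (k + 2) * (1 - \<theta>'))) powr (r / q')) \<le> \<Psi> x epowr (r / q')"
        using rr(1) q'1 mx c0_pos by (simp add: epowr_mult epowr_ennreal powr_powr)
      have "K (\<tau> (k + 1)) epowr r \<le> K x epowr r"
        using rr(1) x2 \<tau>(1)[OF l2(2)] by (intro epowr_mono K_mono) auto
      then have "c k \<le> ennreal ((c0 * 2 powr (real_of_int (k + 2) * (1 - \<theta>'))) powr (r / q')) * K x epowr r"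
        unfolding c_def by (intro mult_left_mono) auto
      also have "K x epowr r = ennreal (m x powr (\<theta>' / p' * (r / q'))) * ennreal (m x powr (\<theta>' / p')) * T x epowr r"
      proof -
        have "r / p' = \<theta>' * (r / q' + 1) / p'" unfolding rr(5) ..
        then have "r / p' = \<theta>' / p' * (r / q') + \<theta>' / p'" by (simp add: distrib_left add_divide_distrib)
        then show ?thesis unfolding K_epowr[OF rr(1) x0] by (simp only: powr_add ennreal_mult'' powr_ge_zero)
      qed
      also have "ennreal ((c0 * 2 powr (real_of_int (k + 2) * (1 - \<theta>'))) powr (r / q')) * (ennreal (m x powr (\<theta>' / p' * (r / q'))) * ennreal (m x powr (\<theta>' / p')) * T x epowr r)
        = (ennreal (m x powr (\<theta>' / p' * (r / q'))) * ennreal ((c0 * 2 powr (real_of_int (k + 2) * (1 - \<theta>'))) powr (r / q'))) * ennreal (m x powr (\<theta>' / p')) * T x epowr r"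
        by (simp only: mult_ac)
      also have "\<dots> \<le> \<Psi> x epowr (r / q') * ennreal (m x powr (\<theta>' / p')) * T x epowr r"
        by (intro mult_right_mono P) auto
      finally show "c k \<le> \<Psi> x epowr (r / q') * ennreal (m x powr (\<theta>' / p')) * T x epowr r" .
    qed simp
    finally show ?thesis .
  qed
  have 2: "(\<Sum>k\<in>I2. ?f k) \<le> ennreal (2 powr (3 * r / \<theta>) / (1 - 2 powr (- (r / \<theta>)))) * B2 epowr r"
  proof (cases "I2 = {}")
    case False
    define k0 where "k0 = Min I2"
    have k0: "k0 \<in> I2" "\<And>k. k \<in> I2 \<Longrightarrow> k0 \<le> k" using False fin(2) by (auto simp: k0_def)
    have d: "0 < r / \<theta>" using rr(1) \<theta> by simp
    have den: "0 < 1 - 2 powr (- (r / \<theta>))" using d by (simp add: powr_less_one)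
    have "(\<Sum>k\<in>I2. ?f k) \<le> (\<Sum>k\<in>I2. ennreal (2 powr (- (r / \<theta>) * real_of_int k)) * Kinf epowr r)"
      unfolding fr using rr(1) by (intro sum_mono mult_left_mono epowr_mono \<kappa>_le_Kinf) auto
    also have "\<dots> = ennreal (\<Sum>k\<in>I2. 2 powr (- (r / \<theta>) * real_of_int k)) * Kinf epowr r"
      by (simp add: sum_distrib_right sum_ennreal[symmetric] del: sum_ennreal)
    also have "(\<Sum>k\<in>I2. 2 powr (- (r / \<theta>) * real_of_int k)) = 2 powr (- (r / \<theta>) * real_of_int k0) * (\<Sum>k\<in>I2. 2 powr (- (r / \<theta>) * real_of_int (k - k0)))"
      by (simp add: sum_distrib_left powr_add[symmetric] algebra_simps)
    also have "ennreal \<dots> * Kinf epowr r \<le> ennreal (2 powr (3 * r / \<theta>) * e powr (r / \<theta>') * (1 / (1 - 2 powr (- (r / \<theta>))))) * Kinf epowr r"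
    proof (intro mult_right_mono ennreal_leI mult_mono)
      \<comment> \<open>Level \<open>k0 + 3\<close> is not exceeded by \<open>U\<close>, so the
        limit \<open>e\<close> dominates here; going back to \<open>k0\<close> costs
        \<open>2 powr (3 * r / \<theta>)\<close>.\<close>
      have "2 powr (- (real_of_int (k0 + 3) / \<theta>)) \<le> e powr (1 / \<theta>')"
        using k0(1) by (intro dead_e) (simp add: I2_def)
      then have "(2 powr (- (real_of_int (k0 + 3) / \<theta>))) powr r \<le> (e powr (1 / \<theta>')) powr r"
        using rr(1) by (intro powr_mono2) auto
      then have "2 powr (- (real_of_int (k0 + 3) / \<theta>) * r) \<le> e powr (r / \<theta>')"
        by (simp add: powr_powr)
      then have "2 powr (3 * r / \<theta>) * 2 powr (- (real_of_int (k0 + 3) / \<theta>) * r) \<le> 2 powr (3 * r / \<theta>) * e powr (r / \<theta>')"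
        by (intro mult_left_mono) auto
      moreover have "3 * r / \<theta> + - (real_of_int (k0 + 3) / \<theta>) * r = - (r / \<theta>) * real_of_int k0"
        by (simp add: algebra_simps add_divide_distrib)
      ultimately show "2 powr (- (r / \<theta>) * real_of_int k0) \<le> 2 powr (3 * r / \<theta>) * e powr (r / \<theta>')"
        by (simp only: powr_add[symmetric])
      show "(\<Sum>k\<in>I2. 2 powr (- (r / \<theta>) * real_of_int (k - k0))) \<le> 1 / (1 - 2 powr (- (r / \<theta>)))"
        using k0(2) d fin(2) by (intro sum_geometric_above) auto
    qed (use fin in \<open>auto intro!: sum_nonneg\<close>)
    also have "\<dots> = ennreal (2 powr (3 * r / \<theta>) / (1 - 2 powr (- (r / \<theta>)))) * B2 epowr r"
    proof -
      have "B2 epowr r = ennreal (e powr (r / \<theta>')) * Kinf epowr r"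
        unfolding B2_def using rr(1) e_nonneg by (simp add: epowr_mult epowr_ennreal_pos powr_powr)
      moreover have "2 powr (3 * r / \<theta>) * e powr (r / \<theta>') * (1 / (1 - 2 powr (- (r / \<theta>)))) = 2 powr (3 * r / \<theta>) / (1 - 2 powr (- (r / \<theta>))) * e powr (r / \<theta>')"
        by simp
      ultimately show ?thesis using den by (simp only: ennreal_mult'' powr_ge_zero mult.assoc)
    qed
    finally show ?thesis .
  qed simp
  show ?thesis unfolding split by (intro add_mono 1 2)
qed

text \<open>For x in block k + 1, thus between \<open>\<tau> (k + 1)\<close> and
  \<open>\<tau> (k + 2)\<close>, the value \<open>\<Psi> x\<close> dominates the partial sum of the
  weights up to k, and \<open>T x\<close> dominates the q-th root of
  \<open>N (\<tau> (k + 2))\<close>. The gap of two blocks is what leaves this block for the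
  integration.\<close>

lemma cross_sum:
  assumes r: "q < \<theta>" "1 / r = 1 / q - 1 / \<theta>"
  shows "(\<Sum>k=a..b - 2. ennreal ((\<Sum>i=a..k. wgt i powr \<theta>') powr (r / q') * wgt k powr \<theta>') * (\<Sum>i=k..b - 2. nU b i) epowr (r / q))
    \<le> ennreal (c1 powr (- (r / q' + 1))) * J r"
proof -
  note rr = r_exps[OF r]
  define I where "I = {k\<in>{a..b - 2}. live (k + 2)}"
  have fin: "finite I" by (auto simp: I_def intro: finite_subset[of _ "{a..b - 2}"])
  let ?W = "\<lambda>k. \<Sum>i=a..k. wgt i powr \<theta>'"
  let ?g = "\<lambda>k. ennreal (?W k powr (r / q') * wgt k powr \<theta>') * (\<Sum>i=k..b - 2. nU b i) epowr (r / q)"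
  define c where "c k = ennreal ((c1 * ?W k) powr (r / q')) * ennreal (m (\<tau> (k + 1)) powr (\<theta>' / p')) * ennreal (N (\<tau> (k + 2)) powr (r / q))" for k
  have W0: "0 \<le> ?W k" for k by (intro sum_nonneg) auto
  have "(\<Sum>k=a..b - 2. ?g k) = (\<Sum>k\<in>I. ?g k)"
  proof (rule sum.mono_neutral_right)
    show "\<forall>k\<in>{a..b - 2} - I. ?g k = 0"
    proof
      fix k assume "k \<in> {a..b - 2} - I"
      then have "(\<Sum>i=k..b - 2. nU b i) = 0" by (intro nU_dead) (auto simp: I_def)
      then show "?g k = 0" using rr q by simp
    qed
  qed (auto simp: I_def)
  also have "\<dots> = (\<Sum>k\<in>I. ennreal (c1 powr (- (r / q' + 1))) * (c k * emeasure \<beta> (U.blk (k + 1))))"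
  proof (intro sum.cong refl)
    fix k assume k: "k \<in> I"
    then have l: "live (k + 2)" "live (k + 1)" "k \<le> b - 2" using live_mono[of "k + 2" "k + 1"] by (auto simp: I_def)
    have "c1 powr (- (r / q' + 1)) * ((c1 * ?W k) powr (r / q') * m (\<tau> (k + 1)) powr (\<theta>' / p') * (c1 * 2 powr (real_of_int k * (1 - \<theta>'))))
       = ?W k powr (r / q') * wgt k powr \<theta>'"
    proof -
      have "c1 powr (- (r / q' + 1)) * (c1 powr (r / q') * c1 powr 1) = 1"
        unfolding powr_add[symmetric] using c1_pos by simp
      moreover have "c1 powr (- (r / q' + 1)) * ((c1 * ?W k) powr (r / q') * m (\<tau> (k + 1)) powr (\<theta>' / p') * (c1 * 2 powr (real_of_int k * (1 - \<theta>'))))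
        = (c1 powr (- (r / q' + 1)) * (c1 powr (r / q') * c1 powr 1)) * (?W k powr (r / q') * (2 powr (real_of_int k * (1 - \<theta>')) * m (\<tau> (k + 1)) powr (\<theta>' / p')))"
        using c1_pos by (simp only: powr_mult powr_one less_imp_le mult_ac)
      ultimately show ?thesis unfolding wgt_\<theta>'[OF l(2)] by simp
    qed
    then have "ennreal (?W k powr (r / q') * wgt k powr \<theta>') = ennreal (c1 powr (- (r / q' + 1))) * (ennreal ((c1 * ?W k) powr (r / q')) * ennreal (m (\<tau> (k + 1)) powr (\<theta>' / p')) * ennreal (c1 * 2 powr (real_of_int k * (1 - \<theta>'))))"
      using c1_pos by (simp add: ennreal_mult'[symmetric] ennreal_mult''[symmetric])
    moreover have "(\<Sum>i=k..b - 2. nU b i) epowr (r / q) = ennreal (N (\<tau> (k + 2)) powr (r / q))"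
      unfolding nU_live[OF l(3,1)] using N_nonneg[OF \<tau>(1)[OF l(1)]] rr q by (simp add: epowr_ennreal_pos)
    ultimately show "?g k = ennreal (c1 powr (- (r / q' + 1))) * (c k * emeasure \<beta> (U.blk (k + 1)))"
      unfolding c_def \<beta>_blk'[OF l(1)] by (simp only: mult_ac)
  qed
  also have "\<dots> = ennreal (c1 powr (- (r / q' + 1))) * (\<Sum>k\<in>I. c k * emeasure \<beta> (U.blk (k + 1)))"
    by (simp only: sum_distrib_left)
  also have "\<dots> \<le> ennreal (c1 powr (- (r / q' + 1))) * J r"
  proof (intro mult_left_mono J_ge fin)
    fix k x assume k: "k \<in> I" and x: "x \<in> U.blk (k + 1)"
    have l: "live (k + 2)" using k by (simp add: I_def)
    have l2: "live (k + 1)" "live (k + 1 + 1)" using live_mono[OF l] by auto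
    have x2: "\<tau> (k + 1) < x" "x \<le> \<tau> (k + 2)" using blk_bounds[OF l2(2) x] by (simp_all add: add.assoc)
    have x0: "0 < x" using x by (rule U.blk_pos)
    show "c k \<le> \<Psi> x epowr (r / q') * ennreal (m x powr (\<theta>' / p')) * T x epowr r"
      unfolding c_def
    proof (intro mult_mono)
      have "ennreal (c1 * ?W k) epowr (r / q') \<le> \<Psi> x epowr (r / q')"
        using rr(1) q'1 x2 by (intro epowr_mono \<Psi>_lower l) auto
      then show "ennreal ((c1 * ?W k) powr (r / q')) \<le> \<Psi> x epowr (r / q')"
        using c1_pos W0[of k] rr(1) q'1 by (simp only: epowr_ennreal_pos mult_nonneg_nonneg less_imp_le divide_pos_pos less_trans[OF zero_less_one])
      show "ennreal (m (\<tau> (k + 1)) powr (\<theta>' / p')) \<le> ennreal (m x powr (\<theta>' / p'))"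
        using \<theta>_exps(4) x2 monoD[OF m.mono, of "\<tau> (k + 1)" x] m.pos[OF \<tau>(1)[OF l2(1)]]
        by (intro ennreal_leI powr_mono2) auto
      have "ennreal (N (\<tau> (k + 2)) powr (1 / q)) \<le> T x"
        by (rule order.trans[OF N_T[OF \<tau>(1)[OF l]] T_anti[OF x0 x2(2)]])
      then have "ennreal (N (\<tau> (k + 2)) powr (1 / q)) epowr r \<le> T x epowr r"
        using rr(1) by (intro epowr_mono) auto
      then show "ennreal (N (\<tau> (k + 2)) powr (r / q)) \<le> T x epowr r"
        using rr(1) by (simp add: epowr_ennreal_pos powr_powr)
    qed auto
  qed simp
  finally show ?thesis .
qed

definition Clarge :: "real \<Rightarrow> real" where
  "Clarge r = 2 powr q * (Cu * 2 powr (q / p) * (1 + 2 powr (q / \<theta>))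
       * (max (1 / cin r) (2 powr (3 * r / \<theta>) / (1 - 2 powr (- (r / \<theta>)))) * 2) powr (q / r)
     + hardyC \<theta> q * c1 powr (- (r / q' + 1) * (q / r))) * 2 powr (q / \<theta>)"

text \<open>Hoelder's inequality with exponents r/q and \<theta>/q takes the place of the comparison
  of power sums, and the discrete Hardy inequality for q < \<theta> that of the one for \<theta>
  \<le> q.\<close>

theorem upper_large:
  assumes r: "q < \<theta>" "1 / r = 1 / q - 1 / \<theta>" and [measurable]: "h \<in> borel_measurable \<mu>"
  shows "L h \<le> ennreal (Clarge r) * (J r epowr (1 / r) + B2) epowr q * D h epowr (q / \<theta>)"
proof -
  note rr = r_exps[OF r]
  define B1 where "B1 = J r epowr (1 / r)"
  have JB: "J r = B1 epowr r" using rr(1) by (simp add: B1_def)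
  let ?B = "(B1 + B2) epowr q"
  define M where "M = max (1 / cin r) (2 powr (3 * r / \<theta>) / (1 - 2 powr (- (r / \<theta>)))) * 2"
  have cin: "0 < cin r" using c0_pos by (simp add: cin_def)
  then have M: "0 < M" unfolding M_def by (simp add: less_max_iff_disj)
  have inB: "ennreal (1 / cin r) * J r + ennreal (2 powr (3 * r / \<theta>) / (1 - 2 powr (- (r / \<theta>)))) * B2 epowr r
     \<le> ennreal M * (B1 + B2) epowr r"
  proof -
    have "ennreal (1 / cin r) * J r + ennreal (2 powr (3 * r / \<theta>) / (1 - 2 powr (- (r / \<theta>)))) * B2 epowr r
      \<le> ennreal (M / 2) * (B1 + B2) epowr r + ennreal (M / 2) * (B1 + B2) epowr r"
      unfolding JB using rr(1) by (intro add_mono mult_mono epowr_mono ennreal_leI) (auto simp: M_def)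
    also have "\<dots> = ennreal M * (B1 + B2) epowr r"
      using M by (simp add: distrib_right[symmetric] ennreal_plus[symmetric] del: ennreal_plus)
    finally show ?thesis .
  qed
  have pw: "(ennreal M * (B1 + B2) epowr r) epowr (q / r) = ennreal (M powr (q / r)) * ?B"
    using rr(1) q M by (simp add: epowr_mult epowr_ennreal)
  have "L h \<le> ennreal (2 powr q) * (ennreal (Cu * 2 powr (q / p) * (1 + 2 powr (q / \<theta>))) * (ennreal (M powr (q / r)) * ?B)
      + ennreal (hardyC \<theta> q * c1 powr (- (r / q' + 1) * (q / r))) * ?B) * (2 * D h) epowr (q / \<theta>)"
  proof (rule upper_core)
    fix a b :: int and d :: "int \<Rightarrow> ennreal"
    let ?I = "{k\<in>{a..b}. live k}"
    let ?x = "\<lambda>k. \<kappa> k * ennreal (2 powr (- (real_of_int k / \<theta>)))"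
    have fin: "finite ?I" by (auto intro: finite_subset[of _ "{a..b}"])
    have e: "1 < r / q" "1 / (r / q) + 1 / (\<theta> / q) = 1" using rr by auto
    have "(\<Sum>k\<in>?I. ?x k epowr q * d k epowr q) \<le> (\<Sum>k\<in>?I. (?x k epowr q) epowr (r / q)) epowr (1 / (r / q)) * (\<Sum>k\<in>?I. (d k epowr q) epowr (\<theta> / q)) epowr (1 / (\<theta> / q))"
      by (rule sum_Hoelder_ennreal[OF fin e])
    also have "\<dots> = (\<Sum>k\<in>?I. ?x k epowr r) epowr (q / r) * (\<Sum>k\<in>?I. d k epowr \<theta>) epowr (q / \<theta>)"
      using q by simp
    also have "\<dots> \<le> (ennreal M * (B1 + B2) epowr r) epowr (q / r) * (\<Sum>k=a..b. d k epowr \<theta>) epowr (q / \<theta>)"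
    proof (intro mult_mono epowr_mono)
      show "(\<Sum>k\<in>?I. ?x k epowr r) \<le> ennreal M * (B1 + B2) epowr r"
        by (rule order.trans[OF inblock_sum[OF r] inB])
      show "(\<Sum>k\<in>?I. d k epowr \<theta>) \<le> (\<Sum>k=a..b. d k epowr \<theta>)" by (intro sum_mono2) auto
    qed (use rr(1) q \<theta> in auto)
    finally show "(\<Sum>k\<in>?I. ?x k epowr q * d k epowr q) \<le> ennreal (M powr (q / r)) * ?B * (\<Sum>k=a..b. d k epowr \<theta>) epowr (q / \<theta>)"
      unfolding pw .
  next
    fix a b :: int and d :: "int \<Rightarrow> ennreal"
    have "(\<Sum>k=a..b - 2. nU b k * (\<Sum>i=a..k. ennreal (wgt i) * d i) epowr q)
       \<le> ennreal (hardyC \<theta> q) * (ennreal (c1 powr (- (r / q' + 1))) * (B1 + B2) epowr r) epowr (q / r) * (\<Sum>k=a..b - 2. d k epowr \<theta>) epowr (q / \<theta>)"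
    proof (rule hardy_upper_gt[where s' = \<theta>' and q' = q'])
      have "J r \<le> (B1 + B2) epowr r" unfolding JB using rr(1) by (intro epowr_mono) auto
      then show "(\<Sum>k=a..b - 2. ennreal ((\<Sum>i=a..k. wgt i powr \<theta>') powr (r / q') * wgt k powr \<theta>') * (\<Sum>i=k..b - 2. nU b i) epowr (r / q))
        \<le> ennreal (c1 powr (- (r / q' + 1))) * (B1 + B2) epowr r"
        by (intro order.trans[OF cross_sum[OF r]] mult_left_mono) auto
    qed (use \<theta> q r nU_finite wgt_pos in auto)
    also have "(ennreal (c1 powr (- (r / q' + 1))) * (B1 + B2) epowr r) epowr (q / r) = ennreal (c1 powr (- (r / q' + 1) * (q / r))) * ?B"
      using rr(1) q c1_pos by (simp only: epowr_mult divide_pos_pos less_trans[OF zero_less_one]) (simp add: epowr_ennreal powr_powr)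
    also have "ennreal (hardyC \<theta> q) * (ennreal (c1 powr (- (r / q' + 1) * (q / r))) * ?B) = ennreal (hardyC \<theta> q * c1 powr (- (r / q' + 1) * (q / r))) * ?B"
      by (simp only: ennreal_mult'' powr_ge_zero mult.assoc)
    finally show "(\<Sum>k=a..b - 2. nU b k * (\<Sum>i=a..k. ennreal (wgt i) * d i) epowr q)
        \<le> ennreal (hardyC \<theta> q * c1 powr (- (r / q' + 1) * (q / r))) * ?B * (\<Sum>k=a..b - 2. d k epowr \<theta>) epowr (q / \<theta>)" .
  qed auto
  also have "(2 * D h) epowr (q / \<theta>) = ennreal (2 powr (q / \<theta>)) * D h epowr (q / \<theta>)"
    using q \<theta> epowr_ennreal[of 2 "q / \<theta>"] by (simp add: epowr_mult)
  also have "ennreal (2 powr q) * (ennreal (Cu * 2 powr (q / p) * (1 + 2 powr (q / \<theta>))) * (ennreal (M powr (q / r)) * ?B)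
      + ennreal (hardyC \<theta> q * c1 powr (- (r / q' + 1) * (q / r))) * ?B) * (ennreal (2 powr (q / \<theta>)) * D h epowr (q / \<theta>))
    = ennreal (Clarge r) * ?B * D h epowr (q / \<theta>)"
  proof -
    have "ennreal (Cu * 2 powr (q / p) * (1 + 2 powr (q / \<theta>))) * (ennreal (M powr (q / r)) * ?B) + ennreal (hardyC \<theta> q * c1 powr (- (r / q' + 1) * (q / r))) * ?B
      = ennreal (Cu * 2 powr (q / p) * (1 + 2 powr (q / \<theta>)) * M powr (q / r) + hardyC \<theta> q * c1 powr (- (r / q' + 1) * (q / r))) * ?B"
      using C_pos \<theta> q by (subst ennreal_plus) (auto simp: distrib_right ennreal_mult'' mult.assoc intro!: mult_nonneg_nonneg hardyC_nonneg)
    then show ?thesis using C_pos \<theta> q hardyC_nonneg[of \<theta> q]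
      by (simp add: Clarge_def M_def ennreal_mult mult_ac)
  qed
  finally show ?thesis unfolding B1_def .
qed

end

section \<open>Lower bounds\<close>

context cope_beta
begin

text \<open>Finiteness of \<open>D h\<close> stands for membership in the Copson space.\<close>

definition feasible :: "ennreal \<Rightarrow> bool" where
  "feasible c \<longleftrightarrow> (\<forall>h\<in>borel_measurable \<mu>. D h < top \<longrightarrow> L h \<le> c epowr q * D h epowr (q / \<theta>))"

lemma AE_\<nu>1: "AE s in \<nu>1. 0 < s"
  using U_le[of 0] U.zero by (intro AE_I[of _ _ "{..0}"]) auto

lemma \<nu>1_sublevel: assumes "0 < c" shows "emeasure \<nu>1 {t. U t \<le> c} \<le> ennreal c"
proof (cases "\<exists>x. c < U x")
  case True
  then obtain x where x: "c < U x" by auto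
  obtain t where t: "U t = c" "\<And>s. c < U s \<longleftrightarrow> t < s" using U.level[OF assms x] by auto
  then have "{t. U t \<le> c} = {..t}"
    by (intro set_eqI) (simp only: mem_Collect_eq atMost_iff not_less[symmetric])
  then show ?thesis using t U_le[of t] by simp
next
  case False
  have "emeasure \<nu>1 {t. U t \<le> c} \<le> emeasure \<nu>1 (\<Union>n::nat. {..real n})"
    using real_arch_simple by (intro emeasure_mono) auto
  also have "\<dots> = (SUP n::nat. emeasure \<nu>1 {..real n})"
    by (intro SUP_emeasure_incseq[symmetric]) (auto simp: incseq_def)
  also have "\<dots> \<le> ennreal c"
    using False by (intro SUP_least) (auto simp: U_le not_less intro!: ennreal_leI)
  finally show ?thesis .
qed

text \<open>A function of norm at most 1 that vanishes from x on has \<open>\<Phi> \<le> 1\<close>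
  up to x and \<open>\<Phi> = 0\<close> after it, so \<open>D\<close> is at most
  \<open>U x\<close>.\<close>

lemma K_feasible:
  assumes c: "feasible c" and x: "0 < x"
  shows "K x * ennreal (U x powr (- (1 / \<theta>))) \<le> ennreal (Cl powr (1 / q)) * c"
proof -
  have Ux: "0 < U x" by (rule U.pos[OF x])
  have *: "K x \<le> ennreal (Cl powr (1 / q)) * c * ennreal (U x powr (1 / \<theta>))"
  proof (rule dense_le)
    fix \<kappa>' assume "\<kappa>' < K x"
    then have "\<kappa>' < ennreal (m x powr (1 / p')) * T x" by (simp only: K_def)
    from lower[OF x this] obtain G where G: "G \<in> borel_measurable borel" "\<kappa>' epowr q \<le> ennreal Cl * (\<integral>\<^sup>+t. G t epowr q \<partial>\<nu>2)"
      "\<forall>y. 0 < y \<longrightarrow> y \<le> x \<longrightarrow> (\<exists>h\<in>borel_measurable borel. (\<forall>s\<ge>y. h s = 0) \<and> Lp UNIV h \<le> 1 \<and>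
            (\<forall>t. ennreal ((m y / m x) powr (1 / p')) * G t \<le> F h t))"
      by (elim bexE conjE) (rule that)
    from G(3)[rule_format, OF x order_refl] obtain h where h: "h \<in> borel_measurable borel" "\<forall>s\<ge>x. h s = 0" "Lp UNIV h \<le> 1"
      "\<forall>t. ennreal ((m x / m x) powr (1 / p')) * G t \<le> F h t" by (elim bexE conjE) (rule that)
    have GF: "G t \<le> F h t" for t using h(4)[rule_format, of t] m.pos[OF x] by simp
    have \<Phi>h: "\<Phi> h t epowr (\<theta> / p) \<le> indicator {..x} t" for t
    proof (cases "t \<le> x")
      case True
      have "\<Phi> h t \<le> Lp UNIV h" unfolding \<Phi>_def Lp_def by (intro nn_integral_mono) (auto split: split_indicator)
      then have "\<Phi> h t epowr (\<theta> / p) \<le> 1 epowr (\<theta> / p)" using h(3) \<theta> p by (intro epowr_mono) auto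
      then show ?thesis using True by simp
    next
      case False
      have "\<Phi> h t = (\<integral>\<^sup>+s. 0 \<partial>\<mu>)" unfolding \<Phi>_def
        using False h(2) p by (intro nn_integral_cong) (auto split: split_indicator)
      then show ?thesis using \<theta> p by simp
    qed
    have "D h \<le> (\<integral>\<^sup>+t. indicator {..x} t \<partial>\<nu>1)"
      unfolding D_def by (intro nn_integral_mono \<Phi>h)
    then have Dh: "D h \<le> ennreal (U x)" by (simp add: U_le)
    then have "D h < top" by (rule le_less_trans) simp
    then have Lh: "L h \<le> c epowr q * D h epowr (q / \<theta>)" using c h(1) unfolding feasible_def by auto
    have "\<kappa>' epowr q \<le> ennreal Cl * L h"
      unfolding L_def using GF q by (intro order.trans[OF G(2)] mult_left_mono nn_integral_mono epowr_mono) auto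
    also have "\<dots> \<le> ennreal Cl * (c epowr q * ennreal (U x) epowr (q / \<theta>))"
      using q \<theta> Dh by (intro mult_left_mono order.trans[OF Lh] epowr_mono) auto
    also have "\<dots> = (ennreal (Cl powr (1 / q)) * c * ennreal (U x powr (1 / \<theta>))) epowr q"
      using q \<theta> C_pos Ux by (simp add: epowr_mult epowr_ennreal powr_powr mult.assoc)
    finally show "\<kappa>' \<le> ennreal (Cl powr (1 / q)) * c * ennreal (U x powr (1 / \<theta>))"
      using q by (simp add: epowr_le_cancel)
  qed
  have "K x * ennreal (U x powr (- (1 / \<theta>))) \<le> (ennreal (Cl powr (1 / q)) * c * ennreal (U x powr (1 / \<theta>))) * ennreal (U x powr (- (1 / \<theta>)))"
    by (intro mult_right_mono *) simp
  also have "\<dots> = ennreal (Cl powr (1 / q)) * c"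
  proof -
    have "ennreal (U x powr (1 / \<theta>)) * ennreal (U x powr (- (1 / \<theta>))) = 1"
      using Ux by (simp add: ennreal_mult''[symmetric] powr_add[symmetric])
    then show ?thesis by (simp only: mult.assoc mult_1_right)
  qed
  finally show ?thesis .
qed

lemma K_finite: assumes "feasible c" "c < top" "0 < x" shows "K x < top"
proof (rule ccontr)
  assume "\<not> K x < top"
  then have "K x = top" by (simp add: not_less top_unique)
  then have "top \<le> ennreal (Cl powr (1 / q)) * c"
    using K_feasible[OF assms(1,3)] U.pos[OF assms(3)] by (simp add: ennreal_top_mult)
  then show False using assms(2) by (auto simp: top_unique ennreal_mult_eq_top_iff)
qed

lemma B2_le: assumes "feasible c" shows "B2 \<le> ennreal (Cl powr (1 / q)) * c"
proof -
  have "B2 = (SUP x\<in>{0<..}. ennreal (e powr (1 / \<theta>')) * K x)"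
    unfolding B2_def Kinf_def by (rule SUP_mult_left_ennreal)
  also have "\<dots> \<le> ennreal (Cl powr (1 / q)) * c"
  proof (rule SUP_least)
    fix x :: real assume "x \<in> {0<..}"
    then have x: "0 < x" by simp
    have "e powr (1 / \<theta>') \<le> (U x powr (1 - \<theta>')) powr (1 / \<theta>')"
      using e_le[OF x] e_nonneg \<theta>_exps(3) by (intro powr_mono2) auto
    also have "\<dots> = U x powr (- (1 / \<theta>))" by (simp only: powr_powr \<theta>_exps(1))
    finally have "ennreal (e powr (1 / \<theta>')) * K x \<le> ennreal (U x powr (- (1 / \<theta>))) * K x"
      by (intro mult_right_mono ennreal_leI) auto
    also have "\<dots> \<le> ennreal (Cl powr (1 / q)) * c" using K_feasible[OF assms x] by (simp add: mult.commute)
    finally show "ennreal (e powr (1 / \<theta>')) * K x \<le> ennreal (Cl powr (1 / q)) * c" .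
  qed
  finally show ?thesis .
qed

section \<open>Superpositions of test functions\<close>

lemma Lp_convex:
  fixes a :: "'j \<Rightarrow> real"
  assumes Js: "finite Js" and [measurable]: "\<And>j. j \<in> Js \<Longrightarrow> g j \<in> borel_measurable \<mu>"
    and a: "\<And>j. 0 \<le> a j" and g: "\<And>j. j \<in> Js \<Longrightarrow> Lp UNIV (g j) \<le> 1"
  shows "Lp UNIV (\<lambda>s. \<Sum>j\<in>Js. ennreal (a j) * g j s) \<le> (\<Sum>j\<in>Js. ennreal (a j)) epowr p"
proof -
  let ?S = "\<Sum>j\<in>Js. ennreal (a j)"
  have pp: "p / p' = p - 1" by (rule conj_exp(3)[OF p])
  have pt: "(\<Sum>j\<in>Js. ennreal (a j) * g j s) epowr p \<le> ?S epowr (p - 1) * (\<Sum>j\<in>Js. ennreal (a j) * g j s epowr p)" for s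
  proof -
    \<comment> \<open>Minkowski's inequality by way of Hoelder's: the coefficient is split into its
      powers of order 1/p' and 1/p.\<close>
    have "(\<Sum>j\<in>Js. ennreal (a j) * g j s) = (\<Sum>j\<in>Js. ennreal (a j) epowr (1 / p') * (ennreal (a j) epowr (1 / p) * g j s))"
    proof (intro sum.cong refl)
      fix j
      have "1 / p' + 1 / p = 1" "0 < 1 / p'" "0 < 1 / p" using p p'1 by auto
      then have "ennreal (a j) epowr (1 / p') * ennreal (a j) epowr (1 / p) = ennreal (a j)"
        using epowr_add[of "1 / p'" "1 / p" "ennreal (a j)"] by simp
      then show "ennreal (a j) * g j s = ennreal (a j) epowr (1 / p') * (ennreal (a j) epowr (1 / p) * g j s)"
        by (simp add: mult.assoc[symmetric])
    qed
    also have "\<dots> \<le> (\<Sum>j\<in>Js. (ennreal (a j) epowr (1 / p')) epowr p') epowr (1 / p') * (\<Sum>j\<in>Js. (ennreal (a j) epowr (1 / p) * g j s) epowr p) epowr (1 / p)"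
      using Js p p'1 by (intro sum_Hoelder_ennreal) auto
    also have "\<dots> = ?S epowr (1 / p') * (\<Sum>j\<in>Js. ennreal (a j) * g j s epowr p) epowr (1 / p)"
      using p p'1 by (simp add: epowr_mult)
    finally have "(\<Sum>j\<in>Js. ennreal (a j) * g j s) epowr p \<le> (?S epowr (1 / p') * (\<Sum>j\<in>Js. ennreal (a j) * g j s epowr p) epowr (1 / p)) epowr p"
      using p by (intro epowr_mono) auto
    also have "\<dots> = ?S epowr (p - 1) * (\<Sum>j\<in>Js. ennreal (a j) * g j s epowr p)"
      using p by (simp add: epowr_mult pp)
    finally show ?thesis .
  qed
  have "Lp UNIV (\<lambda>s. \<Sum>j\<in>Js. ennreal (a j) * g j s) \<le> (\<integral>\<^sup>+s. ?S epowr (p - 1) * (\<Sum>j\<in>Js. ennreal (a j) * g j s epowr p) \<partial>\<mu>)"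
    unfolding Lp_def using pt by (intro nn_integral_mono) simp
  also have "\<dots> = ?S epowr (p - 1) * (\<integral>\<^sup>+s. (\<Sum>j\<in>Js. ennreal (a j) * g j s epowr p) \<partial>\<mu>)"
    by (intro nn_integral_cmult) measurable
  also have "(\<integral>\<^sup>+s. (\<Sum>j\<in>Js. ennreal (a j) * g j s epowr p) \<partial>\<mu>) = (\<Sum>j\<in>Js. ennreal (a j) * Lp UNIV (g j))"
    unfolding Lp_def by (subst nn_integral_sum) (auto simp: nn_integral_cmult)
  also have "?S epowr (p - 1) * (\<Sum>j\<in>Js. ennreal (a j) * Lp UNIV (g j)) \<le> ?S epowr (p - 1) * ?S"
  proof (intro mult_left_mono sum_mono)
    fix j assume "j \<in> Js"
    then show "ennreal (a j) * Lp UNIV (g j) \<le> ennreal (a j)" using mult_left_mono[OF g, of j "ennreal (a j)"] by simp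
  qed simp
  also have "\<dots> = ?S epowr p"
    using epowr_add[of "p - 1" 1 ?S] p by simp
  finally show ?thesis .
qed

text \<open>Comparable with (2^i / U)^(1/2) on the set where 0 < U \<le> 2^(i+1). This power is
  \<nu>1-integrable there, with integral of order 2^i. The form as a supremum of finite sums suits
  monotone convergence.\<close>

definition gfun :: "int \<Rightarrow> real \<Rightarrow> ennreal" where
  "gfun i t = (SUP n. \<Sum>k=i - int n..i. ennreal (2 powr (real_of_int (i - k) / 2)) * indicator (U.blk k) t)"

lemma gfun_ge: assumes "t \<in> U.blk k" "k \<le> i" shows "ennreal (2 powr (real_of_int (i - k) / 2)) \<le> gfun i t"
proof -
  have "ennreal (2 powr (real_of_int (i - k) / 2)) = (\<Sum>k=i - int (nat (i - k))..i. ennreal (2 powr (real_of_int (i - k) / 2)) * indicator (U.blk k) t)"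
    using assms by (subst U.sum_blk[OF _ assms(1)]) auto
  also have "\<dots> \<le> gfun i t" unfolding gfun_def by (rule SUP_upper) simp
  finally show ?thesis .
qed

text \<open>The 2 comes from bounding the \<nu>1-mass of block k by \<open>2 powr (k + 1)\<close>,
  the rest from a geometric series of ratio 2^(-1/2).\<close>

definition gC :: real where "gC = 2 / (1 - 2 powr (- (1 / 2)))"

lemma gfun_int: "(\<integral>\<^sup>+t. gfun i t \<partial>\<nu>1) \<le> ennreal (gC * 2 powr real_of_int i)"
proof -
  have "(\<integral>\<^sup>+t. gfun i t \<partial>\<nu>1) = (SUP n. \<integral>\<^sup>+t. (\<Sum>k=i - int n..i. ennreal (2 powr (real_of_int (i - k) / 2)) * indicator (U.blk k) t) \<partial>\<nu>1)"
    unfolding gfun_def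
  proof (rule nn_integral_monotone_convergence_SUP)
    show "incseq (\<lambda>n t. \<Sum>k=i - int n..i. ennreal (2 powr (real_of_int (i - k) / 2)) * indicator (U.blk k) t)"
      by (intro incseq_SucI le_funI sum_mono2) auto
  qed measurable
  also have "\<dots> \<le> ennreal (gC * 2 powr real_of_int i)"
  proof (rule SUP_least)
    fix n :: nat
    have "(\<integral>\<^sup>+t. (\<Sum>k=i - int n..i. ennreal (2 powr (real_of_int (i - k) / 2)) * indicator (U.blk k) t) \<partial>\<nu>1)
      = (\<Sum>k=i - int n..i. ennreal (2 powr (real_of_int (i - k) / 2)) * emeasure \<nu>1 (U.blk k))"
      by (subst nn_integral_sum) (auto simp: nn_integral_cmult)
    also have "\<dots> \<le> (\<Sum>k=i - int n..i. ennreal (2 * 2 powr (real_of_int i / 2) * 2 powr (1 / 2 * real_of_int k)))"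
    proof (intro sum_mono)
      fix k
      have "emeasure \<nu>1 (U.blk k) \<le> emeasure \<nu>1 {t. U t \<le> 2 powr real_of_int (k + 1)}"
        unfolding U.blk_def by (intro emeasure_mono) auto
      also have "\<dots> \<le> ennreal (2 powr real_of_int (k + 1))" by (intro \<nu>1_sublevel) simp
      finally have "ennreal (2 powr (real_of_int (i - k) / 2)) * emeasure \<nu>1 (U.blk k) \<le> ennreal (2 powr (real_of_int (i - k) / 2)) * ennreal (2 powr real_of_int (k + 1))"
        by (intro mult_left_mono) auto
      also have "\<dots> = ennreal (2 * 2 powr (real_of_int i / 2) * 2 powr (1 / 2 * real_of_int k))"
      proof -
        have "real_of_int (i - k) / 2 + real_of_int (k + 1) = 1 + real_of_int i / 2 + 1 / 2 * real_of_int k" by (simp add: field_simps)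
        then have "2 powr (real_of_int (i - k) / 2) * 2 powr real_of_int (k + 1) = 2 powr 1 * 2 powr (real_of_int i / 2) * 2 powr (1 / 2 * real_of_int k)"
          by (simp only: powr_add[symmetric])
        then show ?thesis by (simp add: ennreal_mult''[symmetric])
      qed
      finally show "ennreal (2 powr (real_of_int (i - k) / 2)) * emeasure \<nu>1 (U.blk k) \<le> ennreal (2 * 2 powr (real_of_int i / 2) * 2 powr (1 / 2 * real_of_int k))" .
    qed
    also have "\<dots> = ennreal (2 * 2 powr (real_of_int i / 2) * (\<Sum>k=i - int n..i. 2 powr (1 / 2 * real_of_int k)))"
      by (simp add: sum_distrib_left)
    also have "\<dots> \<le> ennreal (2 * 2 powr (real_of_int i / 2) * (2 powr (1 / 2 * real_of_int i) / (1 - 2 powr (- (1 / 2)))))"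
      by (intro ennreal_leI mult_left_mono sum_geometric_below) auto
    also have "2 * 2 powr (real_of_int i / 2) * (2 powr (1 / 2 * real_of_int i) / (1 - 2 powr (- (1 / 2)))) = gC * 2 powr real_of_int i"
    proof -
      have "2 powr (real_of_int i / 2) * 2 powr (1 / 2 * real_of_int i) = 2 powr real_of_int i"
        by (simp add: powr_add[symmetric])
      then show ?thesis by (simp add: gC_def)
    qed
    finally show "(\<integral>\<^sup>+t. (\<Sum>k=i - int n..i. ennreal (2 powr (real_of_int (i - k) / 2)) * indicator (U.blk k) t) \<partial>\<nu>1) \<le> ennreal (gC * 2 powr real_of_int i)" .
  qed
  finally show ?thesis .
qed

definition DC :: real where
  "DC = geoC p (p / (4 * \<theta>)) powr (\<theta> / p) * geoC (\<theta> / p) (1 / 4) * gC"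

lemma geoC_pos: "0 < a \<Longrightarrow> 0 < \<epsilon> \<Longrightarrow> 0 < geoC a \<epsilon>"
  by (auto simp: geoC_def powr_less_one)

text \<open>For t in block k only the pieces i \<ge> k are seen beyond t.
  \<open>epowr_sum_geometric\<close> is used twice, for the powers p and \<theta>/p;
  \<open>?\<epsilon>\<close> is such that the first loss, raised to \<theta>/p, equals the second
  one, 2^((i-k)/4). The total loss 2^((i-k)/2) is absorbed by \<open>gfun\<close>, whose integral
  cancels the weights 2^(-i).\<close>

lemma D_superposition:
  fixes g :: "int \<Rightarrow> real \<Rightarrow> ennreal"
  assumes I: "finite I" and [measurable]: "\<And>i. i \<in> I \<Longrightarrow> g i \<in> borel_measurable \<mu>"
    and supp: "\<And>i s. i \<in> I \<Longrightarrow> g i s \<noteq> 0 \<Longrightarrow> U s \<le> 2 powr real_of_int (i + 1)"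
    and g: "\<And>i. i \<in> I \<Longrightarrow> Lp UNIV (g i) \<le> S i epowr p"
  shows "D (\<lambda>s. \<Sum>i\<in>I. ennreal (2 powr (- (real_of_int i / \<theta>))) * g i s) \<le> ennreal DC * (\<Sum>i\<in>I. S i epowr \<theta>)"
proof -
  let ?h = "\<lambda>s. \<Sum>i\<in>I. ennreal (2 powr (- (real_of_int i / \<theta>))) * g i s"
  let ?c = "\<lambda>i. ennreal (2 powr (- (real_of_int i / \<theta>)))"
  let ?\<epsilon> = "p / (4 * \<theta>)"
  have \<epsilon>: "0 < ?\<epsilon>" "0 < p" "0 < \<theta> / p" using p \<theta> by auto
  let ?C = "ennreal (geoC p ?\<epsilon> powr (\<theta> / p) * geoC (\<theta> / p) (1 / 4))"
  have pt: "\<Phi> ?h t epowr (\<theta> / p) \<le> (\<Sum>i\<in>I. ?C * (ennreal (2 powr (- real_of_int i)) * S i epowr \<theta>) * gfun i t)" if t: "0 < t" for t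
  proof -
    obtain k where k: "t \<in> U.blk k" using t by (rule U.blk_ex)
    let ?I = "{i\<in>I. k \<le> i}"
    have fin: "finite ?I" "?I \<subseteq> {k..}" using I by auto
    have "\<Phi> ?h t \<le> (\<integral>\<^sup>+s. ennreal (geoC p ?\<epsilon>) * (\<Sum>i\<in>?I. ennreal (2 powr (?\<epsilon> * real_of_int (i - k))) * (?c i * g i s) epowr p) \<partial>\<mu>)"
      unfolding \<Phi>_def
    proof (rule nn_integral_mono)
      fix s
      show "?h s epowr p * indicator {t<..} s \<le> ennreal (geoC p ?\<epsilon>) * (\<Sum>i\<in>?I. ennreal (2 powr (?\<epsilon> * real_of_int (i - k))) * (?c i * g i s) epowr p)"
      proof (cases "t < s")
        case True
        have "?h s = (\<Sum>i\<in>?I. ?c i * g i s)"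
        proof (rule sum.mono_neutral_right[OF I])
          show "\<forall>i\<in>I - ?I. ?c i * g i s = 0"
          proof
            fix i assume i: "i \<in> I - ?I"
            have "g i s = 0"
            proof (rule ccontr)
              assume "g i s \<noteq> 0"
              then have "U s \<le> 2 powr real_of_int (i + 1)" using supp i by blast
              moreover have "2 powr real_of_int (i + 1) \<le> 2 powr real_of_int k" using i by (intro powr_mono) auto
              ultimately show False using k True monoD[OF U.mono, of t s] unfolding U.blk_def mem_Collect_eq by linarith
            qed
            then show "?c i * g i s = 0" by simp
          qed
        qed auto
        then have "?h s epowr p \<le> ennreal (geoC p ?\<epsilon>) * (\<Sum>i\<in>?I. ennreal (2 powr (?\<epsilon> * real_of_int (i - k))) * (?c i * g i s) epowr p)"
          using epowr_sum_geometric[OF fin \<epsilon>(2,1), of "\<lambda>i. ?c i * g i s"] by simp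
        then show ?thesis using True by simp
      qed simp
    qed
    also have "\<dots> = ennreal (geoC p ?\<epsilon>) * (\<Sum>i\<in>?I. ennreal (2 powr (?\<epsilon> * real_of_int (i - k))) * (?c i epowr p * Lp UNIV (g i)))"
    proof -
      have "(\<integral>\<^sup>+s. ennreal (geoC p ?\<epsilon>) * (\<Sum>i\<in>?I. ennreal (2 powr (?\<epsilon> * real_of_int (i - k))) * (?c i * g i s) epowr p) \<partial>\<mu>)
        = ennreal (geoC p ?\<epsilon>) * (\<integral>\<^sup>+s. (\<Sum>i\<in>?I. ennreal (2 powr (?\<epsilon> * real_of_int (i - k))) * (?c i * g i s) epowr p) \<partial>\<mu>)"
        by (intro nn_integral_cmult) measurable
      also have "(\<integral>\<^sup>+s. (\<Sum>i\<in>?I. ennreal (2 powr (?\<epsilon> * real_of_int (i - k))) * (?c i * g i s) epowr p) \<partial>\<mu>)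
        = (\<Sum>i\<in>?I. \<integral>\<^sup>+s. ennreal (2 powr (?\<epsilon> * real_of_int (i - k))) * (?c i * g i s) epowr p \<partial>\<mu>)"
        by (intro nn_integral_sum) measurable
      also have "\<dots> = (\<Sum>i\<in>?I. ennreal (2 powr (?\<epsilon> * real_of_int (i - k))) * (?c i epowr p * Lp UNIV (g i)))"
        unfolding Lp_def using \<epsilon>(2) by (intro sum.cong refl) (simp add: nn_integral_cmult epowr_mult mult.assoc)
      finally show ?thesis .
    qed
    also have "\<dots> \<le> ennreal (geoC p ?\<epsilon>) * (\<Sum>i\<in>?I. ennreal (2 powr (?\<epsilon> * real_of_int (i - k))) * (?c i epowr p * S i epowr p))"
      using g by (intro mult_left_mono sum_mono) auto
    finally have "\<Phi> ?h t epowr (\<theta> / p) \<le> (ennreal (geoC p ?\<epsilon>) * (\<Sum>i\<in>?I. ennreal (2 powr (?\<epsilon> * real_of_int (i - k))) * (?c i epowr p * S i epowr p))) epowr (\<theta> / p)"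
      using \<epsilon> by (intro epowr_mono) auto
    also have "\<dots> = ennreal (geoC p ?\<epsilon> powr (\<theta> / p)) * (\<Sum>i\<in>?I. ennreal (2 powr (?\<epsilon> * real_of_int (i - k))) * (?c i epowr p * S i epowr p)) epowr (\<theta> / p)"
      using \<epsilon> geoC_pos[of p ?\<epsilon>] by (simp add: epowr_mult epowr_ennreal)
    also have "\<dots> \<le> ennreal (geoC p ?\<epsilon> powr (\<theta> / p)) * (ennreal (geoC (\<theta> / p) (1 / 4)) * (\<Sum>i\<in>?I. ennreal (2 powr (1 / 4 * real_of_int (i - k))) *
        (ennreal (2 powr (?\<epsilon> * real_of_int (i - k))) * (?c i epowr p * S i epowr p)) epowr (\<theta> / p)))"
      by (intro mult_left_mono epowr_sum_geometric fin \<epsilon>) auto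
    also have "\<dots> = ?C * (\<Sum>i\<in>?I. ennreal (2 powr (real_of_int (i - k) / 2)) * (ennreal (2 powr (- real_of_int i)) * S i epowr \<theta>))"
    proof -
      have "ennreal (2 powr (1 / 4 * real_of_int (i - k))) * (ennreal (2 powr (?\<epsilon> * real_of_int (i - k))) * (?c i epowr p * S i epowr p)) epowr (\<theta> / p)
        = ennreal (2 powr (real_of_int (i - k) / 2)) * (ennreal (2 powr (- real_of_int i)) * S i epowr \<theta>)" for i
      proof -
        have "?c i epowr \<theta> = ennreal (2 powr (- real_of_int i))"
          using \<theta> by (simp add: epowr_ennreal powr_powr)
        moreover have "(ennreal (2 powr (?\<epsilon> * real_of_int (i - k)))) epowr (\<theta> / p) = ennreal (2 powr (1 / 4 * real_of_int (i - k)))"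
          using \<theta> p by (simp add: epowr_ennreal powr_powr)
        moreover have "ennreal (2 powr (1 / 4 * real_of_int (i - k))) * ennreal (2 powr (1 / 4 * real_of_int (i - k))) = ennreal (2 powr (real_of_int (i - k) / 2))"
          by (simp add: ennreal_mult''[symmetric] powr_add[symmetric])
        ultimately show ?thesis using \<epsilon> by (simp add: epowr_mult mult.assoc[symmetric])
      qed
      then show ?thesis using geoC_pos[of "\<theta> / p" "1/4"] \<epsilon> by (simp add: ennreal_mult'' less_imp_le mult.assoc)
    qed
    also have "\<dots> \<le> ?C * (\<Sum>i\<in>?I. gfun i t * (ennreal (2 powr (- real_of_int i)) * S i epowr \<theta>))"
      by (intro mult_left_mono sum_mono mult_right_mono gfun_ge k) auto
    also have "\<dots> \<le> ?C * (\<Sum>i\<in>I. gfun i t * (ennreal (2 powr (- real_of_int i)) * S i epowr \<theta>))"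
      using I by (intro mult_left_mono sum_mono2) auto
    also have "\<dots> = (\<Sum>i\<in>I. ?C * (ennreal (2 powr (- real_of_int i)) * S i epowr \<theta>) * gfun i t)"
      unfolding sum_distrib_left by (intro sum.cong refl) (simp only: mult_ac)
    finally show ?thesis .
  qed
  have [measurable]: "gfun i \<in> borel_measurable borel" for i unfolding gfun_def by measurable
  have "D ?h \<le> (\<integral>\<^sup>+t. (\<Sum>i\<in>I. ?C * (ennreal (2 powr (- real_of_int i)) * S i epowr \<theta>) * gfun i t) \<partial>\<nu>1)"
    unfolding D_def by (intro nn_integral_mono_AE, use AE_\<nu>1 in eventually_elim, rule pt)
  also have "\<dots> = (\<Sum>i\<in>I. ?C * (ennreal (2 powr (- real_of_int i)) * S i epowr \<theta>) * (\<integral>\<^sup>+t. gfun i t \<partial>\<nu>1))"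
    by (subst nn_integral_sum) (auto simp: nn_integral_cmult)
  also have "\<dots> \<le> (\<Sum>i\<in>I. ?C * (ennreal (2 powr (- real_of_int i)) * S i epowr \<theta>) * ennreal (gC * 2 powr real_of_int i))"
    by (intro sum_mono mult_left_mono gfun_int) auto
  also have "\<dots> = (\<Sum>i\<in>I. ennreal DC * S i epowr \<theta>)"
  proof (intro sum.cong refl)
    fix i
    have gC: "0 \<le> gC" by (simp add: gC_def powr_less_one less_imp_le)
    have g: "ennreal (2 powr (- real_of_int i)) * ennreal (gC * 2 powr real_of_int i) = ennreal gC"
      using gC by (simp add: ennreal_mult''[symmetric] ennreal_mult'[symmetric] powr_minus)
    have "?C * (ennreal (2 powr (- real_of_int i)) * S i epowr \<theta>) * ennreal (gC * 2 powr real_of_int i)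
       = ?C * (ennreal (2 powr (- real_of_int i)) * ennreal (gC * 2 powr real_of_int i)) * S i epowr \<theta>"
      by (simp only: mult_ac)
    also have "\<dots> = ennreal DC * S i epowr \<theta>"
      unfolding g DC_def using gC by (simp only: ennreal_mult'')
    finally show "?C * (ennreal (2 powr (- real_of_int i)) * S i epowr \<theta>) * ennreal (gC * 2 powr real_of_int i) = ennreal DC * S i epowr \<theta>" .
  qed
  finally show ?thesis by (simp add: sum_distrib_left)
qed

text \<open>The strict inequality demanded by \<open>lower\<close> is met by half of a finite
  positive constant, which costs \<open>2 powr q\<close>.\<close>

lemma lower_half:
  assumes x: "0 < x" "K x < top"
  shows "\<exists>G\<in>borel_measurable borel. K x epowr q \<le> ennreal (2 powr q * Cl) * (\<integral>\<^sup>+t. G t epowr q \<partial>\<nu>2) \<and>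
         (\<forall>y. 0 < y \<longrightarrow> y \<le> x \<longrightarrow> (\<exists>h\<in>borel_measurable borel. (\<forall>s\<ge>y. h s = 0) \<and> Lp UNIV h \<le> 1 \<and>
            (\<forall>t. ennreal ((m y / m x) powr (1 / p')) * G t \<le> F h t)))"
proof (cases "K x = 0")
  case True
  have "Lp UNIV (\<lambda>s. 0) \<le> 1" using p by (simp add: Lp_def)
  then show ?thesis using True q by (intro bexI[of _ "\<lambda>_. 0"]) (auto intro!: bexI[of _ "\<lambda>_. 0"])
next
  case False
  obtain k where k: "K x = ennreal k" "0 \<le> k" using x(2) by (cases "K x") auto
  then have k0: "0 < k" using False by auto
  then have "ennreal (k / 2) < K x" unfolding k(1) by (intro ennreal_lessI) auto
  then have "ennreal (k / 2) < ennreal (m x powr (1 / p')) * T x" by (simp only: K_def)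
  from lower[OF x(1) this] obtain G where G: "G \<in> borel_measurable borel" "ennreal (k / 2) epowr q \<le> ennreal Cl * (\<integral>\<^sup>+t. G t epowr q \<partial>\<nu>2)"
      "\<forall>y. 0 < y \<longrightarrow> y \<le> x \<longrightarrow> (\<exists>h\<in>borel_measurable borel. (\<forall>s\<ge>y. h s = 0) \<and> Lp UNIV h \<le> 1 \<and>
            (\<forall>t. ennreal ((m y / m x) powr (1 / p')) * G t \<le> F h t))"
    by (elim bexE conjE) (rule that)
  have "K x epowr q = ennreal (2 powr q) * ennreal (k / 2) epowr q"
    using k0 by (simp add: k(1) epowr_ennreal ennreal_mult''[symmetric] powr_divide)
  also have "\<dots> \<le> ennreal (2 powr q) * (ennreal Cl * (\<integral>\<^sup>+t. G t epowr q \<partial>\<nu>2))"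
    by (intro mult_left_mono G(2)) simp
  also have "\<dots> = ennreal (2 powr q * Cl) * (\<integral>\<^sup>+t. G t epowr q \<partial>\<nu>2)"
    using C_pos by (simp add: ennreal_mult mult.assoc less_imp_le)
  finally show ?thesis using G(1,3) by (intro bexI[of _ G] conjI)
qed

definition TC :: real where "TC = 2 powr q * Cl * DC powr (q / \<theta>)"

text \<open>An almost extremal function for the interval up to \<open>z j\<close> is dilated to the
  interval up to \<open>y i j\<close>, inside the set U \<le> 2^(i+1), with coefficient
  \<open>\<alpha> i j\<close> times the weight of level i. All pieces with the same j dominate
  multiples of one function \<open>G j\<close>, and different j combine by superadditivity of the
  q-th power; \<open>D\<close> is bounded by \<open>Lp_convex\<close> and
  \<open>D_superposition\<close>. Dilation divides by \<open>m (z j) powr (1 / p')\<close>, which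
  turns \<open>K (z j)\<close> into \<open>T (z j)\<close>.\<close>

lemma test_lemma:
  fixes z :: "'j \<Rightarrow> real" and y :: "int \<Rightarrow> 'j \<Rightarrow> real" and \<alpha> :: "int \<Rightarrow> 'j \<Rightarrow> real"
  assumes c: "feasible c" "c < top" and I: "finite I" and Js: "finite Js"
    and z: "\<And>j. j \<in> Js \<Longrightarrow> 0 < z j"
    and y: "\<And>i j. i \<in> I \<Longrightarrow> j \<in> Js \<Longrightarrow> 0 < y i j \<and> y i j \<le> z j \<and> U (y i j) \<le> 2 powr real_of_int (i + 1)"
    and \<alpha>: "\<And>i j. 0 \<le> \<alpha> i j"
  shows "(\<Sum>j\<in>Js. (T (z j) * (\<Sum>i\<in>I. ennreal (2 powr (- (real_of_int i / \<theta>)) * m (y i j) powr (1 / p') * \<alpha> i j))) epowr q)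
    \<le> ennreal TC * c epowr q * (\<Sum>i\<in>I. (\<Sum>j\<in>Js. ennreal (\<alpha> i j)) epowr \<theta>) epowr (q / \<theta>)"
proof -
  define P where "P j G \<longleftrightarrow> G \<in> borel_measurable borel \<and> K (z j) epowr q \<le> ennreal (2 powr q * Cl) * (\<integral>\<^sup>+t. G t epowr q \<partial>\<nu>2) \<and>
         (\<forall>y. 0 < y \<longrightarrow> y \<le> z j \<longrightarrow> (\<exists>h\<in>borel_measurable borel. (\<forall>s\<ge>y. h s = 0) \<and> Lp UNIV h \<le> 1 \<and>
            (\<forall>t. ennreal ((m y / m (z j)) powr (1 / p')) * G t \<le> F h t)))" for j G
  have "\<exists>G. P j G" if "j \<in> Js" for j
    using lower_half[OF z[OF that] K_finite[OF c z[OF that]]] unfolding P_def Bex_def .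
  then obtain G where GP: "\<And>j. j \<in> Js \<Longrightarrow> P j (G j)" by metis
  have G: "G j \<in> borel_measurable borel" "K (z j) epowr q \<le> ennreal (2 powr q * Cl) * (\<integral>\<^sup>+t. G j t epowr q \<partial>\<nu>2)" if "j \<in> Js" for j
    using GP[OF that] by (simp_all add: P_def)
  define Q where "Q i j h \<longleftrightarrow> h \<in> borel_measurable borel \<and> (\<forall>s\<ge>y i j. h s = 0) \<and> Lp UNIV h \<le> 1 \<and>
            (\<forall>t. ennreal ((m (y i j) / m (z j)) powr (1 / p')) * G j t \<le> F h t)" for i j h
  have "\<exists>h. Q i j h" if "i \<in> I" "j \<in> Js" for i j
  proof -
    have "\<forall>y. 0 < y \<longrightarrow> y \<le> z j \<longrightarrow> (\<exists>h\<in>borel_measurable borel. (\<forall>s\<ge>y. h s = 0) \<and> Lp UNIV h \<le> 1 \<and>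
            (\<forall>t. ennreal ((m y / m (z j)) powr (1 / p')) * G j t \<le> F h t))"
      using GP[OF that(2)] unfolding P_def by (elim conjE)
    moreover have "0 < y i j" "y i j \<le> z j" using y[OF that] by auto
    ultimately have "\<exists>h\<in>borel_measurable borel. (\<forall>s\<ge>y i j. h s = 0) \<and> Lp UNIV h \<le> 1 \<and>
            (\<forall>t. ennreal ((m (y i j) / m (z j)) powr (1 / p')) * G j t \<le> F h t)" by (elim allE impE) 
    then show ?thesis unfolding Q_def Bex_def .
  qed
  then obtain H' where HQ: "\<And>i j. i \<in> I \<Longrightarrow> j \<in> Js \<Longrightarrow> Q i j (H' i j)" by metis
  define H where "H ij = H' (fst ij) (snd ij)" for ij
  have H: "H (i, j) \<in> borel_measurable borel" "y i j \<le> s \<Longrightarrow> H (i, j) s = 0" "Lp UNIV (H (i, j)) \<le> 1"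
    "ennreal ((m (y i j) / m (z j)) powr (1 / p')) * G j t \<le> F (H (i, j)) t" if "i \<in> I" "j \<in> Js" for i j s t
    using HQ[OF that] by (simp_all add: Q_def H_def)
  let ?c = "\<lambda>i. ennreal (2 powr (- (real_of_int i / \<theta>)))"
  define g where "g i s = (\<Sum>j\<in>Js. ennreal (\<alpha> i j) * H (i, j) s)" for i s
  define h where "h s = (\<Sum>i\<in>I. ?c i * g i s)" for s
  have Hm [measurable]: "H (i, j) \<in> borel_measurable \<mu>" if "i \<in> I" "j \<in> Js" for i j
    using H(1)[OF that] by (rule borel_imp_measurable)
  have gm [measurable]: "g i \<in> borel_measurable \<mu>" if "i \<in> I" for i
    unfolding g_def using Hm[OF that] by (intro borel_measurable_sum borel_measurable_times) auto
  have hm: "h \<in> borel_measurable \<mu>"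
    unfolding h_def by (intro borel_measurable_sum borel_measurable_times gm) auto
  have Dh: "D h \<le> ennreal DC * (\<Sum>i\<in>I. (\<Sum>j\<in>Js. ennreal (\<alpha> i j)) epowr \<theta>)"
    unfolding h_def
  proof (rule D_superposition[OF I gm])
    fix i s assume i: "i \<in> I" "g i s \<noteq> 0"
    then obtain j where j: "j \<in> Js" "H (i, j) s \<noteq> 0" unfolding g_def by (auto elim: sum.not_neutral_contains_not_neutral)
    then have "s < y i j" using H(2)[OF i(1) j(1), of s] by (cases "s < y i j") auto
    then show "U s \<le> 2 powr real_of_int (i + 1)" using y[OF i(1) j(1)] monoD[OF U.mono, of s "y i j"] by linarith
  next
    fix i assume i: "i \<in> I"
    show "Lp UNIV (g i) \<le> (\<Sum>j\<in>Js. ennreal (\<alpha> i j)) epowr p"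
      unfolding g_def using i Hm H(3) \<alpha> by (intro Lp_convex Js) auto
  qed
  have "D h < top"
    using I Js \<theta> by (intro le_less_trans[OF Dh]) (auto simp: less_top[symmetric] ennreal_mult_eq_top_iff epowr_eq_top_iff)
  then have Lh: "L h \<le> c epowr q * D h epowr (q / \<theta>)" using c hm unfolding feasible_def by auto
  define w where "w j = (\<Sum>i\<in>I. ennreal (2 powr (- (real_of_int i / \<theta>)) * \<alpha> i j * (m (y i j) / m (z j)) powr (1 / p')))" for j
  have Fh: "(\<Sum>j\<in>Js. w j * G j t) \<le> F h t" for t
  proof -
    have "F h t = (\<integral>\<^sup>+s. (\<Sum>i\<in>I. \<Sum>j\<in>Js. ?c i * (ennreal (\<alpha> i j) * (H (i, j) s * indicator {..<t} s))) \<partial>\<mu>)"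
      unfolding F_def h_def g_def by (intro nn_integral_cong) (simp only: sum_distrib_left sum_distrib_right mult.assoc)
    also have "\<dots> = (\<Sum>i\<in>I. \<integral>\<^sup>+s. (\<Sum>j\<in>Js. ?c i * (ennreal (\<alpha> i j) * (H (i, j) s * indicator {..<t} s))) \<partial>\<mu>)"
      by (intro nn_integral_sum borel_measurable_sum borel_measurable_times Hm) auto
    also have "\<dots> = (\<Sum>i\<in>I. \<Sum>j\<in>Js. \<integral>\<^sup>+s. ?c i * (ennreal (\<alpha> i j) * (H (i, j) s * indicator {..<t} s)) \<partial>\<mu>)"
      by (intro sum.cong refl nn_integral_sum borel_measurable_times Hm) auto
    also have "\<dots> = (\<Sum>i\<in>I. \<Sum>j\<in>Js. ?c i * (ennreal (\<alpha> i j) * F (H (i, j)) t))"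
      unfolding F_def by (intro sum.cong refl) (simp add: nn_integral_cmult)
    also have "\<dots> \<ge> (\<Sum>i\<in>I. \<Sum>j\<in>Js. ?c i * (ennreal (\<alpha> i j) * (ennreal ((m (y i j) / m (z j)) powr (1 / p')) * G j t)))"
      by (intro sum_mono mult_left_mono H(4)) auto
    also (xtrans) have "(\<Sum>i\<in>I. \<Sum>j\<in>Js. ?c i * (ennreal (\<alpha> i j) * (ennreal ((m (y i j) / m (z j)) powr (1 / p')) * G j t)))
      = (\<Sum>j\<in>Js. \<Sum>i\<in>I. ?c i * (ennreal (\<alpha> i j) * (ennreal ((m (y i j) / m (z j)) powr (1 / p')) * G j t)))"
      by (rule sum.swap)
    also (xtrans) have "\<dots> = (\<Sum>j\<in>Js. w j * G j t)"
      unfolding w_def sum_distrib_right using \<alpha> by (intro sum.cong refl) (simp add: ennreal_mult mult.assoc)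
    finally (xtrans) show ?thesis .
  qed
  have wK: "T (z j) * (\<Sum>i\<in>I. ennreal (2 powr (- (real_of_int i / \<theta>)) * m (y i j) powr (1 / p') * \<alpha> i j)) = w j * K (z j)" if j: "j \<in> Js" for j
  proof -
    have mz: "0 < m (z j)" by (rule m.pos[OF z[OF j]])
    have "2 powr (- (real_of_int i / \<theta>)) * m (y i j) powr (1 / p') * \<alpha> i j
       = 2 powr (- (real_of_int i / \<theta>)) * \<alpha> i j * (m (y i j) / m (z j)) powr (1 / p') * m (z j) powr (1 / p')" if "i \<in> I" for i
      using mz m.pos[of "y i j"] y[OF that j] by (simp add: powr_divide)
    then have "(\<Sum>i\<in>I. ennreal (2 powr (- (real_of_int i / \<theta>)) * m (y i j) powr (1 / p') * \<alpha> i j)) = w j * ennreal (m (z j) powr (1 / p'))"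
      unfolding w_def sum_distrib_right using \<alpha> by (intro sum.cong refl) (simp add: ennreal_mult''[symmetric])
    then show ?thesis by (simp add: K_def mult_ac)
  qed
  have "(\<Sum>j\<in>Js. (T (z j) * (\<Sum>i\<in>I. ennreal (2 powr (- (real_of_int i / \<theta>)) * m (y i j) powr (1 / p') * \<alpha> i j))) epowr q)
    = (\<Sum>j\<in>Js. w j epowr q * K (z j) epowr q)"
    using q by (intro sum.cong refl) (simp add: wK epowr_mult)
  also have "\<dots> \<le> (\<Sum>j\<in>Js. w j epowr q * (ennreal (2 powr q * Cl) * (\<integral>\<^sup>+t. G j t epowr q \<partial>\<nu>2)))"
    by (intro sum_mono mult_left_mono G(2)) auto
  also have "\<dots> = ennreal (2 powr q * Cl) * (\<Sum>j\<in>Js. w j epowr q * (\<integral>\<^sup>+t. G j t epowr q \<partial>\<nu>2))"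
    by (simp add: sum_distrib_left mult_ac)
  also have "\<dots> = ennreal (2 powr q * Cl) * (\<integral>\<^sup>+t. (\<Sum>j\<in>Js. (w j * G j t) epowr q) \<partial>\<nu>2)"
  proof -
    have Gm: "(\<lambda>t. G j t epowr q) \<in> borel_measurable \<nu>2" if "j \<in> Js" for j
      using G(1)[OF that] by (intro measurable_epowr borel_imp_measurable)
    have "(\<integral>\<^sup>+t. (\<Sum>j\<in>Js. (w j * G j t) epowr q) \<partial>\<nu>2) = (\<integral>\<^sup>+t. (\<Sum>j\<in>Js. w j epowr q * G j t epowr q) \<partial>\<nu>2)"
      using q by (simp add: epowr_mult)
    also have "\<dots> = (\<Sum>j\<in>Js. \<integral>\<^sup>+t. w j epowr q * G j t epowr q \<partial>\<nu>2)"
      by (rule nn_integral_sum) (rule borel_measurable_times_ennreal[OF borel_measurable_const Gm])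
    also have "\<dots> = (\<Sum>j\<in>Js. w j epowr q * (\<integral>\<^sup>+t. G j t epowr q \<partial>\<nu>2))"
      by (intro sum.cong refl nn_integral_cmult Gm)
    finally show ?thesis by simp
  qed
  also have "\<dots> \<le> ennreal (2 powr q * Cl) * L h"
    unfolding L_def
  proof (intro mult_left_mono nn_integral_mono)
    fix t
    have "(\<Sum>j\<in>Js. (w j * G j t) epowr q) \<le> (\<Sum>j\<in>Js. w j * G j t) epowr q"
      using q Js by (intro sum_epowr_le) auto
    also have "\<dots> \<le> F h t epowr q" using q by (intro epowr_mono Fh) auto
    finally show "(\<Sum>j\<in>Js. (w j * G j t) epowr q) \<le> F h t epowr q" .
  qed simp
  also have "\<dots> \<le> ennreal (2 powr q * Cl) * (c epowr q * (ennreal DC * (\<Sum>i\<in>I. (\<Sum>j\<in>Js. ennreal (\<alpha> i j)) epowr \<theta>)) epowr (q / \<theta>))"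
    using q \<theta> by (intro mult_left_mono order.trans[OF Lh] epowr_mono Dh) auto
  also have "\<dots> = ennreal TC * c epowr q * (\<Sum>i\<in>I. (\<Sum>j\<in>Js. ennreal (\<alpha> i j)) epowr \<theta>) epowr (q / \<theta>)"
  proof -
    have "0 < 1 - 2 powr (- (1 / 2)::real)" by (simp add: powr_less_one)
    then have "0 < DC" using geoC_pos[of p "p / (4 * \<theta>)"] geoC_pos[of "\<theta> / p" "1 / 4"] p \<theta> by (simp add: DC_def gC_def)
    then have "(ennreal DC * (\<Sum>i\<in>I. (\<Sum>j\<in>Js. ennreal (\<alpha> i j)) epowr \<theta>)) epowr (q / \<theta>) = ennreal (DC powr (q / \<theta>)) * (\<Sum>i\<in>I. (\<Sum>j\<in>Js. ennreal (\<alpha> i j)) epowr \<theta>) epowr (q / \<theta>)"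
      using q \<theta> by (simp add: epowr_mult epowr_ennreal)
    then show ?thesis using C_pos by (simp add: TC_def ennreal_mult mult_ac)
  qed
  finally show ?thesis .
qed

end

text \<open>Suprema over several blocks can be approached independently of each other, so it is
  enough to test one arbitrary point per block.\<close>

lemma sum_SUP_le:
  fixes f :: "'i \<Rightarrow> 'a \<Rightarrow> ennreal"
  assumes "finite A" "\<And>i. i \<in> A \<Longrightarrow> X i \<noteq> {}"
    and "\<And>x. (\<And>i. i \<in> A \<Longrightarrow> x i \<in> X i) \<Longrightarrow> (\<Sum>i\<in>A. f i (x i)) \<le> B"
  shows "(\<Sum>i\<in>A. SUP y\<in>X i. f i y) \<le> B"
  using assms
proof (induction A arbitrary: B rule: finite_induct)
  case (insert a A)
  have *: "f a y + (\<Sum>i\<in>A. SUP y\<in>X i. f i y) \<le> B" if y: "y \<in> X a" for y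
  proof -
    have le: "f a y + (\<Sum>i\<in>A. f i (x i)) \<le> B" if x: "\<And>i. i \<in> A \<Longrightarrow> x i \<in> X i" for x
    proof -
      have "(\<Sum>i\<in>insert a A. f i ((x(a := y)) i)) \<le> B" using x y by (intro insert.prems(2)) auto
      moreover have "(\<Sum>i\<in>A. f i ((x(a := y)) i)) = (\<Sum>i\<in>A. f i (x i))" using insert.hyps(2) by (intro sum.cong) auto
      ultimately show ?thesis using insert.hyps by simp
    qed
    show ?thesis
    proof (cases "f a y = top")
      case True
      have "\<exists>x. \<forall>i\<in>A. x i \<in> X i" using insert.prems(1) by (intro bchoice) auto
      then obtain x where "\<And>i. i \<in> A \<Longrightarrow> x i \<in> X i" by blast
      from le[OF this] show ?thesis using True by (simp add: top_unique)
    next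
      case False
      have "(\<Sum>i\<in>A. SUP y\<in>X i. f i y) \<le> B - f a y"
      proof (rule insert.IH)
        fix x assume "\<And>i. i \<in> A \<Longrightarrow> x i \<in> X i"
        from le[OF this] show "(\<Sum>i\<in>A. f i (x i)) \<le> B - f a y"
          using False by (simp add: ennreal_le_minus_iff add.commute)
      qed (use insert.prems(1) in auto)
      moreover have "f a y \<le> B"
      proof -
        have "\<exists>x. \<forall>i\<in>A. x i \<in> X i" using insert.prems(1) by (intro bchoice) auto
        then obtain x where "\<And>i. i \<in> A \<Longrightarrow> x i \<in> X i" by blast
        from order.trans[OF add_increasing2[OF zero_le order_refl] le[OF this]] show ?thesis .
      qed
      ultimately have "f a y + (\<Sum>i\<in>A. SUP y\<in>X i. f i y) \<le> f a y + (B - f a y)" by (intro add_left_mono)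
      also have "\<dots> = B" using \<open>f a y \<le> B\<close> by (rule add_diff_inverse_ennreal)
      finally show ?thesis .
    qed
  qed
  have "(\<Sum>i\<in>insert a A. SUP y\<in>X i. f i y) = (SUP y\<in>X a. f a y) + (\<Sum>i\<in>A. SUP y\<in>X i. f i y)"
    using insert.hyps by simp
  also have "\<dots> = (SUP y\<in>X a. f a y + (\<Sum>i\<in>A. SUP y\<in>X i. f i y))"
    using insert.prems(1) by (intro ennreal_SUP_add_left[symmetric]) auto
  also have "\<dots> \<le> B" using * by (intro SUP_least)
  finally show ?case .
qed simp

lemma powr_self_improve:
  fixes X Z :: real
  assumes "0 \<le> X" "0 \<le> Z" "X \<le> Z * X powr (1 - s)" "0 < s"
  shows "X \<le> Z powr (1 / s)"
proof (cases "X = 0")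
  case False
  then have X: "0 < X" using assms(1) by simp
  have "X powr s * X powr (1 - s) \<le> Z * X powr (1 - s)" using assms(3) X by (simp add: powr_add[symmetric])
  then have "X powr s \<le> Z" using X by simp
  then have "(X powr s) powr (1 / s) \<le> Z powr (1 / s)" using assms(4) by (intro powr_mono2) auto
  then show ?thesis using X assms(4) by (simp add: powr_powr)
qed simp

context cope_beta
begin

text \<open>The power \<theta>' of \<open>2 powr (- i / \<theta>) * m x powr (1 / p')\<close>. By
  \<open>\<beta>_blk_le\<close> it also bounds the \<beta>-mass of block i times
  \<open>m x powr (\<theta>' / p')\<close>.\<close>

definition wt :: "int \<Rightarrow> real \<Rightarrow> real" where
  "wt i x = 2 powr (real_of_int i * (1 - \<theta>')) * m x powr (\<theta>' / p')"

lemma wt_pos: "0 < x \<Longrightarrow> 0 < wt i x"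
  using m.pos[of x] by (simp add: wt_def)

lemma wt_root: "wt i x powr (1 / \<theta>') = 2 powr (- (real_of_int i / \<theta>)) * m x powr (1 / p')"
proof -
  have "real_of_int i * (1 - \<theta>') * (1 / \<theta>') = - (real_of_int i / \<theta>)"
    unfolding mult.assoc \<theta>_exps(1) by simp
  then have "(2 powr (real_of_int i * (1 - \<theta>'))) powr (1 / \<theta>') = 2 powr (- (real_of_int i / \<theta>))"
    by (simp only: powr_powr)
  moreover have "(m x powr (\<theta>' / p')) powr (1 / \<theta>') = m x powr (1 / p')"
    using \<theta>'1 by (simp add: powr_powr)
  ultimately show ?thesis unfolding wt_def by (simp add: powr_mult)
qed

lemma \<theta>_sum: "1 / \<theta>' + 1 / \<theta> = 1" using \<theta> by simp

lemma TC_pos: "0 < TC"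
proof -
  have "0 < 1 - 2 powr (- (1 / 2)::real)" by (simp add: powr_less_one)
  then have "0 < DC" using geoC_pos[of p "p / (4 * \<theta>)"] geoC_pos[of "\<theta> / p" "1 / 4"] p \<theta> by (simp add: DC_def gC_def)
  then show ?thesis using C_pos by (simp add: TC_def)
qed

text \<open>The choice \<alpha> = wt^(1/\<theta>) is the equality case of Hoelder's inequality: the
  tested functional and the sum of the \<theta>-th powers both equal the sum of the weights, of
  which the power 1 - 1/\<theta> = 1/\<theta>' survives.\<close>

lemma test_single:
  assumes c: "feasible c" "c < top" and I: "finite I" and z: "0 < z"
    and y: "\<And>i. i \<in> I \<Longrightarrow> 0 < y i \<and> y i \<le> z \<and> U (y i) \<le> 2 powr real_of_int (i + 1)"
  shows "T z * ennreal ((\<Sum>i\<in>I. wt i (y i)) powr (1 / \<theta>')) \<le> ennreal (TC powr (1 / q)) * c"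
proof (cases "I = {}")
  case False
  let ?S = "\<Sum>i\<in>I. wt i (y i)"
  have wp: "0 < wt i (y i)" if "i \<in> I" for i using y[OF that] by (intro wt_pos) auto
  have S: "0 < ?S" using False I wp by (intro sum_pos) auto
  define \<alpha> where "\<alpha> i j = wt i (y i) powr (1 / \<theta>)" for i and j :: unit
  have "(\<Sum>j\<in>{()}. (T z * (\<Sum>i\<in>I. ennreal (2 powr (- (real_of_int i / \<theta>)) * m (y i) powr (1 / p') * \<alpha> i j))) epowr q)
    \<le> ennreal TC * c epowr q * (\<Sum>i\<in>I. (\<Sum>j\<in>{()}. ennreal (\<alpha> i j)) epowr \<theta>) epowr (q / \<theta>)"
    using z y by (intro test_lemma[where z = "\<lambda>_. z" and y = "\<lambda>i _. y i"] c I) (auto simp: \<alpha>_def)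
  moreover have "(\<Sum>i\<in>I. ennreal (2 powr (- (real_of_int i / \<theta>)) * m (y i) powr (1 / p') * \<alpha> i ())) = ennreal ?S"
  proof -
    have "2 powr (- (real_of_int i / \<theta>)) * m (y i) powr (1 / p') * \<alpha> i () = wt i (y i)" if "i \<in> I" for i
      using wp[OF that] unfolding \<alpha>_def wt_root[symmetric] powr_add[symmetric] \<theta>_sum by simp
    then have "(\<Sum>i\<in>I. ennreal (2 powr (- (real_of_int i / \<theta>)) * m (y i) powr (1 / p') * \<alpha> i ())) = (\<Sum>i\<in>I. ennreal (wt i (y i)))"
      by (intro sum.cong refl) simp
    also have "\<dots> = ennreal ?S" using wp by (intro sum_ennreal) (auto intro: less_imp_le)
    finally show ?thesis .
  qed
  moreover have "(\<Sum>i\<in>I. ennreal (\<alpha> i ()) epowr \<theta>) = ennreal ?S"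
  proof -
    have "(\<Sum>i\<in>I. ennreal (\<alpha> i ()) epowr \<theta>) = (\<Sum>i\<in>I. ennreal (wt i (y i)))"
    proof (intro sum.cong refl)
      fix i assume "i \<in> I"
      then show "ennreal (\<alpha> i ()) epowr \<theta> = ennreal (wt i (y i))"
        using wp[of i] \<theta> by (simp add: \<alpha>_def epowr_ennreal powr_powr)
    qed
    also have "\<dots> = ennreal ?S" using wp by (intro sum_ennreal) (auto intro: less_imp_le)
    finally show ?thesis .
  qed
  ultimately have "(T z * ennreal ?S) epowr q \<le> ennreal TC * c epowr q * ennreal ?S epowr (q / \<theta>)"
    by simp
  also have "\<dots> = (ennreal (TC powr (1 / q)) * c * ennreal (?S powr (1 / \<theta>))) epowr q"
    using q \<theta> S TC_pos by (simp add: epowr_mult epowr_ennreal powr_powr)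
  finally have *: "T z * ennreal ?S \<le> ennreal (TC powr (1 / q)) * c * ennreal (?S powr (1 / \<theta>))"
    using q by (simp add: epowr_le_cancel)
  have e1: "ennreal ?S * ennreal (?S powr (- (1 / \<theta>))) = ennreal (?S powr (1 / \<theta>'))"
  proof -
    have "?S * ?S powr (- (1 / \<theta>)) = ?S powr (1 + - (1 / \<theta>))" using S by (simp only: powr_add powr_one)
    also have "1 + - (1 / \<theta>) = 1 / \<theta>'" using \<theta>_sum by linarith
    finally show ?thesis using S by (simp add: ennreal_mult''[symmetric])
  qed
  have e2: "ennreal (?S powr (1 / \<theta>)) * ennreal (?S powr (- (1 / \<theta>))) = 1"
    using S by (simp add: ennreal_mult''[symmetric] powr_add[symmetric])
  have "T z * ennreal ?S * ennreal (?S powr (- (1 / \<theta>))) \<le> ennreal (TC powr (1 / q)) * c * ennreal (?S powr (1 / \<theta>)) * ennreal (?S powr (- (1 / \<theta>)))"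
    by (intro mult_right_mono *) simp
  then show ?thesis unfolding mult.assoc e1 e2 by simp
qed simp

lemma blk_live': "x \<in> U.blk i \<Longrightarrow> live i" by (auto simp: U.blk_def live_def)

lemma \<beta>_upper: assumes "live i" shows "emeasure \<beta> {\<tau> i<..} \<le> ennreal (2 powr (real_of_int i * (1 - \<theta>')))"
proof -
  have "emeasure \<beta> {\<tau> i<..} = ennreal (U (\<tau> i) powr (1 - \<theta>') - e)" using \<tau>(1)[OF assms] by (rule \<beta>_gt)
  also have "\<dots> \<le> ennreal (U (\<tau> i) powr (1 - \<theta>'))" using e_nonneg by (intro ennreal_leI) simp
  also have "U (\<tau> i) powr (1 - \<theta>') = 2 powr (real_of_int i * (1 - \<theta>'))" unfolding \<tau>(2)[OF assms] by (simp only: powr_powr)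
  finally show ?thesis .
qed

lemma \<beta>_blk_le: "emeasure \<beta> (U.blk i) \<le> ennreal (2 powr (real_of_int i * (1 - \<theta>')))"
proof (cases "live i")
  case True
  have "emeasure \<beta> (U.blk i) \<le> emeasure \<beta> {\<tau> i<..}"
    unfolding U.blk_def by (intro emeasure_mono subsetI) (auto simp: \<tau>(3)[OF True])
  then show ?thesis using \<beta>_upper[OF True] by (rule order.trans)
next
  case False
  then show ?thesis unfolding dead_blk[OF False] by simp
qed

text \<open>Upper discretisation of \<open>\<Psi> x\<close> for x in block i: an earlier block is
  charged with \<open>m\<close> at its right end, all mass beyond \<open>\<tau> i\<close> with
  \<open>m x\<close>, and the blocks below a are left to a limit.\<close>

definition SS :: "int \<Rightarrow> int \<Rightarrow> real \<Rightarrow> real" where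
  "SS a i x = (\<Sum>k=a..i - 1. wt k (\<tau> (k + 1))) + wt i x"

lemma \<Psi>_upper:
  assumes x: "x \<in> U.blk i"
  shows "\<Psi> x \<le> (SUP n::nat. ennreal (SS (- int n) i x))"
proof -
  have li: "live i" by (rule blk_live'[OF x])
  have lk: "live (k + 1)" if "k < i" for k using that by (intro live_mono[OF li]) auto
  have x0: "0 < x" by (rule U.blk_pos[OF x])
  let ?g = "\<lambda>n t. (\<Sum>k=- int n..i - 1. ennreal (m (\<tau> (k + 1)) powr (\<theta>' / p')) * indicator (U.blk k) t)
     + ennreal (m x powr (\<theta>' / p')) * indicator {\<tau> i<..} t"
  have "\<Psi> x \<le> (\<integral>\<^sup>+t. (SUP n. ?g n t) \<partial>\<beta>)"
    unfolding \<Psi>_def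
  proof (intro nn_integral_mono_AE, use AE_\<beta> in eventually_elim)
    fix t :: real assume t: "0 < t"
    obtain k where k: "t \<in> U.blk k" using t by (rule U.blk_ex)
    show "ennreal (min (m x) (m t) powr (\<theta>' / p')) \<le> (SUP n. ?g n t)"
    proof (cases "k < i")
      case True
      have l: "live (k + 1)" using True by (intro live_mono[OF li]) auto
      have tt: "t \<le> \<tau> (k + 1)" using blk_bounds[OF l k] by simp
      have "min (m x) (m t) powr (\<theta>' / p') \<le> m (\<tau> (k + 1)) powr (\<theta>' / p')"
        using m.pos[OF t] m.pos[OF x0] monoD[OF m.mono tt] \<theta>_exps(4) by (intro powr_mono2) auto
      then have "ennreal (min (m x) (m t) powr (\<theta>' / p')) \<le> ennreal (m (\<tau> (k + 1)) powr (\<theta>' / p'))"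
        by (rule ennreal_leI)
      also have "\<dots> = (\<Sum>j=- int (nat (- k))..i - 1. ennreal (m (\<tau> (j + 1)) powr (\<theta>' / p')) * indicator (U.blk j) t)"
        using True by (subst U.sum_blk[OF _ k]) auto
      also have "\<dots> \<le> ?g (nat (- k)) t" by simp
      also have "\<dots> \<le> (SUP n. ?g n t)" by (rule SUP_upper) simp
      finally show ?thesis .
    next
      case False
      have "2 powr real_of_int i \<le> 2 powr real_of_int k" using False by simp
      then have "2 powr real_of_int i < U t" using k unfolding U.blk_def mem_Collect_eq by linarith
      then have "\<tau> i < t" by (simp only: \<tau>(3)[OF li])
      have "min (m x) (m t) powr (\<theta>' / p') \<le> m x powr (\<theta>' / p')"
        using m.pos[OF t] m.pos[OF x0] \<theta>_exps(4) by (intro powr_mono2) auto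
      then have "ennreal (min (m x) (m t) powr (\<theta>' / p')) \<le> ennreal (m x powr (\<theta>' / p')) * indicator {\<tau> i<..} t"
        using \<open>\<tau> i < t\<close> by (simp add: ennreal_leI)
      also have "\<dots> \<le> ?g 0 t" by (simp add: add_increasing)
      also have "\<dots> \<le> (SUP n. ?g n t)" by (rule SUP_upper) simp
      finally show ?thesis .
    qed
  qed
  also have "\<dots> = (SUP n. \<integral>\<^sup>+t. ?g n t \<partial>\<beta>)"
  proof (rule nn_integral_monotone_convergence_SUP)
    show "incseq ?g" by (intro incseq_SucI le_funI add_mono sum_mono2) auto
  qed measurable
  also have "\<dots> \<le> (SUP n::nat. ennreal (SS (- int n) i x))"
  proof (intro SUP_mono bexI)
    fix n :: nat
    have "(\<integral>\<^sup>+t. ?g n t \<partial>\<beta>) = (\<Sum>k=- int n..i - 1. ennreal (m (\<tau> (k + 1)) powr (\<theta>' / p')) * emeasure \<beta> (U.blk k))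
       + ennreal (m x powr (\<theta>' / p')) * emeasure \<beta> {\<tau> i<..}"
    proof -
      have "(\<integral>\<^sup>+t. ?g n t \<partial>\<beta>) = (\<integral>\<^sup>+t. (\<Sum>k=- int n..i - 1. ennreal (m (\<tau> (k + 1)) powr (\<theta>' / p')) * indicator (U.blk k) t) \<partial>\<beta>)
         + (\<integral>\<^sup>+t. ennreal (m x powr (\<theta>' / p')) * indicator {\<tau> i<..} t \<partial>\<beta>)"
        by (rule nn_integral_add) measurable
      also have "(\<integral>\<^sup>+t. (\<Sum>k=- int n..i - 1. ennreal (m (\<tau> (k + 1)) powr (\<theta>' / p')) * indicator (U.blk k) t) \<partial>\<beta>)
         = (\<Sum>k=- int n..i - 1. \<integral>\<^sup>+t. ennreal (m (\<tau> (k + 1)) powr (\<theta>' / p')) * indicator (U.blk k) t \<partial>\<beta>)"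
        by (rule nn_integral_sum) measurable
      finally show ?thesis by (simp only: nn_integral_cmult_indicator sets_\<beta> U.blk_sets borel_open open_greaterThan)
    qed
    also have "\<dots> \<le> (\<Sum>k=- int n..i - 1. ennreal (m (\<tau> (k + 1)) powr (\<theta>' / p')) * ennreal (2 powr (real_of_int k * (1 - \<theta>'))))
       + ennreal (m x powr (\<theta>' / p')) * ennreal (2 powr (real_of_int i * (1 - \<theta>')))"
      by (intro add_mono sum_mono mult_left_mono \<beta>_blk_le \<beta>_upper li) auto
    also have "\<dots> = (\<Sum>k=- int n..i - 1. ennreal (wt k (\<tau> (k + 1)))) + ennreal (wt i x)"
      by (simp add: wt_def ennreal_mult mult.commute)
    also have "\<dots> = ennreal (SS (- int n) i x)"
    proof -
      have nn: "0 \<le> wt k (\<tau> (k + 1))" if "k \<in> {- int n..i - 1}" for k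
        using that by (intro less_imp_le wt_pos \<tau>(1) lk) auto
      have sm: "(\<Sum>k=- int n..i - 1. ennreal (wt k (\<tau> (k + 1)))) = ennreal (\<Sum>k=- int n..i - 1. wt k (\<tau> (k + 1)))"
        by (rule sum_ennreal) (rule nn)
      show ?thesis unfolding SS_def sm
        by (rule ennreal_plus[symmetric]) (rule sum_nonneg[OF nn], assumption, rule less_imp_le[OF wt_pos[OF x0]])
    qed
    finally show "(\<integral>\<^sup>+t. ?g n t \<partial>\<beta>) \<le> ennreal (SS (- int n) i x)" .
  qed simp
  finally show ?thesis .
qed

lemma \<phi>_T_le:
  assumes c: "feasible c" "c < top" and x: "0 < x"
  shows "\<phi> x * T x \<le> ennreal (TC powr (1 / q)) * c"
proof -
  obtain i where i: "x \<in> U.blk i" using x by (rule U.blk_ex)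
  have li: "live i" by (rule blk_live'[OF i])
  have "\<phi> x \<le> (SUP n::nat. ennreal (SS (- int n) i x)) epowr (1 / \<theta>')"
    unfolding \<phi>_def using \<theta>'1 by (intro epowr_mono \<Psi>_upper i) auto
  then have "\<phi> x * T x \<le> (SUP n::nat. ennreal (SS (- int n) i x)) epowr (1 / \<theta>') * T x"
    by (rule mult_right_mono) simp
  also have "\<dots> = (SUP n::nat. ennreal (SS (- int n) i x) epowr (1 / \<theta>') * T x)"
    using \<theta>'1 by (simp add: epowr_SUP SUP_mult_right_ennreal)
  also have "\<dots> \<le> ennreal (TC powr (1 / q)) * c"
  proof (rule SUP_least)
    fix n :: nat
    define a where "a = min i (- int n)"
    \<comment> \<open>The points that occur in \<open>SS\<close>: the right ends of the earlier
      blocks, and x in its own block.\<close>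
    define y where "y k = (if k = i then x else \<tau> (k + 1))" for k
    have lk: "live (k + 1)" if "k < i" for k using that by (intro live_mono[OF li]) auto
    have wn: "0 \<le> wt k (\<tau> (k + 1))" if "k < i" for k using wt_pos[OF \<tau>(1)[OF lk[OF that]]] by (rule less_imp_le)
    have "SS (- int n) i x \<le> SS a i x"
      unfolding SS_def a_def by (intro add_right_mono sum_mono2) (auto intro!: wn)
    also have "SS a i x = (\<Sum>k=a..i - 1. wt k (y k)) + wt i (y i)"
      unfolding SS_def y_def by (intro arg_cong2[of _ _ _ _ "(+)"] sum.cong) auto
    also have "\<dots> = (\<Sum>k\<in>{a..i}. wt k (y k))"
    proof -
      have "{a..i} = insert i {a..i - 1}" by (auto simp: a_def)
      then show ?thesis by simp
    qed
    finally have "ennreal (SS (- int n) i x) epowr (1 / \<theta>') \<le> ennreal ((\<Sum>k\<in>{a..i}. wt k (y k)) powr (1 / \<theta>'))"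
    proof -
      assume *: "SS (- int n) i x \<le> (\<Sum>k\<in>{a..i}. wt k (y k))"
      have "0 < SS (- int n) i x" unfolding SS_def using wt_pos[OF x, of i]
        by (intro add_nonneg_pos sum_nonneg) (auto intro!: wn)
      then show ?thesis using * \<theta>'1 by (simp add: epowr_ennreal ennreal_leI powr_mono2)
    qed
    then have "ennreal (SS (- int n) i x) epowr (1 / \<theta>') * T x \<le> ennreal ((\<Sum>k\<in>{a..i}. wt k (y k)) powr (1 / \<theta>')) * T x"
      by (rule mult_right_mono) simp
    also have "\<dots> = T x * ennreal ((\<Sum>k\<in>{a..i}. wt k (y k)) powr (1 / \<theta>'))" by (rule mult.commute)
    also have "\<dots> \<le> ennreal (TC powr (1 / q)) * c"
    proof (intro test_single c x)
      fix k assume k: "k \<in> {a..i}"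
      show "0 < y k \<and> y k \<le> x \<and> U (y k) \<le> 2 powr real_of_int (k + 1)"
      proof (cases "k = i")
        case True
        then show ?thesis using x i by (simp add: y_def U.blk_def)
      next
        case False
        then have ki: "k < i" using k by auto
        have "\<tau> (k + 1) \<le> \<tau> i" using ki by (intro \<tau>_mono li) auto
        moreover have "\<tau> i < x" using i unfolding U.blk_def mem_Collect_eq \<tau>(3)[OF li] by simp
        ultimately have "\<tau> (k + 1) \<le> x" by linarith
        then show ?thesis using False \<tau>(1)[OF lk[OF ki]] \<tau>(2)[OF lk[OF ki]] unfolding y_def by auto
      qed
    qed simp
    finally show "ennreal (SS (- int n) i x) epowr (1 / \<theta>') * T x \<le> ennreal (TC powr (1 / q)) * c" .
  qed
  finally show ?thesis .
qed

theorem lower_small: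
  assumes c: "feasible c"
  shows "(SUP x\<in>{0<..}. \<phi> x * T x) + B2 \<le> ennreal (TC powr (1 / q) + Cl powr (1 / q)) * c"
proof (cases "c < top")
  case True
  have "(SUP x\<in>{0<..}. \<phi> x * T x) + B2 \<le> ennreal (TC powr (1 / q)) * c + ennreal (Cl powr (1 / q)) * c"
    using \<phi>_T_le[OF c True] by (intro add_mono SUP_least B2_le c) auto
  then show ?thesis by (simp add: distrib_right ennreal_plus)
next
  case False
  then have "c = top" by (simp add: not_less top_unique)
  moreover have "0 < TC powr (1 / q) + Cl powr (1 / q)" using TC_pos C_pos by (simp add: add_pos_pos)
  ultimately show ?thesis using TC_pos C_pos by (simp add: ennreal_mult_top)
qed

lemma T_finite: assumes "feasible c" "c < top" "0 < x" shows "T x < top"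
proof (rule ccontr)
  assume "\<not> T x < top"
  then have "T x = top" by (simp add: not_less top_unique)
  then have "K x = top" using m.pos[OF assms(3)] by (simp add: K_def ennreal_mult_top)
  then show False using K_finite[OF assms] by simp
qed

text \<open>The series over the groups again has the ratio 2^(-1/2) and a rounding factor 2, hence
  \<open>gC\<close>.\<close>

definition Cgrp :: real where "Cgrp = geoC \<theta> (1 / 2) * gC"

lemma Cgrp_pos: "0 < Cgrp"
proof -
  have "0 < 1 - 2 powr (- (1 / 2)::real)" by (simp add: powr_less_one)
  then show ?thesis unfolding Cgrp_def gC_def using \<theta> by (intro mult_pos_pos geoC_pos divide_pos_pos) auto
qed

text \<open>The first factor is the rounding inside a group, the second one results from the
  absorption of \<open>X\<close>.\<close>

definition Cdisc :: "real \<Rightarrow> real" where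
  "Cdisc r = 2 powr (r / \<theta>') * (TC * Cgrp powr (q / \<theta>)) powr (r / q)"

text \<open>
  The partial sums are grouped by their dyadic size.  As \<open>T\<close> decreases, each group is dominated by its
  first member \<open>am l\<close>, and the sums at these members grow geometrically, so that the test functions
  belonging to different groups do not interfere.
\<close>

lemma lower_discrete:
  assumes c: "feasible c" "c < top" and r: "q < \<theta>" "1 / r = 1 / q - 1 / \<theta>"
    and A: "finite A" and x: "\<And>i. i \<in> A \<Longrightarrow> x i \<in> U.blk i"
  shows "(\<Sum>i\<in>A. ennreal ((\<Sum>k\<in>{k\<in>A. k \<le> i}. wt k (x k)) powr (r / q') * wt i (x i)) * T (x i) epowr r)
    \<le> ennreal (Cdisc r) * c epowr r"
proof -
  note rx = r_exps[OF r]
  have qp: "0 < q" "0 < \<theta>" "0 < \<theta>'" "0 < q'" using q \<theta> \<theta>'1 q'1 by auto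
  define w where "w i = wt i (x i)" for i
  define S where "S i = (\<Sum>k\<in>{k\<in>A. k \<le> i}. w k)" for i
  have x0: "0 < x i" if "i \<in> A" for i by (rule U.blk_pos[OF x[OF that]])
  have w: "0 < w i" if "i \<in> A" for i unfolding w_def by (rule wt_pos[OF x0[OF that]])
  have fin: "finite {k \<in> A. P k}" for P using A by simp
  have S_pos: "0 < S i" if "i \<in> A" for i unfolding S_def using that w fin by (intro sum_pos) auto
  have S_mono: "S i \<le> S k" if "i \<le> k" for i k unfolding S_def using that w fin by (intro sum_mono2) (auto intro: less_imp_le)
  have x_mono: "x i \<le> x k" if "i \<in> A" "k \<in> A" "i \<le> k" for i k
  proof (rule ccontr)
    assume *: "\<not> x i \<le> x k"
    then have "k \<le> i" by (intro U.blk_le[OF x x]) (use that in auto)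
    then have "i = k" using that(3) by simp
    then show False using * by simp
  qed
  define tt where "tt i = enn2real (T (x i))" for i
  have tt: "T (x i) = ennreal (tt i)" "0 \<le> tt i" if "i \<in> A" for i
    using T_finite[OF c x0[OF that]] by (simp_all add: tt_def)
  have tt_anti: "tt k \<le> tt i" if "i \<in> A" "k \<in> A" "i \<le> k" for i k
    using T_anti[OF x0[OF that(1)] x_mono[OF that]] unfolding tt(1)[OF that(1)] tt(1)[OF that(2)]
    using tt(2)[OF that(1)] by simp
  define lev where "lev i = \<lceil>log 2 (S i)\<rceil> - 1" for i
  have lev: "2 powr real_of_int (lev i) \<le> S i" "S i \<le> 2 powr real_of_int (lev i + 1)" if "i \<in> A" for i
  proof -
    have S': "2 powr (log 2 (S i)) = S i" using S_pos[OF that] by simp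
    have "2 powr real_of_int (lev i) \<le> 2 powr (log 2 (S i))" unfolding lev_def by (intro powr_mono) linarith+
    then show "2 powr real_of_int (lev i) \<le> S i" unfolding S' .
    have "2 powr (log 2 (S i)) \<le> 2 powr real_of_int (lev i + 1)" unfolding lev_def by (intro powr_mono) linarith+
    then show "S i \<le> 2 powr real_of_int (lev i + 1)" unfolding S' .
  qed
  have lev_mono: "lev i \<le> lev k" if "i \<in> A" "k \<in> A" "i \<le> k" for i k
    unfolding lev_def using S_mono[OF that(3)] S_pos[OF that(1)] by (intro diff_right_mono ceiling_mono) (simp add: log_le_cancel_iff)
  define G where "G l = {i \<in> A. lev i = l}" for l
  define Js where "Js = lev ` A"
  have Js: "finite Js" unfolding Js_def using A by simp
  have G: "finite (G l)" "l \<in> Js \<Longrightarrow> G l \<noteq> {}" for l unfolding G_def Js_def using A by auto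
  define am where "am l = Min (G l)" for l
  have am: "am l \<in> A" "lev (am l) = l" if "l \<in> Js" for l
    using Min_in[OF G(1) G(2)[OF that]] unfolding am_def G_def by auto
  have am_le: "am l \<le> i" if "i \<in> G l" for l i unfolding am_def using that G(1) by (intro Min_le) auto
  have Gsum: "(\<Sum>i\<in>G l. w i) \<le> 2 powr real_of_int (l + 1)" if l: "l \<in> Js" for l
  proof -
    have M: "Max (G l) \<in> A" "lev (Max (G l)) = l" using Max_in[OF G(1) G(2)[OF l]] unfolding G_def by auto
    have "(\<Sum>i\<in>G l. w i) \<le> S (Max (G l))"
      unfolding S_def using G(1) w fin Max_ge[OF G(1)] by (intro sum_mono2) (auto simp: G_def intro: less_imp_le)
    also have "\<dots> \<le> 2 powr real_of_int (l + 1)" using lev(2)[OF M(1)] unfolding M(2) .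
    finally show ?thesis .
  qed
  define t where "t l = tt (am l)" for l
  have t0: "0 \<le> t l" if "l \<in> Js" for l unfolding t_def by (rule tt(2)[OF am(1)[OF that]])
  \<comment> \<open>In group l the weights sum to at most \<open>2 powr (l + 1)\<close>. As r/q' + 1
    = r/\<theta>', the terms \<open>S powr (r / q') * w\<close> of the group therefore sum to at
    most a multiple of \<open>2 powr (l * r / \<theta>')\<close>.\<close>
  define X where "X = (\<Sum>l\<in>Js. (2 powr (real_of_int l / \<theta>') * t l) powr r)"
  have X0: "0 \<le> X" unfolding X_def by (intro sum_nonneg) simp
  have step1: "(\<Sum>i\<in>A. S i powr (r / q') * w i * tt i powr r) \<le> 2 powr (r / \<theta>') * X"
  proof -
    have "(\<Sum>i\<in>A. S i powr (r / q') * w i * tt i powr r) = (\<Sum>l\<in>Js. \<Sum>i\<in>G l. S i powr (r / q') * w i * tt i powr r)"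
      unfolding G_def using A Js by (intro sum.group[symmetric]) (auto simp: Js_def)
    also have "\<dots> \<le> (\<Sum>l\<in>Js. 2 powr (r / \<theta>') * (2 powr (real_of_int l / \<theta>') * t l) powr r)"
    proof (rule sum_mono)
      fix l assume l: "l \<in> Js"
      let ?P = "2 powr real_of_int (l + 1)"
      have "(\<Sum>i\<in>G l. S i powr (r / q') * w i * tt i powr r) \<le> (\<Sum>i\<in>G l. ?P powr (r / q') * w i * t l powr r)"
      proof (rule sum_mono)
        fix i assume i: "i \<in> G l"
        then have iA: "i \<in> A" "lev i = l" by (auto simp: G_def)
        show "S i powr (r / q') * w i * tt i powr r \<le> ?P powr (r / q') * w i * t l powr r"
        proof (intro mult_mono powr_mono2)
          show "S i \<le> ?P" using lev(2)[OF iA(1)] unfolding iA(2) .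
          show "tt i \<le> t l" unfolding t_def by (rule tt_anti[OF am(1)[OF l] iA(1) am_le[OF i]])
        qed (use w[OF iA(1)] tt(2)[OF iA(1)] S_pos[OF iA(1)] rx(1) qp in auto)
      qed
      also have "\<dots> = ?P powr (r / q') * t l powr r * (\<Sum>i\<in>G l. w i)"
        unfolding sum_distrib_left by (intro sum.cong) auto
      also have "\<dots> \<le> ?P powr (r / q') * t l powr r * ?P"
        by (intro mult_left_mono Gsum l) auto
      also have "\<dots> = ?P powr (r / \<theta>') * t l powr r"
      proof -
        have "?P powr (r / q') * ?P = ?P powr (r / \<theta>')" unfolding rx(2)[symmetric] powr_add by simp
        then show ?thesis by (metis mult.assoc mult.commute)
      qed
      also have "\<dots> = 2 powr (r / \<theta>') * (2 powr (real_of_int l / \<theta>') * t l) powr r"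
      proof -
        have "real_of_int (l + 1) * (r / \<theta>') = r / \<theta>' + real_of_int l / \<theta>' * r" by (simp add: algebra_simps)
        then have "?P powr (r / \<theta>') = 2 powr (r / \<theta>') * (2 powr (real_of_int l / \<theta>')) powr r"
          by (simp only: powr_powr powr_add)
        then show ?thesis using t0[OF l] by (simp add: powr_mult)
      qed
      finally show "(\<Sum>i\<in>G l. S i powr (r / q') * w i * tt i powr r) \<le> 2 powr (r / \<theta>') * (2 powr (real_of_int l / \<theta>') * t l) powr r" .
    qed
    finally show ?thesis unfolding X_def sum_distrib_left .
  qed
  \<comment> \<open>Chosen by duality: \<open>e' powr \<theta> * 2 powr l\<close>, on the side of
    \<open>D\<close>, and \<open>(t * e' * 2 powr l) powr q\<close>, on the side of
    \<open>L\<close>, both become the l-th term of \<open>X\<close>.\<close>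
  define e' where "e' l = 2 powr (real_of_int l * (r / (\<theta> * \<theta>') - 1 / \<theta>)) * t l powr (r / \<theta>)" for l
  have e0: "0 \<le> e' l" for l unfolding e'_def by simp
  have e\<theta>: "e' l powr \<theta> * 2 powr real_of_int l = (2 powr (real_of_int l / \<theta>') * t l) powr r" if "l \<in> Js" for l
  proof -
    have "real_of_int l * (r / (\<theta> * \<theta>') - 1 / \<theta>) * \<theta> + real_of_int l = real_of_int l / \<theta>' * r"
      using qp by (simp add: field_simps)
    then have "(2 powr (real_of_int l * (r / (\<theta> * \<theta>') - 1 / \<theta>))) powr \<theta> * 2 powr real_of_int l = (2 powr (real_of_int l / \<theta>')) powr r"
      by (simp only: powr_powr powr_add[symmetric])
    moreover have "(t l powr (r / \<theta>)) powr \<theta> = t l powr r" using qp by (simp add: powr_powr)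
    ultimately show ?thesis unfolding e'_def using t0[OF that] by (simp add: powr_mult)
  qed
  have eq1: "q * (1 + r / \<theta>) = r"
  proof -
    have "(q / r + q / \<theta>) * r = r" unfolding rx(3) by simp
    then show ?thesis using rx(1) by (simp add: algebra_simps)
  qed
  have eq: "(t l * (e' l * 2 powr real_of_int l)) powr q = (2 powr (real_of_int l / \<theta>') * t l) powr r" if "l \<in> Js" for l
  proof (cases "t l = 0")
    case False
    then have t: "0 < t l" using t0[OF that] by simp
    have th: "- (1 / \<theta>) + 1 = 1 / \<theta>'" using \<theta>_sum by linarith
    have "t l * (e' l * 2 powr real_of_int l) = 2 powr (real_of_int l * (r / (\<theta> * \<theta>') - 1 / \<theta>) + real_of_int l) * t l powr (1 + r / \<theta>)"
      unfolding e'_def using t by (simp add: powr_add)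
    also have "real_of_int l * (r / (\<theta> * \<theta>') - 1 / \<theta>) + real_of_int l = real_of_int l / \<theta>' * (1 + r / \<theta>)"
    proof -
      have "real_of_int l * (r / (\<theta> * \<theta>') - 1 / \<theta>) + real_of_int l = real_of_int l * (r / (\<theta> * \<theta>') + (- (1 / \<theta>) + 1))"
        by (simp add: algebra_simps)
      also have "\<dots> = real_of_int l / \<theta>' * (1 + r / \<theta>)" unfolding th using qp by (simp add: field_simps)
      finally show ?thesis .
    qed
    also have "2 powr (real_of_int l / \<theta>' * (1 + r / \<theta>)) * t l powr (1 + r / \<theta>) = (2 powr (real_of_int l / \<theta>') * t l) powr (1 + r / \<theta>)"
      using t by (simp add: powr_mult powr_powr)
    finally show ?thesis using eq1 by (simp add: powr_powr mult.commute)
  qed (use that in simp)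
  define \<alpha> where "\<alpha> i l = (if i \<le> am l then e' l * w i powr (1 / \<theta>) else 0)" for i l
  \<comment> \<open>After the first member of the group the coefficient is 0, and
    \<open>x (am l)\<close> is a point that meets the constraints of
    \<open>test_lemma\<close>.\<close>
  define y where "y i l = (if i \<le> am l then x i else x (am l))" for i l
  have test: "(\<Sum>l\<in>Js. (T (x (am l)) * (\<Sum>i\<in>A. ennreal (2 powr (- (real_of_int i / \<theta>)) * m (y i l) powr (1 / p') * \<alpha> i l))) epowr q)
    \<le> ennreal TC * c epowr q * (\<Sum>i\<in>A. (\<Sum>l\<in>Js. ennreal (\<alpha> i l)) epowr \<theta>) epowr (q / \<theta>)"
  proof (rule test_lemma[OF c A Js])
    show "0 < x (am l)" if "l \<in> Js" for l by (rule x0[OF am(1)[OF that]])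
    show "0 \<le> \<alpha> i l" for i l unfolding \<alpha>_def using e0 by simp
    fix i l assume i: "i \<in> A" and l: "l \<in> Js"
    show "0 < y i l \<and> y i l \<le> x (am l) \<and> U (y i l) \<le> 2 powr real_of_int (i + 1)"
    proof (cases "i \<le> am l")
      case True
      then show ?thesis using x0[OF i] x_mono[OF i am(1)[OF l] True] x[OF i] by (simp add: y_def U.blk_def)
    next
      case False
      have "2 powr real_of_int (am l + 1) \<le> 2 powr real_of_int (i + 1)" using False by simp
      moreover have "U (x (am l)) \<le> 2 powr real_of_int (am l + 1)" using x[OF am(1)[OF l]] unfolding U.blk_def by blast
      ultimately have "U (x (am l)) \<le> 2 powr real_of_int (i + 1)" by linarith
      then show ?thesis using False x0[OF am(1)[OF l]] unfolding y_def by simp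
    qed
  qed
  have left: "ennreal X \<le> (\<Sum>l\<in>Js. (T (x (am l)) * (\<Sum>i\<in>A. ennreal (2 powr (- (real_of_int i / \<theta>)) * m (y i l) powr (1 / p') * \<alpha> i l))) epowr q)"
  proof -
    have "ennreal X = (\<Sum>l\<in>Js. ennreal ((t l * (e' l * 2 powr real_of_int l)) powr q))"
      unfolding X_def using eq by (subst sum_ennreal) (auto intro!: arg_cong[where f = ennreal] sum.cong)
    also have "\<dots> \<le> (\<Sum>l\<in>Js. (T (x (am l)) * (\<Sum>i\<in>A. ennreal (2 powr (- (real_of_int i / \<theta>)) * m (y i l) powr (1 / p') * \<alpha> i l))) epowr q)"
    proof (rule sum_mono)
      fix l assume l: "l \<in> Js"
      have "2 powr (- (real_of_int i / \<theta>)) * m (y i l) powr (1 / p') * \<alpha> i l = (if i \<le> am l then e' l * w i else 0)" if i: "i \<in> A" for i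
      proof (cases "i \<le> am l")
        case True
        have "w i powr (1 / \<theta>') * w i powr (1 / \<theta>) = w i" unfolding powr_add[symmetric] \<theta>_sum using w[OF i] by simp
        then show ?thesis using True by (simp add: y_def \<alpha>_def wt_root[symmetric] w_def[symmetric])
      qed (simp add: \<alpha>_def)
      then have "(\<Sum>i\<in>A. ennreal (2 powr (- (real_of_int i / \<theta>)) * m (y i l) powr (1 / p') * \<alpha> i l)) = (\<Sum>i\<in>A. ennreal (if i \<le> am l then e' l * w i else 0))"
        by (intro sum.cong) auto
      also have "\<dots> = ennreal (\<Sum>i\<in>A. if i \<le> am l then e' l * w i else 0)"
        using e0 w by (intro sum_ennreal) (auto intro: mult_nonneg_nonneg less_imp_le)
      also have "(\<Sum>i\<in>A. if i \<le> am l then e' l * w i else 0) = e' l * S (am l)"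
        unfolding S_def sum_distrib_left using A by (simp add: sum.inter_filter)
      finally have eqS: "(\<Sum>i\<in>A. ennreal (2 powr (- (real_of_int i / \<theta>)) * m (y i l) powr (1 / p') * \<alpha> i l)) = ennreal (e' l * S (am l))" .
      have "ennreal ((t l * (e' l * 2 powr real_of_int l)) powr q) = ennreal (t l * (e' l * 2 powr real_of_int l)) epowr q"
        using t0[OF l] e0[of l] qp by (simp add: epowr_ennreal_pos)
      also have "\<dots> \<le> ennreal (t l * (e' l * S (am l))) epowr q"
        using lev(1)[OF am(1)[OF l]] qp t0[OF l] e0[of l] unfolding am(2)[OF l]
        by (intro epowr_mono ennreal_leI mult_left_mono) auto
      also have "\<dots> = (T (x (am l)) * ennreal (e' l * S (am l))) epowr q"
        unfolding tt(1)[OF am(1)[OF l]] t_def[symmetric] using t0[OF l] by (simp add: ennreal_mult')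
      finally show "ennreal ((t l * (e' l * 2 powr real_of_int l)) powr q) \<le> (T (x (am l)) * (\<Sum>i\<in>A. ennreal (2 powr (- (real_of_int i / \<theta>)) * m (y i l) powr (1 / p') * \<alpha> i l))) epowr q"
        unfolding eqS .
    qed
    finally show ?thesis .
  qed
  have right: "(\<Sum>i\<in>A. (\<Sum>l\<in>Js. ennreal (\<alpha> i l)) epowr \<theta>) \<le> ennreal (Cgrp * X)"
  proof -
    let ?b = "\<lambda>i l. 2 powr (1 / 2 * real_of_int (l - lev i)) * (e' l powr \<theta> * w i)"
    have "(\<Sum>i\<in>A. (\<Sum>l\<in>Js. ennreal (\<alpha> i l)) epowr \<theta>) \<le> (\<Sum>i\<in>A. ennreal (geoC \<theta> (1 / 2) * (\<Sum>l\<in>{l\<in>Js. lev i \<le> l}. ?b i l)))"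
    proof (rule sum_mono)
      fix i assume i: "i \<in> A"
      let ?I = "{l\<in>Js. i \<le> am l}"
      \<comment> \<open>From i \<le> am l follows lev i \<le> l, so the geometric loss can be
        counted from \<open>lev i\<close>.\<close>
      have I: "finite ?I" "?I \<subseteq> {lev i..}" using Js lev_mono[OF i am(1)] am(2) by auto
      have "(\<Sum>l\<in>Js. ennreal (\<alpha> i l)) = (\<Sum>l\<in>?I. ennreal (e' l * w i powr (1 / \<theta>)))"
        unfolding \<alpha>_def using Js by (simp add: sum.inter_filter if_distrib[of ennreal] cong: if_cong)
      then have "(\<Sum>l\<in>Js. ennreal (\<alpha> i l)) epowr \<theta> \<le> ennreal (geoC \<theta> (1 / 2)) * (\<Sum>l\<in>?I. ennreal (2 powr (1 / 2 * real_of_int (l - lev i))) * ennreal (e' l * w i powr (1 / \<theta>)) epowr \<theta>)"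
        using epowr_sum_geometric[OF I qp(2), of "1 / 2" "\<lambda>l. ennreal (e' l * w i powr (1 / \<theta>))"] by simp
      also have "\<dots> = ennreal (geoC \<theta> (1 / 2)) * (\<Sum>l\<in>?I. ennreal (?b i l))"
      proof -
        have "ennreal (e' l * w i powr (1 / \<theta>)) epowr \<theta> = ennreal (e' l powr \<theta> * w i)" for l
          using e0[of l] w[OF i] qp by (simp add: epowr_ennreal_pos powr_mult powr_powr)
        then show ?thesis by (simp only: ennreal_mult'[symmetric] powr_ge_zero)
      qed
      also have "\<dots> \<le> ennreal (geoC \<theta> (1 / 2)) * (\<Sum>l\<in>{l\<in>Js. lev i \<le> l}. ennreal (?b i l))"
        using I Js by (intro mult_left_mono sum_mono2) auto
      also have "\<dots> = ennreal (geoC \<theta> (1 / 2) * (\<Sum>l\<in>{l\<in>Js. lev i \<le> l}. ?b i l))"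
        using w[OF i] geoC_pos[of \<theta> "1 / 2"] qp by (subst sum_ennreal) (auto simp: ennreal_mult' less_imp_le)
      finally show "(\<Sum>l\<in>Js. ennreal (\<alpha> i l)) epowr \<theta> \<le> ennreal (geoC \<theta> (1 / 2) * (\<Sum>l\<in>{l\<in>Js. lev i \<le> l}. ?b i l))" .
    qed
    also have "\<dots> = ennreal (\<Sum>i\<in>A. geoC \<theta> (1 / 2) * (\<Sum>l\<in>{l\<in>Js. lev i \<le> l}. ?b i l))"
      using w geoC_pos[of \<theta> "1 / 2"] qp
      by (intro sum_ennreal mult_nonneg_nonneg sum_nonneg) (auto simp: less_imp_le)
    also have "\<dots> \<le> ennreal (Cgrp * X)"
    proof (rule ennreal_leI)
      have "(\<Sum>i\<in>A. \<Sum>l\<in>{l\<in>Js. lev i \<le> l}. ?b i l) = (\<Sum>l\<in>Js. \<Sum>i\<in>{i\<in>A. lev i \<le> l}. ?b i l)"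
        using A Js by (rule sum.swap_restrict)
      also have "\<dots> \<le> (\<Sum>l\<in>Js. gC * (e' l powr \<theta> * 2 powr real_of_int l))"
      proof (rule sum_mono)
        fix l assume l: "l \<in> Js"
        let ?T = "{k\<in>Js. k \<le> l}"
        have fT: "finite ?T" using Js by simp
        have "(\<Sum>i\<in>{i\<in>A. lev i \<le> l}. ?b i l) = (\<Sum>k\<in>?T. \<Sum>i\<in>{i\<in>{i\<in>A. lev i \<le> l}. lev i = k}. ?b i l)"
          using fin fT by (intro sum.group[symmetric]) (auto simp: Js_def)
        \<comment> \<open>Group k has total weight at most 2^(k+1), and 2^((l-k)/2) * 2^k sums over
          k \<le> l to the order of 2^l.\<close>
        also have "\<dots> \<le> (\<Sum>k\<in>?T. e' l powr \<theta> * (2 powr (1 / 2 * real_of_int l) * (2 * 2 powr (1 / 2 * real_of_int k))))"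
        proof (rule sum_mono)
          fix k assume k: "k \<in> ?T"
          then have kJ: "k \<in> Js" and kl: "k \<le> l" by auto
          have "(\<Sum>i\<in>{i\<in>{i\<in>A. lev i \<le> l}. lev i = k}. ?b i l) = (\<Sum>i\<in>G k. e' l powr \<theta> * 2 powr (1 / 2 * real_of_int (l - k)) * w i)"
            using kl by (intro sum.cong) (auto simp: G_def)
          also have "\<dots> = e' l powr \<theta> * 2 powr (1 / 2 * real_of_int (l - k)) * (\<Sum>i\<in>G k. w i)"
            by (rule sum_distrib_left[symmetric])
          also have "\<dots> \<le> e' l powr \<theta> * 2 powr (1 / 2 * real_of_int (l - k)) * 2 powr real_of_int (k + 1)"
            by (intro mult_left_mono Gsum kJ) auto
          also have "\<dots> = e' l powr \<theta> * (2 powr (1 / 2 * real_of_int l) * (2 * 2 powr (1 / 2 * real_of_int k)))"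
          proof -
            have "1 / 2 * real_of_int (l - k) + real_of_int (k + 1) = 1 / 2 * real_of_int l + (1 + 1 / 2 * real_of_int k)" by (simp add: field_simps)
            then have "2 powr (1 / 2 * real_of_int (l - k)) * 2 powr real_of_int (k + 1) = 2 powr (1 / 2 * real_of_int l) * (2 powr 1 * 2 powr (1 / 2 * real_of_int k))"
              by (simp only: powr_add[symmetric])
            then show ?thesis by (simp only: mult.assoc) simp
          qed
          finally show "(\<Sum>i\<in>{i\<in>{i\<in>A. lev i \<le> l}. lev i = k}. ?b i l) \<le> e' l powr \<theta> * (2 powr (1 / 2 * real_of_int l) * (2 * 2 powr (1 / 2 * real_of_int k)))" .
        qed
        also have "\<dots> = e' l powr \<theta> * (2 powr (1 / 2 * real_of_int l) * (2 * (\<Sum>k\<in>?T. 2 powr (1 / 2 * real_of_int k))))"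
          by (simp only: sum_distrib_left)
        also have "\<dots> \<le> e' l powr \<theta> * (2 powr (1 / 2 * real_of_int l) * (2 * (2 powr (1 / 2 * real_of_int l) / (1 - 2 powr (- (1 / 2))))))"
          using fT by (intro mult_left_mono sum_geometric_below) auto
        also have "\<dots> = gC * (e' l powr \<theta> * 2 powr real_of_int l)"
        proof -
          have "2 powr (1 / 2 * real_of_int l) * 2 powr (1 / 2 * real_of_int l) = 2 powr real_of_int l"
            unfolding powr_add[symmetric] by simp
          then show ?thesis unfolding gC_def by simp
        qed
        finally show "(\<Sum>i\<in>{i\<in>A. lev i \<le> l}. ?b i l) \<le> gC * (e' l powr \<theta> * 2 powr real_of_int l)" .
      qed
      also have "\<dots> = gC * X" unfolding X_def sum_distrib_left using e\<theta> by (intro sum.cong) auto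
      finally have "geoC \<theta> (1 / 2) * (\<Sum>i\<in>A. \<Sum>l\<in>{l\<in>Js. lev i \<le> l}. ?b i l) \<le> geoC \<theta> (1 / 2) * (gC * X)"
        using geoC_pos[of \<theta> "1 / 2"] qp by (intro mult_left_mono) auto
      then show "(\<Sum>i\<in>A. geoC \<theta> (1 / 2) * (\<Sum>l\<in>{l\<in>Js. lev i \<le> l}. ?b i l)) \<le> Cgrp * X"
        unfolding Cgrp_def sum_distrib_left[symmetric] by (simp only: mult.assoc)
    qed
    finally show ?thesis .
  qed
  obtain cc where cc: "c = ennreal cc" "0 \<le> cc" using c(2) by (cases c) auto
  have "ennreal X \<le> ennreal TC * c epowr q * ennreal (Cgrp * X) epowr (q / \<theta>)"
    using qp by (intro order.trans[OF left] order.trans[OF test] mult_left_mono epowr_mono right) auto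
  also have "\<dots> = ennreal (TC * cc powr q * (Cgrp * X) powr (q / \<theta>))"
  proof -
    have "ennreal (Cgrp * X) epowr (q / \<theta>) = ennreal ((Cgrp * X) powr (q / \<theta>))"
      using X0 Cgrp_pos qp by (intro epowr_ennreal_pos) auto
    moreover have "c epowr q = ennreal (cc powr q)" unfolding cc(1) using cc(2) qp by (intro epowr_ennreal_pos) auto
    ultimately show ?thesis using TC_pos by (simp only: ennreal_mult powr_ge_zero mult_nonneg_nonneg less_imp_le)
  qed
  finally have "X \<le> TC * cc powr q * (Cgrp * X) powr (q / \<theta>)" using TC_pos by (simp add: ennreal_le_iff)
  \<comment> \<open>\<open>X\<close> is a finite real number and the exponent q/\<theta> = 1 - q/r
    is below 1, so the power of \<open>X\<close> on the right can be absorbed.\<close>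
  then have "X \<le> (TC * Cgrp powr (q / \<theta>) * cc powr q) * X powr (1 - q / r)"
  proof -
    have "1 - q / r = q / \<theta>" using rx(3) by linarith
    then show "X \<le> TC * cc powr q * (Cgrp * X) powr (q / \<theta>) \<Longrightarrow> ?thesis"
      using Cgrp_pos X0 by (simp add: powr_mult mult_ac)
  qed
  then have "X \<le> (TC * Cgrp powr (q / \<theta>) * cc powr q) powr (1 / (q / r))"
    using X0 TC_pos qp rx(1) by (intro powr_self_improve) auto
  also have "\<dots> = (TC * Cgrp powr (q / \<theta>)) powr (r / q) * cc powr r"
    using TC_pos qp by (simp add: powr_mult powr_powr)
  finally have X: "X \<le> (TC * Cgrp powr (q / \<theta>)) powr (r / q) * cc powr r" .
  have "(\<Sum>i\<in>A. ennreal (S i powr (r / q') * w i) * T (x i) epowr r) = ennreal (\<Sum>i\<in>A. S i powr (r / q') * w i * tt i powr r)"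
  proof -
    have "ennreal (S i powr (r / q') * w i) * T (x i) epowr r = ennreal (S i powr (r / q') * w i * tt i powr r)" if "i \<in> A" for i
      using tt[OF that] rx(1) w[OF that] by (simp add: epowr_ennreal_pos ennreal_mult')
    then have "(\<Sum>i\<in>A. ennreal (S i powr (r / q') * w i) * T (x i) epowr r) = (\<Sum>i\<in>A. ennreal (S i powr (r / q') * w i * tt i powr r))"
      by (intro sum.cong) auto
    also have "\<dots> = ennreal (\<Sum>i\<in>A. S i powr (r / q') * w i * tt i powr r)"
      using w by (intro sum_ennreal mult_nonneg_nonneg) (auto intro: less_imp_le)
    finally show ?thesis .
  qed
  also have "\<dots> \<le> ennreal (2 powr (r / \<theta>') * ((TC * Cgrp powr (q / \<theta>)) powr (r / q) * cc powr r))"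
    using step1 X by (intro ennreal_leI order.trans[OF step1] mult_left_mono) auto
  also have "\<dots> = ennreal (Cdisc r) * c epowr r"
    unfolding Cdisc_def cc(1) using cc(2) rx(1) by (simp add: epowr_ennreal_pos ennreal_mult'' mult_ac)
  finally show ?thesis unfolding S_def w_def .
qed

lemma blk_nonempty: assumes "live i" shows "U.blk i \<noteq> {}"
proof (cases "live (i + 1)")
  case True
  have "2 powr real_of_int i < 2 powr real_of_int (i + 1)" by simp
  then have "\<tau> (i + 1) \<in> U.blk i" unfolding U.blk_def using \<tau>(2)[OF True] by simp
  then show ?thesis by blast
next
  case False
  obtain x where "2 powr real_of_int i < U x" using assms by (auto simp: live_def)
  moreover have "U x \<le> 2 powr real_of_int (i + 1)" using False unfolding live_def by (simp add: not_less)
  ultimately have "x \<in> U.blk i" by (simp add: U.blk_def)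
  then show ?thesis by blast
qed

text \<open>\<open>SS\<close> uses right ends of blocks, \<open>lower_discrete\<close> sample
  points. As \<open>\<tau> (k + 1)\<close> lies to the left of the sample in block k + 1, the index
  is moved up by one at the cost of \<open>2 powr (\<theta>' - 1)\<close>. With the term of block i
  itself the total is at most \<open>2 powr \<theta>'\<close>.\<close>

lemma lower_window:
  assumes c: "feasible c" "c < top" and r: "q < \<theta>" "1 / r = 1 / q - 1 / \<theta>"
    and x: "\<And>i. i \<in> {i\<in>{- int n..int n}. live i} \<Longrightarrow> x i \<in> U.blk i"
  shows "(\<Sum>i\<in>{i\<in>{- int n..int n}. live i}. ennreal (SS (- int n) i (x i) powr (r / q') * wt i (x i)) * T (x i) epowr r)
    \<le> ennreal (2 powr (\<theta>' * r / q') * Cdisc r) * c epowr r"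
proof -
  note rx = r_exps[OF r]
  let ?A = "{i\<in>{- int n..int n}. live i}"
  have A: "finite ?A" by (auto intro: finite_subset[of _ "{- int n..int n}"])
  define S where "S i = (\<Sum>k\<in>{k\<in>?A. k \<le> i}. wt k (x k))" for i
  have fS: "finite {k\<in>?A. k \<le> i}" for i using A by (rule finite_subset[rotated]) blast
  have w: "0 < wt i (x i)" if "i \<in> ?A" for i by (rule wt_pos[OF U.blk_pos[OF x[OF that]]])
  have SS: "0 \<le> SS (- int n) i (x i) \<and> SS (- int n) i (x i) \<le> 2 powr \<theta>' * S i" if i: "i \<in> ?A" for i
  proof -
    have k: "k + 1 \<in> {k\<in>?A. k \<le> i}" if "k \<in> {- int n..i - 1}" for k
      using that i live_mono[of i "k + 1"] by auto
    have wk: "0 \<le> wt k (\<tau> (k + 1)) \<and> wt k (\<tau> (k + 1)) \<le> 2 powr (\<theta>' - 1) * wt (k + 1) (x (k + 1))" if "k \<in> {- int n..i - 1}" for k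
    proof -
      have kA: "k + 1 \<in> ?A" using k[OF that] by blast
      then have l: "live (k + 1)" by blast
      have "\<tau> (k + 1) < x (k + 1)" using x[OF kA] unfolding U.blk_def mem_Collect_eq \<tau>(3)[OF l] by simp
      then have "m (\<tau> (k + 1)) powr (\<theta>' / p') \<le> m (x (k + 1)) powr (\<theta>' / p')"
        using monoD[OF m.mono, of "\<tau> (k + 1)" "x (k + 1)"] m.pos[OF \<tau>(1)[OF l]] \<theta>_exps(4) by (intro powr_mono2) auto
      moreover have "2 powr (real_of_int k * (1 - \<theta>')) = 2 powr (\<theta>' - 1) * 2 powr (real_of_int (k + 1) * (1 - \<theta>'))"
      proof -
        have "real_of_int k * (1 - \<theta>') = (\<theta>' - 1) + real_of_int (k + 1) * (1 - \<theta>')" by (simp add: algebra_simps)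
        then show ?thesis by (simp only: powr_add)
      qed
      ultimately have "wt k (\<tau> (k + 1)) \<le> 2 powr (\<theta>' - 1) * wt (k + 1) (x (k + 1))"
        unfolding wt_def by (simp only: mult.assoc) (intro mult_left_mono, auto)
      then show ?thesis using wt_pos[OF \<tau>(1)[OF l], of k] by simp
    qed
    have "(\<Sum>k=- int n..i - 1. wt k (\<tau> (k + 1))) \<le> (\<Sum>k=- int n..i - 1. 2 powr (\<theta>' - 1) * wt (k + 1) (x (k + 1)))"
      using wk by (intro sum_mono) blast
    also have "\<dots> = 2 powr (\<theta>' - 1) * (\<Sum>k\<in>(\<lambda>k. k + 1) ` {- int n..i - 1}. wt k (x k))"
      by (subst sum.reindex) (auto simp: sum_distrib_left)
    also have "\<dots> \<le> 2 powr (\<theta>' - 1) * S i"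
      unfolding S_def
    proof (intro mult_left_mono sum_mono2 fS)
      show "(\<lambda>k. k + 1) ` {- int n..i - 1} \<subseteq> {k\<in>?A. k \<le> i}" using k by blast
    qed (use w in \<open>auto intro: less_imp_le\<close>)
    also have "wt i (x i) \<le> S i"
      unfolding S_def using i fS w by (intro member_le_sum) (auto intro: less_imp_le)
    finally (add_mono) have *: "SS (- int n) i (x i) \<le> 2 powr (\<theta>' - 1) * S i + S i" unfolding SS_def .
    have "1 \<le> 2 powr (\<theta>' - 1)" using \<theta>'1 by (simp add: ge_one_powr_ge_zero)
    moreover have S0: "0 \<le> S i" unfolding S_def using w by (intro sum_nonneg) (auto intro: less_imp_le)
    ultimately have "S i \<le> 2 powr (\<theta>' - 1) * S i" using mult_right_mono[of 1 "2 powr (\<theta>' - 1)" "S i"] by simp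
    moreover have "2 * 2 powr (\<theta>' - 1) = 2 powr \<theta>'" by (simp add: powr_diff)
    ultimately have "SS (- int n) i (x i) \<le> 2 powr \<theta>' * S i" using * by (simp add: mult.assoc[symmetric] flip: \<open>2 * 2 powr (\<theta>' - 1) = 2 powr \<theta>'\<close>)
    moreover have "0 \<le> SS (- int n) i (x i)" unfolding SS_def using wk w[OF i] by (intro add_nonneg_nonneg sum_nonneg) auto
    ultimately show ?thesis by simp
  qed
  have "(\<Sum>i\<in>?A. ennreal (SS (- int n) i (x i) powr (r / q') * wt i (x i)) * T (x i) epowr r)
    \<le> (\<Sum>i\<in>?A. ennreal (2 powr (\<theta>' * r / q')) * (ennreal (S i powr (r / q') * wt i (x i)) * T (x i) epowr r))"
  proof (rule sum_mono)
    fix i assume i: "i \<in> ?A"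
    have S0: "0 \<le> S i" unfolding S_def using w by (intro sum_nonneg) (auto intro: less_imp_le)
    have "SS (- int n) i (x i) powr (r / q') \<le> (2 powr \<theta>' * S i) powr (r / q')"
      using SS[OF i] rx(1) q'1 by (intro powr_mono2) auto
    also have "\<dots> = 2 powr (\<theta>' * r / q') * S i powr (r / q')" using S0 by (simp add: powr_mult powr_powr)
    finally have "SS (- int n) i (x i) powr (r / q') * wt i (x i) \<le> 2 powr (\<theta>' * r / q') * (S i powr (r / q') * wt i (x i))"
      using w[OF i] unfolding mult.assoc[symmetric] by (intro mult_right_mono) auto
    then have "ennreal (SS (- int n) i (x i) powr (r / q') * wt i (x i)) \<le> ennreal (2 powr (\<theta>' * r / q')) * ennreal (S i powr (r / q') * wt i (x i))"
      by (subst ennreal_mult'[symmetric]) (auto intro: ennreal_leI)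
    then have "ennreal (SS (- int n) i (x i) powr (r / q') * wt i (x i)) * T (x i) epowr r
      \<le> (ennreal (2 powr (\<theta>' * r / q')) * ennreal (S i powr (r / q') * wt i (x i))) * T (x i) epowr r"
      by (rule mult_right_mono) simp
    then show "ennreal (SS (- int n) i (x i) powr (r / q') * wt i (x i)) * T (x i) epowr r
      \<le> ennreal (2 powr (\<theta>' * r / q')) * (ennreal (S i powr (r / q') * wt i (x i)) * T (x i) epowr r)"
      by (simp only: mult.assoc)
  qed
  also have "\<dots> = ennreal (2 powr (\<theta>' * r / q')) * (\<Sum>i\<in>?A. ennreal (S i powr (r / q') * wt i (x i)) * T (x i) epowr r)"
    by (rule sum_distrib_left[symmetric])
  also have "\<dots> \<le> ennreal (2 powr (\<theta>' * r / q')) * (ennreal (Cdisc r) * c epowr r)"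
    unfolding S_def by (intro mult_left_mono lower_discrete[OF c r A x]) auto
  also have "\<dots> = ennreal (2 powr (\<theta>' * r / q') * Cdisc r) * c epowr r"
    by (simp add: ennreal_mult' mult.assoc)
  finally show ?thesis .
qed

text \<open>On each block of a finite window the discretised integrand is replaced by its supremum,
  which \<open>sum_SUP_le\<close> reduces to the sampled sums of \<open>lower_window\<close>; the
  windows exhaust the half-line.\<close>

lemma J_le:
  assumes c: "feasible c" "c < top" and r: "q < \<theta>" "1 / r = 1 / q - 1 / \<theta>"
  shows "J r \<le> ennreal (2 powr (\<theta>' * r / q') * Cdisc r) * c epowr r"
proof -
  note rx = r_exps[OF r]
  define f where "f n i x = ennreal (SS (- int n) i x powr (r / q') * m x powr (\<theta>' / p')) * T x epowr r" for n i x
  define cc where "cc n i = (SUP x\<in>U.blk i. f n i x)" for n i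
  let ?A = "\<lambda>n. {- int n..int n}"
  let ?g = "\<lambda>n x. \<Sum>i\<in>?A n. cc n i * indicator (U.blk i) x"
  have SS_nonneg: "0 \<le> SS (- int n) i x" if x: "x \<in> U.blk i" for n i x
    unfolding SS_def using U.blk_pos[OF x] live_mono[OF blk_live'[OF x]]
    by (intro add_nonneg_nonneg sum_nonneg less_imp_le wt_pos \<tau>(1)) auto
  have SS_mono: "SS (- int n) i x \<le> SS (- int n') i x" if x: "x \<in> U.blk i" and n: "n \<le> n'" for n n' i x
    unfolding SS_def
  proof (intro add_right_mono sum_mono2)
    fix k assume "k \<in> {- int n'..i - 1} - {- int n..i - 1}"
    then have "live (k + 1)" using live_mono[OF blk_live'[OF x], of "k + 1"] by auto
    then show "0 \<le> wt k (\<tau> (k + 1))" by (intro less_imp_le wt_pos \<tau>(1))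
  qed (use n in auto)
  have cc_mono: "cc n i \<le> cc n' i" if "n \<le> n'" for n n' i
    unfolding cc_def f_def using SS_mono[OF _ that] SS_nonneg rx(1) q'1
    by (intro SUP_subset_mono order_refl mult_right_mono ennreal_leI powr_mono2) auto
  have "J r \<le> (\<integral>\<^sup>+x. (SUP n. ?g n x) \<partial>\<beta>)"
    unfolding J_def J_integrand
  proof (intro nn_integral_mono_AE, use AE_\<beta> in eventually_elim)
    fix x :: real assume x0: "0 < x"
    obtain i where i: "x \<in> U.blk i" using x0 by (rule U.blk_ex)
    have rq: "0 < r / q'" using rx(1) q'1 by simp
    have "\<Psi> x epowr (r / q') \<le> (SUP n::nat. ennreal (SS (- int n) i x)) epowr (r / q')"
      using rq by (intro epowr_mono \<Psi>_upper i) auto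
    also have "\<dots> = (SUP n::nat. ennreal (SS (- int n) i x powr (r / q')))"
      using rq SS_nonneg[OF i] by (simp add: epowr_SUP epowr_ennreal_pos)
    finally have "\<Psi> x epowr (r / q') * ennreal (m x powr (\<theta>' / p')) * T x epowr r
       \<le> (SUP n::nat. ennreal (SS (- int n) i x powr (r / q'))) * ennreal (m x powr (\<theta>' / p')) * T x epowr r"
      by (intro mult_right_mono) auto
    also have "\<dots> = (SUP n. f n i x)"
      unfolding f_def by (simp only: SUP_mult_right_ennreal ennreal_mult'[OF powr_ge_zero])
    also have "\<dots> \<le> (SUP n. ?g n x)"
    proof (rule SUP_least)
      fix n
      let ?n = "max n (nat \<bar>i\<bar>)"
      have iA: "i \<in> ?A ?n" by (simp only: atLeastAtMost_iff of_nat_max) (simp, linarith)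
      have "f n i x \<le> cc n i" unfolding cc_def using i by (intro SUP_upper)
      also have "\<dots> \<le> cc ?n i" by (rule cc_mono) simp
      also have "\<dots> = ?g ?n x" using iA by (subst U.sum_blk[OF _ i]) simp_all
      also have "\<dots> \<le> (SUP n. ?g n x)" by (rule SUP_upper) simp
      finally show "f n i x \<le> (SUP n. ?g n x)" .
    qed
    finally show "\<Psi> x epowr (r / q') * ennreal (m x powr (\<theta>' / p')) * T x epowr r \<le> (SUP n. ?g n x)" .
  qed
  also have "\<dots> = (SUP n. \<integral>\<^sup>+x. ?g n x \<partial>\<beta>)"
  proof (rule nn_integral_monotone_convergence_SUP)
    show "incseq ?g"
    proof (intro incseq_SucI le_funI)
      fix n x
      have "?g n x \<le> (\<Sum>i\<in>?A n. cc (Suc n) i * indicator (U.blk i) x)"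
        by (intro sum_mono mult_right_mono cc_mono) auto
      also have "\<dots> \<le> ?g (Suc n) x" by (intro sum_mono2) auto
      finally show "?g n x \<le> ?g (Suc n) x" .
    qed
  qed measurable
  also have "\<dots> \<le> ennreal (2 powr (\<theta>' * r / q') * Cdisc r) * c epowr r"
  proof (rule SUP_least)
    fix n :: nat
    let ?L = "{i\<in>?A n. live i}"
    have fL: "finite ?L" by (auto intro: finite_subset[of _ "?A n"])
    have "(\<integral>\<^sup>+x. ?g n x \<partial>\<beta>) = (\<Sum>i\<in>?A n. \<integral>\<^sup>+x. cc n i * indicator (U.blk i) x \<partial>\<beta>)"
      by (rule nn_integral_sum) measurable
    also have "\<dots> = (\<Sum>i\<in>?A n. cc n i * emeasure \<beta> (U.blk i))"
      by (simp only: nn_integral_cmult_indicator sets_\<beta> U.blk_sets)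
    also have "\<dots> = (\<Sum>i\<in>?L. cc n i * emeasure \<beta> (U.blk i))"
      by (rule sum.mono_neutral_right) (auto simp: dead_blk)
    also have "\<dots> \<le> (\<Sum>i\<in>?L. cc n i * ennreal (2 powr (real_of_int i * (1 - \<theta>'))))"
      by (intro sum_mono mult_left_mono \<beta>_blk_le) auto
    also have "\<dots> = (\<Sum>i\<in>?L. SUP x\<in>U.blk i. ennreal (SS (- int n) i x powr (r / q') * wt i x) * T x epowr r)"
    proof (rule sum.cong[OF refl])
      fix i
      have "f n i x * ennreal (2 powr (real_of_int i * (1 - \<theta>'))) = ennreal (SS (- int n) i x powr (r / q') * wt i x) * T x epowr r" for x
      proof -
        have "SS (- int n) i x powr (r / q') * wt i x = SS (- int n) i x powr (r / q') * m x powr (\<theta>' / p') * 2 powr (real_of_int i * (1 - \<theta>'))"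
          unfolding wt_def by (simp only: mult_ac)
        moreover have "ennreal (SS (- int n) i x powr (r / q') * m x powr (\<theta>' / p') * 2 powr (real_of_int i * (1 - \<theta>')))
          = ennreal (SS (- int n) i x powr (r / q') * m x powr (\<theta>' / p')) * ennreal (2 powr (real_of_int i * (1 - \<theta>')))"
          by (rule ennreal_mult'') simp
        ultimately show ?thesis unfolding f_def by (simp only: mult_ac)
      qed
      then show "cc n i * ennreal (2 powr (real_of_int i * (1 - \<theta>'))) = (SUP x\<in>U.blk i. ennreal (SS (- int n) i x powr (r / q') * wt i x) * T x epowr r)"
        unfolding cc_def by (simp only: SUP_mult_right_ennreal)
    qed
    also have "\<dots> \<le> ennreal (2 powr (\<theta>' * r / q') * Cdisc r) * c epowr r"
      by (rule sum_SUP_le[OF fL]) (auto simp: blk_nonempty intro!: lower_window[OF c r, simplified])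
    finally show "(\<integral>\<^sup>+x. ?g n x \<partial>\<beta>) \<le> ennreal (2 powr (\<theta>' * r / q') * Cdisc r) * c epowr r" .
  qed
  finally show ?thesis .
qed

theorem lower_large:
  assumes c: "feasible c" and r: "q < \<theta>" "1 / r = 1 / q - 1 / \<theta>"
  shows "J r epowr (1 / r) + B2 \<le> ennreal ((2 powr (\<theta>' * r / q') * Cdisc r) powr (1 / r) + Cl powr (1 / q)) * c"
proof (cases "c < top")
  case True
  have r0: "0 < r" by (rule r_exps[OF r])
  have "0 < 2 powr (\<theta>' * r / q') * Cdisc r" unfolding Cdisc_def using TC_pos Cgrp_pos by simp
  then have "J r epowr (1 / r) \<le> ennreal ((2 powr (\<theta>' * r / q') * Cdisc r) powr (1 / r)) * c"
    using epowr_mono[OF _ J_le[OF c True r], of "1 / r"] r0 by (simp add: epowr_mult epowr_ennreal)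
  then have "J r epowr (1 / r) + B2 \<le> ennreal ((2 powr (\<theta>' * r / q') * Cdisc r) powr (1 / r)) * c + ennreal (Cl powr (1 / q)) * c"
    by (intro add_mono B2_le c)
  then show ?thesis by (simp add: distrib_right ennreal_plus)
next
  case False
  then have "c = top" by (simp add: not_less top_unique)
  moreover have "0 < Cl powr (1 / q)" using C_pos by simp
  then have "0 < (2 powr (\<theta>' * r / q') * Cdisc r) powr (1 / r) + Cl powr (1 / q)" by (simp add: add_nonneg_pos)
  ultimately show ?thesis using C_pos by (simp add: ennreal_mult_top)
qed

end

text \<open>Dividing a simple minorant of the multiple by k gives one of \<open>f\<close>, so
  \<open>f\<close> may be arbitrary. It will contain \<open>phi2\<close> and suprema over t, whose
  measurability is not established.\<close>

lemma nn_integral_cmult_le: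
  assumes k: "0 < k" shows "(\<integral>\<^sup>+x. ennreal k * f x \<partial>M) \<le> ennreal k * (\<integral>\<^sup>+x. f x \<partial>M)"
proof -
  have inv: "ennreal k * (ennreal (1 / k) * y) = y" for y
    using k by (simp add: mult.assoc[symmetric] ennreal_mult''[symmetric])
  have "integral\<^sup>S M g \<le> ennreal k * (\<integral>\<^sup>+x. f x \<partial>M)" if g: "simple_function M g" "g \<le> (\<lambda>x. ennreal k * f x)" for g
  proof -
    let ?g = "\<lambda>x. ennreal (1 / k) * g x"
    have sg: "simple_function M ?g" using g(1) by (intro simple_function_mult) auto
    have "?g x \<le> f x" for x
    proof -
      have "ennreal (1 / k) * g x \<le> ennreal (1 / k) * (ennreal k * f x)" using g(2) by (intro mult_left_mono) (auto simp: le_fun_def)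
      also have "\<dots> = f x" using k by (simp add: mult.assoc[symmetric] ennreal_mult''[symmetric])
      finally show ?thesis .
    qed
    then have "integral\<^sup>S M ?g \<le> (\<integral>\<^sup>+x. f x \<partial>M)"
      unfolding nn_integral_def using sg by (intro SUP_upper) (auto simp: le_fun_def)
    then have "ennreal k * integral\<^sup>S M ?g \<le> ennreal k * (\<integral>\<^sup>+x. f x \<partial>M)" by (rule mult_left_mono) simp
    also have "ennreal k * integral\<^sup>S M ?g = integral\<^sup>S M g"
      using simple_integral_mult[OF sg, of "ennreal k"] by (simp only: inv)
    finally show ?thesis .
  qed
  then show ?thesis unfolding nn_integral_def[of M "\<lambda>x. ennreal k * f x"] by (intro SUP_least) auto
qed

lemma approx_by_intro:
  assumes "A \<le> ennreal a * B" "B \<le> ennreal b * A" "0 < c" "a \<le> c" "b \<le> c"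
  shows "approx_by c A B"
proof -
  have "ennreal (1 / c) * B \<le> ennreal (1 / c) * (ennreal c * A)"
    using assms by (intro mult_left_mono order.trans[OF assms(2)] mult_right_mono ennreal_leI) auto
  also have "\<dots> = A" using assms(3) by (simp add: mult.assoc[symmetric] ennreal_mult''[symmetric])
  finally show ?thesis using assms unfolding approx_by_def
    by (intro conjI order.trans[OF assms(1)] mult_right_mono ennreal_leI) auto
qed

section \<open>Two-sided estimates of the normalised best constant\<close>

context cope_beta
begin

text \<open>\<open>N1\<close> and \<open>N2\<close> characterise \<open>N'\<close> as the infimum of
  \<open>c epowr s\<close> over feasible c. Later s is 1/p2, which undoes the division of the
  exponents by p2. \<open>R\<close> stands for the criterion with the kernels of the statement,
  equivalent to \<open>B1 epowr s\<close>.\<close>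

lemma approx_core:
  assumes s: "0 < s" and AB: "0 < AU" "0 < AL" "0 < k"
    and up: "\<And>h. h \<in> borel_measurable \<mu> \<Longrightarrow> L h \<le> ennreal AU * (B1 + B2) epowr q * D h epowr (q / \<theta>)"
    and low: "\<And>c. feasible c \<Longrightarrow> B1 + B2 \<le> ennreal AL * c"
    and N1: "\<And>c. feasible c \<Longrightarrow> N' \<le> c epowr s"
    and N2: "\<And>Y. (\<And>c. feasible c \<Longrightarrow> Y \<le> c epowr s) \<Longrightarrow> Y \<le> N'"
    and R: "R \<le> B1 epowr s" "B1 epowr s \<le> ennreal k * R"
  shows "approx_by (AU powr (s / q) * 2 powr s * (k + 1) + 2 * AL powr s + 1) N' (R + B2 epowr s)"
proof (rule approx_by_intro)
  have "feasible (ennreal (AU powr (1 / q)) * (B1 + B2))"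
    unfolding feasible_def using up AB q by (auto simp: epowr_mult epowr_ennreal powr_powr)
  from N1[OF this] have "N' \<le> ennreal (AU powr (s / q)) * (B1 + B2) epowr s"
    using AB s by (simp add: epowr_mult epowr_ennreal powr_powr)
  also have "\<dots> \<le> ennreal (AU powr (s / q)) * (ennreal (2 powr s) * (B1 epowr s + B2 epowr s))"
    by (intro mult_left_mono epowr_add_le s) auto
  also have "\<dots> \<le> ennreal (AU powr (s / q)) * (ennreal (2 powr s) * (ennreal (k + 1) * (R + B2 epowr s)))"
  proof (intro mult_left_mono)
    have "B1 epowr s + B2 epowr s \<le> ennreal k * R + B2 epowr s" by (intro add_right_mono R)
    also have "\<dots> \<le> ennreal (k + 1) * R + ennreal (k + 1) * B2 epowr s"
    proof (intro add_mono mult_right_mono)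
      show "B2 epowr s \<le> ennreal (k + 1) * B2 epowr s"
        using mult_right_mono[of 1 "ennreal (k + 1)" "B2 epowr s"] AB by simp
    qed (use AB in \<open>auto intro: ennreal_leI\<close>)
    finally show "B1 epowr s + B2 epowr s \<le> ennreal (k + 1) * (R + B2 epowr s)" by (simp add: distrib_left)
  qed auto
  also have "\<dots> = ennreal (AU powr (s / q) * 2 powr s * (k + 1)) * (R + B2 epowr s)"
    using AB by (simp add: ennreal_mult mult.assoc)
  finally show "N' \<le> ennreal (AU powr (s / q) * 2 powr s * (k + 1)) * (R + B2 epowr s)" .
  have *: "R + B2 epowr s \<le> ennreal (2 * AL powr s) * c epowr s" if "feasible c" for c
  proof -
    have "R + B2 epowr s \<le> B1 epowr s + B2 epowr s" by (intro add_right_mono R)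
    also have "\<dots> \<le> 2 * (B1 + B2) epowr s" by (rule add_epowr_le[OF s])
    also have "\<dots> \<le> 2 * (ennreal AL * c) epowr s" using s low[OF that] by (intro mult_left_mono epowr_mono) auto
    also have "\<dots> = ennreal (2 * AL powr s) * c epowr s" using s AB by (simp add: epowr_mult epowr_ennreal ennreal_mult' mult.assoc)
    finally show ?thesis .
  qed
  have pos: "0 < 2 * AL powr s" using AB by simp
  have inv: "ennreal (1 / (2 * AL powr s)) * (ennreal (2 * AL powr s) * y) = y" "ennreal (2 * AL powr s) * (ennreal (1 / (2 * AL powr s)) * y) = y" for y
    using pos by (simp_all add: mult.assoc[symmetric] ennreal_mult''[symmetric])
  have "ennreal (1 / (2 * AL powr s)) * (R + B2 epowr s) \<le> N'"
  proof (rule N2)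
    fix c assume "feasible c"
    then have "ennreal (1 / (2 * AL powr s)) * (R + B2 epowr s) \<le> ennreal (1 / (2 * AL powr s)) * (ennreal (2 * AL powr s) * c epowr s)"
      by (intro mult_left_mono *) auto
    then show "ennreal (1 / (2 * AL powr s)) * (R + B2 epowr s) \<le> c epowr s" unfolding inv .
  qed
  then have "ennreal (2 * AL powr s) * (ennreal (1 / (2 * AL powr s)) * (R + B2 epowr s)) \<le> ennreal (2 * AL powr s) * N'"
    by (rule mult_left_mono) simp
  then show "R + B2 epowr s \<le> ennreal (2 * AL powr s) * N'" unfolding inv .
qed (use AB in \<open>auto intro: add_nonneg_pos\<close>)

lemma c_hardy_nonneg: "0 \<le> hardyC \<theta> q" using \<theta> q by (intro hardyC_nonneg) auto

lemma Csmall_pos: "0 < Csmall"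
  unfolding Csmall_def using C_pos c_hardy_nonneg by (intro mult_pos_pos add_pos_nonneg mult_nonneg_nonneg) (auto simp: add_pos_pos)

lemma Clarge_pos: assumes "q < \<theta>" "1 / r = 1 / q - 1 / \<theta>" shows "0 < Clarge r"
proof -
  have "0 < max (1 / cin r) (2 powr (3 * r / \<theta>) / (1 - 2 powr (- (r / \<theta>))))"
    using c0_pos by (simp add: cin_def less_max_iff_disj)
  then show ?thesis
    unfolding Clarge_def using C_pos c_hardy_nonneg by (intro mult_pos_pos add_pos_nonneg mult_nonneg_nonneg) (auto simp: add_pos_pos)
qed

theorem approx_small:
  assumes s: "0 < s" and \<theta>q: "\<theta> \<le> q"
    and N1: "\<And>c. feasible c \<Longrightarrow> N' \<le> c epowr s"
    and N2: "\<And>Y. (\<And>c. feasible c \<Longrightarrow> Y \<le> c epowr s) \<Longrightarrow> Y \<le> N'"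
    and \<phi>2: "\<And>x. 0 < x \<Longrightarrow> \<phi>2 x \<le> \<phi> x epowr s" "\<And>x. 0 < x \<Longrightarrow> \<phi> x epowr s \<le> 2 * \<phi>2 x"
    and Tt: "\<And>x. 0 < x \<Longrightarrow> Tt x \<le> T x epowr s" "\<And>x. 0 < x \<Longrightarrow> T x epowr s \<le> 2 * Tt x"
  shows "approx_by (Csmall powr (s / q) * 2 powr s * (4 + 1) + 2 * (TC powr (1 / q) + Cl powr (1 / q)) powr s + 1) N'
    ((SUP x\<in>{0<..}. \<phi>2 x * Tt x) + B2 epowr s)"
proof (rule approx_core[OF s])
  let ?B = "SUP x\<in>{0<..}. \<phi> x * T x"
  show "0 < Csmall" by (rule Csmall_pos)
  show "0 < TC powr (1 / q) + Cl powr (1 / q)" using TC_pos C_pos by (simp add: add_pos_pos)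
  show "L h \<le> ennreal Csmall * (?B + B2) epowr q * D h epowr (q / \<theta>)" if "h \<in> borel_measurable \<mu>" for h
    using upper_small[OF \<theta>q that] .
  show "?B + B2 \<le> ennreal (TC powr (1 / q) + Cl powr (1 / q)) * c" if "feasible c" for c
    by (rule lower_small[OF that])
  have B: "?B epowr s = (SUP x\<in>{0<..}. \<phi> x epowr s * T x epowr s)" using s by (simp add: epowr_SUP epowr_mult)
  show "(SUP x\<in>{0<..}. \<phi>2 x * Tt x) \<le> ?B epowr s"
    unfolding B using \<phi>2 Tt by (intro SUP_subset_mono order_refl mult_mono) auto
  have "?B epowr s \<le> (SUP x\<in>{0<..}. ennreal 4 * (\<phi>2 x * Tt x))"
    unfolding B
  proof (intro SUP_subset_mono order_refl)
    fix x :: real assume "x \<in> {0<..}"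
    then have "\<phi> x epowr s * T x epowr s \<le> (2 * \<phi>2 x) * (2 * Tt x)" using \<phi>2 Tt by (intro mult_mono) auto
    also have "\<dots> = (2 * 2) * (\<phi>2 x * Tt x)" by (simp only: mult_ac)
    also have "(2 * 2 :: ennreal) = ennreal 4" by simp
    finally show "\<phi> x epowr s * T x epowr s \<le> ennreal 4 * (\<phi>2 x * Tt x)" .
  qed
  then show "?B epowr s \<le> ennreal 4 * (SUP x\<in>{0<..}. \<phi>2 x * Tt x)" by (simp only: SUP_mult_left_ennreal)
qed (use N1 N2 in auto)

theorem approx_large:
  assumes s: "0 < s" and r: "q < \<theta>" "1 / r = 1 / q - 1 / \<theta>"
    and N1: "\<And>c. feasible c \<Longrightarrow> N' \<le> c epowr s"
    and N2: "\<And>Y. (\<And>c. feasible c \<Longrightarrow> Y \<le> c epowr s) \<Longrightarrow> Y \<le> N'"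
    and \<phi>2: "\<And>x. 0 < x \<Longrightarrow> \<phi>2 x \<le> \<phi> x epowr s" "\<And>x. 0 < x \<Longrightarrow> \<phi> x epowr s \<le> 2 * \<phi>2 x"
    and Tt: "\<And>x. 0 < x \<Longrightarrow> Tt x \<le> T x epowr s" "\<And>x. 0 < x \<Longrightarrow> T x epowr s \<le> 2 * Tt x"
    and g: "\<And>x. 0 < x \<Longrightarrow> g x = \<phi>2 x epowr (r * \<theta>' / q' / s) * ennreal (m x powr (\<theta>' / p')) * Tt x epowr (r / s)"
  shows "approx_by (Clarge r powr (s / q) * 2 powr s * (2 powr (\<theta>' / q' + 1) + 1)
     + 2 * ((2 powr (\<theta>' * r / q') * Cdisc r) powr (1 / r) + Cl powr (1 / q)) powr s + 1) N'
    ((\<integral>\<^sup>+x. g x \<partial>\<beta>) epowr (s / r) + B2 epowr s)"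
proof (rule approx_core[OF s])
  note rx = r_exps[OF r]
  have qp: "0 < q'" "0 < \<theta>'" using q'1 \<theta>'1 by auto
  show "0 < Clarge r" by (rule Clarge_pos[OF r])
  have "0 < Cl powr (1 / q)" using C_pos by simp
  then show "0 < (2 powr (\<theta>' * r / q') * Cdisc r) powr (1 / r) + Cl powr (1 / q)" by (simp add: add_nonneg_pos)
  show "L h \<le> ennreal (Clarge r) * (J r epowr (1 / r) + B2) epowr q * D h epowr (q / \<theta>)" if "h \<in> borel_measurable \<mu>" for h
    by (rule upper_large[OF r that])
  show "J r epowr (1 / r) + B2 \<le> ennreal ((2 powr (\<theta>' * r / q') * Cdisc r) powr (1 / r) + Cl powr (1 / q)) * c" if "feasible c" for c
    by (rule lower_large[OF that r])
  let ?a = "r * \<theta>' / q' / s" and ?b = "r / s"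
  have ab: "0 < ?a" "0 < ?b" using rx(1) s qp by auto
  have \<phi>s: "(\<phi> x epowr s) epowr ?a = \<phi> x epowr (r * \<theta>' / q')" and Ts: "(T x epowr s) epowr ?b = T x epowr r" for x using s by simp_all
  have JJ: "(J r epowr (1 / r)) epowr s = J r epowr (s / r)" by simp
  have "(\<integral>\<^sup>+x. g x \<partial>\<beta>) \<le> J r"
    unfolding J_def
  proof (intro nn_integral_mono_AE, use AE_\<beta> in eventually_elim)
    fix x :: real assume x: "0 < x"
    have "\<phi>2 x epowr ?a \<le> (\<phi> x epowr s) epowr ?a" using ab \<phi>2(1)[OF x] by (intro epowr_mono) auto
    moreover have "Tt x epowr ?b \<le> (T x epowr s) epowr ?b" using ab Tt(1)[OF x] by (intro epowr_mono) auto
    ultimately show "g x \<le> \<phi> x epowr (r * \<theta>' / q') * ennreal (m x powr (\<theta>' / p')) * T x epowr r"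
      unfolding g[OF x] \<phi>s Ts by (intro mult_mono) auto
  qed
  then show "(\<integral>\<^sup>+x. g x \<partial>\<beta>) epowr (s / r) \<le> (J r epowr (1 / r)) epowr s"
    unfolding JJ using s rx(1) by (intro epowr_mono) auto
  have "J r \<le> (\<integral>\<^sup>+x. ennreal (2 powr (?a + ?b)) * g x \<partial>\<beta>)"
    unfolding J_def
  proof (intro nn_integral_mono_AE, use AE_\<beta> in eventually_elim)
    fix x :: real assume x: "0 < x"
    have two: "(2 * y) epowr a = ennreal (2 powr a) * y epowr a" if "0 < a" for y a
      using that epowr_ennreal[of 2 a] by (simp add: epowr_mult)
    have "(\<phi> x epowr s) epowr ?a \<le> (2 * \<phi>2 x) epowr ?a" using ab \<phi>2(2)[OF x] by (intro epowr_mono) auto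
    then have 1: "\<phi> x epowr (r * \<theta>' / q') \<le> ennreal (2 powr ?a) * \<phi>2 x epowr ?a" unfolding \<phi>s two[OF ab(1)] .
    have "(T x epowr s) epowr ?b \<le> (2 * Tt x) epowr ?b" using ab Tt(2)[OF x] by (intro epowr_mono) auto
    then have 2: "T x epowr r \<le> ennreal (2 powr ?b) * Tt x epowr ?b" unfolding Ts two[OF ab(2)] .
    have "\<phi> x epowr (r * \<theta>' / q') * ennreal (m x powr (\<theta>' / p')) * T x epowr r
      \<le> (ennreal (2 powr ?a) * \<phi>2 x epowr ?a) * ennreal (m x powr (\<theta>' / p')) * (ennreal (2 powr ?b) * Tt x epowr ?b)"
      by (intro mult_mono 1 2) auto
    also have "\<dots> = (ennreal (2 powr ?a) * ennreal (2 powr ?b)) * g x" unfolding g[OF x] by (simp only: mult_ac)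
    also have "ennreal (2 powr ?a) * ennreal (2 powr ?b) = ennreal (2 powr (?a + ?b))" by (simp only: powr_add ennreal_mult powr_ge_zero)
    finally show "\<phi> x epowr (r * \<theta>' / q') * ennreal (m x powr (\<theta>' / p')) * T x epowr r \<le> ennreal (2 powr (?a + ?b)) * g x" .
  qed
  also have "\<dots> \<le> ennreal (2 powr (?a + ?b)) * (\<integral>\<^sup>+x. g x \<partial>\<beta>)" by (rule nn_integral_cmult_le) simp
  finally have "J r epowr (s / r) \<le> (ennreal (2 powr (?a + ?b)) * (\<integral>\<^sup>+x. g x \<partial>\<beta>)) epowr (s / r)"
    using s rx(1) by (intro epowr_mono) auto
  also have "\<dots> = ennreal (2 powr ((?a + ?b) * (s / r))) * (\<integral>\<^sup>+x. g x \<partial>\<beta>) epowr (s / r)"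
    using s rx(1) by (simp add: epowr_mult epowr_ennreal powr_powr)
  also have "(?a + ?b) * (s / r) = \<theta>' / q' + 1" using s rx(1) by (simp add: field_simps)
  finally show "(J r epowr (1 / r)) epowr s \<le> ennreal (2 powr (\<theta>' / q' + 1)) * (\<integral>\<^sup>+x. g x \<partial>\<beta>) epowr (s / r)" unfolding JJ .
qed (use N1 N2 in auto)

end

section \<open>Weighted measures and Lebesgue--Stieltjes measures\<close>

text \<open>Monotone continuity of the measure gives the one-sided limits, and these agree because x
  is not an atom. The intersection with \<open>A\<close> provides the finiteness.\<close>

lemma isCont_measure_atMost:
  fixes M :: "real measure"
  assumes sets [simp]: "sets M = sets lebesgue" and A: "A \<in> sets lebesgue" "emeasure M A < \<infinity>" and x: "emeasure M {x} = 0"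
  shows "isCont (\<lambda>t. measure M (A \<inter> {..t})) x"
proof -
  have fin: "emeasure M B \<noteq> \<infinity>" if "B \<subseteq> A" for B
  proof -
    have "emeasure M B \<le> emeasure M A" using that A by (intro emeasure_mono) auto
    then show ?thesis using A(2) by (auto simp: top_unique)
  qed
  have right: "((\<lambda>t. measure M (A \<inter> {..t})) \<longlongrightarrow> measure M (A \<inter> {..x})) (at_right x)"
  proof (rule tendsto_at_right_sequentially[of x "x + 1"])
    fix S :: "nat \<Rightarrow> real" assume S: "\<And>n. x < S n" "decseq S" "S \<longlonglongrightarrow> x"
    have "(\<lambda>n. measure M (A \<inter> {..S n})) \<longlonglongrightarrow> measure M (\<Inter>n. A \<inter> {..S n})"
      using A S(2) fin by (intro Lim_measure_decseq) (auto simp: decseq_def intro: order_trans)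
    also have "(\<Inter>n. A \<inter> {..S n}) = A \<inter> {..x}"
    proof (intro set_eqI iffI)
      fix s assume "s \<in> (\<Inter>n. A \<inter> {..S n})"
      then show "s \<in> A \<inter> {..x}" using LIMSEQ_le_const[OF S(3), of s] by auto
    qed (use S(1) in \<open>auto intro: less_imp_le order_trans\<close>)
    finally show "(\<lambda>n. measure M (A \<inter> {..S n})) \<longlonglongrightarrow> measure M (A \<inter> {..x})" .
  qed simp
  have "measure M (A \<inter> {..<x}) = measure M (A \<inter> {..x})"
  proof -
    have "A \<inter> {..<x} \<union> {x} \<in> sets M" using A by (intro sets.Un) auto
    then have "emeasure M (A \<inter> {..x}) \<le> emeasure M (A \<inter> {..<x} \<union> {x})" by (intro emeasure_mono) auto
    also have "\<dots> \<le> emeasure M (A \<inter> {..<x}) + emeasure M {x}" using A by (intro emeasure_subadditive) auto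
    finally have le: "emeasure M (A \<inter> {..x}) \<le> emeasure M (A \<inter> {..<x})" using x by simp
    have "emeasure M (A \<inter> {..<x}) \<le> emeasure M (A \<inter> {..x})" using A by (intro emeasure_mono) auto
    from antisym[OF this le] show ?thesis by (simp add: measure_def)
  qed
  moreover have "((\<lambda>t. measure M (A \<inter> {..t})) \<longlongrightarrow> measure M (A \<inter> {..<x})) (at_left x)"
  proof (rule tendsto_at_left_sequentially[of "x - 1"])
    fix S :: "nat \<Rightarrow> real" assume S: "\<And>n. S n < x" "incseq S" "S \<longlonglongrightarrow> x"
    have un: "(\<Union>n. A \<inter> {..S n}) = A \<inter> {..<x}"
    proof (intro set_eqI iffI)
      fix s assume s: "s \<in> A \<inter> {..<x}"
      then have "eventually (\<lambda>n. s < S n) sequentially" by (intro order_tendstoD(1)[OF S(3)]) auto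
      then obtain n where "s < S n" by (auto simp: eventually_sequentially)
      then show "s \<in> (\<Union>n. A \<inter> {..S n})" using s by (auto intro: less_imp_le)
    qed (use S(1) in \<open>auto intro: le_less_trans\<close>)
    have "(\<lambda>n. measure M (A \<inter> {..S n})) \<longlonglongrightarrow> measure M (\<Union>n. A \<inter> {..S n})"
      using A S(2) fin[of "\<Union>n. A \<inter> {..S n}"] by (intro Lim_measure_incseq) (auto simp: incseq_def intro: order_trans)
    then show "(\<lambda>n. measure M (A \<inter> {..S n})) \<longlonglongrightarrow> measure M (A \<inter> {..<x})" unfolding un .
  qed simp
  ultimately show ?thesis unfolding continuous_at_split using right by (simp add: continuous_within)
qed

lemma sets_LS_measure [simp]: "sets (LS_measure h) = sets borel"
  by (simp add: LS_measure_def)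

lemma LS_measure_nonpos: "emeasure (LS_measure h) {..0} = 0"
proof -
  have "exp -` {..0::real} = {}" by (auto simp: not_le)
  then show ?thesis unfolding LS_measure_def by (subst emeasure_distr) auto
qed

lemma LS_measure_tail:
  assumes h: "mono_on {0<..} h" and cont: "\<And>x. 0 < x \<Longrightarrow> isCont h x" and lim: "(h \<longlongrightarrow> l) at_top" and x: "0 < x"
  shows "emeasure (LS_measure h) {x<..} = ennreal (l - h x)"
proof -
  have rl: "right_lim h y = h y" if "0 < y" for y
    using right_lim_eq[OF h that] cont[OF that] by (simp add: continuous_at_imp_continuous_at_within)
  have un: "(\<Union>n::nat. {x<..x + real n}) = {x<..}"
  proof (intro set_eqI iffI)
    fix y assume "y \<in> {x<..}"
    moreover obtain n :: nat where "y - x \<le> real n" using real_arch_simple by blast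
    ultimately show "y \<in> (\<Union>n::nat. {x<..x + real n})" by (auto simp: field_simps intro!: exI[of _ n])
  qed auto
  have "(\<lambda>n. emeasure (LS_measure h) {x<..x + real n}) \<longlonglongrightarrow> emeasure (LS_measure h) (\<Union>n::nat. {x<..x + real n})"
    by (intro Lim_emeasure_incseq) (auto simp: incseq_def)
  then have "(\<lambda>n. ennreal (h (x + real n) - h x)) \<longlonglongrightarrow> emeasure (LS_measure h) {x<..}"
    using x by (simp add: un emeasure_LS_measure_Ioc[OF h x] rl)
  moreover have "filterlim (\<lambda>n::nat. x + real n) at_top sequentially"
    by (intro filterlim_tendsto_add_at_top[OF tendsto_const] filterlim_real_sequentially)
  then have "(\<lambda>n. h (x + real n)) \<longlonglongrightarrow> l" by (rule filterlim_compose[OF lim])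
  then have "(\<lambda>n. ennreal (h (x + real n) - h x)) \<longlonglongrightarrow> ennreal (l - h x)" by (intro tendsto_intros)
  ultimately show ?thesis by (rule LIMSEQ_unique)
qed

section \<open>Measures with density \<open>f epowr a\<close>\<close>

definition wmeas :: "(real \<Rightarrow> ennreal) \<Rightarrow> real \<Rightarrow> real measure" where
  "wmeas f a = density lebesgue (\<lambda>x. f x epowr a * indicator {0<..} x)"

lemma Mplus_iff: "f \<in> Mplus \<longleftrightarrow> (\<lambda>x. f x * indicator {0<..} x) \<in> borel_measurable lebesgue"
  unfolding Mplus_def by (rule borel_measurable_restrict_space_iff_ennreal) auto

lemma Mplus_epowr: "f \<in> Mplus \<Longrightarrow> (\<lambda>x. f x epowr a) \<in> Mplus"
  unfolding Mplus_def by (rule measurable_epowr)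

lemma Mplus_mult: "f \<in> Mplus \<Longrightarrow> g \<in> Mplus \<Longrightarrow> (\<lambda>x. f x * g x) \<in> Mplus"
  unfolding Mplus_def by (rule borel_measurable_times_ennreal)

lemma Mplus_lebesgue: "f \<in> borel_measurable lebesgue \<Longrightarrow> f \<in> Mplus"
  unfolding Mplus_def by (rule measurable_restrict_space1)

lemma sets_wmeas [simp]: "sets (wmeas f a) = sets lebesgue"
  by (simp add: wmeas_def)

context
  fixes f :: "real \<Rightarrow> ennreal" and a :: real
  assumes f: "f \<in> Mplus" and a: "0 < a"
begin

lemma wmeas_meas: "(\<lambda>x. f x epowr a * indicator {0<..} x) \<in> borel_measurable lebesgue"
  using Mplus_epowr[OF f] by (simp add: Mplus_iff)

lemma wmeas_emeasure:
  assumes "A \<in> sets lebesgue" shows "emeasure (wmeas f a) A = (\<integral>\<^sup>+x\<in>A \<inter> {0<..}. f x epowr a \<partial>lebesgue)"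
  unfolding wmeas_def by (subst emeasure_density[OF wmeas_meas assms]) (auto intro!: nn_integral_cong split: split_indicator)

lemma wmeas_nn_integral:
  assumes "g \<in> borel_measurable lebesgue"
  shows "(\<integral>\<^sup>+x. g x \<partial>wmeas f a) = (\<integral>\<^sup>+x\<in>{0<..}. g x * f x epowr a \<partial>lebesgue)"
  unfolding wmeas_def by (subst nn_integral_density[OF wmeas_meas assms]) (simp add: mult_ac)

lemma wmeas_singleton: "emeasure (wmeas f a) {t} = 0"
proof -
  have "AE x in lebesgue. f x epowr a * indicator ({t} \<inter> {0<..}) x = 0"
    by (rule AE_I[of _ _ "{t}"]) (auto split: split_indicator)
  then have "(\<integral>\<^sup>+x\<in>{t} \<inter> {0<..}. f x epowr a \<partial>lebesgue) = integral\<^sup>N lebesgue (\<lambda>x::real. 0)" by (rule nn_integral_cong_AE)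
  moreover have "{t} \<in> sets lebesgue" by simp
  ultimately show ?thesis by (simp only: wmeas_emeasure) simp
qed

lemma wmeas_lessThan: "emeasure (wmeas f a) {..<t} = Lnorm a {0<..<t} f epowr a"
proof -
  have "{..<t} \<inter> {0<..} = {0<..<t}" by auto
  then show ?thesis using a by (simp add: wmeas_emeasure Lnorm_def)
qed

lemma wmeas_greaterThan: "0 \<le> t \<Longrightarrow> emeasure (wmeas f a) {t<..} = Lnorm a {t<..} f epowr a"
proof -
  assume "0 \<le> t"
  then have "{t<..} \<inter> {0<..} = {t<..}" by auto
  then show ?thesis using a by (simp add: wmeas_emeasure Lnorm_def)
qed

lemma wmeas_atMost: "emeasure (wmeas f a) {..t} = Lnorm a {0<..<t} f epowr a"
proof -
  have "{..t} = {..<t} \<union> {t}" by auto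
  moreover have "emeasure (wmeas f a) ({..<t} \<union> {t}) = emeasure (wmeas f a) {..<t}"
    by (intro emeasure_Un_null_set) (auto simp: null_sets_def wmeas_singleton)
  ultimately show ?thesis by (simp add: wmeas_lessThan)
qed

lemma Lnorm_nonpos: "t \<le> 0 \<Longrightarrow> Lnorm a {0<..<t} f = 0"
  using a by (simp add: Lnorm_def)

lemma wmeas_nonpos: "emeasure (wmeas f a) {..0} = 0"
  unfolding wmeas_atMost Lnorm_nonpos[OF order_refl] using a by simp

context
  assumes L: "\<And>t. 0 < t \<Longrightarrow> 0 < Lnorm a {0<..<t} f" "\<And>t. 0 < t \<Longrightarrow> Lnorm a {0<..<t} f < \<infinity>"
begin

lemma Lnorm_fin: "Lnorm a {0<..<t} f < \<infinity>"
  using L(2)[of t] Lnorm_nonpos[of t] by (cases "0 < t") auto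

lemma wmeas_fin: "emeasure (wmeas f a) {..t} < \<infinity>"
  using Lnorm_fin[of t] a by (simp add: wmeas_atMost epowr_less_top)

lemma wmeas_measure: "ennreal (measure (wmeas f a) {..t}) = Lnorm a {0<..<t} f epowr a"
  using wmeas_fin[of t] by (subst emeasure_eq_ennreal_measure[symmetric]) (auto simp: wmeas_atMost)

lemma wmeas_level: "level_fun (\<lambda>t. measure (wmeas f a) {..t})"
proof
  show "mono (\<lambda>t. measure (wmeas f a) {..t})"
    using wmeas_fin by (intro monoI measure_mono_fmeasurable) (auto simp: fmeasurable_def)
  show "measure (wmeas f a) {..0} = 0" using wmeas_nonpos by (simp add: measure_def)
  show "0 < measure (wmeas f a) {..x}" if "0 < x" for x
  proof -
    have "0 < Lnorm a {0<..<x} f epowr a" using L(1)[OF that] a by (simp add: zero_less_iff_neq_zero epowr_eq_0_iff)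
    then show ?thesis by (simp add: wmeas_measure[symmetric])
  qed
  show "continuous_on UNIV (\<lambda>t. measure (wmeas f a) {..t})"
  proof (intro continuous_at_imp_continuous_on ballI)
    fix x :: real
    have "isCont (\<lambda>t. measure (wmeas f a) ({..x + 1} \<inter> {..t})) x"
      using wmeas_fin by (intro isCont_measure_atMost) (auto simp: wmeas_singleton)
    moreover have "\<forall>\<^sub>F t in nhds x. measure (wmeas f a) ({..x + 1} \<inter> {..t}) = measure (wmeas f a) {..t}"
    proof (rule eventually_mono[OF eventually_nhds_in_open[of "{..<x + 1}"]])
      fix t assume "t \<in> {..<x + 1}"
      then have "{..x + 1} \<inter> {..t} = {..t}" by auto
      then show "measure (wmeas f a) ({..x + 1} \<inter> {..t}) = measure (wmeas f a) {..t}" by simp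
    qed auto
    ultimately show "isCont (\<lambda>t. measure (wmeas f a) {..t}) x" by (simp add: isCont_cong)
  qed
qed

end

context
  assumes R: "\<And>t. 0 < t \<Longrightarrow> Lnorm a {t<..} f < \<infinity>"
begin

lemma wmeas_tail_measure: "0 < t \<Longrightarrow> ennreal (measure (wmeas f a) {t<..}) = Lnorm a {t<..} f epowr a"
  using R[of t] a by (subst emeasure_eq_ennreal_measure[symmetric]) (auto simp: wmeas_greaterThan epowr_eq_top_iff)

lemma wmeas_tail_cont: assumes t: "0 < t" shows "isCont (\<lambda>t. measure (wmeas f a) {t<..}) t"
proof -
  let ?A = "{t / 2<..}"
  have fA: "emeasure (wmeas f a) ?A < \<infinity>"
    using R[of "t / 2"] t a by (simp add: wmeas_greaterThan epowr_less_top)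
  have "isCont (\<lambda>s. measure (wmeas f a) ?A - measure (wmeas f a) (?A \<inter> {..s})) t"
    using fA by (intro continuous_intros isCont_measure_atMost) (auto simp: wmeas_singleton)
  moreover have "\<forall>\<^sub>F s in nhds t. measure (wmeas f a) ?A - measure (wmeas f a) (?A \<inter> {..s}) = measure (wmeas f a) {s<..}"
  proof (rule eventually_mono[OF eventually_nhds_in_open[of ?A]])
    fix s assume "s \<in> ?A"
    then have "{s<..} = ?A - (?A \<inter> {..s})" by auto
    then show "measure (wmeas f a) ?A - measure (wmeas f a) (?A \<inter> {..s}) = measure (wmeas f a) {s<..}"
      using fA by (simp only:) (intro measure_Diff[symmetric], auto)
  qed (use t in auto)
  ultimately show ?thesis by (simp add: isCont_cong)
qed

lemma wmeas_tail_anti: "0 < s \<Longrightarrow> s \<le> t \<Longrightarrow> measure (wmeas f a) {t<..} \<le> measure (wmeas f a) {s<..}"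
  using R[of s] a by (intro measure_mono_fmeasurable) (auto simp: fmeasurable_def wmeas_greaterThan epowr_less_top)

lemma wmeas_tail_lim: "((\<lambda>t. measure (wmeas f a) {t<..}) \<longlongrightarrow> 0) at_top"
proof (rule tendsto_at_topI_sequentially)
  fix S :: "nat \<Rightarrow> real" assume S: "filterlim S at_top sequentially"
  have "(\<lambda>n. measure (wmeas f a) {real (Suc n)<..}) \<longlonglongrightarrow> measure (wmeas f a) (\<Inter>n. {real (Suc n)<..})"
    using R a by (intro Lim_measure_decseq) (auto simp: decseq_def wmeas_greaterThan epowr_eq_top_iff less_top[symmetric])
  moreover have "(\<Inter>n. {real (Suc n)<..}) = {}"
  proof -
    have "\<exists>n. \<not> real (Suc n) < x" for x
    proof -
      obtain n where "x \<le> real n" using real_arch_simple by blast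
      then show ?thesis by (intro exI[of _ n]) simp
    qed
    then show ?thesis by auto
  qed
  ultimately have lim: "(\<lambda>n. measure (wmeas f a) {real (Suc n)<..}) \<longlonglongrightarrow> 0" by simp
  show "(\<lambda>n. measure (wmeas f a) {S n<..}) \<longlonglongrightarrow> 0"
  proof (rule LIMSEQ_I)
    fix e :: real assume e: "0 < e"
    obtain k where k: "measure (wmeas f a) {real (Suc k)<..} < e"
      using order_tendstoD(2)[OF lim e] by (auto simp: eventually_sequentially)
    obtain n0 where n0: "\<And>n. n0 \<le> n \<Longrightarrow> real (Suc k) \<le> S n"
      using S unfolding filterlim_at_top eventually_sequentially by blast
    have "norm (measure (wmeas f a) {S n<..} - 0) < e" if "n0 \<le> n" for n
      using wmeas_tail_anti[OF _ n0[OF that]] k by simp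
    then show "\<exists>n0. \<forall>n\<ge>n0. norm (measure (wmeas f a) {S n<..} - 0) < e" by blast
  qed
qed

end

end

section \<open>Reduction to the normalised inequality\<close>

lemma epowr_uminus_1: "x epowr (- 1) = inverse x"
proof (cases x)
  case (real r)
  then show ?thesis by (cases "r = 0") (auto simp: epowr_ennreal inverse_ennreal powr_minus epowr_def)
qed (simp add: epowr_def)

text \<open>In both spaces the weights are absorbed: h d\<mu> becomes (f v2)^p2 dx, and h^pp d\<mu>
  becomes (f v1)^p1 dx since the powers of v2/v1 cancel by
  \<open>(p2 - r0) * pp + r0 = 0\<close>.\<close>

lemma cop_ces_pointwise:
  assumes v: "0 < v1" "v1 < \<infinity>" "0 < v2" "v2 < \<infinity>" and p: "0 < p2" "0 < r0" "0 < pp" "p2 * pp = p1" "(p2 - r0) * pp + r0 = 0"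
    and h: "h = (f * v1) epowr p2 * (inverse v1 * v2) epowr (p2 - r0)"
  shows "h * (inverse v1 * v2) epowr r0 = (f * v2) epowr p2" "h epowr pp * (inverse v1 * v2) epowr r0 = (f * v1) epowr p1"
proof -
  obtain a where a: "v1 = ennreal a" "0 < a" using v by (cases v1) auto
  obtain b where b: "v2 = ennreal b" "0 < b" using v by (cases v2) auto
  define c where "c = b / a"
  have c: "0 < c" "inverse v1 * v2 = ennreal c"
    using a b by (simp_all add: c_def inverse_ennreal ennreal_mult''[symmetric] field_simps)
  have v1c: "v1 * ennreal c = v2" using a b by (simp add: c_def ennreal_mult''[symmetric])
  have "ennreal c epowr (p2 - r0) * ennreal c epowr r0 = ennreal c epowr p2"
    using c(1) by (simp add: epowr_ennreal ennreal_mult''[symmetric] powr_add[symmetric])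
  then have "h * ennreal c epowr r0 = (f * v1 * ennreal c) epowr p2"
    unfolding h c(2) using p by (simp add: epowr_mult mult.assoc)
  then show "h * (inverse v1 * v2) epowr r0 = (f * v2) epowr p2"
    unfolding c(2) by (simp add: mult.assoc v1c)
  have "(ennreal c epowr (p2 - r0)) epowr pp * ennreal c epowr r0 = 1"
    using c(1) p(5) by (simp add: epowr_ennreal ennreal_mult''[symmetric] powr_add[symmetric] powr_powr)
  then show "h epowr pp * (inverse v1 * v2) epowr r0 = (f * v1) epowr p1"
    unfolding h c(2) using p by (simp add: epowr_mult mult.assoc flip: p(4))
qed

text \<open>The substitution can be inverted, so every \<open>h\<close> of the normalised inequality
  comes from some \<open>f\<close>.\<close>

lemma cop_ces_inverse:
  assumes v: "0 < v1" "v1 < \<infinity>" "0 < v2" "v2 < \<infinity>" and p: "0 < p2"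
  shows "h = (h epowr (1 / p2) * (inverse v1 * v2) epowr ((r0 - p2) / p2) * inverse v1 * v1) epowr p2 * (inverse v1 * v2) epowr (p2 - r0)"
proof -
  obtain a where a: "v1 = ennreal a" "0 < a" using v by (cases v1) auto
  obtain b where b: "v2 = ennreal b" "0 < b" using v by (cases v2) auto
  define c where "c = b / a"
  have c: "0 < c" "inverse v1 * v2 = ennreal c"
    using a b by (simp_all add: c_def inverse_ennreal ennreal_mult''[symmetric] field_simps)
  have i: "inverse v1 * v1 = 1" using a by (simp add: inverse_ennreal ennreal_mult''[symmetric])
  have "(ennreal c epowr ((r0 - p2) / p2)) epowr p2 * ennreal c epowr (p2 - r0) = 1"
    using c(1) p by (simp add: epowr_ennreal ennreal_mult''[symmetric] powr_add[symmetric] powr_powr)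
  then show ?thesis unfolding c(2) mult.assoc i using p by (simp add: epowr_mult mult.assoc)
qed

locale ces_data =
  fixes p1 p2 q1 q2 :: real and v1 v2 u1 u2 :: "real \<Rightarrow> ennreal"
  assumes pos: "0 < p2" "p2 < p1" "p2 < q1" "p2 < q2"
    and v: "v1 \<in> weights" "v2 \<in> weights" and u: "u1 \<in> cOmega q1" "u2 \<in> Omega q2"
    and adm: "admissible (Vfun p1 p2 v1 v2)"
begin

definition "pp = p1 / p2"
definition "qq = q2 / p2"
definition "th = q1 / p2"
definition "pc = pp / (pp - 1)"
definition "qc = qq / (qq - 1)"
definition "tc = th / (th - 1)"
definition "r0 = p1 \<rightarrowtail> p2"
definition "vv y = inverse (v1 y) * v2 y"
definition "mm t = measure (wmeas vv r0) {..t}"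
definition "UU t = measure (wmeas u1 q1) {..t}"
definition "NN t = measure (wmeas u2 q2) {t<..}"
abbreviation "V \<equiv> Vfun p1 p2 v1 v2"

lemma gt1: "1 < pp" "1 < qq" "1 < th"
  using pos by (simp_all add: pp_def qq_def th_def)

lemma conj: "1 / pp + 1 / pc = 1" "1 / qq + 1 / qc = 1" "1 / th + 1 / tc = 1"
  using gt1 by (simp_all add: pc_def qc_def tc_def field_simps)

lemma gt1c: "1 < pc" "1 < qc" "1 < tc"
  using gt1 by (simp_all add: pc_def qc_def tc_def)

lemma arrows: "r0 = p2 * pc" "q1 \<rightarrowtail> p2 = p2 * tc" "q2 \<rightarrowtail> p2 = p2 * qc"
  using pos by (simp_all add: r0_def arrow_def pc_def tc_def qc_def pp_def th_def qq_def field_simps)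

lemma arrows2: "p1 \<rightarrowtail> q2 = p2 * (1 / (1 / qq - 1 / pp))" "q1 \<rightarrowtail> q2 = p2 * (1 / (1 / qq - 1 / th))"
proof -
  have "1 / q2 - 1 / p1 = (1 / qq - 1 / pp) / p2" "1 / q2 - 1 / q1 = (1 / qq - 1 / th) / p2"
    using pos by (simp_all add: pp_def th_def qq_def diff_divide_distrib)
  then show "p1 \<rightarrowtail> q2 = p2 * (1 / (1 / qq - 1 / pp))" "q1 \<rightarrowtail> q2 = p2 * (1 / (1 / qq - 1 / th))"
    unfolding arrow_def by simp_all
qed

lemma r0: "0 < r0" using arrows(1) pos gt1c by simp

lemma r0_pp: "(p2 - r0) * pp + r0 = 0"
proof -
  have "pc * (pp - 1) = pp" using gt1 by (simp add: pc_def)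
  then have "(p2 - r0) * pp + r0 = p2 * pp - p2 * (pc * (pp - 1))" unfolding arrows(1) by (simp add: algebra_simps)
  then show ?thesis using \<open>pc * (pp - 1) = pp\<close> by simp
qed

lemma Mplus_data: "v1 \<in> Mplus" "v2 \<in> Mplus" "u1 \<in> Mplus" "u2 \<in> Mplus" "(\<lambda>y. inverse (v1 y)) \<in> Mplus" "vv \<in> Mplus"
proof -
  show *: "v1 \<in> Mplus" "v2 \<in> Mplus" "u1 \<in> Mplus" "u2 \<in> Mplus" using v u by (auto simp: weights_def cOmega_def Omega_def)
  show i: "(\<lambda>y. inverse (v1 y)) \<in> Mplus" using *(1) unfolding Mplus_def by (rule borel_measurable_inverse_ennreal)
  show "vv \<in> Mplus" unfolding vv_def by (rule Mplus_mult[OF i *(2)])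
qed

lemma V_eq: "V t = Lnorm r0 {0<..<t} vv"
  unfolding Vfun_def r0_def vv_def by simp

text \<open>Strict monotonicity places \<open>V t\<close> above \<open>V 0 = 0\<close> and below
  \<open>V (t + 1)\<close>, which excludes infinity.\<close>

lemma V_pos: assumes "0 < t" shows "0 < Lnorm r0 {0<..<t} vv" "Lnorm r0 {0<..<t} vv < \<infinity>"
proof -
  have mono: "strict_mono_on {0..} V" "V 0 = 0" using adm unfolding admissible_def by auto
  have "V 0 < V t" using assms by (intro strict_mono_onD[OF mono(1)]) auto
  then show "0 < Lnorm r0 {0<..<t} vv" unfolding V_eq[symmetric] mono(2) .
  have "V t < V (t + 1)" using assms by (intro strict_mono_onD[OF mono(1)]) auto
  then show "Lnorm r0 {0<..<t} vv < \<infinity>" unfolding V_eq by (rule order.strict_trans2) simp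
qed

lemma U_pos: assumes "0 < t" shows "0 < Lnorm q1 {0<..<t} u1" "Lnorm q1 {0<..<t} u1 < \<infinity>"
  using u(1) assms by (auto simp: cOmega_def)

lemma N_pos: assumes "0 < t" shows "0 < Lnorm q2 {t<..} u2" "Lnorm q2 {t<..} u2 < \<infinity>"
  using u(2) assms by (auto simp: Omega_def)

lemma q0: "0 < q1" "0 < q2" using pos by auto

lemma mm_V: "V t = ennreal (mm t powr (1 / r0))"
proof -
  have "ennreal (mm t) = V t epowr r0" unfolding mm_def V_eq by (rule wmeas_measure[OF Mplus_data(6) r0 V_pos])
  then have "ennreal (mm t) epowr (1 / r0) = V t" using r0 by simp
  then show ?thesis using r0 by (simp add: epowr_ennreal_pos mm_def)
qed

lemma UU_eq: "ennreal (UU t) = Lnorm q1 {0<..<t} u1 epowr q1"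
  unfolding UU_def by (rule wmeas_measure[OF Mplus_data(3) q0(1) U_pos])

lemma NN_eq: "0 < t \<Longrightarrow> Lnorm q2 {t<..} u2 = ennreal (NN t powr (1 / q2))"
proof -
  assume t: "0 < t"
  have "ennreal (NN t) = Lnorm q2 {t<..} u2 epowr q2" unfolding NN_def by (rule wmeas_tail_measure[OF Mplus_data(4) q0(2) N_pos(2) t])
  then have "ennreal (NN t) epowr (1 / q2) = Lnorm q2 {t<..} u2" using q0 by simp
  then show ?thesis using q0 by (simp add: epowr_ennreal_pos NN_def)
qed

sublocale cope mm UU NN "wmeas vv r0" "wmeas u1 q1" "wmeas u2 q2" pp qq th pc qc tc
proof (intro cope.intro cope_axioms.intro)
  show "level_fun mm" unfolding mm_def by (rule wmeas_level[OF Mplus_data(6) r0 V_pos])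
  show "level_fun UU" unfolding UU_def by (rule wmeas_level[OF Mplus_data(3) q0(1) U_pos])
  show "emeasure (wmeas vv r0) {..t} = ennreal (mm t)" for t
    unfolding mm_def by (rule trans[OF wmeas_atMost[OF Mplus_data(6) r0] wmeas_measure[OF Mplus_data(6) r0 V_pos, symmetric]])
  show "emeasure (wmeas vv r0) {..<t} = ennreal (mm t)" for t
    unfolding mm_def by (rule trans[OF wmeas_lessThan[OF Mplus_data(6) r0] wmeas_measure[OF Mplus_data(6) r0 V_pos, symmetric]])
  show "emeasure (wmeas u1 q1) {..t} = ennreal (UU t)" for t
    unfolding UU_eq by (rule wmeas_atMost[OF Mplus_data(3) q0(1)])
  show "emeasure (wmeas u2 q2) {t<..} = ennreal (NN t)" if "0 < t" for t
    unfolding NN_def by (rule trans[OF wmeas_greaterThan[OF Mplus_data(4) q0(2) less_imp_le[OF that]] wmeas_tail_measure[OF Mplus_data(4) q0(2) N_pos(2) that, symmetric]])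
  show "emeasure (wmeas u2 q2) {..0} = 0" by (rule wmeas_nonpos[OF Mplus_data(4) q0(2)])
  show "\<exists>x. c < mm x" for c
  proof (rule ccontr)
    assume "\<not> (\<exists>x. c < mm x)"
    then have c: "mm x \<le> c" for x by (simp add: not_less)
    have "V x \<le> ennreal (c powr (1 / r0))" for x
      unfolding mm_V using c[of x] r0 by (intro ennreal_leI powr_mono2) (auto simp: mm_def)
    moreover have "\<forall>\<^sub>F x in at_top. ennreal (c powr (1 / r0)) < V x"
      using adm unfolding admissible_def by (intro order_tendstoD(1)[of V \<infinity>]) auto
    then obtain x where "ennreal (c powr (1 / r0)) < V x" by (auto simp: eventually_at_top_linorder)
    ultimately show False by (simp add: not_less[symmetric])
  qed
qed (use gt1 conj in \<open>auto simp: NN_def\<close>)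

lemma AE_weights: "AE x in lebesgue. 0 < x \<longrightarrow> 0 < v1 x \<and> v1 x < \<infinity> \<and> 0 < v2 x \<and> v2 x < \<infinity>"
proof -
  have "AE x in lebesgue. x \<in> {0<..} \<longrightarrow> 0 < w x \<and> w x < \<infinity>" if "w \<in> weights" for w
    using that unfolding weights_def by (subst AE_restrict_space_iff[symmetric]) auto
  from this[OF v(1)] this[OF v(2)] show ?thesis by eventually_elim auto
qed

lemma transfer:
  assumes h: "h \<in> borel_measurable lebesgue"
    and hf: "AE x in lebesgue. 0 < x \<longrightarrow> h x = (f x * v1 x) epowr p2 * vv x epowr (p2 - r0)"
  shows "D h = Cop_norm p1 q1 u1 v1 f epowr q1" "L h = Ces_norm p2 q2 u2 v2 f epowr q2"
proof -
  have ae: "AE x in lebesgue. 0 < x \<longrightarrow> h x * vv x epowr r0 = (f x * v2 x) epowr p2 \<and> h x epowr pp * vv x epowr r0 = (f x * v1 x) epowr p1"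
    using AE_weights hf
  proof eventually_elim
    case (elim x)
    have "p2 * pp = p1" using pos by (simp add: pp_def)
    then show ?case using cop_ces_pointwise[of "v1 x" "v2 x" p2 r0 pp p1 "h x" "f x"] elim pos r0 gt1 r0_pp unfolding vv_def by auto
  qed
  have F: "F h t = wLnorm p2 v2 {0<..<t} f epowr p2" for t
  proof -
    have "F h t = (\<integral>\<^sup>+x\<in>{0<..}. (h x * indicator {..<t} x) * vv x epowr r0 \<partial>lebesgue)"
      unfolding F_def using h by (intro wmeas_nn_integral[OF Mplus_data(6) r0] borel_measurable_times_ennreal borel_measurable_indicator) auto
    also have "\<dots> = (\<integral>\<^sup>+x\<in>{0<..<t}. (f x * v2 x) epowr p2 \<partial>lebesgue)"
      by (rule nn_integral_cong_AE) (use ae in eventually_elim, auto simp: mult.commute split: split_indicator)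
    also have "\<dots> = wLnorm p2 v2 {0<..<t} f epowr p2" using pos by (simp add: wLnorm_def Lnorm_def)
    finally show ?thesis .
  qed
  have \<Phi>: "\<Phi> h t = wLnorm p1 v1 {t<..} f epowr p1" if t: "0 < t" for t
  proof -
    have "\<Phi> h t = (\<integral>\<^sup>+x\<in>{0<..}. (h x epowr pp * indicator {t<..} x) * vv x epowr r0 \<partial>lebesgue)"
      unfolding \<Phi>_def using h by (intro wmeas_nn_integral[OF Mplus_data(6) r0] borel_measurable_times_ennreal measurable_epowr borel_measurable_indicator) auto
    also have "\<dots> = (\<integral>\<^sup>+x\<in>{t<..}. (f x * v1 x) epowr p1 \<partial>lebesgue)"
      by (rule nn_integral_cong_AE) (use ae in eventually_elim, use t in \<open>auto simp: mult.commute split: split_indicator\<close>)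
    also have "\<dots> = wLnorm p1 v1 {t<..} f epowr p1" using pos by (simp add: wLnorm_def Lnorm_def)
    finally show ?thesis .
  qed
  have bl: "g \<in> borel_measurable borel \<Longrightarrow> g \<in> borel_measurable lebesgue" for g :: "real \<Rightarrow> ennreal"
    by (intro measurable_completion) simp
  have e1: "p1 * th / pp = q1" and e2: "p2 * qq = q2" using pos by (simp_all add: th_def pp_def qq_def)
  have "D h = (\<integral>\<^sup>+t\<in>{0<..}. \<Phi> h t epowr (th / pp) * u1 t epowr q1 \<partial>lebesgue)"
    unfolding D_def by (intro wmeas_nn_integral[OF Mplus_data(3) q0(1)] bl) measurable
  also have "\<dots> = (\<integral>\<^sup>+t\<in>{0<..}. (wLnorm p1 v1 {t<..} f * u1 t) epowr q1 \<partial>lebesgue)"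
    by (intro nn_integral_cong) (use q0 in \<open>auto simp: \<Phi> e1 epowr_mult split: split_indicator\<close>)
  also have "\<dots> = Cop_norm p1 q1 u1 v1 f epowr q1" using q0 by (simp add: Cop_norm_def wLnorm_def[of q1] Lnorm_def[of q1])
  finally show "D h = Cop_norm p1 q1 u1 v1 f epowr q1" .
  have "L h = (\<integral>\<^sup>+t\<in>{0<..}. F h t epowr qq * u2 t epowr q2 \<partial>lebesgue)"
    unfolding L_def by (intro wmeas_nn_integral[OF Mplus_data(4) q0(2)] bl) measurable
  also have "\<dots> = (\<integral>\<^sup>+t\<in>{0<..}. (wLnorm p2 v2 {0<..<t} f * u2 t) epowr q2 \<partial>lebesgue)"
    by (intro nn_integral_cong) (use q0 in \<open>auto simp: F e2 epowr_mult split: split_indicator\<close>)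
  also have "\<dots> = Ces_norm p2 q2 u2 v2 f epowr q2" using q0 by (simp add: Ces_norm_def wLnorm_def[of q2] Lnorm_def[of q2])
  finally show "L h = Ces_norm p2 q2 u2 v2 f epowr q2" .
qed

text \<open>A copy of \<open>feasible\<close> that is available before \<open>T\<close> is
  chosen.\<close>

definition feas :: "ennreal \<Rightarrow> bool" where
  "feas c \<longleftrightarrow> (\<forall>h\<in>borel_measurable (wmeas vv r0). D h < top \<longrightarrow> L h \<le> c epowr qq * D h epowr (qq / th))"

abbreviation "nrm \<equiv> Cop_Ces_norm p1 q1 u1 v1 p2 q2 u2 v2"

lemma meas_iff: "borel_measurable (wmeas vv r0) = borel_measurable lebesgue"
  by (intro measurable_cong_sets) auto

lemma exps: "q1 * (qq / th) = q2" "1 / p2 * q2 = qq" "p2 * qq = q2"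
  using pos by (simp_all add: th_def qq_def)

lemma nrm_le: assumes "feas c" shows "nrm \<le> c epowr (1 / p2)"
  unfolding Cop_Ces_norm_def embedding_norm_def
proof (rule Inf_lower, clarify)
  fix f assume f: "f \<in> Cop p1 q1 u1 v1"
  then have fM: "f \<in> Mplus" and fin: "Cop_norm p1 q1 u1 v1 f < \<infinity>" by (auto simp: Cop_def)
  define h where "h x = (f x * v1 x) epowr p2 * vv x epowr (p2 - r0) * indicator {0<..} x" for x
  have h: "h \<in> borel_measurable lebesgue"
    unfolding h_def Mplus_iff[symmetric] by (intro Mplus_mult Mplus_epowr fM Mplus_data)
  have "AE x in lebesgue. 0 < x \<longrightarrow> h x = (f x * v1 x) epowr p2 * vv x epowr (p2 - r0)" by (rule AE_I2) (simp add: h_def)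
  note tr = transfer[OF h this]
  have "D h < top" unfolding tr using fin q0 by (simp add: epowr_less_top)
  then have "L h \<le> c epowr qq * D h epowr (qq / th)" using assms h unfolding feas_def meas_iff by blast
  also have "\<dots> = (c epowr (1 / p2) * Cop_norm p1 q1 u1 v1 f) epowr q2"
    unfolding tr using q0 exps by (simp add: epowr_mult)
  finally show "Ces_norm p2 q2 u2 v2 f \<le> c epowr (1 / p2) * Cop_norm p1 q1 u1 v1 f"
    unfolding tr using q0 by (simp add: epowr_le_cancel)
qed

text \<open>A constant c of the embedding makes \<open>c epowr p2\<close> feasible, because each
  \<open>h\<close> arises from an \<open>f\<close>.\<close>

lemma le_nrm: assumes Y: "\<And>c. feas c \<Longrightarrow> Y \<le> c epowr (1 / p2)" shows "Y \<le> nrm"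
  unfolding Cop_Ces_norm_def embedding_norm_def
proof (rule Inf_greatest, clarify)
  fix c assume c: "\<forall>f\<in>Cop p1 q1 u1 v1. Ces_norm p2 q2 u2 v2 f \<le> c * Cop_norm p1 q1 u1 v1 f"
  have "feas (c epowr p2)"
    unfolding feas_def meas_iff
  proof (intro ballI impI)
    fix h assume h: "h \<in> borel_measurable lebesgue" "D h < top"
    define f where "f x = h x epowr (1 / p2) * vv x epowr ((r0 - p2) / p2) * inverse (v1 x)" for x
    have fM: "f \<in> Mplus" unfolding f_def by (intro Mplus_mult Mplus_epowr Mplus_lebesgue h Mplus_data)
    have "AE x in lebesgue. 0 < x \<longrightarrow> h x = (f x * v1 x) epowr p2 * vv x epowr (p2 - r0)"
      using AE_weights
    proof eventually_elim
      case (elim x)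
      then show ?case unfolding f_def vv_def using cop_ces_inverse[of "v1 x" "v2 x" p2 "h x" r0] pos by blast
    qed
    note tr = transfer[OF h(1) this]
    have "Cop_norm p1 q1 u1 v1 f < \<infinity>" using h(2) q0 unfolding tr by (auto simp: less_top[symmetric] epowr_eq_top_iff)
    then have "Ces_norm p2 q2 u2 v2 f \<le> c * Cop_norm p1 q1 u1 v1 f" using c fM by (auto simp: Cop_def)
    then have "L h \<le> (c * Cop_norm p1 q1 u1 v1 f) epowr q2" unfolding tr using q0 by (intro epowr_mono) auto
    also have "\<dots> = (c epowr p2) epowr qq * D h epowr (qq / th)" unfolding tr using q0 exps by (simp add: epowr_mult)
    finally show "L h \<le> (c epowr p2) epowr qq * D h epowr (qq / th)" .
  qed
  from Y[OF this] show "Y \<le> c" using pos by simp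
qed

end

lemma approx_by_mono: assumes "approx_by a A B" "0 < a" "a \<le> c" shows "approx_by c A B"
proof -
  have "1 / c \<le> 1 / a" using assms by (simp add: frac_le)
  then have "ennreal (1 / c) * B \<le> ennreal (1 / a) * B" by (intro mult_right_mono ennreal_leI) auto
  moreover have "ennreal a * B \<le> ennreal c * B" using assms by (intro mult_right_mono ennreal_leI) auto
  ultimately show ?thesis using assms(1) unfolding approx_by_def by (meson order.trans)
qed

lemma epowr_integral_equiv:
  assumes a: "0 < a" and f: "AE t in M. f t \<le> g t" "AE t in M. g t \<le> 2 * f t"
  shows "(\<integral>\<^sup>+t. f t epowr a \<partial>M) epowr (1 / a) \<le> (\<integral>\<^sup>+t. g t epowr a \<partial>M) epowr (1 / a)"
    "(\<integral>\<^sup>+t. g t epowr a \<partial>M) epowr (1 / a) \<le> 2 * (\<integral>\<^sup>+t. f t epowr a \<partial>M) epowr (1 / a)"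
proof -
  have "(\<integral>\<^sup>+t. f t epowr a \<partial>M) \<le> (\<integral>\<^sup>+t. g t epowr a \<partial>M)"
    by (intro nn_integral_mono_AE, use f(1) in eventually_elim) (use a in \<open>auto intro: epowr_mono\<close>)
  then show "(\<integral>\<^sup>+t. f t epowr a \<partial>M) epowr (1 / a) \<le> (\<integral>\<^sup>+t. g t epowr a \<partial>M) epowr (1 / a)"
    using a by (intro epowr_mono) auto
  have "(\<integral>\<^sup>+t. g t epowr a \<partial>M) \<le> (\<integral>\<^sup>+t. ennreal (2 powr a) * f t epowr a \<partial>M)"
  proof (intro nn_integral_mono_AE, use f(2) in eventually_elim)
    fix t assume "g t \<le> 2 * f t"
    then have "g t epowr a \<le> (2 * f t) epowr a" using a by (intro epowr_mono) auto
    also have "\<dots> = ennreal (2 powr a) * f t epowr a" using a epowr_ennreal[of 2 a] by (simp add: epowr_mult)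
    finally show "g t epowr a \<le> ennreal (2 powr a) * f t epowr a" .
  qed
  also have "\<dots> \<le> ennreal (2 powr a) * (\<integral>\<^sup>+t. f t epowr a \<partial>M)" by (rule nn_integral_cmult_le) simp
  finally have "(\<integral>\<^sup>+t. g t epowr a \<partial>M) epowr (1 / a) \<le> (ennreal (2 powr a) * (\<integral>\<^sup>+t. f t epowr a \<partial>M)) epowr (1 / a)"
    using a by (intro epowr_mono) auto
  also have "\<dots> = 2 * (\<integral>\<^sup>+t. f t epowr a \<partial>M) epowr (1 / a)"
    using a by (simp add: epowr_mult epowr_ennreal powr_powr)
  finally show "(\<integral>\<^sup>+t. g t epowr a \<partial>M) epowr (1 / a) \<le> 2 * (\<integral>\<^sup>+t. f t epowr a \<partial>M) epowr (1 / a)" .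
qed

lemma min_powr: fixes a y z :: real assumes "0 \<le> y" "0 \<le> z" "0 \<le> a" shows "min y z powr a = min (y powr a) (z powr a)"
proof (cases "y \<le> z")
  case True
  then have "y powr a \<le> z powr a" using assms by (intro powr_mono2)
  then show ?thesis using True by (simp add: min_def)
next
  case False
  then have "z powr a \<le> y powr a" using assms by (intro powr_mono2) auto
  then show ?thesis using False by (simp add: min_def)
qed

text \<open>Compares the kernels of the statement with minima: a + b lies between the larger of a
  and b and its double.\<close>

lemma frac_bounds:
  fixes a b :: real assumes "0 < a" "0 < b"
  shows "a / (a + b) \<le> min 1 (a / b)" "min 1 (a / b) \<le> 2 * (a / (a + b))"
    "a / (a + b) * b \<le> min a b" "min a b \<le> 2 * (a / (a + b) * b)"
proof -
  show 1: "a / (a + b) \<le> min 1 (a / b)" using assms by (auto intro: divide_left_mono)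
  show 2: "min 1 (a / b) \<le> 2 * (a / (a + b))"
  proof (cases "a \<le> b")
    case True
    then have "a / b \<le> 2 * (a / (a + b))" using assms by (simp add: divide_simps)
    then show ?thesis by simp
  next
    case False
    then have "1 \<le> 2 * (a / (a + b))" using assms by (simp add: divide_simps)
    then show ?thesis by simp
  qed
  have *: "min 1 (a / b) * b = min a b" using assms by (simp add: min_def divide_simps)
  show "a / (a + b) * b \<le> min a b" using mult_right_mono[OF 1, of b] assms unfolding * by simp
  show "min a b \<le> 2 * (a / (a + b) * b)" using mult_right_mono[OF 2, of b] assms unfolding * by simp
qed

context ces_data
begin

definition W :: "real \<Rightarrow> real" where "W x = mm x powr (1 / r0)"

lemma V_W: "V x = ennreal (W x)" unfolding W_def by (rule mm_V)
lemma W_pos: "0 < x \<Longrightarrow> 0 < W x" unfolding W_def using m.pos[of x] by simp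
lemma mm_nonneg: "0 \<le> mm x" by (simp add: mm_def)
lemma NN_nonneg: "0 \<le> NN x" by (simp add: NN_def)

lemma Vfrac_W: "0 < x \<Longrightarrow> 0 < t \<Longrightarrow> Vfrac V t x = ennreal (W t / (W t + W x))"
  using W_pos[of x] W_pos[of t] unfolding Vfrac_def V_W by (simp add: ennreal_plus[symmetric] divide_ennreal del: ennreal_plus)

lemma r0_exps: "1 / pc * (1 / p2) = 1 / r0" "1 / r0 * (p2 * a) = a / pc" "1 / qq * (1 / p2) = 1 / q2"
  using pos gt1c by (simp_all add: arrows(1) qq_def)

lemma min_W:
  assumes "0 < x" "0 < t"
  shows "min (W x) (W t) powr (p2 * a) = min (mm x) (mm t) powr (a / pc)" "min 1 (W t / W x) powr (p2 * a) = min 1 (mm t / mm x) powr (a / pc)"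
proof -
  have r: "0 \<le> 1 / r0" using r0 by simp
  have "min (W x) (W t) = min (mm x) (mm t) powr (1 / r0)" unfolding W_def using mm_nonneg r by (simp add: min_powr)
  then show "min (W x) (W t) powr (p2 * a) = min (mm x) (mm t) powr (a / pc)" by (simp only: powr_powr r0_exps)
  have "min 1 (W t / W x) = min 1 (mm t / mm x) powr (1 / r0)" unfolding W_def using mm_nonneg r by (simp add: min_powr powr_divide)
  then show "min 1 (W t / W x) powr (p2 * a) = min 1 (mm t / mm x) powr (a / pc)" by (simp only: powr_powr r0_exps)
qed

definition "Uinf = emeasure (wmeas u1 q1) UNIV"
text \<open>The limit of \<open>UU powr (1 - tc)\<close> at infinity; the exponent is negative, so
  an infinite total mass gives 0.\<close>

definition "ee = enn2real (Uinf epowr (1 - tc))"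
definition "bt = LS_measure (hleft q1 u1 (q1 \<rightarrowtail> p2))"

lemma UU_le_Uinf: "ennreal (UU x) \<le> Uinf"
  unfolding Uinf_def U_le[symmetric] by (intro emeasure_mono) auto

lemma Uinf_le: assumes "\<And>x. UU x \<le> c" shows "Uinf \<le> ennreal c"
proof -
  have "Uinf \<le> emeasure (wmeas u1 q1) (\<Union>n::nat. {..real n})"
    unfolding Uinf_def using real_arch_simple by (intro emeasure_mono) auto
  also have "\<dots> = (SUP n::nat. emeasure (wmeas u1 q1) {..real n})"
    by (intro SUP_emeasure_incseq[symmetric]) (auto simp: incseq_def)
  also have "\<dots> \<le> ennreal c" using assms by (intro SUP_least) (auto simp: U_le intro!: ennreal_leI)
  finally show ?thesis .
qed

lemma ee_cases: "(Uinf = top \<and> ee = 0) \<or> (\<exists>w>0. Uinf = ennreal w \<and> ee = w powr (1 - tc))"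
proof (cases Uinf)
  case (real w)
  have "0 < UU 1" using U.pos[of 1] by simp
  then have "0 < w" using UU_le_Uinf[of 1] real by simp
  then show ?thesis using real by (auto simp: ee_def epowr_ennreal)
qed (use gt1c in \<open>simp add: ee_def epowr_def\<close>)

lemma ee_nonneg: "0 \<le> ee" by (simp add: ee_def)

lemma ee_le: assumes "0 < x" shows "ee \<le> UU x powr (1 - tc)"
  using ee_cases
proof
  assume "\<exists>w>0. Uinf = ennreal w \<and> ee = w powr (1 - tc)"
  then obtain w where w: "0 < w" "Uinf = ennreal w" "ee = w powr (1 - tc)" by blast
  then have "UU x \<le> w" using UU_le_Uinf[of x] by simp
  then show ?thesis unfolding w(3) using U.pos[OF assms] gt1c by (intro powr_mono2') auto
qed simp

lemma ee_top: assumes "0 < c" "\<And>x. UU x \<le> c" shows "c powr (1 - tc) \<le> ee"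
proof -
  have le: "Uinf \<le> ennreal c" by (rule Uinf_le[OF assms(2)])
  then obtain w where w: "0 < w" "Uinf = ennreal w" "ee = w powr (1 - tc)" using ee_cases by (auto simp: top_unique)
  then have "w \<le> c" using le assms(1) by simp
  then show ?thesis unfolding w(3) using w(1) gt1c by (intro powr_mono2') auto
qed

text \<open>Identifies the factor e^(1/\<theta>') of \<open>B2\<close>, raised to 1/p2, with the
  inverse norm of \<open>u1\<close> in the second summand of the statement.\<close>

lemma ee_Lnorm: "inverse (Lnorm q1 {0<..} u1) = ennreal (ee powr (1 / (p2 * tc)))"
proof -
  have Ui: "Uinf = Lnorm q1 {0<..} u1 epowr q1"
    unfolding Uinf_def using q0 by (subst wmeas_emeasure[OF Mplus_data(3) q0(1)]) (simp_all add: Lnorm_def)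
  have x: "(1 - tc) * (1 / (p2 * tc)) = - (1 / q1)"
  proof -
    have "tc / th = tc - 1" by (rule conj_exp(4)[OF gt1(3) conj(3)])
    then have "(1 - tc) * (1 / (p2 * tc)) = - (tc / th) / (p2 * tc)" by simp
    also have "\<dots> = - (1 / q1)" using gt1c pos by (simp add: th_def)
    finally show ?thesis .
  qed
  have s: "0 < 1 / (p2 * tc)" using pos gt1c by simp
  have ne: "Uinf \<noteq> 0" using ee_cases by auto
  have "ennreal ee = Uinf epowr (1 - tc)"
    using ee_cases gt1c by (auto simp: epowr_ennreal epowr_def[of top])
  then have "ennreal ee epowr (1 / (p2 * tc)) = Uinf epowr (- (1 / q1))" by (simp only: epowr_epowr x)
  then have "ennreal (ee powr (1 / (p2 * tc))) = Uinf epowr (- (1 / q1))"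
    unfolding epowr_ennreal_pos[OF ee_nonneg s] .
  also have "\<dots> = Lnorm q1 {0<..} u1 epowr (- 1)" unfolding Ui using q0 by simp
  finally show ?thesis by (simp add: epowr_uminus_1)
qed

lemma hleft_eq: assumes "0 < t" shows "hleft q1 u1 (q1 \<rightarrowtail> p2) t = - (UU t powr (1 - tc))"
proof -
  have "tc / th = tc - 1" by (rule conj_exp(4)[OF gt1(3) conj(3)])
  then have x: "1 / q1 * - (p2 * tc) = 1 - tc" using pos by (simp add: th_def field_simps)
  have "Lnorm q1 {0<..<t} u1 = ennreal (UU t) epowr (1 / q1)" unfolding UU_eq using q0 by simp
  then have "Lnorm q1 {0<..<t} u1 epowr (- (p2 * tc)) = ennreal (UU t) epowr (1 - tc)"
    by (simp only: epowr_epowr x)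
  then show ?thesis unfolding hleft_def arrows(2) using U.pos[OF assms] by (simp add: epowr_ennreal)
qed

lemma isCont_local: assumes "isCont g x" "0 < x" "\<And>t. 0 < t \<Longrightarrow> f t = g t" shows "isCont f (x::real)"
proof -
  have "\<forall>\<^sub>F t in nhds x. f t = g t"
    by (rule eventually_mono[OF eventually_nhds_in_open[of "{0<..}"]]) (use assms in auto)
  then show ?thesis using assms(1) by (simp add: isCont_cong)
qed

lemma bt_gt: assumes x: "0 < x" shows "emeasure bt {x<..} = ennreal (UU x powr (1 - tc) - ee)"
proof -
  let ?h = "hleft q1 u1 (q1 \<rightarrowtail> p2)"
  have anti: "UU t powr (1 - tc) \<le> UU s powr (1 - tc)" if "0 < s" "s \<le> t" for s t
    using U.pos[OF that(1)] monoD[OF U.mono that(2)] gt1c by (intro powr_mono2') auto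
  have "emeasure bt {x<..} = ennreal (- ee - ?h x)"
    unfolding bt_def
  proof (rule LS_measure_tail[OF _ _ _ x])
    show "mono_on {0<..} ?h" by (intro mono_onI) (simp add: hleft_eq anti)
    fix y :: real assume y: "0 < y"
    have "isCont UU y" using U.cont by (simp add: continuous_on_eq_continuous_at)
    then have "isCont (\<lambda>t. - (UU t powr (1 - tc))) y" using U.pos[OF y] by (intro continuous_intros) auto
    then show "isCont ?h y" by (rule isCont_local[OF _ y hleft_eq])
  next
    have lim: "((\<lambda>t. UU t powr (1 - tc)) \<longlongrightarrow> ee) at_top"
    proof (rule order_tendstoI)
      fix a assume a: "a < ee"
      show "\<forall>\<^sub>F t in at_top. a < UU t powr (1 - tc)"
        using eventually_gt_at_top[of 0] by eventually_elim (use a ee_le in \<open>auto intro: less_le_trans\<close>)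
    next
      fix d assume d: "ee < d"
      \<comment> \<open>Otherwise \<open>UU\<close> would be bounded by
        \<open>d powr (1 / (1 - tc))\<close>, and \<open>ee_top\<close> would give d \<le>
        ee.\<close>
      have "\<exists>t>0. UU t powr (1 - tc) < d"
      proof (rule ccontr)
        assume "\<not> (\<exists>t>0. UU t powr (1 - tc) < d)"
        then have *: "d \<le> UU t powr (1 - tc)" if "0 < t" for t using \<open>\<not> (\<exists>t>0. UU t powr (1 - tc) < d)\<close> that by (meson not_less)
        have d0: "0 < d" using d ee_nonneg by linarith
        have le: "UU t \<le> d powr (1 / (1 - tc))" for t
        proof (cases "0 < t")
          case True
          have "(UU t powr (1 - tc)) powr (1 / (1 - tc)) \<le> d powr (1 / (1 - tc))"
            using *[OF True] d0 gt1c by (intro powr_mono2') auto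
          then show ?thesis using U.pos[OF True] gt1c by (simp add: powr_powr)
        next
          case False
          then have "UU t \<le> UU 0" by (intro monoD[OF U.mono]) simp
          then show ?thesis using U.zero by (intro order.trans[OF _ powr_ge_zero]) simp
        qed
        have "(d powr (1 / (1 - tc))) powr (1 - tc) \<le> ee" using d0 by (intro ee_top le) simp
        then show False using d d0 gt1c by (simp add: powr_powr)
      qed
      then obtain t0 where t0: "0 < t0" "UU t0 powr (1 - tc) < d" by blast
      show "\<forall>\<^sub>F t in at_top. UU t powr (1 - tc) < d"
        using eventually_ge_at_top[of t0] by eventually_elim (use t0 anti in \<open>auto intro: le_less_trans\<close>)
    qed
    have "\<forall>\<^sub>F t in at_top. - (UU t powr (1 - tc)) = ?h t"
      using eventually_gt_at_top[of 0] by eventually_elim (simp add: hleft_eq)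
    with tendsto_minus[OF lim] show "(?h \<longlongrightarrow> - ee) at_top" by (rule Lim_transform_eventually)
  qed
  then show ?thesis by (simp add: hleft_eq[OF x])
qed

lemma AE_LS_pos: "AE t in LS_measure h. 0 < t"
  using LS_measure_nonpos[of h] by (intro AE_I[of _ _ "{..0}"]) auto

lemma cope_beta_bt:
  assumes "cope_T mm UU NN (wmeas vv r0) (wmeas u1 q1) (wmeas u2 q2) pp qq th pc qc tc T Cu Cl"
  shows "cope_beta mm UU NN (wmeas vv r0) (wmeas u1 q1) (wmeas u2 q2) pp qq th pc qc tc T Cu Cl bt ee"
  using assms by (intro cope_beta.intro cope_beta_axioms.intro bt_gt ee_nonneg ee_le ee_top)
    (simp_all add: bt_def LS_measure_nonpos)

definition "\<phi>m x = (\<integral>\<^sup>+t. ennreal (min (mm x) (mm t) powr (tc / pc)) \<partial>bt) epowr (1 / tc)"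

lemma phi2_equiv:
  assumes x: "0 < x"
  shows "phi2 p2 q1 u1 V x \<le> \<phi>m x epowr (1 / p2)" "\<phi>m x epowr (1 / p2) \<le> 2 * phi2 p2 q1 u1 V x"
proof -
  let ?a = "p2 * tc"
  have a: "0 < ?a" using pos gt1c by simp
  have f: "Vfrac V x t * V t = ennreal (W x / (W x + W t) * W t)" if "0 < t" for t
    unfolding Vfrac_W[OF that x] V_W using W_pos[OF x] W_pos[OF that] by (simp add: ennreal_mult''[symmetric])
  have "\<phi>m x epowr (1 / p2) = (\<integral>\<^sup>+t. ennreal (min (W x) (W t)) epowr ?a \<partial>bt) epowr (1 / ?a)"
  proof -
    have "(\<integral>\<^sup>+t. ennreal (min (mm x) (mm t) powr (tc / pc)) \<partial>bt) = (\<integral>\<^sup>+t. ennreal (min (W x) (W t)) epowr ?a \<partial>bt)"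
      unfolding bt_def
    proof (intro nn_integral_cong_AE, use AE_LS_pos in eventually_elim)
      fix t :: real assume t: "0 < t"
      show "ennreal (min (mm x) (mm t) powr (tc / pc)) = ennreal (min (W x) (W t)) epowr ?a"
        using W_pos[OF x] W_pos[OF t] by (simp add: epowr_ennreal min_W[OF x t])
    qed
    then show ?thesis unfolding \<phi>m_def using pos by (simp add: mult.commute)
  qed
  moreover have "AE t in bt. Vfrac V x t * V t \<le> ennreal (min (W x) (W t))" "AE t in bt. ennreal (min (W x) (W t)) \<le> 2 * (Vfrac V x t * V t)"
  proof -
    have 2: "2 * ennreal y = ennreal (2 * y)" for y by (simp add: ennreal_mult')
    show "AE t in bt. Vfrac V x t * V t \<le> ennreal (min (W x) (W t))"
      unfolding bt_def using AE_LS_pos by eventually_elim (simp only: f, intro ennreal_leI frac_bounds W_pos x)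
    show "AE t in bt. ennreal (min (W x) (W t)) \<le> 2 * (Vfrac V x t * V t)"
      unfolding bt_def using AE_LS_pos by eventually_elim (simp only: f 2, intro ennreal_leI frac_bounds W_pos x)
  qed
  note epowr_integral_equiv[OF a this]
  ultimately show "phi2 p2 q1 u1 V x \<le> \<phi>m x epowr (1 / p2)" "\<phi>m x epowr (1 / p2) \<le> 2 * phi2 p2 q1 u1 V x"
    unfolding phi2_def LS_int_def arrows(2) bt_def[unfolded arrows(2)] by simp_all
qed

text \<open>Built from exported constants of the locales, whose arguments are the exponents and the
  two constants of Hardy's inequality. No weight enters, so the uniformity is visible.\<close>

definition "Kc Cu Cl = cope_beta.Csmall pp qq th tc Cu powr ((1 / p2) / qq) * 2 powr (1 / p2) * (4 + 1)
   + 2 * (cope_beta.TC pp qq th Cl powr (1 / qq) + Cl powr (1 / qq)) powr (1 / p2) + 1"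

definition "rr = 1 / (1 / qq - 1 / th)"
definition "Kd Cu Cl = cope_beta.Clarge pp qq th qc tc Cu rr powr ((1 / p2) / qq) * 2 powr (1 / p2) * (2 powr (tc / qc + 1) + 1)
   + 2 * ((2 powr (tc * rr / qc) * cope_beta.Cdisc pp qq th tc Cl rr) powr (1 / rr) + Cl powr (1 / qq)) powr (1 / p2) + 1"

lemma K_pos: "0 < Kc Cu Cl" "0 < Kd Cu Cl"
  unfolding Kc_def Kd_def by (intro add_nonneg_pos add_nonneg_nonneg mult_nonneg_nonneg; simp)+

lemma case_small:
  assumes T: "cope_T mm UU NN (wmeas vv r0) (wmeas u1 q1) (wmeas u2 q2) pp qq th pc qc tc T Cu Cl" and q: "q1 \<le> q2"
    and Tt: "\<And>x. 0 < x \<Longrightarrow> Tt x \<le> T x epowr (1 / p2)" "\<And>x. 0 < x \<Longrightarrow> T x epowr (1 / p2) \<le> 2 * Tt x"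
    and K: "(SUP x\<in>{0<..}. (ennreal (mm x powr (1 / pc)) * T x) epowr (1 / p2)) = Kt"
  shows "approx_by (Kc Cu Cl) nrm ((SUP x\<in>{0<..}. phi2 p2 q1 u1 V x * Tt x) + inverse (Lnorm q1 {0<..} u1) * Kt)"
proof -
  interpret B: cope_beta mm UU NN "wmeas vv r0" "wmeas u1 q1" "wmeas u2 q2" pp qq th pc qc tc T Cu Cl bt ee
    by (rule cope_beta_bt[OF T])
  have s: "0 < 1 / p2" using pos by simp
  have fe: "B.feasible c \<longleftrightarrow> feas c" for c unfolding B.feasible_def feas_def by (rule refl)
  have ph: "B.\<phi> x = \<phi>m x" for x unfolding B.\<phi>_def B.\<Psi>_def \<phi>m_def by (rule refl)
  have B2: "B.B2 epowr (1 / p2) = inverse (Lnorm q1 {0<..} u1) * Kt"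
    unfolding B.B2_def B.Kinf_def B.K_def ee_Lnorm K[symmetric] using s ee_nonneg gt1c
    by (simp add: epowr_mult epowr_SUP epowr_ennreal_pos powr_powr mult.commute)
  have "th \<le> qq" using q pos by (simp add: th_def qq_def divide_right_mono)
  from B.approx_small[OF s this, of nrm "phi2 p2 q1 u1 V" Tt, unfolded fe ph, OF nrm_le le_nrm phi2_equiv Tt]
  show ?thesis unfolding B2 Kc_def by simp
qed

lemma case_large:
  assumes T: "cope_T mm UU NN (wmeas vv r0) (wmeas u1 q1) (wmeas u2 q2) pp qq th pc qc tc T Cu Cl" and q: "q2 < q1"
    and Tt: "\<And>x. 0 < x \<Longrightarrow> Tt x \<le> T x epowr (1 / p2)" "\<And>x. 0 < x \<Longrightarrow> T x epowr (1 / p2) \<le> 2 * Tt x"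
    and K: "(SUP x\<in>{0<..}. (ennreal (mm x powr (1 / pc)) * T x) epowr (1 / p2)) = Kt"
  shows "approx_by (Kd Cu Cl) nrm (LS_int (\<lambda>x. phi2 p2 q1 u1 V x epowr ((q1 \<rightarrowtail> q2) * (q1 \<rightarrowtail> p2) / (q2 \<rightarrowtail> p2)) * V x epowr (q1 \<rightarrowtail> p2)
     * Tt x epowr (q1 \<rightarrowtail> q2)) (hleft q1 u1 (q1 \<rightarrowtail> p2)) epowr (1 / (q1 \<rightarrowtail> q2)) + inverse (Lnorm q1 {0<..} u1) * Kt)"
proof -
  interpret B: cope_beta mm UU NN "wmeas vv r0" "wmeas u1 q1" "wmeas u2 q2" pp qq th pc qc tc T Cu Cl bt ee
    by (rule cope_beta_bt[OF T])
  have s: "0 < 1 / p2" using pos by simp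
  have fe: "B.feasible c \<longleftrightarrow> feas c" for c unfolding B.feasible_def feas_def by (rule refl)
  have ph: "B.\<phi> x = \<phi>m x" for x unfolding B.\<phi>_def B.\<Psi>_def \<phi>m_def by (rule refl)
  have B2: "B.B2 epowr (1 / p2) = inverse (Lnorm q1 {0<..} u1) * Kt"
    unfolding B.B2_def B.Kinf_def B.K_def ee_Lnorm K[symmetric] using s ee_nonneg gt1c
    by (simp add: epowr_mult epowr_SUP epowr_ennreal_pos powr_powr mult.commute)
  have qt: "qq < th" using q pos by (simp add: th_def qq_def divide_strict_right_mono)
  have rr: "1 / rr = 1 / qq - 1 / th" by (simp add: rr_def)
  let ?g = "\<lambda>x. phi2 p2 q1 u1 V x epowr ((q1 \<rightarrowtail> q2) * (q1 \<rightarrowtail> p2) / (q2 \<rightarrowtail> p2)) * V x epowr (q1 \<rightarrowtail> p2) * Tt x epowr (q1 \<rightarrowtail> q2)"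
  have e1: "q1 \<rightarrowtail> q2 = rr / (1 / p2)" unfolding arrows2 rr_def[symmetric] by simp
  have e2: "(q1 \<rightarrowtail> q2) * (q1 \<rightarrowtail> p2) / (q2 \<rightarrowtail> p2) = rr * tc / qc / (1 / p2)" unfolding e1 arrows using pos by simp
  have e3: "1 / (q1 \<rightarrowtail> q2) = (1 / p2) / rr" unfolding e1 by simp
  have g: "?g x = phi2 p2 q1 u1 V x epowr (rr * tc / qc / (1 / p2)) * ennreal (mm x powr (tc / pc)) * Tt x epowr (rr / (1 / p2))" if "0 < x" for x
  proof -
    have "V x epowr (q1 \<rightarrowtail> p2) = ennreal (mm x powr (tc / pc))"
      unfolding V_W arrows(2) using W_pos[OF that] by (simp add: epowr_ennreal W_def powr_powr r0_exps[simplified])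
    then show ?thesis unfolding e2 by (simp only: e1)
  qed
  from B.approx_large[OF s qt rr, of nrm "phi2 p2 q1 u1 V" Tt ?g, unfolded fe ph, OF nrm_le le_nrm phi2_equiv Tt g]
  show ?thesis unfolding B2 Kd_def e3 LS_int_def bt_def by simp
qed

end

section \<open>The four cases\<close>

context ces_data
begin

lemma s_pos: "0 < 1 / p2" using pos by simp

lemma min_W1: "0 < x \<Longrightarrow> 0 < t \<Longrightarrow> ennreal (min 1 (mm t / mm x) powr (1 / pc)) epowr (1 / p2) = ennreal (min 1 (W t / W x))"
proof -
  assume x: "0 < x" "0 < t"
  have "p2 * (1 / p2) = 1" "1 / p2 / pc = 1 / pc * (1 / p2)" using pos by simp_all
  moreover have "0 < min 1 (mm t / mm x)" using m.pos[OF x(1)] m.pos[OF x(2)] by simp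
  moreover have "0 < min 1 (W t / W x)" using W_pos[OF x(1)] W_pos[OF x(2)] by simp
  ultimately show ?thesis using min_W(2)[OF x, of "1 / p2"] by (simp add: epowr_ennreal powr_powr mult.commute)
qed

lemma Tsup_s:
  assumes x: "0 < x"
  shows "Tsup x epowr (1 / p2) = (SUP t\<in>{0<..}. ennreal (min 1 (W t / W x)) * Lnorm q2 {t<..} u2)"
  unfolding Tsup_def epowr_SUP[OF s_pos]
proof (intro SUP_cong refl)
  fix t :: real assume "t \<in> {0<..}"
  then have t: "0 < t" by simp
  have "0 < NN t" using N_pos(1)[OF t] unfolding NN_eq[OF t] using NN_nonneg[of t] by (cases "NN t = 0") auto
  then have "ennreal (NN t powr (1 / qq)) epowr (1 / p2) = Lnorm q2 {t<..} u2"
    unfolding NN_eq[OF t] r0_exps(3)[symmetric] by (simp add: epowr_ennreal powr_powr)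
  then show "(ennreal (min 1 (mm t / mm x) powr (1 / pc)) * ennreal (NN t powr (1 / qq))) epowr (1 / p2)
    = ennreal (min 1 (W t / W x)) * Lnorm q2 {t<..} u2"
    unfolding epowr_mult[OF s_pos] min_W1[OF x t] by simp
qed

lemma two_ennreal: "2 * ennreal y = ennreal (2 * y)" by (simp add: ennreal_mult')

lemma Tsup_equiv:
  assumes x: "0 < x"
  shows "(SUP t\<in>{0<..}. Vfrac V t x * Lnorm q2 {t<..} u2) \<le> Tsup x epowr (1 / p2)"
    "Tsup x epowr (1 / p2) \<le> 2 * (SUP t\<in>{0<..}. Vfrac V t x * Lnorm q2 {t<..} u2)"
proof -
  show "(SUP t\<in>{0<..}. Vfrac V t x * Lnorm q2 {t<..} u2) \<le> Tsup x epowr (1 / p2)"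
    unfolding Tsup_s[OF x]
  proof (intro SUP_subset_mono order_refl mult_right_mono)
    fix t :: real assume "t \<in> {0<..}"
    then have t: "0 < t" by simp
    show "Vfrac V t x \<le> ennreal (min 1 (W t / W x))"
      unfolding Vfrac_W[OF x t] by (intro ennreal_leI frac_bounds W_pos x t)
  qed simp
  have "Tsup x epowr (1 / p2) \<le> (SUP t\<in>{0<..}. 2 * (Vfrac V t x * Lnorm q2 {t<..} u2))"
    unfolding Tsup_s[OF x] mult.assoc[symmetric]
  proof (intro SUP_subset_mono order_refl mult_right_mono)
    fix t :: real assume "t \<in> {0<..}"
    then have t: "0 < t" by simp
    show "ennreal (min 1 (W t / W x)) \<le> 2 * Vfrac V t x"
      unfolding Vfrac_W[OF x t] two_ennreal by (intro ennreal_leI frac_bounds W_pos x t)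
  qed simp
  then show "Tsup x epowr (1 / p2) \<le> 2 * (SUP t\<in>{0<..}. Vfrac V t x * Lnorm q2 {t<..} u2)"
    by (simp only: SUP_mult_left_ennreal)
qed

lemma W_epowr: "0 < x \<Longrightarrow> ennreal (mm x powr (1 / pc)) epowr (1 / p2) = ennreal (W x)"
  using m.pos[of x] unfolding W_def r0_exps(1)[symmetric] by (simp add: epowr_ennreal powr_powr)

text \<open>For fixed t the minimum of \<open>W x\<close> and \<open>W t\<close> is at most
  \<open>W t\<close>, and this value is reached at x = t.\<close>

lemma Ksup_s: "(SUP x\<in>{0<..}. (ennreal (mm x powr (1 / pc)) * Tsup x) epowr (1 / p2)) = (SUP t\<in>{0<..}. V t * Lnorm q2 {t<..} u2)"
proof -
  have eq: "(ennreal (mm x powr (1 / pc)) * Tsup x) epowr (1 / p2) = (SUP t\<in>{0<..}. ennreal (min (W x) (W t)) * Lnorm q2 {t<..} u2)" if x: "0 < x" for x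
  proof -
    have "(ennreal (mm x powr (1 / pc)) * Tsup x) epowr (1 / p2)
      = (SUP t\<in>{0<..}. ennreal (W x) * (ennreal (min 1 (W t / W x)) * Lnorm q2 {t<..} u2))"
      unfolding epowr_mult[OF s_pos] W_epowr[OF x] Tsup_s[OF x] by (rule SUP_mult_left_ennreal)
    also have "\<dots> = (SUP t\<in>{0<..}. ennreal (min (W x) (W t)) * Lnorm q2 {t<..} u2)"
    proof (intro SUP_cong refl)
      fix t
      have "W x * min 1 (W t / W x) = min (W x) (W t)" using W_pos[OF x] by (simp add: min_def divide_simps)
      then have "ennreal (W x) * ennreal (min 1 (W t / W x)) = ennreal (min (W x) (W t))"
        using W_pos[OF x] by (simp add: ennreal_mult'[symmetric])
      then show "ennreal (W x) * (ennreal (min 1 (W t / W x)) * Lnorm q2 {t<..} u2) = ennreal (min (W x) (W t)) * Lnorm q2 {t<..} u2"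
        by (simp only: mult.assoc[symmetric])
    qed
    finally show ?thesis .
  qed
  show ?thesis
  proof (rule antisym)
    show "(SUP x\<in>{0<..}. (ennreal (mm x powr (1 / pc)) * Tsup x) epowr (1 / p2)) \<le> (SUP t\<in>{0<..}. V t * Lnorm q2 {t<..} u2)"
    proof (rule SUP_least)
      fix x :: real assume "x \<in> {0<..}"
      then have x: "0 < x" by simp
      show "(ennreal (mm x powr (1 / pc)) * Tsup x) epowr (1 / p2) \<le> (SUP t\<in>{0<..}. V t * Lnorm q2 {t<..} u2)"
        unfolding eq[OF x] V_W by (intro SUP_subset_mono order_refl mult_right_mono ennreal_leI) auto
    qed
    show "(SUP t\<in>{0<..}. V t * Lnorm q2 {t<..} u2) \<le> (SUP x\<in>{0<..}. (ennreal (mm x powr (1 / pc)) * Tsup x) epowr (1 / p2))"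
    proof (intro SUP_mono bexI)
      fix t :: real assume "t \<in> {0<..}"
      then have t: "0 < t" by simp
      have "V t * Lnorm q2 {t<..} u2 = ennreal (min (W t) (W t)) * Lnorm q2 {t<..} u2" by (simp add: V_W)
      also have "\<dots> \<le> (SUP s\<in>{0<..}. ennreal (min (W t) (W s)) * Lnorm q2 {s<..} u2)" using t by (intro SUP_upper) simp
      finally show "V t * Lnorm q2 {t<..} u2 \<le> (ennreal (mm t powr (1 / pc)) * Tsup t) epowr (1 / p2)" unfolding eq[OF t] .
    qed
  qed
qed

definition "rho = 1 / (1 / qq - 1 / pp)"
definition "sg = LS_measure (hright q2 u2 (p1 \<rightarrowtail> q2))"

lemma arrow_rho: "p1 \<rightarrowtail> q2 = p2 * rho" unfolding arrows2 rho_def ..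

context
  assumes qp: "q2 < p1"
begin

lemma rho_pos: "0 < rho"
proof -
  have "qq < pp" using qp pos by (simp add: qq_def pp_def divide_strict_right_mono)
  then show ?thesis using gt1 unfolding rho_def by (simp add: frac_less2)
qed

lemma hright_eq: assumes "0 < t" shows "hright q2 u2 (p1 \<rightarrowtail> q2) t = - (NN t powr (rho / qq))"
proof -
  have "0 < p2 * rho" using rho_pos pos by simp
  moreover have "1 / q2 * (p2 * rho) = rho / qq" using pos by (simp add: qq_def)
  ultimately show ?thesis
    unfolding hright_def arrow_rho NN_eq[OF assms] by (simp add: epowr_ennreal_pos powr_powr)
qed

lemma NN_pos: "0 < t \<Longrightarrow> 0 < NN t"
  using N_pos(1)[of t] NN_eq[of t] NN_nonneg[of t] by (cases "NN t = 0") auto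

lemma sg_gt: assumes x: "0 < x" shows "emeasure sg {x<..} = ennreal (NN x powr (rho / qq))"
proof -
  let ?h = "hright q2 u2 (p1 \<rightarrowtail> q2)"
  have r: "0 < rho / qq" using rho_pos gt1 by simp
  have "emeasure sg {x<..} = ennreal (0 - ?h x)"
    unfolding sg_def
  proof (rule LS_measure_tail[OF _ _ _ x])
    have "NN t powr (rho / qq) \<le> NN s powr (rho / qq)" if "0 < s" "s \<le> t" for s t
      unfolding NN_def using wmeas_tail_anti[OF Mplus_data(4) q0(2) N_pos(2) that] r by (intro powr_mono2) auto
    then show "mono_on {0<..} ?h" by (intro mono_onI) (simp add: hright_eq)
    fix y :: real assume y: "0 < y"
    have "isCont NN y" using wmeas_tail_cont[OF Mplus_data(4) q0(2) N_pos(2) y] unfolding NN_def .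
    then have "isCont (\<lambda>t. - (NN t powr (rho / qq))) y" using NN_pos[OF y] by (intro continuous_intros) auto
    then show "isCont ?h y" by (rule isCont_local[OF _ y hright_eq])
  next
    have "(NN \<longlongrightarrow> 0) at_top" using wmeas_tail_lim[OF Mplus_data(4) q0(2) N_pos(2)] unfolding NN_def .
    then have "((\<lambda>t. NN t powr (rho / qq)) \<longlongrightarrow> 0) at_top"
      by (rule tendsto_zero_powrI[OF _ tendsto_const]) (use r NN_nonneg in auto)
    then have "((\<lambda>t. - (NN t powr (rho / qq))) \<longlongrightarrow> 0) at_top" using tendsto_minus by fastforce
    moreover have "\<forall>\<^sub>F t in at_top. - (NN t powr (rho / qq)) = ?h t"
      using eventually_gt_at_top[of 0] by eventually_elim (simp add: hright_eq)
    ultimately show "(?h \<longlongrightarrow> 0) at_top" by (rule Lim_transform_eventually)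
  qed
  then show ?thesis by (simp add: hright_eq[OF x])
qed

lemma cope_sigma_sg: "cope_sigma mm UU NN (wmeas vv r0) (wmeas u1 q1) (wmeas u2 q2) pp qq th pc qc tc sg rho"
proof (intro cope_sigma.intro cope_sigma_axioms.intro)
  show "cope mm UU NN (wmeas vv r0) (wmeas u1 q1) (wmeas u2 q2) pp qq th pc qc tc" by unfold_locales
  show "qq < pp" using qp pos by (simp add: qq_def pp_def divide_strict_right_mono)
  show "1 / rho = 1 / qq - 1 / pp" by (simp add: rho_def)
qed (auto simp: sg_def LS_measure_nonpos sg_gt[unfolded sg_def])

interpretation S: cope_sigma mm UU NN "wmeas vv r0" "wmeas u1 q1" "wmeas u2 q2" pp qq th pc qc tc sg rho
  by (rule cope_sigma_sg)

lemma Tint_equiv: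
  assumes x: "0 < x"
  shows "LS_int (\<lambda>t. Vfrac V t x epowr (p1 \<rightarrowtail> q2)) (hright q2 u2 (p1 \<rightarrowtail> q2)) epowr (1 / (p1 \<rightarrowtail> q2)) \<le> S.Tint x epowr (1 / p2)"
    "S.Tint x epowr (1 / p2) \<le> 2 * LS_int (\<lambda>t. Vfrac V t x epowr (p1 \<rightarrowtail> q2)) (hright q2 u2 (p1 \<rightarrowtail> q2)) epowr (1 / (p1 \<rightarrowtail> q2))"
proof -
  let ?a = "p2 * rho"
  have a: "0 < ?a" using pos rho_pos by simp
  have "S.Tint x epowr (1 / p2) = (\<integral>\<^sup>+t. ennreal (min 1 (W t / W x)) epowr ?a \<partial>sg) epowr (1 / ?a)"
  proof -
    have "(\<integral>\<^sup>+t. ennreal (min 1 (mm t / mm x) powr (rho / pc)) \<partial>sg) = (\<integral>\<^sup>+t. ennreal (min 1 (W t / W x)) epowr ?a \<partial>sg)"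
      unfolding sg_def
    proof (intro nn_integral_cong_AE, use AE_LS_pos in eventually_elim)
      fix t :: real assume t: "0 < t"
      show "ennreal (min 1 (mm t / mm x) powr (rho / pc)) = ennreal (min 1 (W t / W x)) epowr ?a"
        using W_pos[OF x] W_pos[OF t] by (simp add: epowr_ennreal min_W[OF x t])
    qed
    then show ?thesis unfolding S.Tint_def using pos by (simp add: mult.commute)
  qed
  moreover have "AE t in sg. Vfrac V t x \<le> ennreal (min 1 (W t / W x))"
    unfolding sg_def using AE_LS_pos by eventually_elim (simp only: Vfrac_W[OF x], intro ennreal_leI frac_bounds W_pos x)
  moreover have "AE t in sg. ennreal (min 1 (W t / W x)) \<le> 2 * Vfrac V t x"
    unfolding sg_def using AE_LS_pos by eventually_elim (simp only: Vfrac_W[OF x] two_ennreal, intro ennreal_leI frac_bounds W_pos x)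
  note epowr_integral_equiv[OF a calculation(2) this]
  ultimately show "LS_int (\<lambda>t. Vfrac V t x epowr (p1 \<rightarrowtail> q2)) (hright q2 u2 (p1 \<rightarrowtail> q2)) epowr (1 / (p1 \<rightarrowtail> q2)) \<le> S.Tint x epowr (1 / p2)"
    "S.Tint x epowr (1 / p2) \<le> 2 * LS_int (\<lambda>t. Vfrac V t x epowr (p1 \<rightarrowtail> q2)) (hright q2 u2 (p1 \<rightarrowtail> q2)) epowr (1 / (p1 \<rightarrowtail> q2))"
    unfolding LS_int_def sg_def arrow_rho by simp_all
qed

text \<open>As x grows, the minimum of \<open>mm x\<close> and \<open>mm t\<close> increases to
  \<open>mm t\<close>, so the supremum is evaluated by monotone convergence along the
  integers.\<close>

lemma Kint_s: "(SUP x\<in>{0<..}. (ennreal (mm x powr (1 / pc)) * S.Tint x) epowr (1 / p2))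
  = LS_int (\<lambda>t. V t epowr (p1 \<rightarrowtail> q2)) (hright q2 u2 (p1 \<rightarrowtail> q2)) epowr (1 / (p1 \<rightarrowtail> q2))"
proof -
  let ?a = "p2 * rho"
  have a: "0 < 1 / ?a" using pos rho_pos by simp
  have rp: "0 \<le> rho / pc" using rho_pos gt1c by simp
  have "(SUP x\<in>{0<..}. (ennreal (mm x powr (1 / pc)) * S.Tint x) epowr (1 / p2)) = (SUP x\<in>{0<..}. S.I x epowr (1 / ?a))"
  proof (intro SUP_cong refl)
    fix x :: real assume "x \<in> {0<..}"
    then have "ennreal (mm x powr (1 / pc)) * S.Tint x = S.I x epowr (1 / rho)" by (intro S.Kint) simp
    then show "(ennreal (mm x powr (1 / pc)) * S.Tint x) epowr (1 / p2) = S.I x epowr (1 / ?a)"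
      by (simp add: mult.commute)
  qed
  also have "\<dots> = (SUP x\<in>{0<..}. S.I x) epowr (1 / ?a)" by (rule epowr_SUP[OF a, symmetric])
  also have "(SUP x\<in>{0<..}. S.I x) = (\<integral>\<^sup>+t. ennreal (mm t powr (rho / pc)) \<partial>sg)"
  proof (rule antisym)
    show "(SUP x\<in>{0<..}. S.I x) \<le> (\<integral>\<^sup>+t. ennreal (mm t powr (rho / pc)) \<partial>sg)"
      unfolding S.I_def using mm_nonneg rp by (intro SUP_least nn_integral_mono ennreal_leI powr_mono2) auto
    have mono: "min (mm x) (mm t) powr (rho / pc) \<le> min (mm y) (mm t) powr (rho / pc)" if "x \<le> y" for x y t
      using mm_nonneg rp monoD[OF m.mono that] by (intro powr_mono2) auto
    have "(\<integral>\<^sup>+t. ennreal (mm t powr (rho / pc)) \<partial>sg) \<le> (\<integral>\<^sup>+t. (SUP n. ennreal (min (mm (real (Suc n))) (mm t) powr (rho / pc))) \<partial>sg)"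
    proof (rule nn_integral_mono)
      fix t
      obtain n where n: "t \<le> real n" using real_arch_simple by blast
      have "mm t \<le> mm (real (Suc n))" using n by (intro monoD[OF m.mono]) simp
      then have "ennreal (mm t powr (rho / pc)) = ennreal (min (mm (real (Suc n))) (mm t) powr (rho / pc))" by (simp add: min_def)
      also have "\<dots> \<le> (SUP n. ennreal (min (mm (real (Suc n))) (mm t) powr (rho / pc)))" by (rule SUP_upper) simp
      finally show "ennreal (mm t powr (rho / pc)) \<le> (SUP n. ennreal (min (mm (real (Suc n))) (mm t) powr (rho / pc)))" .
    qed
    also have "\<dots> = (SUP n. S.I (real (Suc n)))"
      unfolding S.I_def
    proof (rule nn_integral_monotone_convergence_SUP)
      show "incseq (\<lambda>n t. ennreal (min (mm (real (Suc n))) (mm t) powr (rho / pc)))"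
        by (intro incseq_SucI le_funI ennreal_leI mono) simp
    qed measurable
    also have "\<dots> \<le> (SUP x\<in>{0<..}. S.I x)" by (intro SUP_mono) auto
    finally show "(\<integral>\<^sup>+t. ennreal (mm t powr (rho / pc)) \<partial>sg) \<le> (SUP x\<in>{0<..}. S.I x)" .
  qed
  also have "\<dots> = LS_int (\<lambda>t. V t epowr ?a) (hright q2 u2 (p1 \<rightarrowtail> q2))"
    unfolding LS_int_def sg_def
  proof (intro nn_integral_cong_AE, use AE_LS_pos in eventually_elim)
    fix t :: real assume t: "0 < t"
    show "ennreal (mm t powr (rho / pc)) = V t epowr ?a"
      unfolding V_W using W_pos[OF t] by (simp add: epowr_ennreal W_def powr_powr r0_exps[simplified])
  qed
  finally show ?thesis unfolding arrow_rho .
qed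

end

definition "Cu1 = hardyC pp qq * 4 powr qq"
definition "Cl1 = 2 powr (3 * qq / pc)"
definition "Cu2 = hardyC pp qq * (2 powr (rho / qc) / (1 - 2 powr (- (rho / pc)))) powr (qq / rho)"
definition "Cl2 = 2 powr (3 * qq / pc) * (rho / qq) * (1 / (1 - 2 powr (- (rho / pc)))) powr (qq / pp)"
definition "Ctot = Kc Cu1 Cl1 + Kd Cu1 Cl1 + Kc Cu2 Cl2 + Kd Cu2 Cl2"

lemma Ctot_ge: "Kc Cu1 Cl1 \<le> Ctot" "Kd Cu1 Cl1 \<le> Ctot" "Kc Cu2 Cl2 \<le> Ctot" "Kd Cu2 Cl2 \<le> Ctot"
  using K_pos[of Cu1 Cl1] K_pos[of Cu2 Cl2] by (auto simp: Ctot_def)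

lemma cope_T1: "p1 \<le> q2 \<Longrightarrow> cope_T mm UU NN (wmeas vv r0) (wmeas u1 q1) (wmeas u2 q2) pp qq th pc qc tc Tsup Cu1 Cl1"
  unfolding Cu1_def Cl1_def using pos by (intro cope_T_sup) (simp add: pp_def qq_def divide_right_mono)

lemma cope_T2: "q2 < p1 \<Longrightarrow> cope_T mm UU NN (wmeas vv r0) (wmeas u1 q1) (wmeas u2 q2) pp qq th pc qc tc (cope_sigma.Tint mm pc sg rho) Cu2 Cl2"
  unfolding Cu2_def Cl2_def by (rule cope_sigma.cope_T_int[OF cope_sigma_sg])

lemmas case_i = approx_by_mono[OF case_small[OF cope_T1 _ Tsup_equiv Ksup_s] K_pos(1) order.trans[OF Ctot_ge(1)]]
lemmas case_ii = approx_by_mono[OF case_large[OF cope_T1 _ Tsup_equiv Ksup_s] K_pos(2) order.trans[OF Ctot_ge(2)]]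
lemmas case_iii = approx_by_mono[OF case_small[OF cope_T2 _ Tint_equiv Kint_s] K_pos(1) order.trans[OF Ctot_ge(3)]]
lemmas case_iv = approx_by_mono[OF case_large[OF cope_T2 _ Tint_equiv Kint_s] K_pos(2) order.trans[OF Ctot_ge(4)]]

end

theorem theorem7p8:
  fixes p1 p2 q1 q2 :: real
  assumes "0 < p1" "0 < p2" "0 < q1" "0 < q2"
    and "p2 < p1" and "p2 < min q1 q2"
  shows "\<exists>c>0. \<forall>v1 v2 u1 u2 :: real \<Rightarrow> ennreal.
    v1 \<in> weights \<longrightarrow> v2 \<in> weights \<longrightarrow> u1 \<in> cOmega q1 \<longrightarrow> u2 \<in> Omega q2 \<longrightarrow>
    (let V = Vfun p1 p2 v1 v2;
         \<V> = Vfrac V;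
         \<phi>\<^sub>2 = phi2 p2 q1 u1 V;
         N = Cop_Ces_norm p1 q1 u1 v1 p2 q2 u2 v2
     in admissible V \<longrightarrow> \<phi>\<^sub>2 \<in> QU (\<lambda>x. V x epowr (1 / (p1 \<rightarrowtail> p2))) \<longrightarrow>
      (max p1 q1 \<le> q2 \<longrightarrow>
        approx_by c N
          ((SUP x\<in>{0<..}. \<phi>\<^sub>2 x * (SUP t\<in>{0<..}. \<V> t x * Lnorm q2 {t<..} u2))
           + inverse (Lnorm q1 {0<..} u1) * (SUP t\<in>{0<..}. V t * Lnorm q2 {t<..} u2))) \<and>
      (p1 \<le> q2 \<and> q2 < q1 \<longrightarrow>
        approx_by c N
          (LS_int (\<lambda>x. \<phi>\<^sub>2 x epowr ((q1 \<rightarrowtail> q2) * (q1 \<rightarrowtail> p2) / (q2 \<rightarrowtail> p2))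
                      * V x epowr (q1 \<rightarrowtail> p2)
                      * (SUP t\<in>{0<..}. \<V> t x * Lnorm q2 {t<..} u2) epowr (q1 \<rightarrowtail> q2))
                  (hleft q1 u1 (q1 \<rightarrowtail> p2))
             epowr (1 / (q1 \<rightarrowtail> q2))
           + inverse (Lnorm q1 {0<..} u1) * (SUP t\<in>{0<..}. V t * Lnorm q2 {t<..} u2))) \<and>
      (q1 \<le> q2 \<and> q2 < p1 \<longrightarrow>
        approx_by c N
          ((SUP x\<in>{0<..}. \<phi>\<^sub>2 x *
              LS_int (\<lambda>t. \<V> t x epowr (p1 \<rightarrowtail> q2)) (hright q2 u2 (p1 \<rightarrowtail> q2))
                epowr (1 / (p1 \<rightarrowtail> q2)))
           + inverse (Lnorm q1 {0<..} u1) *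
              LS_int (\<lambda>t. V t epowr (p1 \<rightarrowtail> q2)) (hright q2 u2 (p1 \<rightarrowtail> q2))
                epowr (1 / (p1 \<rightarrowtail> q2)))) \<and>
      (q2 < min p1 q1 \<longrightarrow>
        approx_by c N
          (LS_int (\<lambda>x. \<phi>\<^sub>2 x epowr ((q1 \<rightarrowtail> q2) * (q1 \<rightarrowtail> p2) / (q2 \<rightarrowtail> p2))
                      * V x epowr (q1 \<rightarrowtail> p2)
                      * LS_int (\<lambda>t. \<V> t x epowr (p1 \<rightarrowtail> q2)) (hright q2 u2 (p1 \<rightarrowtail> q2))
                          epowr ((q1 \<rightarrowtail> q2) / (p1 \<rightarrowtail> q2)))
                  (hleft q1 u1 (q1 \<rightarrowtail> p2))
             epowr (1 / (q1 \<rightarrowtail> q2))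
           + inverse (Lnorm q1 {0<..} u1) *
              LS_int (\<lambda>t. V t epowr (p1 \<rightarrowtail> q2)) (hright q2 u2 (p1 \<rightarrowtail> q2))
                epowr (1 / (p1 \<rightarrowtail> q2)))))"
  unfolding Let_def
proof (intro exI conjI allI impI)
  \<comment> \<open>The constant must be named before the weights; the maximum with 1 makes it
    positive without recourse to them.\<close>
  let ?c = "max 1 (ces_data.Ctot p1 p2 q1 q2)"
  show "0 < ?c" by simp
  fix v1 v2 u1 u2 :: "real \<Rightarrow> ennreal"
  assume "v1 \<in> weights" "v2 \<in> weights" "u1 \<in> cOmega q1" "u2 \<in> Omega q2" "admissible (Vfun p1 p2 v1 v2)"
  then interpret ces_data p1 p2 q1 q2 v1 v2 u1 u2 using assms by unfold_locales auto
  have C: "Ctot \<le> ?c" by simp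
  {
    assume "max p1 q1 \<le> q2"
    then show "approx_by ?c nrm
          ((SUP x\<in>{0<..}. phi2 p2 q1 u1 V x * (SUP t\<in>{0<..}. Vfrac V t x * Lnorm q2 {t<..} u2))
           + inverse (Lnorm q1 {0<..} u1) * (SUP t\<in>{0<..}. V t * Lnorm q2 {t<..} u2))"
      by (intro case_i C) auto
  next
    assume "p1 \<le> q2 \<and> q2 < q1"
    then show "approx_by ?c nrm
          (LS_int (\<lambda>x. phi2 p2 q1 u1 V x epowr ((q1 \<rightarrowtail> q2) * (q1 \<rightarrowtail> p2) / (q2 \<rightarrowtail> p2))
                      * V x epowr (q1 \<rightarrowtail> p2)
                      * (SUP t\<in>{0<..}. Vfrac V t x * Lnorm q2 {t<..} u2) epowr (q1 \<rightarrowtail> q2))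
                  (hleft q1 u1 (q1 \<rightarrowtail> p2))
             epowr (1 / (q1 \<rightarrowtail> q2))
           + inverse (Lnorm q1 {0<..} u1) * (SUP t\<in>{0<..}. V t * Lnorm q2 {t<..} u2))"
      by (intro case_ii C) auto
  next
    assume "q1 \<le> q2 \<and> q2 < p1"
    then show "approx_by ?c nrm
          ((SUP x\<in>{0<..}. phi2 p2 q1 u1 V x *
              LS_int (\<lambda>t. Vfrac V t x epowr (p1 \<rightarrowtail> q2)) (hright q2 u2 (p1 \<rightarrowtail> q2))
                epowr (1 / (p1 \<rightarrowtail> q2)))
           + inverse (Lnorm q1 {0<..} u1) *
              LS_int (\<lambda>t. V t epowr (p1 \<rightarrowtail> q2)) (hright q2 u2 (p1 \<rightarrowtail> q2))
                epowr (1 / (p1 \<rightarrowtail> q2)))"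
      by (intro case_iii C) auto
  next
    assume q: "q2 < min p1 q1"
    then have "q2 < p1" "q2 < q1" by auto
    from case_iv[OF this this(1) _ this(1) _ this(1) C]
    show "approx_by ?c nrm
          (LS_int (\<lambda>x. phi2 p2 q1 u1 V x epowr ((q1 \<rightarrowtail> q2) * (q1 \<rightarrowtail> p2) / (q2 \<rightarrowtail> p2))
                      * V x epowr (q1 \<rightarrowtail> p2)
                      * LS_int (\<lambda>t. Vfrac V t x epowr (p1 \<rightarrowtail> q2)) (hright q2 u2 (p1 \<rightarrowtail> q2))
                          epowr ((q1 \<rightarrowtail> q2) / (p1 \<rightarrowtail> q2)))
                  (hleft q1 u1 (q1 \<rightarrowtail> p2))
             epowr (1 / (q1 \<rightarrowtail> q2))
           + inverse (Lnorm q1 {0<..} u1) *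
              LS_int (\<lambda>t. V t epowr (p1 \<rightarrowtail> q2)) (hright q2 u2 (p1 \<rightarrowtail> q2))
                epowr (1 / (p1 \<rightarrowtail> q2)))"
      by simp
  }
qed

end
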